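(* Let $N,d\in\mathbb{N}$ and let $\{S_n\}_{n=0}^{2d}$ be Hermitian complex $(N\times N)$ matrices such that, with $\Gamma_n=(S_{k+l})_{k,l=0}^{n}$, one has $\Gamma_{d-1}>0$ and $\Gamma_d\ge 0$. Let the finite-dimensional Hilbert space $H$, the elements $\{x_n\}_{n=0}^{dN+N-1}\subset H$ and the (not necessarily densely defined) symmetric operator $A$ in $H$ be constructed from $\{S_n\}$ as described in the context. All solutions of the truncated matrix Hamburger moment problem with data $\{S_n\}_{n=0}^{2d}$ have the form $$M(x)=(m_{k,j}(x))_{k,j=0}^{N-1},$$ where the $m_{k,j}$ satisfy $$\int_{\mathbb{R}}\frac{1}{x-\lambda}\,dm_{k,j}(x)=\left((A_{F(\lambda)}-\lambda E_H)^{-1}x_k,x_j\right)_H,\qquad \lambda\in\mathbb{C}_+,\ 0\le k,j\le N-1,\qquad( * )$$ where $F(\lambda)\in K_a(A;\mathbb{C}_+;N_i,N_{-i})$. Conversely, to any operator function $F(\lambda)\in K_a(A;\mathbb{C}_+;N_i,N_{-i})$ there corresponds by relation $( * )$ a solution of the truncated matrix Hamburger moment problem. Moreover, the correspondence between $K_a(A;\mathbb{C}_+;N_i,N_{-i})$ and all solutions of the truncated moment problem, established by relation $( * )$, is one-to-one.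
   Context: Notation: $\mathbb{C}_+=\{z\in\mathbb{C}:\operatorname{Im}z>0\}$, $E_H$ is the identity operator on $H$; scalar products are linear in the first argument. Truncated matrix Hamburger moment problem: given Hermitian $N\times N$ complex matrices $\{S_n\}_{n=0}^{2d}$, find a left-continuous non-decreasing (with respect to the order of Hermitian matrices) matrix function $M(x)=(m_{k,l}(x))_{k,l=0}^{N-1}$ on $\mathbb{R}$ with $M(-\infty)=0$ such that $\int_{\mathbb{R}}x^n\,dM(x)=S_n$ for $n=0,1,\ldots,2d$. Such $M$ is called a solution. Construction of $H$, $x_n$, $A$: write $S_n=(s_n^{k,l})_{k,l=0}^{N-1}$ and $\Gamma_d=(\gamma^d_{n,m})_{n,m=0}^{dN+N-1}$ as a scalar matrix, i.e. $\gamma^d_{rN+j,tN+n}=s_{r+t}^{j,n}$ for $0\le j,n\le N-1$, $0\le r,t\le d$. Since $\Gamma_d\ge 0$, there are a finite-dimensional Hilbert space $H$ and elements $\{x_n\}_{n=0}^{dN+N-1}$ spanning $H$ with $(x_n,x_m)_H=\gamma^d_{n,m}$ for $0\le n,m\le dN+N-1$; fix them. Since $\Gamma_{d-1}>0$, the elements $x_0,\ldots,x_{dN-1}$ are linearly independent; let $L_a$ be their linear span. The symmetric operator $A$ with domain $D(A)=L_a$ is defined by $A\sum_{k=0}^{dN-1}\alpha_kx_k=\sum_{k=0}^{dN-1}\alpha_kx_{k+N}$. Defect subspaces: $N_\lambda=N_\lambda(A)=H\ominus(A-\lambda E_H)D(A)$, $\lambda\in\mathbb{C}\setminus\mathbb{R}$.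 Forbidden operator $X_i$: the operator from a subset of $N_i$ into $N_{-i}$ given by $\varphi=X_i\psi$ if $\psi\in N_i$, $\varphi\in N_{-i}$ and $\varphi-\psi\in D(A)$ (its domain $D(X_i)$ is the set of all $\psi\in N_i$ for which such a $\varphi$, which is then unique, exists). Class $K_a$: $K(A;\mathbb{C}_+;N_i,N_{-i})$ is the class of operator-valued functions $F(\lambda)$ analytic in $\mathbb{C}_+$ whose values are contractions ($\|F(\lambda)\|\le1$) mapping $N_i$ into $N_{-i}$. Fix $\varepsilon$ with $0<\varepsilon\le\frac{\pi}{2}$ and put $\mathbb{C}_+^\varepsilon=\{z\in\mathbb{C}_+:\varepsilon\le\arg z\le\pi-\varepsilon\}$. A function $F\in K(A;\mathbb{C}_+;N_i,N_{-i})$ is called admissible with respect to $A$ if, for $\psi\in D(X_i)$, the two relations $$\lim_{\lambda\in\mathbb{C}_+^\varepsilon,\ \lambda\to\infty}F(\lambda)\psi=X_i\psi,\qquad \liminf_{\lambda\in\mathbb{C}_+^\varepsilon,\ \lambda\to\infty}|\lambda|\left(\|\psi\|-\|F(\lambda)\psi\|\right)<+\infty$$ together imply $\psi=0$. The class of all admissible $F$ is denoted $K_a(A;\mathbb{C}_+;N_i,N_{-i})$. For $F\in K_a(A;\mathbb{C}_+;N_i,N_{-i})$ and $\lambda\in\mathbb{C}_+$, the relation $F(\lambda)\psi-\psi\in D(A)$ with $\psi\in N_i$ holds only for $\psi=0$. The operator $A_{F(\lambda)}$: its domain is the direct sum $D(A)\dotplus(F(\lambda)-E_H)N_i$, and $A_{F(\lambda)}(f+F(\lambda)\psi-\psi)=Af+iF(\lambda)\psi+i\psi$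 for $f\in D(A)$, $\psi\in N_i$. *)

theory Defs
  imports
    "HOL-Probability.Probability"
    "Jordan_Normal_Form.Schur_Decomposition"
begin

section \<open>Complex inner product spaces\<close>

text \<open>The scalar product is linear in the first argument.  Completeness is not required:
  only spaces spanned by finitely many vectors are considered, and these are Hilbert spaces.\<close>

class complex_inner_space = real_normed_vector +
  fixes scaleC :: "complex \<Rightarrow> 'a \<Rightarrow> 'a"  (infixr "*\<^sub>C" 75)
    and cinner :: "'a \<Rightarrow> 'a \<Rightarrow> complex"
  assumes scaleC_add_right: "a *\<^sub>C (u + v) = a *\<^sub>C u + a *\<^sub>C v"
    and scaleC_add_left: "(a + b) *\<^sub>C u = a *\<^sub>C u + b *\<^sub>C u"
    and scaleC_scaleC: "a *\<^sub>C b *\<^sub>C u = (a * b) *\<^sub>C u"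
    and scaleC_one: "1 *\<^sub>C u = u"
    and scaleR_scaleC: "r *\<^sub>R u = complex_of_real r *\<^sub>C u"
    and cinner_commute: "cinner u v = cnj (cinner v u)"
    and cinner_add_left: "cinner (u + v) w = cinner u w + cinner v w"
    and cinner_scaleC_left: "cinner (a *\<^sub>C u) v = a * cinner u v"
    and cinner_nonneg: "0 \<le> Re (cinner u u)"
    and norm_eq_sqrt_cinner: "norm u = sqrt (Re (cinner u u))"

interpretation complex_vector:
  vector_space "scaleC :: complex \<Rightarrow> 'a \<Rightarrow> 'a::complex_inner_space"
  by unfold_locales
    (simp_all add: scaleC_add_right scaleC_add_left scaleC_scaleC scaleC_one)

instantiation complex :: complex_inner_space
begin

definition "scaleC (a::complex) (u::complex) = a * u"
definition "cinner (u::complex) (v::complex) = u * cnj v"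

instance
proof
  fix u :: complex
  show "norm u = sqrt (Re (cinner u u))"
    by (simp add: cinner_complex_def cmod_def power2_eq_square)
qed (auto simp: scaleC_complex_def cinner_complex_def scaleR_conv_of_real algebra_simps)

end

instantiation Finite_Cartesian_Product.vec :: (complex_inner_space, finite) complex_inner_space
begin

definition "scaleC (a::complex) (u::'a^'b) = (\<chi> i. a *\<^sub>C vec_nth u i)"
definition "cinner (u::'a^'b) (v::'a^'b) = (\<Sum>i\<in>UNIV. cinner (vec_nth u i) (vec_nth v i))"

instance
proof
  fix u v w :: "'a^'b" and a b :: complex and r :: real
  show "a *\<^sub>C (u + v) = a *\<^sub>C u + a *\<^sub>C v" "(a + b) *\<^sub>C u = a *\<^sub>C u + b *\<^sub>C u"
    "a *\<^sub>C b *\<^sub>C u = (a * b) *\<^sub>C u" "1 *\<^sub>C u = u" "r *\<^sub>R u = complex_of_real r *\<^sub>C u"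
    by (simp_all add: scaleC_vec_def Finite_Cartesian_Product.vec_eq_iff scaleC_add_right
        scaleC_add_left scaleC_scaleC scaleC_one scaleR_scaleC)
  show "cinner u v = cnj (cinner v u)"
    unfolding cinner_vec_def cnj_sum by (intro sum.cong refl cinner_commute)
  show "cinner (u + v) w = cinner u w + cinner v w"
    by (simp add: cinner_vec_def cinner_add_left sum.distrib)
  show "cinner (a *\<^sub>C u) v = a * cinner u v"
    by (simp add: cinner_vec_def scaleC_vec_def cinner_scaleC_left sum_distrib_left)
  show "0 \<le> Re (cinner u u)"
    by (simp add: cinner_vec_def sum_nonneg cinner_nonneg)
  show "norm u = sqrt (Re (cinner u u))"
    by (simp add: cinner_vec_def norm_vec_def L2_set_def norm_eq_sqrt_cinner cinner_nonneg)
qed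

end

section \<open>Hermitian matrices\<close>

definition hermitian_mat :: "nat \<Rightarrow> complex mat \<Rightarrow> bool" where
  "hermitian_mat n A \<longleftrightarrow> A \<in> carrier_mat n n \<and> mat_adjoint A = A"

definition pos_semidef_mat :: "nat \<Rightarrow> complex mat \<Rightarrow> bool" where
  "pos_semidef_mat n A \<longleftrightarrow>
     hermitian_mat n A \<and> (\<forall>v\<in>carrier_vec n. 0 \<le> Re ((A *\<^sub>v v) \<bullet>c v))"

definition pos_def_mat :: "nat \<Rightarrow> complex mat \<Rightarrow> bool" where
  "pos_def_mat n A \<longleftrightarrow>
     hermitian_mat n A \<and> (\<forall>v\<in>carrier_vec n. v \<noteq> 0\<^sub>v n \<longrightarrow> 0 < Re ((A *\<^sub>v v) \<bullet>c v))"

text \<open>The block matrix $(S_{k+l})_{k,l=0}^n$ with $N \times N$ blocks, as a scalar matrix.\<close>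

definition block_hankel :: "nat \<Rightarrow> (nat \<Rightarrow> complex mat) \<Rightarrow> nat \<Rightarrow> complex mat" where
  "block_hankel N S n =
     Matrix.mat (n * N + N) (n * N + N) (\<lambda>(a, b). S (a div N + b div N) $$ (a mod N, b mod N))"

section \<open>Stieltjes integrals and the truncated moment problem\<close>

text \<open>The Lebesgue--Stieltjes integral $\int f\,dm = I$ for a left-continuous
  $m : \mathbb{R} \to \mathbb{C}$ of bounded variation, through a decomposition
  $dm = \mu_1 - \mu_2 + i (\mu_3 - \mu_4)$ into finite positive Borel measures, for all of which
  $f$ is integrable; by left-continuity the half-open interval $[a, b)$ carries the
  mass $m(b) - m(a)$.  The value $I$ does not depend on the chosen decomposition.\<close>

definition has_stieltjes_integral ::
    "(real \<Rightarrow> complex) \<Rightarrow> (real \<Rightarrow> complex) \<Rightarrow> complex \<Rightarrow> bool" where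
  "has_stieltjes_integral f m I \<longleftrightarrow>
     (\<exists>\<mu>1 \<mu>2 \<mu>3 \<mu>4.
        (\<forall>\<mu>\<in>{\<mu>1, \<mu>2, \<mu>3, \<mu>4}. finite_borel_measure \<mu> \<and> integrable \<mu> f) \<and>
        (\<forall>a b. a \<le> b \<longrightarrow>
           m b - m a =
             complex_of_real (measure \<mu>1 {a..<b}) - complex_of_real (measure \<mu>2 {a..<b})
             + \<i> * (complex_of_real (measure \<mu>3 {a..<b}) - complex_of_real (measure \<mu>4 {a..<b}))) \<and>
        I = integral\<^sup>L \<mu>1 f - integral\<^sup>L \<mu>2 f + \<i> * (integral\<^sup>L \<mu>3 f - integral\<^sup>L \<mu>4 f))"

definition moment_solutions ::
    "nat \<Rightarrow> nat \<Rightarrow> (nat \<Rightarrow> complex mat) \<Rightarrow> (real \<Rightarrow> complex mat) set" where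
  "moment_solutions N d S = {M.
     (\<forall>t. hermitian_mat N (M t)) \<and>
     (\<forall>s t. s \<le> t \<longrightarrow> pos_semidef_mat N (M t - M s)) \<and>
     (\<forall>k<N. \<forall>j<N. \<forall>t. continuous (at_left t) (\<lambda>s. M s $$ (k, j))) \<and>
     (\<forall>k<N. \<forall>j<N. ((\<lambda>t. M t $$ (k, j)) \<longlongrightarrow> 0) at_bot) \<and>
     (\<forall>n\<le>2 * d. \<forall>k<N. \<forall>j<N.
        has_stieltjes_integral (\<lambda>t. complex_of_real (t ^ n)) (\<lambda>t. M t $$ (k, j)) (S n $$ (k, j)))}"

section \<open>Operators as graphs\<close>

text \<open>A partially defined operator \<open>T\<close> in \<open>H\<close> is represented by its graph, the set of all pairs
  $(f, Tf)$; its domain is \<open>Domain T\<close>.\<close>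

definition shift_operator ::
    "nat \<Rightarrow> nat \<Rightarrow> (nat \<Rightarrow> 'h) \<Rightarrow> ('h::complex_inner_space \<times> 'h) set" where
  "shift_operator N d x =
     {(\<Sum>k<d * N. \<alpha> k *\<^sub>C x k, \<Sum>k<d * N. \<alpha> k *\<^sub>C x (k + N)) | \<alpha>. True}"

definition defect_subspace ::
    "('h::complex_inner_space \<times> 'h) set \<Rightarrow> complex \<Rightarrow> 'h set" where
  "defect_subspace A z = {h. \<forall>(f, g)\<in>A. cinner h (g - z *\<^sub>C f) = 0}"

definition forbidden_operator ::
    "('h::complex_inner_space \<times> 'h) set \<Rightarrow> ('h \<times> 'h) set" where
  "forbidden_operator A =
     {(\<psi>, \<phi>). \<psi> \<in> defect_subspace A \<i> \<and> \<phi> \<in> defect_subspace A (-\<i>) \<and> \<phi> - \<psi> \<in> Domain A}"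

definition upper_half_plane :: "complex set" where
  "upper_half_plane = {z. 0 < Im z}"

definition upper_sector :: "real \<Rightarrow> complex set" where
  "upper_sector \<epsilon> = {z \<in> upper_half_plane. \<epsilon> \<le> Arg z \<and> Arg z \<le> pi - \<epsilon>}"

text \<open>Differentiability with respect to the operator norm: uniform convergence of the difference
  quotients on the unit ball of the subspace \<open>U\<close>.\<close>

definition operator_analytic_on ::
    "(complex \<Rightarrow> 'h \<Rightarrow> 'h::complex_inner_space) \<Rightarrow> 'h set \<Rightarrow> complex set \<Rightarrow> bool" where
  "operator_analytic_on F U \<Omega> \<longleftrightarrow>
     (\<forall>z\<in>\<Omega>. \<exists>D. uniform_limit {\<psi>\<in>U. norm \<psi> \<le> 1}
        (\<lambda>w \<psi>. inverse (w - z) *\<^sub>C (F w \<psi> - F z \<psi>)) D (at z within \<Omega>))"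

text \<open>Functions on the upper half plane with values in the maps from $N_i$ to $N_{-i}$ are
  extensional, so that equality in this class is equality at all points of the upper half plane
  and all vectors of $N_i$.\<close>

definition contractive_class ::
    "('h::complex_inner_space \<times> 'h) set \<Rightarrow> (complex \<Rightarrow> 'h \<Rightarrow> 'h) set" where
  "contractive_class A = {F \<in> upper_half_plane \<rightarrow>\<^sub>E (defect_subspace A \<i> \<rightarrow>\<^sub>E defect_subspace A (-\<i>)).
     (\<forall>z\<in>upper_half_plane.
        (\<forall>\<psi>\<in>defect_subspace A \<i>. \<forall>\<phi>\<in>defect_subspace A \<i>. F z (\<psi> + \<phi>) = F z \<psi> + F z \<phi>) \<and>
        (\<forall>c. \<forall>\<psi>\<in>defect_subspace A \<i>. F z (c *\<^sub>C \<psi>) = c *\<^sub>C F z \<psi>) \<and>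
        (\<forall>\<psi>\<in>defect_subspace A \<i>. norm (F z \<psi>) \<le> norm \<psi>)) \<and>
     operator_analytic_on F (defect_subspace A \<i>) upper_half_plane}"

definition sector_at_infinity :: "real \<Rightarrow> complex filter" where
  "sector_at_infinity \<epsilon> = inf at_infinity (principal (upper_sector \<epsilon>))"

definition admissible_class ::
    "real \<Rightarrow> ('h::complex_inner_space \<times> 'h) set \<Rightarrow> (complex \<Rightarrow> 'h \<Rightarrow> 'h) set" where
  "admissible_class \<epsilon> A = {F \<in> contractive_class A.
     \<forall>(\<psi>, \<phi>)\<in>forbidden_operator A.
       ((\<lambda>z. F z \<psi>) \<longlongrightarrow> \<phi>) (sector_at_infinity \<epsilon>) \<longrightarrow>
       Liminf (sector_at_infinity \<epsilon>) (\<lambda>z. ereal (cmod z * (norm \<psi> - norm (F z \<psi>)))) < \<infinity> \<longrightarrow>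
       \<psi> = 0}"

definition extension_operator ::
    "('h::complex_inner_space \<times> 'h) set \<Rightarrow> ('h \<Rightarrow> 'h) \<Rightarrow> ('h \<times> 'h) set" where
  "extension_operator A V =
     {(f + V \<psi> - \<psi>, g + \<i> *\<^sub>C V \<psi> + \<i> *\<^sub>C \<psi>) | f g \<psi>. (f, g) \<in> A \<and> \<psi> \<in> defect_subspace A \<i>}"

definition resolvent ::
    "('h::complex_inner_space \<times> 'h) set \<Rightarrow> complex \<Rightarrow> ('h \<times> 'h) set" where
  "resolvent T z = {(g - z *\<^sub>C f, f) | f g. (f, g) \<in> T}"

definition op_apply :: "('h \<times> 'h) set \<Rightarrow> 'h \<Rightarrow> 'h" where
  "op_apply T f = (THE g. (f, g) \<in> T)"

text \<open>The relation $\int (t - z)^{-1}\,dm_{k,j}(t) = ((A_{F(z)} - z E_H)^{-1} x_k, x_j)$;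
  it includes that $A_{F(z)}$ is a well-defined operator and that
  $(A_{F(z)} - z E_H)^{-1}$ exists as an operator on the whole of $H$.\<close>

definition stieltjes_resolvent_relation ::
    "nat \<Rightarrow> (nat \<Rightarrow> 'h) \<Rightarrow> ('h::complex_inner_space \<times> 'h) set \<Rightarrow>
     (real \<Rightarrow> complex mat) \<Rightarrow> (complex \<Rightarrow> 'h \<Rightarrow> 'h) \<Rightarrow> bool" where
  "stieltjes_resolvent_relation N x A M F \<longleftrightarrow>
     (\<forall>z\<in>upper_half_plane.
        single_valued (extension_operator A (F z)) \<and>
        single_valued (resolvent (extension_operator A (F z)) z) \<and>
        Domain (resolvent (extension_operator A (F z)) z) = UNIV \<and>
        (\<forall>k<N. \<forall>j<N.
           has_stieltjes_integral (\<lambda>t. 1 / (complex_of_real t - z)) (\<lambda>t. M t $$ (k, j))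
             (cinner (op_apply (resolvent (extension_operator A (F z)) z) (x k)) (x j))))"

end

theory Submission
  imports Defs "HOL-Complex_Analysis.Complex_Analysis"
begin

text \<open>A generalized resolvent \<open>R\<close> of \<open>A\<close> is a dissipative holomorphic family with
  $R_z(g - zf) = f$ for \<open>(f, g) \<in> A\<close>.  Its Cayley transform is a holomorphic family of contractions
  which extends the isometric Cayley transform of \<open>A\<close>, so \<open>R\<close> amounts to the restriction of this family
  to $N_i$, an arbitrary element \<open>F\<close> of the contractive class, and $R_z = (A_{F(z)} - z)^{-1}$.

  By Herglotz' theorem $\langle R_z u, u\rangle$ is the Stieltjes transform of a measure, and these measures
  are the diagonal of a positive operator measure with total mass $E \le 1$.  The point of the proof
  is that \<open>F\<close> is admissible if and only if \<open>E = 1\<close>: a vector on which $E \neq 1$ produces a vector of $N_i$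
  on which \<open>F\<close> tends to the forbidden operator at the forbidden rate, and conversely.  If \<open>E = 1\<close>, the
  relations $(x_n, x_{n+N}) \in A$ turn the transforms of the measures of $x_0, \dots, x_{N-1}$ into their moments.
  In the other direction a solution \<open>M\<close> yields \<open>R\<close> by compressing the multiplication by $(t - z)^{-1}$
  from the vector polynomials with the scalar product of $L^2(M)$ to \<open>H\<close>.\<close>

subsection \<open>Positive Stieltjes forms and resolvent kernels\<close>

text \<open>The operator measure is never built: there is one Herglotz measure per vector, each
  chosen separately, and sesquilinearity in the vector has to be recovered. Stieltjes inversion
  turns linear relations between transforms into relations between the masses of intervals [a, b),
  and Riemann sums turn nonnegativity on intervals into nonnegativity of integrals. These two
  transfers replace operator-valued integration and the dilation space. Both directions of the
  admissibility criterion come from integrating squares such as that of v/(t - z) - R_z v, which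
  bounds the dissipation of R_z from below by the form of 1 - E. For w = u - E u this forces |w|^2 -
  |U_z w|^2 to be O(1/Im z), the rate in the definition of admissibility. If E = 1, a version with
  two points z and w makes a vector with that rate vanish as z tends to infinity. The entries of M
  are an obstacle of their own: each integral comes with its own decomposition into four positive
  measures, so values for different integrands can be compared only after independence of the
  decomposition is shown.\<close>

lemma cmod_sq_le_of_quadratic:
  fixes b :: complex and a c :: real
  assumes c: "0 \<le> c" and q: "\<And>\<zeta>. 0 \<le> a + 2 * Re (\<zeta> * b) + (cmod \<zeta>)\<^sup>2 * c"
  shows "(cmod b)\<^sup>2 \<le> a * c"
proof -
  \<comment> \<open>The choice \<zeta> = -s conj(b) turns the linear term into -2 s |b|^2 and leaves
    a real quadratic in s. Its minimum s = 1/c gives the claim; for c = 0 it is affine in s and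
    unbounded below unless b = 0.\<close>
  have *: "0 \<le> a - 2 * s * (cmod b)\<^sup>2 + s\<^sup>2 * (cmod b)\<^sup>2 * c" for s :: real
  proof -
    have "Re ((- of_real s * cnj b) * b) = - s * (cmod b)\<^sup>2"
      by (simp add: cmod_def power2_eq_square algebra_simps)
    moreover have "(cmod (- of_real s * cnj b))\<^sup>2 = s\<^sup>2 * (cmod b)\<^sup>2"
      by (simp add: norm_mult power_mult_distrib)
    ultimately show ?thesis using q[of "- of_real s * cnj b"] by simp
  qed
  show ?thesis
  proof (cases "c = 0")
    case True
    have "b = 0"
    proof (rule ccontr)
      assume "b \<noteq> 0"
      then have "0 < (cmod b)\<^sup>2" by simp
      then show False
        using *[of "(\<bar>a\<bar> + 1) / (2 * (cmod b)\<^sup>2)"] True by simp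
    qed
    then show ?thesis using True by simp
  next
    case False
    then have "0 < c" using c by simp
    then show ?thesis using *[of "1 / c"] by (simp add: field_simps power2_eq_square)
  qed
qed

lemma finite_borel_measure_measurable:
  assumes "finite_borel_measure \<mu>" and "f \<in> borel_measurable borel"
  shows "f \<in> borel_measurable \<mu>"
  using assms finite_borel_measure.M_is_borel measurable_cong_sets by blast

text \<open>Riemann sums with left endpoints: on each mesh interval the integrands are frozen at one
  point t, where \<open>pos\<close> applies to the masses of that interval. The weight (1 + |t|)^m
  dominates the step functions, so dominated convergence carries the sign to the limit. The measures
  have different integrands, and only their sum has a sign.\<close>

lemma stieltjes_form_nonneg:
  fixes \<mu> :: "'i \<Rightarrow> real measure" and h :: "'i \<Rightarrow> real \<Rightarrow> complex"
  assumes fin: "finite I" and \<mu>: "\<And>i. i \<in> I \<Longrightarrow> finite_borel_measure (\<mu> i)"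
    and cont: "\<And>i. i \<in> I \<Longrightarrow> continuous_on UNIV (h i)"
    and bound: "\<And>i t. i \<in> I \<Longrightarrow> cmod (h i t) \<le> C * (1 + \<bar>t\<bar>) ^ m"
    and int: "\<And>i. i \<in> I \<Longrightarrow> integrable (\<mu> i) (\<lambda>t. (1 + \<bar>t\<bar>) ^ m)"
    and pos: "\<And>t a b. a \<le> b \<Longrightarrow> 0 \<le> Re (\<Sum>i\<in>I. h i t * measure (\<mu> i) {a..<b})"
  shows "0 \<le> Re (\<Sum>i\<in>I. \<integral>t. h i t \<partial>\<mu> i)"
proof -
  \<comment> \<open>Mesh width 1/n and range [-n, n), hence n^2 indices on each side of 0.\<close>
  define J where "J n = {-(int n * int n)..<int n * int n}" for n
  define I' where "I' n j = {of_int j / real n..<(of_int j + 1) / real n}" for n and j :: int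
  define f where "f i n t = (\<Sum>j\<in>J n. h i (of_int j / real n) * complex_of_real (indicator (I' n j) t))" for i n t
  have f_eq: "f i n t = (if \<lfloor>real n * t\<rfloor> \<in> J n then h i (of_int \<lfloor>real n * t\<rfloor> / real n) else 0)"
    if n: "n > 0" for i n t
  proof -
    have "t \<in> I' n j \<longleftrightarrow> j = \<lfloor>real n * t\<rfloor>" for j
    proof -
      have "t \<in> I' n j \<longleftrightarrow> of_int j \<le> real n * t \<and> real n * t < of_int j + 1"
        using n by (simp add: I'_def field_simps)
      also have "\<dots> \<longleftrightarrow> \<lfloor>real n * t\<rfloor> = j" by (simp add: floor_eq_iff)
      finally show ?thesis by auto
    qed
    then have "f i n t = (\<Sum>j\<in>J n. if j = \<lfloor>real n * t\<rfloor> then h i (of_int j / real n) else 0)"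
      unfolding f_def by (intro sum.cong) (auto simp: indicator_def)
    then show ?thesis by (simp add: sum.delta' J_def)
  qed
  have lim: "(\<lambda>n. \<integral>t. f i (Suc n) t \<partial>\<mu> i) \<longlonglongrightarrow> (\<integral>t. h i t \<partial>\<mu> i)" if i: "i \<in> I" for i
  proof (rule integral_dominated_convergence[where w = "\<lambda>t. (C * 2 ^ m) * (1 + \<bar>t\<bar>) ^ m"])
    show "h i \<in> borel_measurable (\<mu> i)"
      by (rule finite_borel_measure_measurable[OF \<mu>[OF i]], rule borel_measurable_continuous_onI[OF cont[OF i]])
    show "integrable (\<mu> i) (\<lambda>t. (C * 2 ^ m) * (1 + \<bar>t\<bar>) ^ m)"
      using int[OF i] by simp
    have floor_close: "\<bar>of_int \<lfloor>real n * t\<rfloor> / real n - t\<bar> \<le> 1 / real n" if "n > 0" for n t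
    proof -
      have "\<bar>of_int \<lfloor>real n * t\<rfloor> - real n * t\<bar> \<le> 1" by linarith
      then have "\<bar>(of_int \<lfloor>real n * t\<rfloor> - real n * t) / real n\<bar> \<le> 1 / real n"
        using that by (simp add: divide_right_mono abs_divide)
      then show ?thesis using that by (simp add: diff_divide_distrib)
    qed
    have C: "0 \<le> C" using order_trans[OF norm_ge_zero bound[OF i, of 0]] by simp
    show "AE t in \<mu> i. norm (f i (Suc n) t) \<le> (C * 2 ^ m) * (1 + \<bar>t\<bar>) ^ m" for n
    proof (rule AE_I2)
      fix t
      have "cmod (h i (of_int \<lfloor>real (Suc n) * t\<rfloor> / real (Suc n))) \<le>
            C * (1 + \<bar>of_int \<lfloor>real (Suc n) * t\<rfloor> / real (Suc n)\<bar>) ^ m"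
        by (rule bound[OF i])
      \<comment> \<open>The left endpoint lies within distance 1 of t, which costs the factor 2^m in
        the dominating function.\<close>
      also have "\<dots> \<le> C * (2 * (1 + \<bar>t\<bar>)) ^ m"
      proof (intro mult_left_mono power_mono C)
        have "1 / real (Suc n) \<le> 1" by simp
        then have "\<bar>of_int \<lfloor>real (Suc n) * t\<rfloor> / real (Suc n) - t\<bar> \<le> 1"
          by (rule order_trans[OF floor_close[OF zero_less_Suc]])
        moreover have "\<bar>q - t\<bar> \<le> 1 \<Longrightarrow> 1 + \<bar>q\<bar> \<le> 2 * (1 + \<bar>t\<bar>)" for q :: real
          by (simp add: abs_if split: if_splits)
        ultimately show "1 + \<bar>of_int \<lfloor>real (Suc n) * t\<rfloor> / real (Suc n)\<bar> \<le> 2 * (1 + \<bar>t\<bar>)"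
          by blast
      qed auto
      also have "\<dots> = (C * 2 ^ m) * (1 + \<bar>t\<bar>) ^ m"
        by (simp only: power_mult_distrib mult.assoc)
      finally show "norm (f i (Suc n) t) \<le> (C * 2 ^ m) * (1 + \<bar>t\<bar>) ^ m"
        using C by (subst f_eq) (simp_all del: of_nat_Suc)
    qed
    show "AE t in \<mu> i. (\<lambda>n. f i (Suc n) t) \<longlonglongrightarrow> h i t"
    proof (rule AE_I2)
      fix t
      have "(\<lambda>n. of_int \<lfloor>real (Suc n) * t\<rfloor> / real (Suc n) - t) \<longlonglongrightarrow> 0"
      proof (rule Lim_null_comparison[OF always_eventually])
        show "\<forall>n. norm (of_int \<lfloor>real (Suc n) * t\<rfloor> / real (Suc n) - t) \<le> inverse (real (Suc n))"
          unfolding real_norm_def inverse_eq_divide by (intro allI floor_close) simp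
      qed (rule LIMSEQ_inverse_real_of_nat)
      then have "(\<lambda>n. of_int \<lfloor>real (Suc n) * t\<rfloor> / real (Suc n)) \<longlonglongrightarrow> t"
        by (simp add: LIM_zero_iff)
      then have "(\<lambda>n. h i (of_int \<lfloor>real (Suc n) * t\<rfloor> / real (Suc n))) \<longlonglongrightarrow> h i t"
        using cont[OF i] by (auto simp: continuous_on_eq_continuous_at intro: isCont_tendsto_compose)
      moreover have "\<forall>\<^sub>F n in sequentially. f i (Suc n) t = h i (of_int \<lfloor>real (Suc n) * t\<rfloor> / real (Suc n))"
      proof (rule eventually_sequentiallyI)
        fix n assume n: "nat \<lceil>\<bar>t\<bar>\<rceil> \<le> n"
        then have t: "\<bar>t\<bar> \<le> real n" by linarith
        have "\<bar>real (Suc n) * t\<bar> \<le> real (Suc n) * real n"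
          unfolding abs_mult using t by (intro mult_mono) auto
        then have "-(real (Suc n) * real (Suc n)) \<le> real (Suc n) * t"
          "real (Suc n) * t < real (Suc n) * real (Suc n)" by (auto simp: algebra_simps)
        then have "\<lfloor>real (Suc n) * t\<rfloor> \<in> J (Suc n)"
          by (auto simp: J_def le_floor_iff floor_less_iff simp del: of_nat_Suc of_nat_add)
        then show "f i (Suc n) t = h i (of_int \<lfloor>real (Suc n) * t\<rfloor> / real (Suc n))"
          by (subst f_eq) auto
      qed
      ultimately show "(\<lambda>n. f i (Suc n) t) \<longlonglongrightarrow> h i t"
        by (simp add: tendsto_cong)
    qed
    show "f i (Suc n) \<in> borel_measurable (\<mu> i)" for n
      by (rule finite_borel_measure_measurable[OF \<mu>[OF i]]) (simp add: f_def[abs_def] I'_def)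
  qed
  have nonneg: "0 \<le> Re (\<Sum>i\<in>I. \<integral>t. f i n t \<partial>\<mu> i)" if "n > 0" for n
  proof -
    have eq: "(\<integral>t. f i n t \<partial>\<mu> i) = (\<Sum>j\<in>J n. h i (of_int j / real n) * measure (\<mu> i) (I' n j))"
      if i: "i \<in> I" for i
    proof -
      interpret finite_borel_measure "\<mu> i" by (rule \<mu>[OF i])
      have [measurable]: "I' n j \<in> sets (\<mu> i)" for j by (simp add: I'_def M_is_borel)
      show ?thesis
        unfolding f_def
        by (subst Bochner_Integration.integral_sum)
          (auto simp: borel_UNIV less_top[symmetric] intro!: integrable_of_real integrable_real_indicator)
    qed
    have "(\<Sum>i\<in>I. \<integral>t. f i n t \<partial>\<mu> i) =
          (\<Sum>j\<in>J n. \<Sum>i\<in>I. h i (of_int j / real n) * measure (\<mu> i) (I' n j))"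
      by (subst sum.swap) (simp add: eq)
    also have "0 \<le> Re \<dots>"
      unfolding Re_sum[of _ "J n"] I'_def using that
      by (intro sum_nonneg pos) (simp add: divide_right_mono)
    finally show ?thesis .
  qed
  have "(\<lambda>n. Re (\<Sum>i\<in>I. \<integral>t. f i (Suc n) t \<partial>\<mu> i)) \<longlonglongrightarrow> Re (\<Sum>i\<in>I. \<integral>t. h i t \<partial>\<mu> i)"
    by (intro tendsto_intros lim)
  then show ?thesis
    by (rule LIMSEQ_le_const) (use nonneg in auto)
qed


section \<open>Estimates for the kernel 1/(t - z) and limits in the sector\<close>

lemma continuous_resolvent_kernel:
  fixes z :: complex
  assumes "Im z \<noteq> 0"
  shows "continuous_on UNIV (\<lambda>t::real. 1 / (complex_of_real t - z))"
proof -
  have "complex_of_real t - z \<noteq> 0" for t using assms by (auto simp: complex_eq_iff)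
  then show ?thesis by (intro continuous_intros) auto
qed

lemma resolvent_kernel_bound:
  fixes z :: complex
  assumes "Im z \<noteq> 0"
  shows "cmod (1 / (complex_of_real t - z)) \<le> 1 / \<bar>Im z\<bar>"
proof -
  have "\<bar>Im z\<bar> \<le> cmod (complex_of_real t - z)"
    using abs_Im_le_cmod[of "complex_of_real t - z"] by simp
  then show ?thesis using assms by (simp add: norm_divide divide_simps)
qed

lemma integrable_mult_resolvent_kernel:
  assumes \<mu>: "finite_borel_measure \<mu>" and z: "Im z \<noteq> 0" and g: "integrable \<mu> (g :: real \<Rightarrow> complex)"
  shows "integrable \<mu> (\<lambda>t. g t / (complex_of_real t - z))"
proof (rule Bochner_Integration.integrable_bound)
  show "integrable \<mu> (\<lambda>t. (1 / \<bar>Im z\<bar>) * cmod (g t))"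
    using g by simp
  have "(\<lambda>t::real. 1 / (complex_of_real t - z)) \<in> borel_measurable \<mu>"
    by (rule finite_borel_measure_measurable[OF \<mu>],
        rule borel_measurable_continuous_onI[OF continuous_resolvent_kernel[OF z]])
  then have "(\<lambda>t. g t * (1 / (complex_of_real t - z))) \<in> borel_measurable \<mu>"
    using g by (intro borel_measurable_times) auto
  then show "(\<lambda>t. g t / (complex_of_real t - z)) \<in> borel_measurable \<mu>" by simp
  show "AE t in \<mu>. norm (g t / (complex_of_real t - z)) \<le> norm ((1 / \<bar>Im z\<bar>) * cmod (g t))"
  proof (rule AE_I2)
    fix t
    have "norm (g t / (complex_of_real t - z)) = cmod (g t) * cmod (1 / (complex_of_real t - z))"
      by (simp add: norm_divide norm_mult)
    also have "\<dots> \<le> cmod (g t) * (1 / \<bar>Im z\<bar>)"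
      by (intro mult_left_mono resolvent_kernel_bound z) simp
    finally show "norm (g t / (complex_of_real t - z)) \<le> norm ((1 / \<bar>Im z\<bar>) * cmod (g t))"
      using z by (simp add: abs_mult)
  qed
qed

lemma integrable_resolvent_kernel:
  assumes \<mu>: "finite_borel_measure \<mu>" and z: "Im z \<noteq> 0"
  shows "integrable \<mu> (\<lambda>t. 1 / (complex_of_real t - z))"
proof -
  interpret finite_borel_measure \<mu> by fact
  show ?thesis using integrable_mult_resolvent_kernel[OF \<mu> z, of "\<lambda>_. 1"] by simp
qed

text \<open>From Im z = |z| sin(Arg z): in the sector Im z is comparable to |z|. The angle
  \<epsilon> enters the estimates through this factor sin \<epsilon>.\<close>

lemma upper_sector_bounds:
  assumes \<epsilon>: "0 < \<epsilon>" "\<epsilon> \<le> pi / 2" and z: "z \<in> upper_sector \<epsilon>"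
  shows "0 < Im z" "sin \<epsilon> * cmod z \<le> Im z"
proof -
  show im: "0 < Im z" using z by (simp add: upper_sector_def upper_half_plane_def)
  have arg: "\<epsilon> \<le> Arg z" "Arg z \<le> pi - \<epsilon>" using z by (auto simp: upper_sector_def)
  have "sin \<epsilon> \<le> sin (Arg z)"
  proof (cases "Arg z \<le> pi / 2")
    case True
    then show ?thesis using arg \<epsilon> by (intro sin_monotone_2pi_le) auto
  next
    case False
    have "sin \<epsilon> \<le> sin (pi - Arg z)" using arg \<epsilon> False by (intro sin_monotone_2pi_le) auto
    then show ?thesis by simp
  qed
  moreover have "Im z = cmod z * sin (Arg z)"
    using im by (subst sin_Arg) auto
  ultimately show "sin \<epsilon> * cmod z \<le> Im z" by (simp add: mult.commute mult_left_mono)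
qed

text \<open>The bound \<epsilon> \<le> pi/2 keeps the upper imaginary axis inside the sector. Hence
  the filter is proper, and a sectorial limit may be computed along iy.\<close>

lemma imaginary_axis_sector:
  assumes "0 < \<epsilon>" "\<epsilon> \<le> pi / 2"
  shows "filterlim (\<lambda>y. \<i> * complex_of_real y) (sector_at_infinity \<epsilon>) at_top"
  unfolding sector_at_infinity_def filterlim_inf filterlim_principal
proof
  show "filterlim (\<lambda>y. \<i> * complex_of_real y) at_infinity at_top"
    by (simp add: filterlim_at_infinity_conv_norm_at_top norm_mult filterlim_abs_real)
  show "\<forall>\<^sub>F y in at_top. \<i> * complex_of_real y \<in> upper_sector \<epsilon>"
  proof (rule eventually_mono[OF eventually_gt_at_top[of 0]])
    fix y :: real assume "0 < y"
    then have "Arg (\<i> * complex_of_real y) = pi / 2" by (simp add: Arg_ii Arg_times_of_real)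
    then show "\<i> * complex_of_real y \<in> upper_sector \<epsilon>"
      using assms \<open>0 < y\<close> by (auto simp: upper_sector_def upper_half_plane_def)
  qed
qed

lemma sector_at_infinity_neq_bot:
  assumes "0 < \<epsilon>" "\<epsilon> \<le> pi / 2"
  shows "sector_at_infinity \<epsilon> \<noteq> bot"
  using filterlim_mono[OF imaginary_axis_sector[OF assms] order_refl order_refl]
  by (auto simp: filterlim_def filtermap_bot_iff bot_unique)

lemma eventually_sector_at_infinity:
  "\<forall>\<^sub>F z in sector_at_infinity \<epsilon>. z \<in> upper_sector \<epsilon>"
  by (simp add: sector_at_infinity_def eventually_inf_principal)

lemma cmod_sector_at_infinity: "filterlim cmod at_top (sector_at_infinity \<epsilon>)"
  unfolding sector_at_infinity_def
  by (rule filterlim_mono[OF _ order_refl inf_le1]) (rule filterlim_norm_at_top)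

text \<open>Since -z/(t - z) - 1 = -t/(t - z), the error is the integral of -t g(t)/(t - z),
  dominated in the sector by K min(1, |t|/|z|) |g(t)|. The minimum is bounded and tends to 0
  pointwise, so integrability of g suffices.\<close>

lemma resolvent_kernel_integral_limit:
  assumes \<mu>: "finite_borel_measure \<mu>" and g: "integrable \<mu> (g :: real \<Rightarrow> complex)"
    and \<epsilon>: "0 < \<epsilon>" "\<epsilon> \<le> pi / 2"
  shows "((\<lambda>z. - z * (\<integral>t. g t / (complex_of_real t - z) \<partial>\<mu>)) \<longlongrightarrow> (\<integral>t. g t \<partial>\<mu>)) (sector_at_infinity \<epsilon>)"
proof -
  interpret finite_borel_measure \<mu> by fact
  \<comment> \<open>One constant for two bounds of |t|/|t - z|: it is at most 1 + |z|/|t - z| \<le>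
    1 + 1/sin \<epsilon>, and at most (1/sin \<epsilon>) |t|/|z|.\<close>
  define K where "K = 1 + 1 / sin \<epsilon>"
  have sin: "0 < sin \<epsilon>" using \<epsilon> by (intro sin_gt_zero) auto
  then have K: "0 \<le> K" by (simp add: K_def)
  define w where "w s t = min 1 (\<bar>t\<bar> / s) * cmod (g t)" for s t :: real
  have [measurable]: "g \<in> borel_measurable \<mu>" using g by auto
  have [measurable]: "(\<lambda>t. t) \<in> borel_measurable \<mu>" by (rule finite_borel_measure_measurable[OF \<mu>]) simp
  have w_meas: "w s \<in> borel_measurable \<mu>" for s unfolding w_def[abs_def] by measurable
  have w_bound: "norm (w s t) \<le> cmod (g t)" if "s > 0" for s t
  proof -
    have "min 1 (\<bar>t\<bar> / s) * cmod (g t) \<le> 1 * cmod (g t)" by (intro mult_right_mono) auto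
    moreover have "0 \<le> min 1 (\<bar>t\<bar> / s)" using that by auto
    ultimately show ?thesis by (simp add: w_def abs_mult)
  qed
  have w_int: "integrable \<mu> (w s)" if "s > 0" for s
    by (rule Bochner_Integration.integrable_bound[OF integrable_norm[OF g]])
       (use w_meas w_bound[OF that] in auto)
  \<comment> \<open>The dominating integral depends on |z| only, so the sectorial limit reduces to a
    real parameter s; \<open>max 1 s\<close> keeps the quotient |t|/s meaningful for every
    s.\<close>
  have "((\<lambda>s. \<integral>t. w (max 1 s) t \<partial>\<mu>) \<longlongrightarrow> (\<integral>t. 0 \<partial>\<mu>)) at_top"
  proof (rule integral_dominated_convergence_at_top[where w = "\<lambda>t. cmod (g t)"])
    show "\<forall>\<^sub>F s in at_top. AE t in \<mu>. norm (w (max 1 s) t) \<le> cmod (g t)"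
      by (intro always_eventually allI AE_I2 w_bound) simp
    show "AE t in \<mu>. ((\<lambda>s. w (max 1 s) t) \<longlongrightarrow> 0) at_top"
    proof (rule AE_I2)
      fix t :: real
      have "((\<lambda>s. \<bar>t\<bar> * inverse s) \<longlongrightarrow> \<bar>t\<bar> * 0) at_top"
        by (intro tendsto_mult tendsto_const tendsto_inverse_0_at_top filterlim_ident)
      then have "((\<lambda>s. \<bar>t\<bar> / s) \<longlongrightarrow> 0) at_top" by (simp add: divide_inverse)
      then have "((\<lambda>s. min 1 (\<bar>t\<bar> / s) * cmod (g t)) \<longlongrightarrow> min 1 0 * cmod (g t)) at_top"
        by (intro tendsto_intros tendsto_min)
      moreover have "\<forall>\<^sub>F s in at_top. min 1 (\<bar>t\<bar> / s) * cmod (g t) = w (max 1 s) t"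
        by (rule eventually_mono[OF eventually_ge_at_top[of 1]]) (simp add: w_def max_absorb2)
      ultimately show "((\<lambda>s. w (max 1 s) t) \<longlongrightarrow> 0) at_top"
        by (simp add: tendsto_cong)
    qed
  qed (use g w_meas in auto)
  then have "((\<lambda>s. \<integral>t. w (max 1 s) t \<partial>\<mu>) \<longlongrightarrow> 0) at_top" by simp
  then have w_lim: "((\<lambda>z. K * (\<integral>t. w (max 1 (cmod z)) t \<partial>\<mu>)) \<longlongrightarrow> K * 0) (sector_at_infinity \<epsilon>)"
    by (intro tendsto_mult tendsto_const) (rule filterlim_compose[OF _ cmod_sector_at_infinity])
  have "((\<lambda>z. - z * (\<integral>t. g t / (complex_of_real t - z) \<partial>\<mu>) - (\<integral>t. g t \<partial>\<mu>)) \<longlongrightarrow> 0) (sector_at_infinity \<epsilon>)"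
  proof (rule tendsto_0_le[where K = 1, OF w_lim[simplified]])
    have ev: "\<forall>\<^sub>F z in sector_at_infinity \<epsilon>. z \<in> upper_sector \<epsilon> \<and> 1 \<le> cmod z"
      using eventually_sector_at_infinity filterlim_at_top[THEN iffD1, OF cmod_sector_at_infinity]
      by (auto simp: eventually_conj)
    show "\<forall>\<^sub>F z in sector_at_infinity \<epsilon>.
       norm (- z * (\<integral>t. g t / (complex_of_real t - z) \<partial>\<mu>) - (\<integral>t. g t \<partial>\<mu>))
         \<le> norm (K * (\<integral>t. w (max 1 (cmod z)) t \<partial>\<mu>)) * 1"
    proof (rule eventually_mono[OF ev])
      fix z assume z: "z \<in> upper_sector \<epsilon> \<and> 1 \<le> cmod z"
      note zb = upper_sector_bounds[OF \<epsilon> conjunct1[OF z]]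
      have z0: "0 < cmod z" using z by linarith
      have ne: "complex_of_real t - z \<noteq> 0" for t using zb(1) by (auto simp: complex_eq_iff)
      have i1: "integrable \<mu> (\<lambda>t. g t / (complex_of_real t - z))"
        using integrable_mult_resolvent_kernel[OF \<mu> _ g] zb(1) by simp
      have "- z * (\<integral>t. g t / (complex_of_real t - z) \<partial>\<mu>) - (\<integral>t. g t \<partial>\<mu>) =
            (\<integral>t. - z * (g t / (complex_of_real t - z)) - g t \<partial>\<mu>)"
        by (subst Bochner_Integration.integral_diff[OF integrable_mult_right g, OF i1])
           (simp only: integral_mult_right_zero)
      also have "\<dots> = (\<integral>t. - (complex_of_real t * g t / (complex_of_real t - z)) \<partial>\<mu>)"
        using ne by (intro Bochner_Integration.integral_cong refl) (simp add: divide_simps, simp add: algebra_simps)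
      also have "norm \<dots> \<le> (\<integral>t. K * w (cmod z) t \<partial>\<mu>)"
      proof (rule Bochner_Integration.integral_norm_bound_integral)
        have "(\<lambda>t. - z * (g t / (complex_of_real t - z)) - g t) = (\<lambda>t. - (complex_of_real t * g t / (complex_of_real t - z)))"
          using ne by (intro ext) (simp add: divide_simps, simp add: algebra_simps)
        moreover have "integrable \<mu> (\<lambda>t. - z * (g t / (complex_of_real t - z)) - g t)"
          by (intro Bochner_Integration.integrable_diff integrable_mult_right i1 g)
        ultimately show "integrable \<mu> (\<lambda>t. - (complex_of_real t * g t / (complex_of_real t - z)))" by simp
        show "integrable \<mu> (\<lambda>t. K * w (cmod z) t)" using w_int[OF z0] by simp
        fix t
        define D where "D = cmod (complex_of_real t - z)"
        have D0: "0 < D" using ne by (simp add: D_def)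
        have D1: "sin \<epsilon> * cmod z \<le> D"
          using zb abs_Im_le_cmod[of "complex_of_real t - z"] by (simp add: D_def)
        have "\<bar>t\<bar> \<le> D + cmod z"
          using norm_triangle_ineq[of "complex_of_real t - z" z] by (simp add: D_def)
        also have "\<dots> \<le> D * K" using D1 sin by (simp add: K_def field_simps)
        finally have 1: "\<bar>t\<bar> / D \<le> K" using D0 by (simp add: field_simps)
        have "\<bar>t\<bar> / D \<le> \<bar>t\<bar> / (sin \<epsilon> * cmod z)"
          using D1 D0 sin z0 by (intro divide_left_mono) auto
        also have "\<dots> = (1 / sin \<epsilon>) * (\<bar>t\<bar> / cmod z)" by simp
        also have "\<dots> \<le> K * (\<bar>t\<bar> / cmod z)" by (intro mult_right_mono) (auto simp: K_def)
        finally have 2: "\<bar>t\<bar> / D \<le> K * (\<bar>t\<bar> / cmod z)" .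
        have "norm (- (complex_of_real t * g t / (complex_of_real t - z))) = (\<bar>t\<bar> / D) * cmod (g t)"
          by (simp add: norm_mult norm_divide D_def)
        also have "\<dots> \<le> (K * min 1 (\<bar>t\<bar> / cmod z)) * cmod (g t)"
          using 1 2 by (intro mult_right_mono) (auto simp: min_def)
        finally show "norm (- (complex_of_real t * g t / (complex_of_real t - z))) \<le> K * w (cmod z) t"
          by (simp add: w_def mult.assoc)
      qed
      also have "\<dots> = K * (\<integral>t. w (max 1 (cmod z)) t \<partial>\<mu>)" using z by (simp add: max_absorb2)
      finally show "norm (- z * (\<integral>t. g t / (complex_of_real t - z) \<partial>\<mu>) - (\<integral>t. g t \<partial>\<mu>))
         \<le> norm (K * (\<integral>t. w (max 1 (cmod z)) t \<partial>\<mu>)) * 1" by simp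
    qed
  qed
  then show ?thesis by (simp add: LIM_zero_iff)
qed

subsection \<open>Stieltjes inversion\<close>

text \<open>Stieltjes inversion, kept linear because the coefficients are complex. Integrating the
  Poisson kernel over x gives a difference of arctangents in t, whose limit is pi times the
  indicator of an interval; the combination vanishes before the limit, hence also after it.\<close>

lemma resolvent_kernel_combination_inversion:
  fixes \<mu> :: "'i \<Rightarrow> real measure" and a :: "'i \<Rightarrow> complex"
  assumes fin: "finite I" and \<mu>: "\<And>i. i \<in> I \<Longrightarrow> finite_borel_measure (\<mu> i)"
    and zero: "\<And>z. Im z \<noteq> 0 \<Longrightarrow> (\<Sum>i\<in>I. a i * (\<integral>t. 1 / (complex_of_real t - z) \<partial>\<mu> i)) = 0"
    and uv: "u \<le> v"
  shows "(\<Sum>i\<in>I. a i * measure (\<mu> i) {u..<v}) = 0"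
proof -
  define P where "P \<eta> x t = \<eta> / ((t - x)\<^sup>2 + \<eta>\<^sup>2)" for \<eta> x t :: real
  have cP: "continuous_on UNIV (P \<eta> x)" if "0 < \<eta>" for \<eta> x
    unfolding P_def using that
    by (intro continuous_intros) (auto simp: add_nonneg_eq_0_iff)
  \<comment> \<open>The Poisson kernel is the imaginary part of the kernel at x + i \<eta>. Written
    as a difference of kernels at conjugate points it stays linear in the transforms, which is why
    \<open>zero\<close> covers both half planes.\<close>
  have P_kernel: "complex_of_real (P \<eta> x t) =
      (1 / (complex_of_real t - Complex x \<eta>) - 1 / (complex_of_real t - Complex x (- \<eta>))) / (2 * \<i>)"
    if "0 < \<eta>" for \<eta> x t
  proof -
    define A where "A = complex_of_real t - Complex x \<eta>"
    define B where "B = complex_of_real t - Complex x (- \<eta>)"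
    have AB: "A * B = complex_of_real ((t - x)\<^sup>2 + \<eta>\<^sup>2)" "B - A = 2 * \<i> * \<eta>"
      by (auto simp: A_def B_def complex_eq_iff power2_eq_square algebra_simps)
    have "A \<noteq> 0" "B \<noteq> 0" using that by (auto simp: A_def B_def complex_eq_iff)
    then have "1 / A - 1 / B = (B - A) / (A * B)" by (simp add: field_simps)
    moreover have "2 * \<i> * a / X / (2 * \<i>) = a / X" for a X :: complex
      by (cases "X = 0") (simp_all add: field_simps)
    ultimately have "(1 / A - 1 / B) / (2 * \<i>) = complex_of_real \<eta> / complex_of_real ((t - x)\<^sup>2 + \<eta>\<^sup>2)"
      using AB by (simp only:)
    then show ?thesis by (simp only: A_def B_def P_def of_real_divide)
  qed
  have P_zero: "(\<Sum>i\<in>I. a i * complex_of_real (\<integral>t. P \<eta> x t \<partial>\<mu> i)) = 0" if "0 < \<eta>" for \<eta> x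
  proof -
    have "complex_of_real (\<integral>t. P \<eta> x t \<partial>\<mu> i) =
        ((\<integral>t. 1 / (complex_of_real t - Complex x \<eta>) \<partial>\<mu> i)
          - (\<integral>t. 1 / (complex_of_real t - Complex x (-\<eta>)) \<partial>\<mu> i)) / (2 * \<i>)" if i: "i \<in> I" for i
      using integrable_resolvent_kernel[OF \<mu>[OF i]] \<open>0 < \<eta>\<close>
      unfolding integral_complex_of_real[symmetric] P_kernel[OF \<open>0 < \<eta>\<close>]
      by (subst Bochner_Integration.integral_diff[symmetric]) auto
    then have "(\<Sum>i\<in>I. a i * complex_of_real (\<integral>t. P \<eta> x t \<partial>\<mu> i)) =
      ((\<Sum>i\<in>I. a i * (\<integral>t. 1 / (complex_of_real t - Complex x \<eta>) \<partial>\<mu> i))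
          - (\<Sum>i\<in>I. a i * (\<integral>t. 1 / (complex_of_real t - Complex x (-\<eta>)) \<partial>\<mu> i))) / (2 * \<i>)"
      by (simp only: sum_divide_distrib sum_subtractf[symmetric] right_diff_distrib[symmetric]
          times_divide_eq_right cong: sum.cong)
    then show ?thesis using zero that by simp
  qed
  define R where "R \<eta> c d t = arctan ((d - t) / \<eta>) - arctan ((c - t) / \<eta>)" for \<eta> c d t :: real
  have R_P: "R \<eta> c d t = (\<integral>x. indicator {c..d} x * P \<eta> x t \<partial>lborel)" if "0 < \<eta>" "c \<le> d" for \<eta> c d t
  proof -
    have "(\<integral>x. indicator {c..d} x *\<^sub>R P \<eta> x t \<partial>lborel) = arctan ((d - t) / \<eta>) - arctan ((c - t) / \<eta>)"
    proof (rule integral_FTC_Icc)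
      show "c \<le> d" by fact
      show "((\<lambda>x. arctan ((x - t) / \<eta>)) has_vector_derivative P \<eta> x t) (at x within {c..d})" for x
      proof -
        have "((\<lambda>x. arctan ((x - t) / \<eta>)) has_real_derivative inverse (1 + ((x - t) / \<eta>)\<^sup>2) * (1 / \<eta>)) (at x)"
          using that by (auto intro!: derivative_eq_intros)
        moreover have "inverse (1 + ((x - t) / \<eta>)\<^sup>2) * (1 / \<eta>) = P \<eta> x t"
          using that by (simp add: P_def field_simps power2_eq_square)
        ultimately show ?thesis
          by (metis has_field_derivative_at_within has_real_derivative_iff_has_vector_derivative)
      qed
      show "continuous_on {c..d} (\<lambda>x. P \<eta> x t)"
        unfolding P_def using that by (intro continuous_intros) (auto simp: add_nonneg_eq_0_iff)
    qed
    then show ?thesis by (simp add: R_def)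
  qed
  have R_zero: "(\<Sum>i\<in>I. a i * complex_of_real (\<integral>t. R \<eta> c d t \<partial>\<mu> i)) = 0" if \<eta>: "0 < \<eta>" and cd: "c \<le> d" for \<eta> c d
  proof -
    have fub: "(\<integral>t. R \<eta> c d t \<partial>\<mu> i) = (\<integral>x. indicator {c..d} x * (\<integral>t. P \<eta> x t \<partial>\<mu> i) \<partial>lborel)"
      and fub_int: "integrable lborel (\<lambda>x. indicator {c..d} x * (\<integral>t. P \<eta> x t \<partial>\<mu> i))"
      if i: "i \<in> I" for i
    proof -
      interpret finite_borel_measure "\<mu> i" by (rule \<mu>[OF i])
      interpret pair_sigma_finite "\<mu> i" lborel ..
      have [measurable_cong]: "sets (\<mu> i) = sets borel" by (rule M_is_borel)
      have int: "integrable (\<mu> i \<Otimes>\<^sub>M lborel) (\<lambda>(t, x). indicator {c..d} x * P \<eta> x t)"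
      proof (rule Bochner_Integration.integrable_bound)
        have "emeasure (\<mu> i \<Otimes>\<^sub>M lborel) (space (\<mu> i) \<times> {c..d}) = emeasure (\<mu> i) (space (\<mu> i)) * emeasure lborel {c..d}"
          by (rule lborel.emeasure_pair_measure_Times) auto
        also have "\<dots> < \<infinity>" using cd by (simp add: emeasure_eq_measure ennreal_mult_less_top)
        finally show "integrable (\<mu> i \<Otimes>\<^sub>M lborel) (\<lambda>p. indicator (space (\<mu> i) \<times> {c..d}) p * (1 / \<eta>))"
          by (intro integrable_mult_left integrable_real_indicator) auto
        show "(\<lambda>(t, x). indicator {c..d} x * P \<eta> x t) \<in> borel_measurable (\<mu> i \<Otimes>\<^sub>M lborel)"
          unfolding P_def by measurable
        have P_le: "P \<eta> x t \<le> 1 / \<eta>" for x t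
        proof -
          have "P \<eta> x t \<le> \<eta> / \<eta>\<^sup>2" unfolding P_def using \<eta> by (intro divide_left_mono) (auto intro!: mult_pos_pos add_nonneg_pos)
          then show ?thesis using \<eta> by (simp add: power2_eq_square)
        qed
        have "0 \<le> P \<eta> x t" for x t using \<eta> by (simp add: P_def)
        then show "AE p in \<mu> i \<Otimes>\<^sub>M lborel. norm (case p of (t, x) \<Rightarrow> indicator {c..d} x * P \<eta> x t)
                  \<le> norm (indicator (space (\<mu> i) \<times> {c..d}) p * (1 / \<eta>))"
          using P_le \<eta> by (intro AE_I2) (auto simp: borel_UNIV indicator_def space_pair_measure)
      qed
      have "(\<integral>t. R \<eta> c d t \<partial>\<mu> i) = (\<integral>t. (\<integral>x. indicator {c..d} x * P \<eta> x t \<partial>lborel) \<partial>\<mu> i)"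
        by (simp add: R_P[OF \<eta> cd])
      also have "\<dots> = (\<integral>x. (\<integral>t. indicator {c..d} x * P \<eta> x t \<partial>\<mu> i) \<partial>lborel)"
        by (rule Fubini_integral[OF int, symmetric])
      finally show "(\<integral>t. R \<eta> c d t \<partial>\<mu> i) = (\<integral>x. indicator {c..d} x * (\<integral>t. P \<eta> x t \<partial>\<mu> i) \<partial>lborel)"
        by simp
      show "integrable lborel (\<lambda>x. indicator {c..d} x * (\<integral>t. P \<eta> x t \<partial>\<mu> i))"
        using integrable_snd[OF int] by simp
    qed
    have "(\<Sum>i\<in>I. a i * complex_of_real (\<integral>t. R \<eta> c d t \<partial>\<mu> i)) =
          (\<Sum>i\<in>I. \<integral>x. a i * complex_of_real (indicator {c..d} x * (\<integral>t. P \<eta> x t \<partial>\<mu> i)) \<partial>lborel)"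
      by (intro sum.cong refl) (simp only: fub integral_mult_right_zero integral_complex_of_real)
    also have "\<dots> = (\<integral>x. (\<Sum>i\<in>I. a i * complex_of_real (indicator {c..d} x * (\<integral>t. P \<eta> x t \<partial>\<mu> i))) \<partial>lborel)"
      using fub_int by (intro Bochner_Integration.integral_sum[symmetric] integrable_mult_right integrable_of_real) auto
    also have "\<dots> = (\<integral>x. indicator {c..d} x * (\<Sum>i\<in>I. a i * complex_of_real (\<integral>t. P \<eta> x t \<partial>\<mu> i)) \<partial>lborel)"
      by (intro Bochner_Integration.integral_cong refl) (simp add: sum_distrib_left mult_ac indicator_def)
    also have "\<dots> = 0" using P_zero[OF \<eta>] by simp
    finally show ?thesis .
  qed
  \<comment> \<open>The endpoints move left by 1/n while the smoothing width is the smaller 1/n^2.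
    In the limit an atom at u is therefore counted fully and an atom at v not at all, which produces
    [u, v).\<close>
  define Q where "Q n = R (1 / (real n)\<^sup>2) (u - 1 / real n) (v - 1 / real n)" for n
  have Q_eq: "Q n t = arctan ((real n)\<^sup>2 * (v - t) - real n) - arctan ((real n)\<^sup>2 * (u - t) - real n)" for n t
  proof -
    have "(s - 1 / real n - t) / (1 / (real n)\<^sup>2) = (real n)\<^sup>2 * (s - t) - real n" for s
      by (cases "n = 0") (simp_all add: power2_eq_square algebra_simps)
    then show ?thesis by (simp only: Q_def R_def)
  qed
  have arctan_lim: "(\<lambda>n. arctan ((real n)\<^sup>2 * s - real n)) \<longlonglongrightarrow> (if 0 < s then pi / 2 else - (pi / 2))" for s
  proof (cases "0 < s")
    case True
    then have "filterlim (\<lambda>n. (real n)\<^sup>2 * s - real n) at_top sequentially" by real_asymp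
    then show ?thesis using True by (auto intro: filterlim_compose[OF tendsto_arctan_at_top])
  next
    case False
    have "filterlim (\<lambda>n. (real n)\<^sup>2 * (- s) + real n) at_top sequentially"
      by (rule filterlim_at_top_mono[OF filterlim_real_sequentially]) (use False in \<open>auto intro!: always_eventually mult_nonneg_nonpos\<close>)
    then have "filterlim (\<lambda>n. (real n)\<^sup>2 * s - real n) at_bot sequentially"
      by (subst filterlim_uminus_at_bot) simp
    then show ?thesis using False by (auto intro: filterlim_compose[OF tendsto_arctan_at_bot])
  qed
  have Q_lim: "(\<lambda>n. \<integral>t. Q n t \<partial>\<mu> i) \<longlonglongrightarrow> pi * measure (\<mu> i) {u..<v}" if i: "i \<in> I" for i
  proof -
    interpret finite_borel_measure "\<mu> i" by (rule \<mu>[OF i])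
    have "(\<lambda>n. \<integral>t. Q n t \<partial>\<mu> i) \<longlonglongrightarrow> (\<integral>t. pi * indicator {u..<v} t \<partial>\<mu> i)"
    proof (rule integral_dominated_convergence[where w = "\<lambda>_. pi"])
      show "(\<lambda>t. pi * indicator {u..<v} t) \<in> borel_measurable (\<mu> i)"
        by (rule finite_borel_measure_measurable[OF \<mu>[OF i]]) simp
      show "Q n \<in> borel_measurable (\<mu> i)" for n
      proof (rule finite_borel_measure_measurable[OF \<mu>[OF i]], rule borel_measurable_continuous_onI)
        show "continuous_on UNIV (Q n)" unfolding Q_eq[abs_def] by (intro continuous_intros)
      qed
      show "integrable (\<mu> i) (\<lambda>_. pi)" by simp
      show "AE t in \<mu> i. (\<lambda>n. Q n t) \<longlonglongrightarrow> pi * indicator {u..<v} t"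
      proof (rule AE_I2)
        fix t
        have "(\<lambda>n. Q n t) \<longlonglongrightarrow> (if 0 < v - t then pi / 2 else - (pi / 2)) - (if 0 < u - t then pi / 2 else - (pi / 2))"
          unfolding Q_eq by (intro tendsto_diff arctan_lim)
        also have "(if 0 < v - t then pi / 2 else - (pi / 2)) - (if 0 < u - t then pi / 2 else - (pi / 2)) = pi * indicator {u..<v} t"
          using uv by (auto simp: indicator_def)
        finally show "(\<lambda>n. Q n t) \<longlonglongrightarrow> pi * indicator {u..<v} t" .
      qed
      show "AE t in \<mu> i. norm (Q n t) \<le> pi" for n
      proof (rule AE_I2)
        fix t show "norm (Q n t) \<le> pi"
          using arctan_bounded[of "(real n)\<^sup>2 * (v - t) - real n"] arctan_bounded[of "(real n)\<^sup>2 * (u - t) - real n"]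
          by (auto simp: Q_eq abs_le_iff)
      qed
    qed
    moreover have "(\<integral>t. pi * indicator {u..<v} t \<partial>\<mu> i) = pi * measure (\<mu> i) {u..<v}"
      by (simp add: borel_UNIV)
    ultimately show ?thesis by simp
  qed
  have "(\<lambda>n. \<Sum>i\<in>I. a i * complex_of_real (\<integral>t. Q n t \<partial>\<mu> i)) \<longlonglongrightarrow>
        (\<Sum>i\<in>I. a i * complex_of_real (pi * measure (\<mu> i) {u..<v}))"
    by (intro tendsto_intros Q_lim)
  moreover have "\<forall>\<^sub>F n in sequentially. (\<Sum>i\<in>I. a i * complex_of_real (\<integral>t. Q n t \<partial>\<mu> i)) = 0"
  proof (rule eventually_mono[OF eventually_gt_at_top[of 0]])
    fix n :: nat assume "0 < n"
    then show "(\<Sum>i\<in>I. a i * complex_of_real (\<integral>t. Q n t \<partial>\<mu> i)) = 0"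
      unfolding Q_def by (intro R_zero) (use uv in simp_all)
  qed
  ultimately have "(\<lambda>n. 0) \<longlonglongrightarrow> (\<Sum>i\<in>I. a i * complex_of_real (pi * measure (\<mu> i) {u..<v}))"
    by (rule Lim_transform_eventually)
  then have "complex_of_real pi * (\<Sum>i\<in>I. a i * complex_of_real (measure (\<mu> i) {u..<v})) = 0"
    by (simp add: LIMSEQ_const_iff sum_distrib_left mult_ac)
  then show ?thesis by simp
qed

subsection \<open>The Herglotz representation\<close>

text \<open>Cauchy's formula for g(r u) at w, plus the conjugate of Cauchy's formula at 0 for g(r
  u)/(1 - conj(w) u). On the unit circle 1/(1 - w conj(u)) = u/(u - w), so both integrals carry the
  same kernel and g + conj(g) = 2 Re g appears. The radius r < 1 keeps the circle inside the domain
  of g.\<close>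

lemma schwarz_disk_formula:
  fixes g :: "complex \<Rightarrow> complex" and r :: real and w :: complex
  assumes hol: "g holomorphic_on ball 0 1" and r: "0 < r" "r < 1" and w: "cmod w < 1"
  shows "((\<lambda>\<theta>. complex_of_real (Re (g (r * cis \<theta>))) * (2 * cis \<theta> / (cis \<theta> - w))) has_integral
          2 * pi * (g (r * w) + cnj (g 0))) {0..2 * pi}"
proof -
  have sub: "(\<lambda>u. complex_of_real r * u) ` cball 0 1 \<subseteq> ball 0 1"
  proof safe
    fix u :: complex assume "u \<in> cball 0 1"
    then have "r * cmod u \<le> r * 1" using r by (intro mult_left_mono) auto
    then have "r * cmod u < 1" using r by linarith
    then show "complex_of_real r * u \<in> ball 0 1" using r by (simp add: norm_mult)
  qed
  have h1: "(\<lambda>u. g (r * u)) holomorphic_on cball 0 1"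
    by (rule holomorphic_on_compose_gen[OF _ hol sub, unfolded comp_def]) (intro holomorphic_intros)
  have nz: "1 - cnj w * u \<noteq> 0" if "u \<in> cball 0 1" for u
  proof
    assume "1 - cnj w * u = 0"
    then have "cmod (cnj w * u) = 1" by (metis eq_iff_diff_eq_0 norm_one)
    moreover have "cmod (cnj w * u) \<le> cmod w * 1"
      using mult_left_mono[OF _ norm_ge_zero[of w], of "cmod u" 1] that by (simp add: norm_mult)
    ultimately show False using w by simp
  qed
  have h2: "(\<lambda>u. g (r * u) / (1 - cnj w * u)) holomorphic_on cball 0 1"
    using nz by (intro holomorphic_intros h1) auto
  have cisw: "cis \<theta> - w \<noteq> 0" for \<theta> using w by (metis eq_iff_diff_eq_0 less_irrefl norm_cis)
  have "((\<lambda>u. g (r * u) / (u - w)) has_contour_integral (2 * of_real pi * \<i> * g (r * w))) (circlepath 0 1)"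
    by (rule Cauchy_integral_circlepath_simple[OF h1]) (use w in simp)
  then have "((\<lambda>\<theta>. g (r * cis \<theta>) / (cis \<theta> - w) * \<i> * cis \<theta>) has_integral (2 * of_real pi * \<i> * g (r * w))) {0..2*pi}"
    unfolding circlepath_def by (subst (asm) has_contour_integral_part_circlepath_iff) (simp_all add: mult.assoc)
  from has_integral_mult_right[OF this, of "- \<i>"]
  have I1: "((\<lambda>\<theta>. g (r * cis \<theta>) * (cis \<theta> / (cis \<theta> - w))) has_integral (2 * of_real pi * g (r * w))) {0..2*pi}"
    by (simp add: mult_ac)
  have "((\<lambda>u. g (r * u) / (1 - cnj w * u) / (u - 0)) has_contour_integral (2 * of_real pi * \<i> * (g (complex_of_real r * 0) / (1 - cnj w * 0)))) (circlepath 0 1)"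
    by (rule Cauchy_integral_circlepath_simple[OF h2]) simp
  then have "((\<lambda>\<theta>. g (r * cis \<theta>) / (1 - cnj w * cis \<theta>) / cis \<theta> * \<i> * cis \<theta>) has_integral (2 * of_real pi * \<i> * g 0)) {0..2*pi}"
    unfolding circlepath_def by (subst (asm) has_contour_integral_part_circlepath_iff) (simp_all add: mult.assoc)
  from has_integral_mult_right[OF this, of "- \<i>"]
  have "((\<lambda>\<theta>. g (r * cis \<theta>) / (1 - cnj w * cis \<theta>)) has_integral (2 * of_real pi * g 0)) {0..2*pi}"
    by (simp add: mult_ac)
  then have I2': "(cnj \<circ> (\<lambda>\<theta>. g (r * cis \<theta>) / (1 - cnj w * cis \<theta>)) has_integral cnj (2 * of_real pi * g 0)) {0..2*pi}"
    by (simp only: has_integral_cnj)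
  have ker: "1 / (1 - w * cnj (cis \<theta>)) = cis \<theta> / (cis \<theta> - w)" for \<theta>
  proof -
    have "cis \<theta> * cnj (cis \<theta>) = 1" by (simp add: complex_norm_square[symmetric] del: cis_cnj)
    then have "cis \<theta> - w = cis \<theta> * (1 - w * cnj (cis \<theta>))" by (simp add: algebra_simps)
    then show ?thesis using cisw[of \<theta>] by simp
  qed
  have "cnj \<circ> (\<lambda>\<theta>. g (r * cis \<theta>) / (1 - cnj w * cis \<theta>)) = (\<lambda>\<theta>. cnj (g (r * cis \<theta>)) * (cis \<theta> / (cis \<theta> - w)))"
    by (auto simp: fun_eq_iff ker[symmetric] simp del: cis_cnj)
  then have I2: "((\<lambda>\<theta>. cnj (g (r * cis \<theta>)) * (cis \<theta> / (cis \<theta> - w))) has_integral (2 * of_real pi * cnj (g 0))) {0..2*pi}"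
    using I2' by simp
  have "((\<lambda>\<theta>. g (r * cis \<theta>) * (cis \<theta> / (cis \<theta> - w)) + cnj (g (r * cis \<theta>)) * (cis \<theta> / (cis \<theta> - w))) has_integral
      (2 * of_real pi * g (r * w) + 2 * of_real pi * cnj (g 0))) {0..2*pi}"
    by (rule has_integral_add[OF I1 I2])
  moreover have "g u * K + cnj (g u) * K = complex_of_real (Re (g u)) * (2 * K)" for u K
    using complex_add_cnj[of "g u"] by (simp add: distrib_right[symmetric])
  ultimately show ?thesis
    by (simp only: times_divide_eq_right[symmetric] distrib_left mult.assoc of_real_mult of_real_numeral)
qed

text \<open>By Schwarz's formula, Re g(r e^(i \<theta>)) / (2 pi m) on [0, 2 pi], with m = Re g(0),
  are probability densities reproducing g(r w). They live on a fixed compact set, so a subsequence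
  converges weakly as r tends to 1, and the kernel is bounded and continuous for |w| < 1.\<close>

lemma herglotz_disk:
  fixes g :: "complex \<Rightarrow> complex"
  assumes hol: "g holomorphic_on ball 0 1" and nonneg: "\<And>w :: complex. cmod w < 1 \<Longrightarrow> 0 \<le> Re (g w)"
  shows "\<exists>M. real_distribution M \<and>
    (\<forall>w :: complex. cmod w < 1 \<longrightarrow> g w = Re (g 0) * (\<integral>\<theta>. 2 * cis \<theta> / (cis \<theta> - w) \<partial>M) - cnj (g 0))"
proof -
  have g_cont: "isCont g w" if "cmod w < 1" for w :: complex
    using holomorphic_on_imp_continuous_on[OF hol] that by (simp add: continuous_on_eq_continuous_at)
  define m where "m = Re (g 0)"
  define K where "K w \<theta> = 2 * cis \<theta> / (cis \<theta> - w)" for w :: complex and \<theta>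
  have cisw: "cis \<theta> - w \<noteq> 0" if "cmod w < 1" for \<theta> and w :: complex using that by (metis eq_iff_diff_eq_0 less_irrefl norm_cis)
  have K_cont: "continuous_on UNIV (K w)" if "cmod w < 1" for w :: complex
    unfolding K_def using cisw[OF that] by (intro continuous_intros) auto
  define r where "r n = 1 - 1 / (real n + 2)" for n
  have r: "0 < r n" "r n < 1" for n by (auto simp: r_def field_simps)
  have rlim: "r \<longlonglongrightarrow> 1" unfolding r_def by real_asymp
  define G where "G n \<theta> = Re (g (r n * cis \<theta>))" for n \<theta>
  have rc: "cmod (r n * cis \<theta>) < 1" for n \<theta> using r[of n] by (simp add: norm_mult)
  have G_nonneg: "0 \<le> G n \<theta>" for n \<theta> unfolding G_def by (rule nonneg[OF rc])
  have G_cont: "continuous_on UNIV (G n)" for n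
  proof -
    have "continuous_on UNIV (g \<circ> (\<lambda>\<theta>. r n * cis \<theta>))"
      by (intro continuous_on_compose continuous_intros continuous_on_subset[OF holomorphic_on_imp_continuous_on[OF hol]])
         (use rc in auto)
    then show ?thesis unfolding G_def comp_def by (intro continuous_intros)
  qed
  have GK: "((\<lambda>\<theta>. G n \<theta> * K w \<theta>) has_integral 2 * pi * (g (r n * w) + cnj (g 0))) {0..2 * pi}"
    if "cmod w < 1" for n and w :: complex
    using schwarz_disk_formula[OF hol r that, of n] by (simp add: G_def K_def)
  have G_int: "(G n has_integral 2 * pi * m) {0..2 * pi}" for n
  proof -
    have "K 0 \<theta> = 2" for \<theta> by (simp add: K_def)
    then have "((\<lambda>\<theta>. Re (complex_of_real (G n \<theta>) * 2)) has_integral Re (2 * pi * (2 * m))) {0..2 * pi}"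
      using has_integral_Re[OF GK[of 0 n]] complex_add_cnj[of "g 0"] by (simp add: m_def)
    then have "((\<lambda>\<theta>. G n \<theta> * 2) has_integral (2 * pi * m) * 2) {0..2 * pi}" by (simp add: mult_ac)
    from has_integral_mult_left[OF this, of "1/2"] show ?thesis by (simp add: mult.assoc)
  qed
  show ?thesis
  proof (cases "m = 0")
    \<comment> \<open>The densities cannot be normalized here. But Re g vanishes on each circle
      (continuous, nonnegative, mean 0), so g is constant, and the factor Re g(0) = 0 allows any
      probability measure, such as the point mass at 0.\<close>
    case True
    have ne: "box 0 (2 * pi) \<noteq> {}"
      using pi_gt_zero by (simp only: box_real greaterThanLessThan_empty_iff not_le mult_pos_pos zero_less_numeral simp_thms)
    have "G n \<theta> = 0" if "\<theta> \<in> {0..2*pi}" for n \<theta>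
    proof (rule has_integral_0_cbox_imp_0[where f = "G n" and x = \<theta>, OF _ _ _ ne])
      show "continuous_on (cbox 0 (2 * pi)) (G n)" by (rule continuous_on_subset[OF G_cont]) simp
      show "(G n has_integral 0) (cbox 0 (2 * pi))" using G_int[of n] True by (simp add: box_real)
      show "\<theta> \<in> cbox 0 (2 * pi)" using that by (simp add: box_real)
    qed (rule G_nonneg)
    then have z: "((\<lambda>\<theta>. G n \<theta> * K w \<theta>) has_integral 0) {0..2 * pi}" for n and w :: complex
      by (intro has_integral_is_0) auto
    have eq: "g (r n * w) + cnj (g 0) = 0" if "cmod w < 1" for n and w :: complex
      using has_integral_unique[OF z GK[OF that]] by simp
    have const: "g w = - cnj (g 0)" if w: "cmod w < 1" for w :: complex
    proof -
      have "(\<lambda>n. g (r n * w)) \<longlonglongrightarrow> g w"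
      proof (rule isCont_tendsto_compose[of w g])
        show "isCont g w" by (rule g_cont[OF w])
        have "(\<lambda>n. complex_of_real (r n) * w) \<longlonglongrightarrow> complex_of_real 1 * w" by (intro tendsto_intros rlim)
        then show "(\<lambda>n. complex_of_real (r n) * w) \<longlonglongrightarrow> w" by simp
      qed
      moreover have "g (r n * w) = - cnj (g 0)" for n using eq[OF w, of n] by (simp add: eq_neg_iff_add_eq_0)
      ultimately show ?thesis by (simp add: LIMSEQ_const_iff)
    qed
    show ?thesis
    proof (intro exI conjI allI impI)
      show "real_distribution (return borel 0)"
        by (simp add: real_distribution_def real_distribution_axioms_def prob_space_return)
      fix w :: complex assume "cmod w < 1"
      from const[OF this]
      show "g w = Re (g 0) * (\<integral>\<theta>. 2 * cis \<theta> / (cis \<theta> - w) \<partial>return borel 0) - cnj (g 0)"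
        by (simp only: m_def[symmetric] True of_real_0 mult_zero_left diff_0)
    qed
  next
    case False
    then have m: "0 < m" using nonneg[of 0] by (simp add: m_def)
    define \<rho> where "\<rho> n \<theta> = indicator {0..2 * pi} \<theta> * (G n \<theta> / (2 * pi * m))" for n \<theta>
    have \<rho>0: "0 \<le> \<rho> n \<theta>" for n \<theta> using G_nonneg m by (simp add: \<rho>_def)
    have \<rho>_meas[measurable]: "\<rho> n \<in> borel_measurable borel" for n
      unfolding \<rho>_def using borel_measurable_continuous_onI[OF G_cont] by measurable
    define \<nu> where "\<nu> n = density lborel (\<rho> n)" for n
    have \<rho>_int: "(\<rho> n has_integral 1) UNIV" for n
    proof -
      have "((\<lambda>\<theta>. G n \<theta> * (1 / (2 * pi * m))) has_integral (2 * pi * m) * (1 / (2 * pi * m))) {0..2 * pi}"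
        by (rule has_integral_mult_left[OF G_int])
      then have "((\<lambda>\<theta>. if \<theta> \<in> {0..2*pi} then G n \<theta> * (1 / (2 * pi * m)) else 0) has_integral 1) UNIV"
        using m by (subst has_integral_restrict_UNIV) simp
      moreover have "(\<lambda>\<theta>. if \<theta> \<in> {0..2*pi} then G n \<theta> * (1 / (2 * pi * m)) else 0) = \<rho> n"
        by (auto simp: \<rho>_def fun_eq_iff)
      ultimately show ?thesis by simp
    qed
    have \<rho>_nn: "(\<integral>\<^sup>+ x. ennreal (\<rho> n x) \<partial>lborel) = 1" for n
      using nn_integral_has_integral_lborel[OF \<rho>_meas \<rho>0 \<rho>_int] by simp
    have prob: "prob_space (\<nu> n)" for n
      by (rule prob_spaceI) (simp add: \<nu>_def emeasure_density \<rho>_nn)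
    have rd: "real_distribution (\<nu> n)" for n
      using prob by (auto simp: real_distribution_def real_distribution_axioms_def \<nu>_def)
    have "tight \<nu>"
      unfolding tight_def
    proof (intro conjI allI impI rd)
      fix \<epsilon> :: real assume \<epsilon>: "0 < \<epsilon>"
      \<comment> \<open>The interval (-1, 7] contains [0, 2 pi].\<close>
      have "measure (\<nu> n) {-1<..7} = 1" for n
      proof -
        have "emeasure (\<nu> n) {-1<..7} = (\<integral>\<^sup>+ x. ennreal (\<rho> n x) * indicator {-1<..7} x \<partial>lborel)"
          by (simp add: \<nu>_def emeasure_density)
        also have "\<dots> = (\<integral>\<^sup>+ x. ennreal (\<rho> n x) \<partial>lborel)"
          using pi_less_4 pi_approx by (intro nn_integral_cong) (auto simp: \<rho>_def indicator_def)
        finally show ?thesis by (simp add: \<rho>_nn measure_def)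
      qed
      then show "\<exists>a b. a < b \<and> (\<forall>n. 1 - \<epsilon> < measure (\<nu> n) {a<..b})"
        using \<epsilon> by (intro exI[of _ "-1"] exI[of _ 7]) auto
    qed
    from tight_imp_convergent_subsubsequence[OF this strict_mono_id]
    obtain s M where s: "strict_mono (s :: nat \<Rightarrow> nat)" and M: "real_distribution M"
      and conv: "weak_conv_m (\<nu> \<circ> s) M" by (auto simp: comp_def)
    have "g w = m * (\<integral>\<theta>. K w \<theta> \<partial>M) - cnj (g 0)" if w: "cmod w < 1" for w :: complex
    proof -
      have K_bound: "cmod (K w \<theta>) \<le> 2 / (1 - cmod w)" for \<theta>
      proof -
        have "1 - cmod w \<le> cmod (cis \<theta> - w)" by (metis norm_cis norm_triangle_ineq2)
        then show ?thesis using w by (simp add: K_def norm_divide norm_mult frac_le)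
      qed
      have K_nu: "(\<integral>\<theta>. K w \<theta> \<partial>\<nu> n) = (g (r n * w) + cnj (g 0)) / m" for n
      proof -
        have K_meas: "K w \<in> borel_measurable borel" by (rule borel_measurable_continuous_onI[OF K_cont[OF w]])
        have si: "set_integrable lborel {0..2 * pi} (\<lambda>\<theta>. G n \<theta> * K w \<theta>)"
          by (intro borel_integrable_atLeastAtMost' continuous_intros continuous_on_subset[OF G_cont] continuous_on_subset[OF K_cont[OF w]]) auto
        have "(\<integral>\<theta>. K w \<theta> \<partial>\<nu> n) = (\<integral>\<theta>. \<rho> n \<theta> *\<^sub>R K w \<theta> \<partial>lborel)"
          unfolding \<nu>_def using K_meas \<rho>0 by (intro integral_density) auto
        also have "\<dots> = (\<integral>\<theta>. (indicator {0..2*pi} \<theta> *\<^sub>R (G n \<theta> * K w \<theta>)) / (2 * pi * m) \<partial>lborel)"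
          by (intro Bochner_Integration.integral_cong) (auto simp: \<rho>_def scaleR_conv_of_real indicator_def)
        also have "\<dots> = (LINT \<theta>:{0..2*pi}|lborel. G n \<theta> * K w \<theta>) / (2 * pi * m)"
          unfolding set_lebesgue_integral_def by simp
        also have "(LINT \<theta>:{0..2*pi}|lborel. G n \<theta> * K w \<theta>) = 2 * pi * (g (r n * w) + cnj (g 0))"
          using set_borel_integral_eq_integral(2)[OF si] integral_unique[OF GK[OF w]] by simp
        finally show ?thesis by simp
      qed
      have "(\<lambda>n. \<integral>\<theta>. K w \<theta> \<partial>(\<nu> \<circ> s) n) \<longlonglongrightarrow> (\<integral>\<theta>. K w \<theta> \<partial>M)"
        by (rule weak_conv_imp_integral_bdd_continuous_conv[OF _ M conv, of "K w", OF _ _ K_bound])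
           (use rd K_cont[OF w] in \<open>auto simp: continuous_on_eq_continuous_at\<close>)
      then have "(\<lambda>n. (g (r (s n) * w) + cnj (g 0)) / m) \<longlonglongrightarrow> (\<integral>\<theta>. K w \<theta> \<partial>M)" by (simp add: K_nu)
      moreover have "(\<lambda>n. g (r (s n) * w)) \<longlonglongrightarrow> g w"
      proof (rule isCont_tendsto_compose[of w g])
        show "isCont g w" by (rule g_cont[OF w])
        have "(\<lambda>n. complex_of_real (r (s n)) * w) \<longlonglongrightarrow> complex_of_real 1 * w"
          using LIMSEQ_subseq_LIMSEQ[OF rlim s] by (intro tendsto_intros) (simp add: comp_def)
        then show "(\<lambda>n. complex_of_real (r (s n)) * w) \<longlonglongrightarrow> w" by simp
      qed
      then have "(\<lambda>n. (g (r (s n) * w) + cnj (g 0)) / m) \<longlonglongrightarrow> (g w + cnj (g 0)) / m"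
        using m by (intro tendsto_intros) auto
      ultimately have "(\<integral>\<theta>. K w \<theta> \<partial>M) = (g w + cnj (g 0)) / m" by (rule LIMSEQ_unique)
      then show ?thesis using m by simp
    qed
    then show ?thesis using M unfolding m_def K_def by blast
  qed
qed

text \<open>The disk result, transported by the Cayley transform, represents q by the Nevanlinna
  kernel (1 + t z)/(t - z) and a possible mass at infinity. The bound C / Im z does the rest: y Im
  q(iy) stays bounded, which excludes mass at infinity and makes 1 + t^2 integrable, and the
  remaining real constant must vanish.\<close>

theorem herglotz_resolvent_measure:
  fixes q :: "complex \<Rightarrow> complex" and C :: real
  assumes hol: "q holomorphic_on upper_half_plane"
    and im: "\<And>z. z \<in> upper_half_plane \<Longrightarrow> 0 \<le> Im (q z)"
    and bound: "\<And>z. z \<in> upper_half_plane \<Longrightarrow> cmod (q z) \<le> C / Im z"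
  shows "\<exists>\<mu>. finite_borel_measure \<mu> \<and>
    (\<forall>z\<in>upper_half_plane. q z = (\<integral>t. 1 / (complex_of_real t - z) \<partial>\<mu>))"
proof -
  define \<alpha> where "\<alpha> = Re (q \<i>)"
  define m where "m = Im (q \<i>)"
  define \<phi> where "\<phi> w = \<i> * (1 + w) / (1 - w)" for w :: complex
  \<comment> \<open>The factor -i turns Im q \<ge> 0 into Re g \<ge> 0; subtracting Re q(i) makes
    g(0) real.\<close>
  define g where "g w = - \<i> * (q (\<phi> w) - \<alpha>)" for w
  have Im_\<phi>: "Im (\<phi> w) = (1 - (cmod w)\<^sup>2) / (cmod (1 - w))\<^sup>2" for w
  proof -
    have "\<phi> w = \<i> * ((1 + w) * cnj (1 - w)) / ((1 - w) * cnj (1 - w))"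
      by (cases "w = 1") (auto simp: \<phi>_def)
    also have "(1 - w) * cnj (1 - w) = complex_of_real ((cmod (1 - w))\<^sup>2)"
      by (simp only: complex_norm_square)
    finally have "Im (\<phi> w) = Im (\<i> * ((1 + w) * cnj (1 - w))) / (cmod (1 - w))\<^sup>2"
      by (simp only: Im_divide_of_real)
    also have "Im (\<i> * ((1 + w) * cnj (1 - w))) = 1 - (cmod w)\<^sup>2"
      unfolding cmod_power2 by (simp add: power2_eq_square algebra_simps)
    finally show ?thesis .
  qed
  have \<phi>: "\<phi> w \<in> upper_half_plane" if "cmod w < 1" for w
  proof -
    have "(cmod w)\<^sup>2 < 1" using that by (simp add: power2_eq_square abs_square_less_1[unfolded power2_eq_square])
    moreover have "1 - w \<noteq> 0" using that by auto
    ultimately show ?thesis unfolding upper_half_plane_def mem_Collect_eq Im_\<phi>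
      by (intro divide_pos_pos) auto
  qed
  have "\<phi> holomorphic_on ball 0 1"
    unfolding \<phi>_def by (intro holomorphic_intros) auto
  then have "(q \<circ> \<phi>) holomorphic_on ball 0 1"
    by (rule holomorphic_on_compose_gen[OF _ hol]) (use \<phi> in auto)
  then have g_hol: "g holomorphic_on ball 0 1"
    unfolding g_def comp_def by (intro holomorphic_intros)
  have g_Re: "0 \<le> Re (g w)" if "cmod w < 1" for w
    using im[OF \<phi>[OF that]] by (simp add: g_def)
  have g0: "g 0 = complex_of_real m"
    by (simp add: g_def \<phi>_def \<alpha>_def m_def complex_eq_iff)
  obtain M where M: "real_distribution M"
    and gM: "\<And>w. cmod w < 1 \<Longrightarrow> g w = m * (\<integral>\<theta>. 2 * cis \<theta> / (cis \<theta> - w) \<partial>M) - m"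
    using herglotz_disk[OF g_hol g_Re] by (auto simp: g0)
  interpret real_distribution M by fact
  \<comment> \<open>This is -cot(\<theta>/2), the real point corresponding to the boundary point
    e^(i \<theta>). Where cos \<theta> = 1 the image is infinity; division by zero returns 0 there,
    and the case is separated in \<open>k\<close> and \<open>L\<close>.\<close>
  define T where "T \<theta> = - sin \<theta> / (1 - cos \<theta>)" for \<theta> :: real
  have T_meas[measurable]: "T \<in> borel_measurable borel" unfolding T_def by measurable
  define k where "k z \<theta> = (if cos \<theta> = 1 then z else (1 + complex_of_real (T \<theta>) * z) / (complex_of_real (T \<theta>) - z))"
    for z \<theta>
  have Tz: "complex_of_real t - z \<noteq> 0" if "z \<in> upper_half_plane" for t z
    using that by (auto simp: upper_half_plane_def)
  have k_eq: "\<i> * (2 * cis \<theta> / (cis \<theta> - w) - 1) = k z \<theta>"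
    if z: "z \<in> upper_half_plane" and w: "w = (z - \<i>) / (z + \<i>)" for z w \<theta>
  proof -
    have zi: "z + \<i> \<noteq> 0" using z by (auto simp: upper_half_plane_def complex_eq_iff)
    show ?thesis
    proof (cases "cos \<theta> = 1")
      case True
      then have "sin \<theta> = 0" by (metis cos_one_sin_zero)
      then have c: "cis \<theta> = 1" using True by (simp add: complex_eq_iff)
      have "1 - w = 2 * \<i> / (z + \<i>)" using zi by (simp add: w divide_simps)
      then have "2 * cis \<theta> / (cis \<theta> - w) = (z + \<i>) / \<i>"
        unfolding c by (simp only: divide_divide_eq_right mult_1_right) simp
      then show ?thesis using True by (simp add: k_def right_diff_distrib)
    next
      case False
      define t where "t = complex_of_real (T \<theta>)"
      have ti: "t + \<i> \<noteq> 0" by (simp add: t_def complex_eq_iff)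
      have sc: "(sin \<theta>)\<^sup>2 = (1 - cos \<theta>) * (1 + cos \<theta>)"
        using sin_cos_squared_add[of \<theta>] by (simp add: power2_eq_square algebra_simps)
      have "cis \<theta> * (t + \<i>) = t - \<i>"
        using False sc by (auto simp: complex_eq_iff t_def T_def field_simps power2_eq_square)
      then have c: "cis \<theta> = (t - \<i>) / (t + \<i>)" using ti by (simp add: field_simps)
      have tz: "t - z \<noteq> 0" using Tz[OF z] by (simp add: t_def)
      have d: "cis \<theta> - w = 2 * \<i> * (t - z) / ((t + \<i>) * (z + \<i>))"
        using ti zi by (simp add: c w divide_simps) (simp add: algebra_simps)
      have "2 * cis \<theta> / (cis \<theta> - w) = (t - \<i>) * (z + \<i>) / (\<i> * (t - z))"
        unfolding d using ti zi tz by (simp add: c divide_simps) (simp add: algebra_simps)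
      also have "\<i> * (\<dots> - 1) = (1 + t * z) / (t - z)"
        using tz by (simp add: divide_simps) (simp add: algebra_simps)
      finally show ?thesis using False by (simp add: k_def t_def)
    qed
  qed
  have cisw: "cis \<theta> - w \<noteq> 0" if "cmod w < 1" for \<theta> w
    using that by (metis eq_iff_diff_eq_0 less_irrefl norm_cis)
  have w_less: "cmod ((z - \<i>) / (z + \<i>)) < 1" if "z \<in> upper_half_plane" for z
  proof -
    have "0 < Im z" using that by (simp add: upper_half_plane_def)
    then have "(cmod (z - \<i>))\<^sup>2 < (cmod (z + \<i>))\<^sup>2"
      by (simp add: cmod_power2) (simp add: power2_eq_square algebra_simps)
    then have "cmod (z - \<i>) < cmod (z + \<i>)" by (rule power2_less_imp_less) simp
    then show ?thesis by (simp add: norm_divide divide_less_eq)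
  qed
  have k_int: "integrable M (k z)" and q_k: "q z = \<alpha> + m * (\<integral>\<theta>. k z \<theta> \<partial>M)"
    if z: "z \<in> upper_half_plane" for z
  proof -
    define w where "w = (z - \<i>) / (z + \<i>)"
    have w: "cmod w < 1" unfolding w_def by (rule w_less[OF z])
    have cont: "continuous_on UNIV (\<lambda>\<theta>. 2 * cis \<theta> / (cis \<theta> - w))"
      using cisw[OF w] by (intro continuous_intros) auto
    have i1: "integrable M (\<lambda>\<theta>. 2 * cis \<theta> / (cis \<theta> - w))"
    proof (rule integrable_const_bound)
      show "AE \<theta> in M. norm (2 * cis \<theta> / (cis \<theta> - w)) \<le> 2 / (1 - cmod w)"
      proof (rule AE_I2)
        fix \<theta>
        have "1 - cmod w \<le> cmod (cis \<theta> - w)" by (metis norm_cis norm_triangle_ineq2)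
        then show "norm (2 * cis \<theta> / (cis \<theta> - w)) \<le> 2 / (1 - cmod w)"
          using w by (simp add: norm_divide norm_mult frac_le)
      qed
      show "(\<lambda>\<theta>. 2 * cis \<theta> / (cis \<theta> - w)) \<in> borel_measurable M"
        using borel_measurable_continuous_onI[OF cont] by simp
    qed
    have keq: "k z = (\<lambda>\<theta>. \<i> * (2 * cis \<theta> / (cis \<theta> - w) - 1))"
      using k_eq[OF z w_def] by auto
    show "integrable M (k z)" unfolding keq using i1 by (intro integrable_mult_right Bochner_Integration.integrable_diff) auto
    have zi: "z + \<i> \<noteq> 0" using z by (auto simp: upper_half_plane_def complex_eq_iff)
    have "1 - w = 2 * \<i> / (z + \<i>)" "1 + w = 2 * z / (z + \<i>)" using zi by (simp_all add: w_def divide_simps)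
    then have "\<phi> w = z" using zi by (simp add: \<phi>_def)
    then have "q z = \<alpha> + \<i> * g w" by (simp add: g_def)
    also have "\<dots> = \<alpha> + m * (\<i> * ((\<integral>\<theta>. 2 * cis \<theta> / (cis \<theta> - w) \<partial>M) - 1))"
      unfolding gM[OF w] by (simp add: algebra_simps)
    also have "\<i> * ((\<integral>\<theta>. 2 * cis \<theta> / (cis \<theta> - w) \<partial>M) - 1) = (\<integral>\<theta>. k z \<theta> \<partial>M)"
      unfolding keq using i1 prob_space by simp
    finally show "q z = \<alpha> + m * (\<integral>\<theta>. k z \<theta> \<partial>M)" .
  qed
  have iy: "\<i> * complex_of_real y \<in> upper_half_plane" if "0 < y" for y
    using that by (simp add: upper_half_plane_def)
  have m0: "0 \<le> m" using im[of \<i>] by (simp add: m_def upper_half_plane_def)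
  have small: "\<beta> = 0" if "\<And>y. 0 < y \<Longrightarrow> cmod \<beta> \<le> B / y" for \<beta> :: complex and B
  proof (rule ccontr)
    assume "\<beta> \<noteq> 0"
    then have b: "0 < cmod \<beta>" by simp
    have B: "cmod \<beta> \<le> B" using that[of 1] by simp
    then have B0: "0 < B" using b by linarith
    have "cmod \<beta> \<le> B / (2 * B / cmod \<beta>)" using b B0 by (intro that divide_pos_pos) auto
    also have "\<dots> = cmod \<beta> / 2" using B0 by simp
    finally show False using b by linarith
  qed
  show ?thesis
  proof (cases "m = 0")
    case True
    have "complex_of_real \<alpha> = 0"
    proof (rule small)
      fix y :: real assume y: "0 < y"
      show "cmod (complex_of_real \<alpha>) \<le> C / y"
        using bound[OF iy[OF y]] q_k[OF iy[OF y]] True by simp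
    qed
    then have "q z = 0" if "z \<in> upper_half_plane" for z using q_k[OF that] True by simp
    moreover have "finite_borel_measure (null_measure borel)"
      by (intro finite_borel_measure.intro finite_measureI finite_borel_measure_axioms.intro) auto
    ultimately show ?thesis by (intro exI[of _ "null_measure borel"]) auto
  next
    case False
    then have m: "0 < m" using m0 by simp
    \<comment> \<open>The limit of n Im k(i n) at \<theta>, infinite exactly at the point
      representing infinity. By Fatou its integral is at most C / m, so that point carries no mass
      and 1 + T^2 is integrable.\<close>
    define L where "L \<theta> = (if cos \<theta> = 1 then \<infinity> else ennreal (1 + (T \<theta>)\<^sup>2))" for \<theta>
    define h where "h n \<theta> = real n * Im (k (\<i> * complex_of_real (real n)) \<theta>)" for n \<theta>
    have h_eq: "h n \<theta> = (if cos \<theta> = 1 then (real n)\<^sup>2 else (real n)\<^sup>2 * (1 + (T \<theta>)\<^sup>2) / ((T \<theta>)\<^sup>2 + (real n)\<^sup>2))" for n \<theta>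
      by (auto simp: h_def k_def Im_divide power2_eq_square algebra_simps)
    have h0: "0 \<le> h n \<theta>" for n \<theta> by (simp add: h_eq)
    have h_lim: "(\<lambda>n. ennreal (h n \<theta>)) \<longlonglongrightarrow> L \<theta>" for \<theta>
    proof (cases "cos \<theta> = 1")
      case True
      have "filterlim (\<lambda>n. (real n)\<^sup>2) at_top sequentially" by real_asymp
      then show ?thesis using True by (simp add: h_eq L_def ennreal_tendsto_top_eq_at_top)
    next
      case False
      have "(\<lambda>n. (real n)\<^sup>2 * (1 + (T \<theta>)\<^sup>2) / ((T \<theta>)\<^sup>2 + (real n)\<^sup>2)) \<longlonglongrightarrow> 1 + (T \<theta>)\<^sup>2" by real_asymp
      from tendsto_ennrealI[OF this] show ?thesis by (simp only: h_eq L_def False if_False)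
    qed
    have hn_int: "integrable M (h n)" and hn_le: "(\<integral>\<theta>. h n \<theta> \<partial>M) \<le> C / m" if n: "0 < n" for n
    proof -
      let ?z = "\<i> * complex_of_real (real n)"
      have z: "?z \<in> upper_half_plane" using n by (intro iy) simp
      show "integrable M (h n)" unfolding h_def using k_int[OF z] by (intro integrable_mult_right integrable_Im)
      have "(\<integral>\<theta>. h n \<theta> \<partial>M) = real n * Im (\<integral>\<theta>. k ?z \<theta> \<partial>M)"
        unfolding h_def using k_int[OF z] by simp
      also have "m * \<dots> = real n * Im (q ?z)" using q_k[OF z] by simp
      also have "\<dots> \<le> real n * (C / real n)"
        using order_trans[OF order_trans[OF abs_ge_self abs_Im_le_cmod] bound[OF z]] by (intro mult_left_mono) auto
      also have "\<dots> = C" using n by simp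
      finally show "(\<integral>\<theta>. h n \<theta> \<partial>M) \<le> C / m" using m by (simp add: field_simps)
    qed
    have h_meas: "h n \<in> borel_measurable M" for n
      using hn_int[of n] by (cases "n = 0") (auto simp: h_def[abs_def])
    have "(\<integral>\<^sup>+\<theta>. L \<theta> \<partial>M) = (\<integral>\<^sup>+\<theta>. liminf (\<lambda>n. ennreal (h n \<theta>)) \<partial>M)"
      by (intro nn_integral_cong lim_imp_Liminf[OF sequentially_bot h_lim, symmetric])
    also have "\<dots> \<le> liminf (\<lambda>n. \<integral>\<^sup>+\<theta>. ennreal (h n \<theta>) \<partial>M)"
      by (rule nn_integral_liminf) (use h_meas in auto)
    also have "\<dots> \<le> liminf (\<lambda>n::nat. ennreal (C / m))"
    proof (rule Liminf_mono)
      show "\<forall>\<^sub>F n in sequentially. (\<integral>\<^sup>+\<theta>. ennreal (h n \<theta>) \<partial>M) \<le> ennreal (C / m)"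
      proof (rule eventually_mono[OF eventually_gt_at_top[of 0]])
        fix n :: nat assume "0 < n"
        then show "(\<integral>\<^sup>+\<theta>. ennreal (h n \<theta>) \<partial>M) \<le> ennreal (C / m)"
          using hn_le by (subst nn_integral_eq_integral) (auto simp: h0 hn_int intro!: ennreal_leI)
      qed
    qed
    also have "\<dots> = ennreal (C / m)" by (simp add: Liminf_const)
    finally have L_int: "(\<integral>\<^sup>+\<theta>. L \<theta> \<partial>M) < \<infinity>" using ennreal_less_top le_less_trans by fastforce
    have L_meas: "L \<in> borel_measurable M" unfolding L_def by measurable
    have ae: "AE \<theta> in M. cos \<theta> \<noteq> 1"
    proof -
      have "AE \<theta> in M. L \<theta> \<noteq> \<infinity>" using nn_integral_PInf_AE[OF L_meas] L_int by auto
      then show ?thesis by eventually_elim (auto simp: L_def split: if_splits)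
    qed
    define \<rho> where "\<rho> \<theta> = m * (1 + (T \<theta>)\<^sup>2)" for \<theta>
    have \<rho>0: "0 \<le> \<rho> \<theta>" for \<theta> using m by (simp add: \<rho>_def)
    have \<rho>_meas[measurable]: "\<rho> \<in> borel_measurable borel" unfolding \<rho>_def by measurable
    have "(\<integral>\<^sup>+\<theta>. ennreal (1 + (T \<theta>)\<^sup>2) \<partial>M) = (\<integral>\<^sup>+\<theta>. L \<theta> \<partial>M)"
      by (rule nn_integral_cong_AE) (use ae in \<open>eventually_elim, auto simp: L_def\<close>)
    then have "(\<integral>\<^sup>+\<theta>. ennreal (1 + (T \<theta>)\<^sup>2) \<partial>M) < \<infinity>" using L_int by simp
    then have T2_int: "integrable M (\<lambda>\<theta>. 1 + (T \<theta>)\<^sup>2)"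
      by (intro integrableI_nonneg) auto
    then have \<rho>_int: "integrable M \<rho>" unfolding \<rho>_def by simp
    have T_int: "integrable M T"
    proof (rule Bochner_Integration.integrable_bound[OF T2_int])
      have "\<bar>T \<theta>\<bar> \<le> 1 + (T \<theta>)\<^sup>2" for \<theta>
        using sum_squares_bound[of "\<bar>T \<theta>\<bar>" 1] by simp
      then show "AE \<theta> in M. norm (T \<theta>) \<le> norm (1 + (T \<theta>)\<^sup>2)" by (intro AE_I2) simp
    qed simp
    define \<mu> where "\<mu> = distr (density M \<rho>) borel T"
    have \<mu>_emeasure: "emeasure \<mu> (space \<mu>) < \<infinity>"
    proof -
      have "emeasure \<mu> (space \<mu>) = (\<integral>\<^sup>+\<theta>. ennreal (\<rho> \<theta>) \<partial>M)"
        by (simp add: \<mu>_def emeasure_distr emeasure_density)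
      also have "\<dots> < \<infinity>" using \<rho>_int by (simp add: nn_integral_eq_integral \<rho>0)
      finally show ?thesis .
    qed
    have \<mu>: "finite_borel_measure \<mu>"
      using \<mu>_emeasure by (intro finite_borel_measure.intro finite_measureI finite_borel_measure_axioms.intro)
        (auto simp: \<mu>_def)
    interpret \<mu>: finite_borel_measure \<mu> by fact
    \<comment> \<open>The constant left over from (1 + t z)/(t - z) = (1 + t^2)/(t - z) - t. Along
      iy both q and the transform of \<open>\<mu>\<close> are O(1/y), hence it is 0.\<close>
    define \<beta> where "\<beta> = complex_of_real (\<alpha> - m * (\<integral>\<theta>. T \<theta> \<partial>M))"
    have rep: "q z = \<beta> + (\<integral>t. 1 / (complex_of_real t - z) \<partial>\<mu>)" if z: "z \<in> upper_half_plane" for z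
    proof -
      have ker_meas: "(\<lambda>t. 1 / (complex_of_real t - z)) \<in> borel_measurable borel"
        by (rule borel_measurable_continuous_onI[OF continuous_resolvent_kernel])
           (use z in \<open>auto simp: upper_half_plane_def\<close>)
      have "integrable \<mu> (\<lambda>t. 1 / (complex_of_real t - z))"
        by (rule integrable_resolvent_kernel[OF \<mu>]) (use z in \<open>auto simp: upper_half_plane_def\<close>)
      then have i: "integrable M (\<lambda>\<theta>. \<rho> \<theta> *\<^sub>R (1 / (complex_of_real (T \<theta>) - z)))"
        unfolding \<mu>_def using ker_meas \<rho>0
        by (subst (asm) integrable_distr_eq) (auto simp: integrable_density)
      have "(\<integral>t. 1 / (complex_of_real t - z) \<partial>\<mu>) = (\<integral>\<theta>. \<rho> \<theta> *\<^sub>R (1 / (complex_of_real (T \<theta>) - z)) \<partial>M)"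
        unfolding \<mu>_def using ker_meas \<rho>0
        by (subst integral_distr) (auto intro!: integral_density)
      moreover have "m * (\<integral>\<theta>. k z \<theta> \<partial>M) = (\<integral>\<theta>. \<rho> \<theta> *\<^sub>R (1 / (complex_of_real (T \<theta>) - z)) \<partial>M) - m * complex_of_real (\<integral>\<theta>. T \<theta> \<partial>M)"
      proof -
        have "m * (\<integral>\<theta>. k z \<theta> \<partial>M) = (\<integral>\<theta>. m * k z \<theta> \<partial>M)" by simp
        also have "\<dots> = (\<integral>\<theta>. \<rho> \<theta> *\<^sub>R (1 / (complex_of_real (T \<theta>) - z)) - m * complex_of_real (T \<theta>) \<partial>M)"
        proof (rule integral_cong_AE)
          show "AE \<theta> in M. m * k z \<theta> = \<rho> \<theta> *\<^sub>R (1 / (complex_of_real (T \<theta>) - z)) - m * complex_of_real (T \<theta>)"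
            using ae
          proof eventually_elim
            case (elim \<theta>)
            have "(1 + a * z) / (a - z) = (1 + a\<^sup>2) / (a - z) - a" if "a - z \<noteq> 0" for a
              using that by (simp add: divide_simps) (simp add: algebra_simps power2_eq_square)
            from this[OF Tz[OF z, of "T \<theta>"]] elim show ?case
              by (simp add: k_def \<rho>_def scaleR_conv_of_real right_diff_distrib)
          qed
          show "(\<lambda>\<theta>. m * k z \<theta>) \<in> borel_measurable M" using k_int[OF z] by auto
          show "(\<lambda>\<theta>. \<rho> \<theta> *\<^sub>R (1 / (complex_of_real (T \<theta>) - z)) - m * complex_of_real (T \<theta>)) \<in> borel_measurable M"
            using i T_int by auto
        qed
        also have "\<dots> = (\<integral>\<theta>. \<rho> \<theta> *\<^sub>R (1 / (complex_of_real (T \<theta>) - z)) \<partial>M) - (\<integral>\<theta>. m * complex_of_real (T \<theta>) \<partial>M)"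
          using T_int by (intro Bochner_Integration.integral_diff i) auto
        finally show ?thesis by simp
      qed
      ultimately show ?thesis using q_k[OF z] by (simp add: \<beta>_def algebra_simps)
    qed
    have "\<beta> = 0"
    proof (rule small)
      fix y :: real assume y: "0 < y"
      let ?z = "\<i> * complex_of_real y"
      have "cmod (\<integral>t. 1 / (complex_of_real t - ?z) \<partial>\<mu>) \<le> (\<integral>t. 1 / y \<partial>\<mu>)"
      proof (rule Bochner_Integration.integral_norm_bound_integral)
        show "integrable \<mu> (\<lambda>t. 1 / (complex_of_real t - ?z))"
          by (rule integrable_resolvent_kernel[OF \<mu>]) (use y in simp)
        show "cmod (1 / (complex_of_real t - ?z)) \<le> 1 / y" for t
          using resolvent_kernel_bound[of ?z t] y by simp
      qed simp
      then have "cmod (\<integral>t. 1 / (complex_of_real t - ?z) \<partial>\<mu>) \<le> measure \<mu> (space \<mu>) / y" by simp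
      moreover have "cmod \<beta> \<le> cmod (q ?z) + cmod (\<integral>t. 1 / (complex_of_real t - ?z) \<partial>\<mu>)"
        using rep[OF iy[OF y]] norm_triangle_ineq4[of "q ?z" "\<integral>t. 1 / (complex_of_real t - ?z) \<partial>\<mu>"] by simp
      ultimately show "cmod \<beta> \<le> (C + measure \<mu> (space \<mu>)) / y"
        using bound[OF iy[OF y]] by (simp add: add_divide_distrib)
    qed
    then show ?thesis using \<mu> rep by auto
  qed
qed

subsection \<open>Complex inner product spaces\<close>

lemma cinner_add_right: "cinner u (v + w) = cinner u v + cinner (u::'a::complex_inner_space) w"
  by (metis cinner_commute cinner_add_left complex_cnj_add)

lemma cinner_scaleC_right: "cinner u (a *\<^sub>C v) = cnj a * cinner (u::'a::complex_inner_space) v"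
  by (metis cinner_commute cinner_scaleC_left complex_cnj_mult complex_cnj_cnj)

lemma scaleC_minus_one: "(- 1) *\<^sub>C u = - (u::'a::complex_inner_space)"
  using scaleR_scaleC[of "-1" u] by simp

lemma scaleC_zero_left [simp]: "0 *\<^sub>C u = (0::'a::complex_inner_space)"
  by (rule complex_vector.scale_zero_left)

lemma scaleC_zero_right [simp]: "a *\<^sub>C (0::'a::complex_inner_space) = 0"
  by (rule complex_vector.scale_zero_right)

lemma scaleC_one_left [simp]: "1 *\<^sub>C u = (u::'a::complex_inner_space)"
  by (rule scaleC_one)

lemma cinner_minus_left [simp]: "cinner (- u) v = - cinner (u::'a::complex_inner_space) v"
  using cinner_scaleC_left[of "-1" u v] by (simp only: scaleC_minus_one) simp

lemma cinner_minus_right [simp]: "cinner u (- v) = - cinner (u::'a::complex_inner_space) v"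
  using cinner_scaleC_right[of u "-1" v] by (simp only: scaleC_minus_one) simp

lemma cinner_diff_left: "cinner (u - v) w = cinner u w - cinner (v::'a::complex_inner_space) w"
  using cinner_add_left[of u "- v" w] by simp

lemma cinner_diff_right: "cinner w (u - v) = cinner w u - cinner w (v::'a::complex_inner_space)"
  using cinner_add_right[of w u "- v"] by simp

lemma cinner_zero_left [simp]: "cinner 0 (v::'a::complex_inner_space) = 0"
  using cinner_scaleC_left[of 0 0 v] by (simp only: scaleC_zero_left mult_zero_left)

lemma cinner_zero_right [simp]: "cinner (v::'a::complex_inner_space) 0 = 0"
  using cinner_scaleC_right[of v 0 0] by (simp only: scaleC_zero_left complex_cnj_zero mult_zero_left)

lemma cinner_sum_left: "cinner (\<Sum>i\<in>I. f i) (v::'a::complex_inner_space) = (\<Sum>i\<in>I. cinner (f i) v)"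
  by (induction I rule: infinite_finite_induct) (auto simp: cinner_add_left)

lemma cinner_sum_right: "cinner (v::'a::complex_inner_space) (\<Sum>i\<in>I. f i) = (\<Sum>i\<in>I. cinner v (f i))"
  by (induction I rule: infinite_finite_induct) (auto simp: cinner_add_right)

lemma scaleC_minus_left: "(- a) *\<^sub>C u = - (a *\<^sub>C (u::'a::complex_inner_space))"
  by (rule complex_vector.scale_minus_left)

lemma scaleC_minus_right: "a *\<^sub>C (- u) = - (a *\<^sub>C (u::'a::complex_inner_space))"
  by (rule complex_vector.scale_minus_right)

lemma scaleC_diff_left: "(a - b) *\<^sub>C u = a *\<^sub>C u - b *\<^sub>C (u::'a::complex_inner_space)"
  by (rule complex_vector.scale_left_diff_distrib)

lemma scaleC_diff_right: "a *\<^sub>C (u - v) = a *\<^sub>C u - a *\<^sub>C (v::'a::complex_inner_space)"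
  by (rule complex_vector.scale_right_diff_distrib)

lemmas cinner_simps = cinner_add_left cinner_add_right cinner_diff_left cinner_diff_right
  cinner_scaleC_left cinner_scaleC_right

lemma cinner_self: "cinner u u = complex_of_real ((norm (u::'a::complex_inner_space))\<^sup>2)"
proof -
  have "Im (cinner u u) = 0" using cinner_commute[of u u] by (metis Reals_cnj_iff complex_is_Real_iff)
  moreover have "Re (cinner u u) = (norm u)\<^sup>2" by (simp add: norm_eq_sqrt_cinner cinner_nonneg)
  ultimately show ?thesis by (simp add: complex_eq_iff)
qed

lemma norm_scaleC: "norm (a *\<^sub>C (u::'a::complex_inner_space)) = cmod a * norm u"
proof -
  have "complex_of_real ((norm (a *\<^sub>C u))\<^sup>2) = (a * cnj a) * complex_of_real ((norm u)\<^sup>2)"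
    unfolding cinner_self[symmetric] by (simp add: cinner_simps mult_ac)
  also have "\<dots> = complex_of_real ((cmod a * norm u)\<^sup>2)"
    by (simp add: complex_norm_square[symmetric] power_mult_distrib)
  finally have "(norm (a *\<^sub>C u))\<^sup>2 = (cmod a * norm u)\<^sup>2" by (simp only: of_real_eq_iff)
  then show ?thesis by simp
qed

lemma Re_cinner_commute: "Re (cinner v u) = Re (cinner (u::'a::complex_inner_space) v)"
  by (subst cinner_commute) simp

lemma norm_add_square:
  "(norm (u + v))\<^sup>2 = (norm u)\<^sup>2 + 2 * Re (cinner u v) + (norm (v::'a::complex_inner_space))\<^sup>2"
proof -
  have "complex_of_real ((norm (u + v))\<^sup>2) = cinner u u + cinner u v + cinner v u + cinner v v"
    by (simp only: cinner_self[symmetric] cinner_add_left cinner_add_right add_ac)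
  then have "Re (complex_of_real ((norm (u + v))\<^sup>2)) = Re (cinner u u + cinner u v + cinner v u + cinner v v)"
    by (simp only:)
  then show ?thesis by (simp add: cinner_self Re_cinner_commute[of v u])
qed

lemma cinner_cauchy_schwarz: "cmod (cinner u v) \<le> norm u * norm (v::'a::complex_inner_space)"
proof -
  have "(cmod (cinner u v))\<^sup>2 \<le> (norm v)\<^sup>2 * (norm u)\<^sup>2"
  proof (rule cmod_sq_le_of_quadratic)
    fix \<zeta>
    have "0 \<le> (norm (v + \<zeta> *\<^sub>C u))\<^sup>2" by simp
    then show "0 \<le> (norm v)\<^sup>2 + 2 * Re (\<zeta> * cinner u v) + (cmod \<zeta>)\<^sup>2 * (norm u)\<^sup>2"
      using Re_cinner_commute[of v "\<zeta> *\<^sub>C u"]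
      by (simp add: norm_add_square norm_scaleC power_mult_distrib cinner_scaleC_left)
  qed simp
  then have "(cmod (cinner u v))\<^sup>2 \<le> (norm u * norm v)\<^sup>2" by (simp add: power_mult_distrib mult.commute)
  then show ?thesis by (rule power2_le_imp_le) simp
qed

lemma bounded_linear_cinner_left: "bounded_linear (\<lambda>u::'a::complex_inner_space. cinner u v)"
  by (rule bounded_linear_intro[where K = "norm v"])
     (auto simp: cinner_add_left scaleR_scaleC[where 'a='a] cinner_scaleC_left scaleR_conv_of_real cinner_cauchy_schwarz)

lemmas tendsto_cinner_left = bounded_linear.tendsto[OF bounded_linear_cinner_left]

lemma cinner_eqI: "(\<And>v. cinner u v = cinner w v) \<Longrightarrow> u = (w::'a::complex_inner_space)"
  using cinner_self[of "u - w"] by (simp add: cinner_diff_left)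

section \<open>Everywhere defined operators on a finite-dimensional space\<close>

definition clinear_op :: "('a::complex_inner_space \<Rightarrow> 'a) \<Rightarrow> bool" where
  "clinear_op f \<longleftrightarrow> (\<forall>u v. f (u + v) = f u + f v) \<and> (\<forall>c u. f (c *\<^sub>C u) = c *\<^sub>C f u)"

lemma clinear_opI: "(\<And>u v. f (u + v) = f u + f v) \<Longrightarrow> (\<And>c u. f (c *\<^sub>C u) = c *\<^sub>C f u) \<Longrightarrow> clinear_op f"
  by (simp add: clinear_op_def)

lemma clinear_op_add: "clinear_op f \<Longrightarrow> f (u + v) = f u + f v"
  by (simp add: clinear_op_def)

lemma clinear_op_scale: "clinear_op f \<Longrightarrow> f (c *\<^sub>C u) = c *\<^sub>C f u"
  by (simp add: clinear_op_def)

lemma clinear_op_zero: "clinear_op f \<Longrightarrow> f 0 = 0"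
  using clinear_op_scale[of f 0 0] by (simp only: scaleC_zero_left)

lemma clinear_op_minus: "clinear_op f \<Longrightarrow> f (- u) = - f u"
  using clinear_op_scale[of f "-1" u] by (simp add: scaleC_minus_one)

lemma clinear_op_diff: "clinear_op f \<Longrightarrow> f (u - v) = f u - f v"
  using clinear_op_add[of f u "- v"] by (simp add: clinear_op_minus)

lemma clinear_op_sum: "clinear_op f \<Longrightarrow> f (\<Sum>i\<in>I. g i) = (\<Sum>i\<in>I. f (g i))"
  by (induction I rule: infinite_finite_induct) (auto simp: clinear_op_add clinear_op_zero)

text \<open>Gram-Schmidt by induction on the finite set. The spanning vectors may be dependent, as
  the x_n are when \<Gamma>_d is singular: a vector with zero residual \<open>r\<close> adds nothing
  to the basis.\<close>

lemma orthonormal_basis_of_span: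
  fixes B :: "'a::complex_inner_space set"
  assumes "finite B"
  shows "\<exists>(e::nat \<Rightarrow> 'a) n. (\<forall>i<n. \<forall>j<n. cinner (e i) (e j) = (if i = j then 1 else 0)) \<and>
    (\<forall>i<n. e i \<in> complex_vector.span B) \<and>
    (\<forall>u\<in>complex_vector.span B. u = (\<Sum>i<n. cinner u (e i) *\<^sub>C e i))"
  using assms
proof (induction B rule: finite_induct)
  case empty
  show ?case by (intro exI[of _ "\<lambda>_. 0"] exI[of _ 0]) simp
next
  case (insert b B)
  then obtain e :: "nat \<Rightarrow> 'a" and n where
    orth: "\<And>i j. i < n \<Longrightarrow> j < n \<Longrightarrow> cinner (e i) (e j) = (if i = j then 1 else 0)"
    and span: "\<And>i. i < n \<Longrightarrow> e i \<in> complex_vector.span B"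
    and exp: "\<And>u. u \<in> complex_vector.span B \<Longrightarrow> u = (\<Sum>i<n. cinner u (e i) *\<^sub>C e i)"
    by blast
  define r where "r = b - (\<Sum>i<n. cinner b (e i) *\<^sub>C e i)"
  have span': "e i \<in> complex_vector.span (insert b B)" if "i < n" for i
    using span[OF that] complex_vector.span_mono[of B "insert b B"] by auto
  have r_orth: "cinner r (e j) = 0" if "j < n" for j
  proof -
    have "cinner (\<Sum>i<n. cinner b (e i) *\<^sub>C e i) (e j) = (\<Sum>i<n. if i = j then cinner b (e j) else 0)"
      unfolding cinner_sum_left using that orth by (intro sum.cong) (auto simp: cinner_scaleC_left)
    then show ?thesis using that by (simp add: r_def cinner_diff_left)
  qed
  have r_orth': "cinner (e j) r = 0" if "j < n" for j
    using r_orth[OF that] by (subst cinner_commute) simp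
  show ?case
  proof (cases "r = 0")
    case True
    show ?thesis
    proof (intro exI[of _ e] exI[of _ n] conjI allI impI ballI)
      fix u assume "u \<in> complex_vector.span (insert b B)"
      then obtain k where "u - k *\<^sub>C b \<in> complex_vector.span B"
        by (auto simp: complex_vector.span_breakdown_eq)
      then have k: "u - k *\<^sub>C b = (\<Sum>i<n. cinner (u - k *\<^sub>C b) (e i) *\<^sub>C e i)" by (rule exp)
      have b: "b = (\<Sum>i<n. cinner b (e i) *\<^sub>C e i)" using True by (simp add: r_def)
      have "u = (u - k *\<^sub>C b) + k *\<^sub>C b" by simp
      also have "\<dots> = (\<Sum>i<n. cinner (u - k *\<^sub>C b) (e i) *\<^sub>C e i) + k *\<^sub>C (\<Sum>i<n. cinner b (e i) *\<^sub>C e i)"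
        by (rule arg_cong2[where f = "\<lambda>x y. x + k *\<^sub>C y", OF k b])
      also have "\<dots> = (\<Sum>i<n. cinner u (e i) *\<^sub>C e i)"
        unfolding complex_vector.scale_sum_right sum.distrib[symmetric]
        by (intro sum.cong refl) (simp add: cinner_simps scaleC_diff_left scaleC_scaleC)
      finally show "u = (\<Sum>i<n. cinner u (e i) *\<^sub>C e i)" .
    qed (use orth span' in auto)
  next
    case False
    define s where "s = complex_of_real (1 / norm r)"
    define e' where "e' = e(n := s *\<^sub>C r)"
    have [simp]: "e' n = s *\<^sub>C r" and e'[simp]: "\<And>i. i < n \<Longrightarrow> e' i = e i" by (auto simp: e'_def)
    have rr: "s * cinner r r * s = 1" "cinner r r * (s * s) = 1" "cnj s = s"
      using False by (simp_all add: s_def cinner_self power2_eq_square)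
    have b_r: "cinner b r = cinner r r"
    proof -
      have "b = (\<Sum>i<n. cinner b (e i) *\<^sub>C e i) + r" by (simp add: r_def)
      then have "cinner b r = cinner ((\<Sum>i<n. cinner b (e i) *\<^sub>C e i) + r) r" by (rule arg_cong[where f = "\<lambda>u. cinner u r"])
      then show ?thesis by (simp add: cinner_add_left cinner_sum_left cinner_scaleC_left r_orth')
    qed
    have span_r: "w \<in> complex_vector.span B \<Longrightarrow> cinner w r = 0" for w
    proof -
      assume "w \<in> complex_vector.span B"
      then have "cinner w r = cinner (\<Sum>i<n. cinner w (e i) *\<^sub>C e i) r" by (rule arg_cong[where f = "\<lambda>u. cinner u r", OF exp])
      then show "cinner w r = 0" by (simp add: cinner_sum_left cinner_scaleC_left r_orth')
    qed
    show ?thesis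
    proof (intro exI[of _ e'] exI[of _ "Suc n"] conjI allI impI ballI)
      fix i j assume "i < Suc n" "j < Suc n"
      then show "cinner (e' i) (e' j) = (if i = j then 1 else 0)"
        using orth rr by (auto simp: less_Suc_eq cinner_simps r_orth r_orth' mult_ac)
    next
      fix i assume "i < Suc n"
      moreover have "r \<in> complex_vector.span (insert b B)" unfolding r_def
        by (intro complex_vector.span_diff complex_vector.span_sum complex_vector.span_scale span')
           (auto intro: complex_vector.span_base)
      ultimately show "e' i \<in> complex_vector.span (insert b B)"
        using span' by (auto simp: less_Suc_eq intro: complex_vector.span_scale)
    next
      fix u assume "u \<in> complex_vector.span (insert b B)"
      then obtain k where kB: "u - k *\<^sub>C b \<in> complex_vector.span B"
        by (auto simp: complex_vector.span_breakdown_eq)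
      then have k: "u - k *\<^sub>C b = (\<Sum>i<n. cinner (u - k *\<^sub>C b) (e i) *\<^sub>C e i)" by (rule exp)
      have ur: "cinner u r = k * cinner r r"
        using span_r[OF kB] by (simp add: cinner_simps b_r)
      have b: "b = (\<Sum>i<n. cinner b (e i) *\<^sub>C e i) + r" by (simp add: r_def)
      have "u = (u - k *\<^sub>C b) + k *\<^sub>C b" by simp
      also have "\<dots> = (\<Sum>i<n. cinner (u - k *\<^sub>C b) (e i) *\<^sub>C e i) + k *\<^sub>C ((\<Sum>i<n. cinner b (e i) *\<^sub>C e i) + r)"
        by (rule arg_cong2[where f = "\<lambda>x y. x + k *\<^sub>C y", OF k b])
      also have "\<dots> = (\<Sum>i<n. cinner u (e i) *\<^sub>C e i) + k *\<^sub>C r"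
        unfolding complex_vector.scale_sum_right scaleC_add_right add.assoc[symmetric] sum.distrib[symmetric]
        by (intro arg_cong2[where f = plus] sum.cong refl) (simp add: cinner_simps scaleC_diff_left scaleC_scaleC)
      also have "k *\<^sub>C r = cinner u (e' n) *\<^sub>C e' n"
        using rr by (simp add: cinner_scaleC_right ur scaleC_scaleC mult_ac)
      finally show "u = (\<Sum>i<Suc n. cinner u (e' i) *\<^sub>C e' i)" by simp
    qed
  qed
qed

text \<open>The whole type stands for H, and this expansion is the form in which its finite
  dimension is used.\<close>

locale onb =
  fixes e :: "nat \<Rightarrow> 'h::complex_inner_space" and n :: nat
  assumes orth: "i < n \<Longrightarrow> j < n \<Longrightarrow> cinner (e i) (e j) = (if i = j then 1 else 0)"
    and expand: "u = (\<Sum>i<n. cinner u (e i) *\<^sub>C e i)"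

lemma onb_exists:
  fixes B :: "'h::complex_inner_space set"
  assumes "finite B" "complex_vector.span B = UNIV"
  shows "\<exists>(e::nat \<Rightarrow> 'h) n. onb e n"
proof -
  obtain e :: "nat \<Rightarrow> 'h" and n where
    e: "\<And>i j. i < n \<Longrightarrow> j < n \<Longrightarrow> cinner (e i) (e j) = (if i = j then 1 else 0)"
      "\<And>u. u \<in> complex_vector.span B \<Longrightarrow> u = (\<Sum>i<n. cinner u (e i) *\<^sub>C e i)"
    using orthonormal_basis_of_span[OF assms(1)] by blast
  have "onb e n"
  proof
    show "u = (\<Sum>i<n. cinner u (e i) *\<^sub>C e i)" for u by (rule e(2)) (simp add: assms(2))
  qed (rule e(1))
  then show ?thesis by blast
qed

context onb
begin

lemma norm_e: "i < n \<Longrightarrow> norm (e i) = 1"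
proof -
  assume "i < n"
  then have "complex_of_real ((norm (e i))\<^sup>2) = complex_of_real 1" using orth[of i i] by (simp only: cinner_self[symmetric] of_real_1 if_True refl)
  then have "(norm (e i))\<^sup>2 = 1" by (simp only: of_real_eq_iff)
  then show "norm (e i) = 1" by (simp add: power2_eq_1_iff) (metis norm_ge_zero not_one_le_zero neg_0_le_iff_le)
qed

lemma clinear_op_expand:
  assumes "clinear_op f"
  shows "f u = (\<Sum>i<n. cinner u (e i) *\<^sub>C f (e i))"
proof -
  have "f u = f (\<Sum>i<n. cinner u (e i) *\<^sub>C e i)" by (rule arg_cong[where f = f, OF expand])
  then show ?thesis by (simp only: clinear_op_sum[OF assms] clinear_op_scale[OF assms])
qed

lemma span_e: "complex_vector.span (e ` {..<n}) = UNIV"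
proof -
  have "u \<in> complex_vector.span (e ` {..<n})" for u :: 'h
  proof -
    have "(\<Sum>i<n. cinner u (e i) *\<^sub>C e i) \<in> complex_vector.span (e ` {..<n})"
      by (intro complex_vector.span_sum complex_vector.span_scale complex_vector.span_base) auto
    then show ?thesis by (rule back_subst[where P = "\<lambda>u. u \<in> complex_vector.span (e ` {..<n})"]) (rule expand[symmetric])
  qed
  then show ?thesis by auto
qed

text \<open>In finite dimension convergence of the coordinates is convergence in norm; limits of
  operator functions are thus reduced to limits of scalar products.\<close>

lemma tendsto_onb:
  assumes "\<And>i. i < n \<Longrightarrow> ((\<lambda>w. cinner (f w) (e i)) \<longlongrightarrow> cinner l (e i)) F"
  shows "(f \<longlongrightarrow> l) F"
proof -
  have "((\<lambda>w. norm (f w - l)) \<longlongrightarrow> 0) F"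
  proof (rule tendsto_0_le[where K = 1])
    have "((\<lambda>w. \<Sum>i<n. cmod (cinner (f w) (e i) - cinner l (e i))) \<longlongrightarrow> (\<Sum>i<n. 0)) F"
      by (intro tendsto_sum tendsto_norm_zero) (use assms in \<open>auto simp: LIM_zero_iff\<close>)
    then show "((\<lambda>w. \<Sum>i<n. cmod (cinner (f w) (e i) - cinner l (e i))) \<longlongrightarrow> 0) F" by simp
    have "norm (\<Sum>i<n. cinner (f w - l) (e i) *\<^sub>C e i) \<le> (\<Sum>i<n. cmod (cinner (f w) (e i) - cinner l (e i)))" for w
    proof (rule sum_norm_le)
      fix i assume "i \<in> {..<n}"
      then have "norm (e i) = 1" by (simp add: norm_e)
      then show "norm (cinner (f w - l) (e i) *\<^sub>C e i) \<le> cmod (cinner (f w) (e i) - cinner l (e i))"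
        by (simp add: norm_scaleC cinner_diff_left)
    qed
    then have "norm (f w - l) \<le> (\<Sum>i<n. cmod (cinner (f w) (e i) - cinner l (e i)))" for w
      by (rule ord_eq_le_trans[OF arg_cong[where f = norm, OF expand]])
    then show "\<forall>\<^sub>F w in F. norm (norm (f w - l)) \<le> norm (\<Sum>i<n. cmod (cinner (f w) (e i) - cinner l (e i))) * 1"
      by (intro always_eventually) (simp add: abs_of_nonneg sum_nonneg)
  qed
  then show ?thesis by (simp add: tendsto_norm_zero_iff LIM_zero_iff)
qed

lemma injective_imp_bij:
  fixes f :: "'h \<Rightarrow> 'h"
  assumes f: "clinear_op f" and inj: "\<And>u. f u = 0 \<Longrightarrow> u = 0"
  shows "bij f"
proof -
  obtain B where B: "B \<subseteq> e ` {..<n}" "complex_vector.independent B" "e ` {..<n} \<subseteq> complex_vector.span B"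
    using complex_vector.maximal_independent_subset by blast
  have "complex_vector.span B = UNIV"
    using complex_vector.span_minimal[OF B(3) complex_vector.subspace_span] span_e by auto
  then have fd: "finite_dimensional_vector_space (scaleC :: complex \<Rightarrow> 'h \<Rightarrow> 'h) B"
    using B finite_subset[OF B(1)] complex_vector.vector_space_axioms
    by (intro finite_dimensional_vector_space.intro finite_dimensional_vector_space_axioms.intro) auto
  have "Vector_Spaces.linear scaleC scaleC f"
    using f complex_vector.vector_space_axioms by (auto simp: Vector_Spaces.linear_iff clinear_op_def)
  moreover have "inj f"
  proof (rule injI)
    fix u v assume "f u = f v"
    then have "f (u - v) = 0" using clinear_op_diff[OF f] by simp
    then show "u = v" using inj by fastforce
  qed
  ultimately show ?thesis using finite_dimensional_vector_space.linear_inj_imp_surj[OF fd] by (simp add: bij_def)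
qed

lemma clinear_op_inv:
  assumes f: "clinear_op f" and bij: "bij f"
  shows "clinear_op (inv_into UNIV f)"
proof (rule clinear_opI)
  show "inv_into UNIV f (u + v) = inv_into UNIV f u + inv_into UNIV f v" for u v
    using bij by (metis bij_inv_eq_iff clinear_op_add[OF f])
  show "inv_into UNIV f (c *\<^sub>C u) = c *\<^sub>C inv_into UNIV f u" for c u
    using bij by (metis bij_inv_eq_iff clinear_op_scale[OF f])
qed

text \<open>\<open>P\<close> is the projection onto the orthogonal complement of \<open>W\<close>,
  not onto \<open>W\<close>: with \<open>W\<close> the range of A - i it becomes the projection onto
  N_i. It arises by subtracting the expansion along an orthonormal basis of
  \<open>W\<close>.\<close>

lemma orthogonal_projection_exists:
  fixes W :: "'h set"
  assumes W: "complex_vector.subspace W"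
  shows "\<exists>P. clinear_op P \<and> (\<forall>u. u - P u \<in> W) \<and> (\<forall>u. \<forall>w\<in>W. cinner (P u) w = 0)"
proof -
  obtain B where B: "B \<subseteq> W" "complex_vector.independent B" "W \<subseteq> complex_vector.span B"
    using complex_vector.maximal_independent_subset by blast
  have "finite B" using complex_vector.independent_span_bound[of "e ` {..<n}" B] B(2) span_e by auto
  have WB: "complex_vector.span B = W"
    using B complex_vector.span_minimal[OF B(1) W] by auto
  from orthonormal_basis_of_span[OF \<open>finite B\<close>] obtain b :: "nat \<Rightarrow> 'h" and m where
    b: "\<And>i j. i < m \<Longrightarrow> j < m \<Longrightarrow> cinner (b i) (b j) = (if i = j then 1 else 0)"
      "\<And>i. i < m \<Longrightarrow> b i \<in> W" "\<And>u. u \<in> W \<Longrightarrow> u = (\<Sum>i<m. cinner u (b i) *\<^sub>C b i)"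
    unfolding WB by blast
  define P where "P u = u - (\<Sum>i<m. cinner u (b i) *\<^sub>C b i)" for u
  have "clinear_op P"
  proof (rule clinear_opI)
    show "P (u + v) = P u + P v" for u v
      by (simp add: P_def cinner_add_left scaleC_add_left sum.distrib)
    show "P (c *\<^sub>C u) = c *\<^sub>C P u" for c u
      by (simp add: P_def cinner_scaleC_left scaleC_diff_right complex_vector.scale_sum_right scaleC_scaleC)
  qed
  moreover have "u - P u \<in> W" for u
    unfolding P_def using b(2) W
    by (auto intro!: complex_vector.subspace_sum complex_vector.subspace_scale)
  moreover have "cinner (P u) w = 0" if "w \<in> W" for u w
  proof -
    have Pb: "cinner (P u) (b j) = 0" if "j < m" for j
    proof -
      have "cinner (\<Sum>i<m. cinner u (b i) *\<^sub>C b i) (b j) = (\<Sum>i<m. if i = j then cinner u (b j) else 0)"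
        unfolding cinner_sum_left using that b(1) by (intro sum.cong) (auto simp: cinner_scaleC_left)
      then show ?thesis using that by (simp add: P_def cinner_diff_left)
    qed
    have "cinner (P u) w = cinner (P u) (\<Sum>i<m. cinner w (b i) *\<^sub>C b i)"
      by (rule arg_cong[where f = "cinner (P u)", OF b(3)[OF that]])
    then show ?thesis by (simp add: cinner_sum_right cinner_scaleC_right Pb)
  qed
  ultimately show ?thesis by blast
qed

end

text \<open>Formulated through matrix elements so that scalar function theory applies directly. For
  linear operators on a finite-dimensional space it amounts to holomorphy in operator norm, and
  \<open>param_analytic\<close> makes that passage.\<close>

definition weakly_holomorphic :: "(complex \<Rightarrow> 'h::complex_inner_space \<Rightarrow> 'h) \<Rightarrow> bool" where
  "weakly_holomorphic W \<longleftrightarrow> (\<forall>u v. (\<lambda>z. cinner (W z u) v) holomorphic_on upper_half_plane)"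

lemma open_upper_half_plane: "open upper_half_plane"
  unfolding upper_half_plane_def by (rule open_halfspace_Im_gt)

lemma weakly_holomorphicD: "weakly_holomorphic W \<Longrightarrow> (\<lambda>z. cinner (W z u) v) holomorphic_on upper_half_plane"
  by (simp add: weakly_holomorphic_def)

lemma weakly_holomorphic_const: "weakly_holomorphic (\<lambda>z. K)"
  by (simp add: weakly_holomorphic_def)

lemma weakly_holomorphic_add:
  "weakly_holomorphic V \<Longrightarrow> weakly_holomorphic W \<Longrightarrow> weakly_holomorphic (\<lambda>z u. V z u + W z u)"
  by (auto simp: weakly_holomorphic_def cinner_add_left intro!: holomorphic_on_add)

lemma weakly_holomorphic_diff:
  "weakly_holomorphic V \<Longrightarrow> weakly_holomorphic W \<Longrightarrow> weakly_holomorphic (\<lambda>z u. V z u - W z u)"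
  by (auto simp: weakly_holomorphic_def cinner_diff_left intro!: holomorphic_on_diff)

lemma weakly_holomorphic_scale:
  "weakly_holomorphic V \<Longrightarrow> f holomorphic_on upper_half_plane \<Longrightarrow> weakly_holomorphic (\<lambda>z u. f z *\<^sub>C V z u)"
  by (auto simp: weakly_holomorphic_def cinner_scaleC_left intro!: holomorphic_on_mult)

context onb
begin

text \<open>After expansion of the inner vector in the basis, a product of operator functions
  becomes a finite sum of products of scalar holomorphic functions.\<close>

lemma weakly_holomorphic_compose:
  fixes V W :: "complex \<Rightarrow> 'h \<Rightarrow> 'h"
  assumes V: "weakly_holomorphic V" and lin: "\<And>z. z \<in> upper_half_plane \<Longrightarrow> clinear_op (V z)"
    and W: "weakly_holomorphic W"
  shows "weakly_holomorphic (\<lambda>z u. V z (W z u))"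
  unfolding weakly_holomorphic_def
proof (intro allI)
  fix u v
  have "(\<lambda>z. \<Sum>i<n. cinner (W z u) (e i) * cinner (V z (e i)) v) holomorphic_on upper_half_plane"
    using V W by (intro holomorphic_intros) (auto simp: weakly_holomorphic_def)
  moreover have "(\<Sum>i<n. cinner (W z u) (e i) * cinner (V z (e i)) v) = cinner (V z (W z u)) v"
    if "z \<in> upper_half_plane" for z
    unfolding clinear_op_expand[OF lin[OF that], of "W z u"] by (simp only: cinner_sum_left cinner_scaleC_left)
  ultimately show "(\<lambda>z. cinner (V z (W z u)) v) holomorphic_on upper_half_plane"
    by (rule holomorphic_transform)
qed

text \<open>From Y_w - Y_z = -Y_w (X_w - X_z) Y_z: local boundedness of \<open>Y\<close> gives
  continuity, and then the difference quotient converges to -Y X' Y. The local bound is a hypothesis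
  because the two families to which this is applied obtain it from different estimates.\<close>

lemma weakly_holomorphic_inverse:
  fixes X Y :: "complex \<Rightarrow> 'h \<Rightarrow> 'h"
  assumes X: "weakly_holomorphic X" and linX: "\<And>z. z \<in> upper_half_plane \<Longrightarrow> clinear_op (X z)"
    and linY: "\<And>z. z \<in> upper_half_plane \<Longrightarrow> clinear_op (Y z)"
    and XY: "\<And>z u. z \<in> upper_half_plane \<Longrightarrow> X z (Y z u) = u"
    and YX: "\<And>z u. z \<in> upper_half_plane \<Longrightarrow> Y z (X z u) = u"
    and bound: "\<And>z. z \<in> upper_half_plane \<Longrightarrow> \<exists>B. \<forall>\<^sub>F w in at z. \<forall>u. norm (Y w u) \<le> B * norm u"
  shows "weakly_holomorphic Y"
proof -
  have uhp: "\<forall>\<^sub>F w in at z. w \<in> upper_half_plane" if "z \<in> upper_half_plane" for z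
    using that open_upper_half_plane by (metis eventually_at_topological)
  have diff: "Y w u - Y z u = - Y w (X w (Y z u) - X z (Y z u))"
    if "z \<in> upper_half_plane" "w \<in> upper_half_plane" for z w u
    using that by (simp add: clinear_op_diff[OF linY] XY YX)
  have X_der: "((\<lambda>w. cinner (X w y) v) has_field_derivative deriv (\<lambda>w. cinner (X w y) v) z) (at z)"
    if "z \<in> upper_half_plane" for y v z
    using weakly_holomorphicD[OF X] open_upper_half_plane that by (rule holomorphic_derivI)
  have X_lim: "((\<lambda>w. X w y) \<longlongrightarrow> X z y) (at z)" if "z \<in> upper_half_plane" for y z
    by (rule tendsto_onb) (use DERIV_isCont[OF X_der[OF that]] in \<open>auto simp: isCont_def\<close>)
  have Y_lim: "((\<lambda>w. Y w u) \<longlongrightarrow> Y z u) (at z)" if z: "z \<in> upper_half_plane" for u z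
  proof -
    obtain B where B: "\<forall>\<^sub>F w in at z. \<forall>u. norm (Y w u) \<le> B * norm u" using bound[OF z] by blast
    have "((\<lambda>w. Y w u - Y z u) \<longlongrightarrow> 0) (at z)"
    proof (rule tendsto_0_le[where K = "B" and f = "\<lambda>w. X w (Y z u) - X z (Y z u)"])
      show "((\<lambda>w. X w (Y z u) - X z (Y z u)) \<longlongrightarrow> 0) (at z)" using X_lim[OF z] by (simp add: LIM_zero_iff)
      show "\<forall>\<^sub>F w in at z. norm (Y w u - Y z u) \<le> norm (X w (Y z u) - X z (Y z u)) * B"
        using B uhp[OF z]
      proof eventually_elim
        case (elim w)
        have "norm (Y w u - Y z u) = norm (Y w (X w (Y z u) - X z (Y z u)))"
          unfolding diff[OF z elim(2)] by simp
        then show ?case using elim(1) by (metis mult.commute)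
      qed
    qed
    then show ?thesis by (simp add: LIM_zero_iff)
  qed
  show ?thesis
    unfolding weakly_holomorphic_def
  proof (intro allI)
    fix u v
    show "(\<lambda>z. cinner (Y z u) v) holomorphic_on upper_half_plane"
      unfolding holomorphic_on_open[OF open_upper_half_plane]
    proof (intro ballI)
      fix z assume z: "z \<in> upper_half_plane"
      define D where "D i = deriv (\<lambda>w. cinner (X w (Y z u)) (e i)) z" for i
      have lim: "((\<lambda>w. - (\<Sum>i<n. ((cinner (X w (Y z u)) (e i) - cinner (X z (Y z u)) (e i)) / (w - z)) * cinner (Y w (e i)) v))
          \<longlongrightarrow> - (\<Sum>i<n. D i * cinner (Y z (e i)) v)) (at z)"
        unfolding D_def
        by (intro tendsto_minus tendsto_sum tendsto_mult tendsto_cinner_left Y_lim[OF z])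
           (rule X_der[OF z, unfolded has_field_derivative_iff])
      have "((\<lambda>w. (cinner (Y w u) v - cinner (Y z u) v) / (w - z)) \<longlongrightarrow> - (\<Sum>i<n. D i * cinner (Y z (e i)) v)) (at z)"
      proof (rule Lim_transform_eventually[OF lim])
        show "\<forall>\<^sub>F w in at z. - (\<Sum>i<n. ((cinner (X w (Y z u)) (e i) - cinner (X z (Y z u)) (e i)) / (w - z)) * cinner (Y w (e i)) v)
            = (cinner (Y w u) v - cinner (Y z u) v) / (w - z)"
          using uhp[OF z]
        proof eventually_elim
          case (elim w)
          let ?d = "X w (Y z u) - X z (Y z u)"
          have "cinner (Y w u) v - cinner (Y z u) v = - cinner (Y w ?d) v"
            unfolding cinner_diff_left[symmetric] diff[OF z elim] by simp
          also have "Y w ?d = (\<Sum>i<n. cinner ?d (e i) *\<^sub>C Y w (e i))"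
            by (rule clinear_op_expand[OF linY[OF elim]])
          finally show ?case
            by (simp add: cinner_sum_left cinner_scaleC_left cinner_diff_left sum_divide_distrib)
        qed
      qed
      then show "\<exists>f'. ((\<lambda>z. cinner (Y z u) v) has_field_derivative f') (at z)"
        unfolding has_field_derivative_iff by blast
    qed
  qed
qed

end

subsection \<open>Generalized resolvents and their parameters\<close>

lemma uhp_ne: "z \<in> upper_half_plane \<Longrightarrow> z + \<i> \<noteq> 0" "z \<in> upper_half_plane \<Longrightarrow> 0 < Im z"
  by (auto simp: upper_half_plane_def complex_eq_iff)

lemma uhp_norm_less:
  assumes "z \<in> upper_half_plane"
  shows "cmod (z - \<i>) < cmod (z + \<i>)"
proof -
  have "(cmod (z - \<i>))\<^sup>2 < (cmod (z + \<i>))\<^sup>2"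
    using uhp_ne(2)[OF assms] by (simp add: cmod_power2) (simp add: power2_eq_square algebra_simps)
  then show ?thesis by (rule power2_less_imp_less) simp
qed

text \<open>With $h = Ru$ this compares the Cayley transform of $R$ with the dissipation of $R$.\<close>

lemma cayley_norm_identity:
  "(norm (u + (z - \<i>) *\<^sub>C h))\<^sup>2 - (norm (u + (z + \<i>) *\<^sub>C h))\<^sup>2
     = 4 * (Im (cinner h u) - Im z * (norm (h::'a::complex_inner_space))\<^sup>2)"
proof -
  have n: "(cmod (z - \<i>))\<^sup>2 - (cmod (z + \<i>))\<^sup>2 = - 4 * Im z"
    by (simp add: cmod_power2) (simp add: power2_eq_square algebra_simps)
  have c: "Im (cinner h u) = - Im (cinner u h)" by (subst cinner_commute) simp
  have "(norm (u + (z - \<i>) *\<^sub>C h))\<^sup>2 - (norm (u + (z + \<i>) *\<^sub>C h))\<^sup>2 =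
    2 * Re (cnj (z - \<i>) * cinner u h) - 2 * Re (cnj (z + \<i>) * cinner u h)
      + ((cmod (z - \<i>))\<^sup>2 - (cmod (z + \<i>))\<^sup>2) * (norm h)\<^sup>2"
    by (simp add: norm_add_square cinner_scaleC_right norm_scaleC power_mult_distrib left_diff_distrib)
  also have "2 * Re (cnj (z - \<i>) * cinner u h) - 2 * Re (cnj (z + \<i>) * cinner u h) = 4 * Im (cinner h u)"
    unfolding c by (simp add: algebra_simps)
  finally show ?thesis unfolding n by (simp add: algebra_simps)
qed

lemma scaleC_two_i: "(2 * \<i>) *\<^sub>C u = \<i> *\<^sub>C u + \<i> *\<^sub>C (u::'a::complex_inner_space)"
  by (simp only: mult_2 scaleC_add_left)

text \<open>A symmetric linear relation: the graph may contain pairs (0, g). That A is an operator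
  is stated separately, where the argument calls for it.\<close>

locale symmetric_relation = onb e n for e :: "nat \<Rightarrow> 'h::complex_inner_space" and n +
  fixes A :: "('h \<times> 'h) set"
  assumes zero_mem: "(0, 0) \<in> A"
    and add_mem: "(f, g) \<in> A \<Longrightarrow> (f', g') \<in> A \<Longrightarrow> (f + f', g + g') \<in> A"
    and scale_mem: "(f, g) \<in> A \<Longrightarrow> (c *\<^sub>C f, c *\<^sub>C g) \<in> A"
    and symmetric: "(f, g) \<in> A \<Longrightarrow> (f', g') \<in> A \<Longrightarrow> cinner g f' = cinner f g'"
begin

lemma cinner_real: "(f, g) \<in> A \<Longrightarrow> Im (cinner f g) = 0"
  using symmetric[of f g f g] cinner_commute[of f g] by (metis Reals_cnj_iff complex_is_Real_iff)

text \<open>The two squares differ by a multiple of Re <g, i f>, which vanishes because <f, g> is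
  real. This is the isometry of the Cayley transform g - i f \<mapsto> g + i f of
  \<open>A\<close>.\<close>

lemma norm_minus_plus: "(f, g) \<in> A \<Longrightarrow> norm (g - \<i> *\<^sub>C f) = norm (g + \<i> *\<^sub>C f)"
proof -
  assume "(f, g) \<in> A"
  then have "Re (cinner g (\<i> *\<^sub>C f)) = 0" using cinner_real symmetric[of f g f g]
    by (simp add: cinner_scaleC_right)
  then have "(norm (g + \<i> *\<^sub>C f))\<^sup>2 = (norm (g + - (\<i> *\<^sub>C f)))\<^sup>2"
    unfolding norm_add_square by simp
  then show ?thesis by simp
qed

text \<open>The range of A - i, whose orthogonal complement is N_i.\<close>

definition cayley_domain :: "'h set" where
  "cayley_domain = {g - \<i> *\<^sub>C f | f g. (f, g) \<in> A}"

lemma cayley_domainI: "(f, g) \<in> A \<Longrightarrow> g - \<i> *\<^sub>C f \<in> cayley_domain"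
  by (auto simp: cayley_domain_def)

lemma cayley_domain_subspace: "complex_vector.subspace cayley_domain"
  unfolding complex_vector.subspace_def
proof (intro conjI ballI allI)
  show "0 \<in> cayley_domain" using cayley_domainI[OF zero_mem] by simp
next
  fix u v assume "u \<in> cayley_domain" "v \<in> cayley_domain"
  then obtain f g f' g' where fg: "(f, g) \<in> A" "(f', g') \<in> A" "u = g - \<i> *\<^sub>C f" "v = g' - \<i> *\<^sub>C f'"
    unfolding cayley_domain_def by blast
  then have "u + v = (g + g') - \<i> *\<^sub>C (f + f')" by (simp add: scaleC_add_right)
  then show "u + v \<in> cayley_domain" using cayley_domainI[OF add_mem[OF fg(1,2)]] by simp
next
  fix c u assume "u \<in> cayley_domain"
  then obtain f g where fg: "(f, g) \<in> A" "u = g - \<i> *\<^sub>C f" unfolding cayley_domain_def by blast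
  then have "c *\<^sub>C u = c *\<^sub>C g - \<i> *\<^sub>C (c *\<^sub>C f)" by (simp add: scaleC_diff_right scaleC_scaleC mult.commute)
  then show "c *\<^sub>C u \<in> cayley_domain" using cayley_domainI[OF scale_mem[OF fg(1)]] by simp
qed

definition defect_proj :: "'h \<Rightarrow> 'h" where
  "defect_proj = (SOME P. clinear_op P \<and> (\<forall>u. u - P u \<in> cayley_domain) \<and> (\<forall>u. \<forall>w\<in>cayley_domain. cinner (P u) w = 0))"

lemma defect_proj:
  shows clinear_defect_proj: "clinear_op defect_proj"
    and defect_proj_diff: "u - defect_proj u \<in> cayley_domain"
    and defect_proj_orth: "w \<in> cayley_domain \<Longrightarrow> cinner (defect_proj u) w = 0"
  using someI_ex[OF orthogonal_projection_exists[OF cayley_domain_subspace]]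
  unfolding defect_proj_def[symmetric] by blast+

lemma defect_subspace_eq: "defect_subspace A \<i> = {h. \<forall>w\<in>cayley_domain. cinner h w = 0}"
  by (auto simp: defect_subspace_def cayley_domain_def)

lemma defect_proj_mem: "defect_proj u \<in> defect_subspace A \<i>"
  using defect_proj_orth by (auto simp: defect_subspace_eq)

lemma defect_proj_id:
  assumes "\<psi> \<in> defect_subspace A \<i>"
  shows "defect_proj \<psi> = \<psi>"
proof -
  let ?w = "\<psi> - defect_proj \<psi>"
  have "cinner ?w ?w = cinner \<psi> ?w - cinner (defect_proj \<psi>) ?w" by (simp add: cinner_diff_left)
  also have "\<dots> = 0"
    using assms defect_proj_diff[of \<psi>] defect_proj_orth[OF defect_proj_diff] by (simp add: defect_subspace_eq)
  finally show ?thesis by (simp add: cinner_self)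
qed

lemma decompose: obtains f g where "(f, g) \<in> A" "u = (g - \<i> *\<^sub>C f) + defect_proj u"
proof -
  obtain f g where "(f, g) \<in> A" "u - defect_proj u = g - \<i> *\<^sub>C f"
    using defect_proj_diff[of u] by (auto simp: cayley_domain_def)
  then have "u = (g - \<i> *\<^sub>C f) + defect_proj u" by (metis diff_add_cancel)
  with \<open>(f, g) \<in> A\<close> show thesis by (rule that)
qed

lemma norm_square_orth_sum: "cinner u v = 0 \<Longrightarrow> (norm (u + v))\<^sup>2 = (norm u)\<^sup>2 + (norm (v::'h))\<^sup>2"
  by (simp add: norm_add_square)

text \<open>Pythagoras for the range of A - i and N_i. The right side mentions g + i f here and in
  \<open>norm_decompose'\<close>, so that the contribution of \<open>A\<close> cancels when a vector
  is compared with its image under an extension of the Cayley transform.\<close>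

lemma norm_decompose:
  assumes "(f, g) \<in> A" and "\<psi> \<in> defect_subspace A \<i>"
  shows "(norm ((g - \<i> *\<^sub>C f) + \<psi>))\<^sup>2 = (norm (g + \<i> *\<^sub>C f))\<^sup>2 + (norm \<psi>)\<^sup>2"
proof -
  have "cinner \<psi> (g - \<i> *\<^sub>C f) = 0" using assms by (auto simp: defect_subspace_def)
  then have "cinner (g - \<i> *\<^sub>C f) \<psi> = 0" by (subst cinner_commute) simp
  then show ?thesis using norm_minus_plus[OF assms(1)] by (simp add: norm_square_orth_sum)
qed

lemma norm_decompose':
  assumes "(f, g) \<in> A" and "\<phi> \<in> defect_subspace A (- \<i>)"
  shows "(norm ((g + \<i> *\<^sub>C f) + \<phi>))\<^sup>2 = (norm (g + \<i> *\<^sub>C f))\<^sup>2 + (norm \<phi>)\<^sup>2"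
proof -
  have "cinner \<phi> (g + \<i> *\<^sub>C f) = 0" using assms by (auto simp: defect_subspace_def scaleC_minus_left)
  then have "cinner (g + \<i> *\<^sub>C f) \<phi> = 0" by (subst cinner_commute) simp
  then show ?thesis by (simp add: norm_square_orth_sum)
qed

lemma defect_subspace_zero: "0 \<in> defect_subspace A z"
  by (auto simp: defect_subspace_def)

lemma defect_subspace_add: "u \<in> defect_subspace A z \<Longrightarrow> v \<in> defect_subspace A z \<Longrightarrow> u + v \<in> defect_subspace A z"
  by (fastforce simp: defect_subspace_def cinner_add_left)

lemma defect_subspace_scale: "u \<in> defect_subspace A z \<Longrightarrow> c *\<^sub>C u \<in> defect_subspace A z"
  by (fastforce simp: defect_subspace_def cinner_scaleC_left)

end

text \<open>\<open>U\<close> is the Cayley transform of \<open>R\<close>; it extends that of \<open>A\<close>, and its restriction to $N_i$ is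
  the parameter \<open>F\<close>.\<close>

locale generalized_resolvent = symmetric_relation e n A for e :: "nat \<Rightarrow> 'h::complex_inner_space" and n and A +
  fixes R :: "complex \<Rightarrow> 'h \<Rightarrow> 'h"
  assumes lin: "z \<in> upper_half_plane \<Longrightarrow> clinear_op (R z)"
    and dissipative: "z \<in> upper_half_plane \<Longrightarrow> Im z * (norm (R z u))\<^sup>2 \<le> Im (cinner (R z u) u)"
    and holomorphic: "weakly_holomorphic R"
    and extends: "z \<in> upper_half_plane \<Longrightarrow> (f, g) \<in> A \<Longrightarrow> R z (g - z *\<^sub>C f) = f"
begin

lemma R_bound: "z \<in> upper_half_plane \<Longrightarrow> norm (R z u) \<le> norm u / Im z"
proof -
  assume z: "z \<in> upper_half_plane"
  have "Im z * (norm (R z u))\<^sup>2 \<le> norm (R z u) * norm u"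
    using dissipative[OF z, of u] cinner_cauchy_schwarz[of "R z u" u] abs_Im_le_cmod[of "cinner (R z u) u"] by linarith
  then have "norm (R z u) * (Im z * norm (R z u)) \<le> norm (R z u) * norm u"
    by (simp add: power2_eq_square mult_ac)
  then have "Im z * norm (R z u) \<le> norm u"
    by (cases "norm (R z u) = 0") (simp, metis mult_le_cancel_left_pos norm_ge_zero order_le_less)
  then show ?thesis using uhp_ne(2)[OF z] by (simp add: field_simps)
qed

text \<open>If R_z = (T - z)^(-1), then V_z = (T - i) R_z and W_z = (T + i) R_z, so \<open>U\<close>
  = W V^(-1) is the Cayley transform of T. Written this way it does not presuppose that T is an
  operator.\<close>

definition V :: "complex \<Rightarrow> 'h \<Rightarrow> 'h" where "V z u = u + (z - \<i>) *\<^sub>C R z u"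
definition W :: "complex \<Rightarrow> 'h \<Rightarrow> 'h" where "W z u = u + (z + \<i>) *\<^sub>C R z u"
definition Y :: "complex \<Rightarrow> 'h \<Rightarrow> 'h" where "Y z = inv_into UNIV (V z)"
definition U :: "complex \<Rightarrow> 'h \<Rightarrow> 'h" where "U z u = W z (Y z u)"

context
  fixes z assumes z: "z \<in> upper_half_plane"
begin

lemma clinear_V: "clinear_op (V z)" and clinear_W: "clinear_op (W z)"
  by (auto intro!: clinear_opI
      simp: V_def W_def clinear_op_add[OF lin[OF z]] clinear_op_scale[OF lin[OF z]] scaleC_add_right scaleC_scaleC mult.commute)

lemma norm_V_W: "(norm (V z u))\<^sup>2 - (norm (W z u))\<^sup>2 = 4 * (Im (cinner (R z u) u) - Im z * (norm (R z u))\<^sup>2)"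
  unfolding V_def W_def by (rule cayley_norm_identity)

lemma norm_W_le: "norm (W z u) \<le> norm (V z u)"
proof (rule power2_le_imp_le)
  have "0 \<le> 4 * (Im (cinner (R z u) u) - Im z * (norm (R z u))\<^sup>2)" using dissipative[OF z, of u] by simp
  then show "(norm (W z u))\<^sup>2 \<le> (norm (V z u))\<^sup>2" unfolding norm_V_W[symmetric] by simp
qed simp

lemma W_minus_V: "W z u - V z u = (2 * \<i>) *\<^sub>C R z u"
  by (simp add: V_def W_def scaleC_diff_left[symmetric])

text \<open>If V u = 0, then W u = 0 by the norm comparison, so the difference 2i R u vanishes and u
  = V u - (z - i) R u = 0. Finite dimension gives surjectivity.\<close>

lemma bij_V: "bij (V z)"
proof (rule injective_imp_bij[OF clinear_V])
  fix u assume V: "V z u = 0"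
  then have "W z u = 0" using norm_W_le[of u] by simp
  then have "(2 * \<i>) *\<^sub>C R z u = 0" using W_minus_V[of u] V by simp
  then have "R z u = 0" by (simp add: complex_vector.scale_eq_0_iff)
  then show "u = 0" using V by (simp add: V_def)
qed

lemma V_Y: "V z (Y z u) = u" and Y_V: "Y z (V z u) = u"
  unfolding Y_def using bij_V by (auto simp: bij_def surj_f_inv_f inv_f_f)

lemma clinear_Y: "clinear_op (Y z)"
  unfolding Y_def by (rule clinear_op_inv[OF clinear_V bij_V])

lemma U_V: "U z (V z u) = W z u" by (simp add: U_def Y_V)

lemma clinear_U: "clinear_op (U z)"
  by (auto intro!: clinear_opI simp: U_def clinear_op_add[OF clinear_Y] clinear_op_add[OF clinear_W]
      clinear_op_scale[OF clinear_Y] clinear_op_scale[OF clinear_W])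

lemma norm_U_le: "norm (U z u) \<le> norm u"
  using norm_W_le[of "Y z u"] by (simp add: U_def V_Y)

lemma U_extends: "(f, g) \<in> A \<Longrightarrow> U z (g - \<i> *\<^sub>C f) = g + \<i> *\<^sub>C f"
proof -
  assume fg: "(f, g) \<in> A"
  have "V z (g - z *\<^sub>C f) = g - \<i> *\<^sub>C f" "W z (g - z *\<^sub>C f) = g + \<i> *\<^sub>C f"
    unfolding V_def W_def extends[OF z fg] by (simp_all add: scaleC_diff_left scaleC_add_left)
  then show ?thesis using U_V by metis
qed

text \<open>A vector on which the contraction \<open>U z\<close> is isometric is null for the positive form
  $|u|^2 - |Uu|^2$, hence orthogonal to everything with respect to it.\<close>

lemma U_polar:
  assumes fg: "(f, g) \<in> A"
  shows "cinner (U z v) (g + \<i> *\<^sub>C f) = cinner v (g - \<i> *\<^sub>C f)"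
proof -
  define u0 where "u0 = g - \<i> *\<^sub>C f"
  have Uu0: "U z u0 = g + \<i> *\<^sub>C f" unfolding u0_def by (rule U_extends[OF fg])
  have n0: "norm (U z u0) = norm u0" unfolding Uu0 using norm_minus_plus[OF fg] by (simp add: u0_def)
  define b where "b = cinner u0 v - cinner (U z u0) (U z v)"
  have "(cmod b)\<^sup>2 \<le> ((norm v)\<^sup>2 - (norm (U z v))\<^sup>2) * 0"
  proof (rule cmod_sq_le_of_quadratic)
    fix \<zeta>
    have "(norm (U z (v + \<zeta> *\<^sub>C u0)))\<^sup>2 \<le> (norm (v + \<zeta> *\<^sub>C u0))\<^sup>2" by (intro power_mono norm_U_le) simp
    then have "0 \<le> (norm v)\<^sup>2 - (norm (U z v))\<^sup>2 + 2 * (Re (cinner v (\<zeta> *\<^sub>C u0)) - Re (cinner (U z v) (\<zeta> *\<^sub>C U z u0)))"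
      by (simp add: clinear_op_add[OF clinear_U] clinear_op_scale[OF clinear_U] norm_add_square norm_scaleC n0)
    then show "0 \<le> (norm v)\<^sup>2 - (norm (U z v))\<^sup>2 + 2 * Re (\<zeta> * b) + (cmod \<zeta>)\<^sup>2 * 0"
      unfolding Re_cinner_commute[of v "\<zeta> *\<^sub>C u0"] Re_cinner_commute[of "U z v" "\<zeta> *\<^sub>C U z u0"]
      by (simp add: b_def cinner_scaleC_left right_diff_distrib)
  qed simp
  then have eq: "cinner u0 v = cinner (U z u0) (U z v)" by (simp add: b_def)
  have "cinner v u0 = cnj (cinner u0 v)" by (rule cinner_commute)
  also have "\<dots> = cnj (cinner (U z u0) (U z v))" using eq by simp
  also have "\<dots> = cinner (U z v) (U z u0)" by (rule cinner_commute[symmetric])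
  finally show ?thesis unfolding Uu0 unfolding u0_def by (rule sym)
qed

lemma U_defect: "\<psi> \<in> defect_subspace A \<i> \<Longrightarrow> U z \<psi> \<in> defect_subspace A (- \<i>)"
  unfolding defect_subspace_def by (auto simp: scaleC_minus_left U_polar)

text \<open>The adjoint of R_z extends (A - conj z)^(-1). This is \<open>U_polar\<close> at V_z v
  multiplied out; it allows the passage from x_i to x_(i+N) in the second argument of <R_z v, .> as
  well.\<close>

lemma extends_adjoint: "(f, g) \<in> A \<Longrightarrow> cinner (R z v) (g - cnj z *\<^sub>C f) = cinner v f"
proof -
  assume fg: "(f, g) \<in> A"
  have "cinner (W z v) (g + \<i> *\<^sub>C f) = cinner (V z v) (g - \<i> *\<^sub>C f)"
    using U_polar[OF fg, of "V z v"] by (simp add: U_V)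
  then have "2 * \<i> * cinner (R z v) (g - cnj z *\<^sub>C f) = 2 * \<i> * cinner v f"
    by (simp add: V_def W_def cinner_simps algebra_simps)
  then show ?thesis by simp
qed

text \<open>The inverse Cayley transform: the right side consists of the pairs ((U w - w)/(2i), (U w
  + w)/2) with w = V_z v. Every w splits as (g - i f) + 2i \<psi> with \<psi> in N_i, and this
  splitting reproduces the defining pairs of A_F term by term.\<close>

lemma resolvent_graph_eq:
  assumes F: "\<And>\<psi>. \<psi> \<in> defect_subspace A \<i> \<Longrightarrow> F \<psi> = U z \<psi>"
  shows "extension_operator A F = {(R z v, v + z *\<^sub>C R z v) | v. True}"
proof (rule subset_antisym; rule subsetI)
  fix p assume "p \<in> extension_operator A F"
  then obtain f g \<psi> where fg: "(f, g) \<in> A" and \<psi>: "\<psi> \<in> defect_subspace A \<i>"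
    and p: "p = (f + U z \<psi> - \<psi>, g + \<i> *\<^sub>C U z \<psi> + \<i> *\<^sub>C \<psi>)"
    unfolding extension_operator_def using F by auto
  define w where "w = (g - \<i> *\<^sub>C f) + (2 * \<i>) *\<^sub>C \<psi>"
  have Uw: "U z w = (g + \<i> *\<^sub>C f) + (2 * \<i>) *\<^sub>C U z \<psi>"
    unfolding w_def by (simp add: clinear_op_add[OF clinear_U] clinear_op_scale[OF clinear_U] U_extends[OF fg])
  define v where "v = Y z w"
  have Vv: "V z v = w" and Wv: "W z v = U z w" by (simp_all add: v_def V_Y U_def)
  have "(2 * \<i>) *\<^sub>C R z v = U z w - w" using W_minus_V[of v] Vv Wv by simp
  also have "\<dots> = (2 * \<i>) *\<^sub>C (f + U z \<psi> - \<psi>)"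
    unfolding Uw unfolding w_def by (simp only: scaleC_two_i scaleC_add_right scaleC_diff_right) simp
  finally have 1: "R z v = f + U z \<psi> - \<psi>" by (simp add: complex_vector.scale_left_imp_eq)
  have "v + z *\<^sub>C R z v = w + \<i> *\<^sub>C R z v"
    unfolding Vv[symmetric] V_def by (simp add: scaleC_diff_left)
  also have "\<dots> = g + \<i> *\<^sub>C U z \<psi> + \<i> *\<^sub>C \<psi>"
    unfolding 1 w_def mult_2 scaleC_add_left by (simp add: scaleC_add_right scaleC_diff_right)
  finally have "p = (R z v, v + z *\<^sub>C R z v)" using p 1 by simp
  then show "p \<in> {(R z v, v + z *\<^sub>C R z v) | v. True}" by blast
next
  fix p assume "p \<in> {(R z v, v + z *\<^sub>C R z v) | v. True}"
  then obtain v where p: "p = (R z v, v + z *\<^sub>C R z v)" by blast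
  obtain f g where fg: "(f, g) \<in> A" and Vd: "V z v = (g - \<i> *\<^sub>C f) + defect_proj (V z v)"
    using decompose[of "V z v"] by blast
  define \<psi> where "\<psi> = (1 / (2 * \<i>)) *\<^sub>C defect_proj (V z v)"
  have \<psi>: "\<psi> \<in> defect_subspace A \<i>" unfolding \<psi>_def by (intro defect_subspace_scale defect_proj_mem)
  have Vv: "V z v = (g - \<i> *\<^sub>C f) + (2 * \<i>) *\<^sub>C \<psi>"
    using Vd by (simp add: \<psi>_def scaleC_scaleC)
  have Wv: "W z v = (g + \<i> *\<^sub>C f) + (2 * \<i>) *\<^sub>C U z \<psi>"
    unfolding U_V[symmetric] Vv by (simp add: clinear_op_add[OF clinear_U] clinear_op_scale[OF clinear_U] U_extends[OF fg])
  have "(2 * \<i>) *\<^sub>C R z v = W z v - V z v" by (simp add: W_minus_V)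
  also have "\<dots> = (2 * \<i>) *\<^sub>C (f + U z \<psi> - \<psi>)"
    unfolding Vv Wv by (simp only: scaleC_two_i scaleC_add_right scaleC_diff_right) simp
  finally have 1: "R z v = f + U z \<psi> - \<psi>" by (simp add: complex_vector.scale_left_imp_eq)
  have "v + z *\<^sub>C R z v = V z v + \<i> *\<^sub>C R z v" unfolding V_def by (simp add: scaleC_diff_left)
  also have "\<dots> = g + \<i> *\<^sub>C U z \<psi> + \<i> *\<^sub>C \<psi>"
    unfolding 1 Vv mult_2 scaleC_add_left by (simp add: scaleC_add_right scaleC_diff_right)
  finally have 2: "v + z *\<^sub>C R z v = g + \<i> *\<^sub>C U z \<psi> + \<i> *\<^sub>C \<psi>" .
  have "(f + F \<psi> - \<psi>, g + \<i> *\<^sub>C F \<psi> + \<i> *\<^sub>C \<psi>) \<in> extension_operator A F"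
    unfolding extension_operator_def using fg \<psi> by blast
  then show "p \<in> extension_operator A F"
    unfolding p 2 unfolding 1 F[OF \<psi>] .
qed

lemma resolvent_eq:
  assumes F: "\<And>\<psi>. \<psi> \<in> defect_subspace A \<i> \<Longrightarrow> F \<psi> = U z \<psi>"
  shows "resolvent (extension_operator A F) z = {(v, R z v) | v. True}"
proof -
  have eq: "extension_operator A F = {(R z v, v + z *\<^sub>C R z v) | v. True}"
    by (rule resolvent_graph_eq) (rule F)
  show ?thesis unfolding resolvent_def eq by auto (metis add_diff_cancel_right')
qed

end

lemma weakly_holomorphic_V: "weakly_holomorphic V"
  unfolding V_def[abs_def]
  by (intro weakly_holomorphic_add weakly_holomorphic_scale weakly_holomorphic_const holomorphic holomorphic_intros)

lemma weakly_holomorphic_W: "weakly_holomorphic W"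
  unfolding W_def[abs_def]
  by (intro weakly_holomorphic_add weakly_holomorphic_scale weakly_holomorphic_const holomorphic holomorphic_intros)

text \<open>R_z is eliminated from u = V_z Y_z u and U_z u = W_z Y_z u. Since \<open>U\<close> is a
  contraction, this bounds the inverse of V_z locally uniformly in z.\<close>

lemma Y_eq: "z \<in> upper_half_plane \<Longrightarrow> Y z u = (1 / (2 * \<i>)) *\<^sub>C ((z + \<i>) *\<^sub>C u - (z - \<i>) *\<^sub>C U z u)"
proof -
  assume z: "z \<in> upper_half_plane"
  have u: "u = Y z u + (z - \<i>) *\<^sub>C R z (Y z u)" using V_Y[OF z, of u] by (simp add: V_def)
  have Uu: "U z u = Y z u + (z + \<i>) *\<^sub>C R z (Y z u)" by (simp add: U_def W_def)
  have "(z + \<i>) *\<^sub>C u - (z - \<i>) *\<^sub>C U z u =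
        (z + \<i>) *\<^sub>C (Y z u + (z - \<i>) *\<^sub>C R z (Y z u)) - (z - \<i>) *\<^sub>C (Y z u + (z + \<i>) *\<^sub>C R z (Y z u))"
    by (rule arg_cong2[where f = "\<lambda>a b. (z + \<i>) *\<^sub>C a - (z - \<i>) *\<^sub>C b", OF u Uu])
  also have "\<dots> = (z + \<i> - (z - \<i>)) *\<^sub>C Y z u"
    by (simp only: scaleC_add_right scaleC_scaleC mult.commute[of "z - \<i>" "z + \<i>"]
        scaleC_diff_left[of "z + \<i>" "z - \<i>"]) simp
  finally show ?thesis by (simp add: scaleC_scaleC)
qed

lemma weakly_holomorphic_Y: "weakly_holomorphic Y"
proof (rule weakly_holomorphic_inverse[OF weakly_holomorphic_V])
  fix z assume z: "z \<in> upper_half_plane"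
  show "\<exists>B. \<forall>\<^sub>F w in at z. \<forall>u. norm (Y w u) \<le> B * norm u"
  proof (intro exI)
    have "((\<lambda>w. cmod (w + \<i>) + cmod (w - \<i>)) \<longlongrightarrow> cmod (z + \<i>) + cmod (z - \<i>)) (at z)"
      by (intro tendsto_intros)
    then have 1: "\<forall>\<^sub>F w in at z. cmod (w + \<i>) + cmod (w - \<i>) < cmod (z + \<i>) + cmod (z - \<i>) + 1"
      by (rule order_tendstoD) simp
    have 2: "\<forall>\<^sub>F w in at z. w \<in> upper_half_plane"
      using z open_upper_half_plane by (metis eventually_at_topological)
    show "\<forall>\<^sub>F w in at z. \<forall>u. norm (Y w u) \<le> (cmod (z + \<i>) + cmod (z - \<i>) + 1) * norm u"
      using 1 2
    proof eventually_elim
      case (elim w)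
      show ?case
      proof
        fix u
        have "norm (Y w u) = norm ((w + \<i>) *\<^sub>C u - (w - \<i>) *\<^sub>C U w u) / 2"
          unfolding Y_eq[OF elim(2)] by (simp add: norm_scaleC norm_divide)
        also have "\<dots> \<le> norm ((w + \<i>) *\<^sub>C u - (w - \<i>) *\<^sub>C U w u)" by simp
        also have "\<dots> \<le> cmod (w + \<i>) * norm u + cmod (w - \<i>) * norm (U w u)"
          by (rule order_trans[OF norm_triangle_ineq4]) (simp add: norm_scaleC)
        also have "\<dots> \<le> cmod (w + \<i>) * norm u + cmod (w - \<i>) * norm u"
          by (intro add_mono mult_left_mono norm_U_le elim) auto
        also have "\<dots> = (cmod (w + \<i>) + cmod (w - \<i>)) * norm u" by (simp add: distrib_right)
        also have "\<dots> \<le> (cmod (z + \<i>) + cmod (z - \<i>) + 1) * norm u"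
          using elim by (intro mult_right_mono) auto
        finally show "norm (Y w u) \<le> (cmod (z + \<i>) + cmod (z - \<i>) + 1) * norm u" .
      qed
    qed
  qed
qed (auto intro: clinear_V clinear_Y simp: V_Y Y_V)

lemma weakly_holomorphic_U: "weakly_holomorphic U"
  unfolding U_def[abs_def]
  by (rule weakly_holomorphic_compose[OF weakly_holomorphic_W clinear_W weakly_holomorphic_Y])

definition param :: "complex \<Rightarrow> 'h \<Rightarrow> 'h" where
  "param = (\<lambda>z\<in>upper_half_plane. \<lambda>\<psi>\<in>defect_subspace A \<i>. U z \<psi>)"

lemma param_eq: "z \<in> upper_half_plane \<Longrightarrow> \<psi> \<in> defect_subspace A \<i> \<Longrightarrow> param z \<psi> = U z \<psi>"
  by (simp add: param_def)

text \<open>The difference quotients of the finitely many vectors U_z e_i converge, and on the unit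
  ball the coordinates of \<psi> are at most 1 in modulus, so the convergence is uniform
  there.\<close>

lemma param_analytic: "operator_analytic_on param (defect_subspace A \<i>) upper_half_plane"
  unfolding operator_analytic_on_def
proof
  fix z assume z: "z \<in> upper_half_plane"
  define D where "D i = (\<Sum>j<n. deriv (\<lambda>w. cinner (U w (e i)) (e j)) z *\<^sub>C e j)" for i
  define q where "q w i = inverse (w - z) *\<^sub>C (U w (e i) - U z (e i))" for w i
  have D_e: "cinner (D i) (e j) = deriv (\<lambda>w. cinner (U w (e i)) (e j)) z" if "j < n" for i j
  proof -
    have "cinner (D i) (e j) = (\<Sum>k<n. if k = j then deriv (\<lambda>w. cinner (U w (e i)) (e j)) z else 0)"
      unfolding D_def cinner_sum_left using that orth by (intro sum.cong) (auto simp: cinner_scaleC_left)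
    then show ?thesis using that by simp
  qed
  have q_lim: "((\<lambda>w. q w i) \<longlongrightarrow> D i) (at z within upper_half_plane)" for i
  proof (rule tendsto_onb)
    fix j assume j: "j < n"
    have "((\<lambda>w. cinner (U w (e i)) (e j)) has_field_derivative cinner (D i) (e j)) (at z)"
      unfolding D_e[OF j]
      using weakly_holomorphicD[OF weakly_holomorphic_U] open_upper_half_plane z by (rule holomorphic_derivI)
    then have "((\<lambda>w. cinner (U w (e i)) (e j)) has_field_derivative cinner (D i) (e j)) (at z within upper_half_plane)"
      by (rule has_field_derivative_at_within)
    then have "((\<lambda>w. (cinner (U w (e i)) (e j) - cinner (U z (e i)) (e j)) / (w - z)) \<longlongrightarrow> cinner (D i) (e j)) (at z within upper_half_plane)"
      by (simp only: has_field_derivative_iff)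
    then show "((\<lambda>w. cinner (q w i) (e j)) \<longlongrightarrow> cinner (D i) (e j)) (at z within upper_half_plane)"
      by (simp add: q_def cinner_scaleC_left cinner_diff_left divide_inverse mult.commute)
  qed
  show "\<exists>D. uniform_limit {\<psi> \<in> defect_subspace A \<i>. norm \<psi> \<le> 1}
     (\<lambda>w \<psi>. inverse (w - z) *\<^sub>C (param w \<psi> - param z \<psi>)) D (at z within upper_half_plane)"
  proof (intro exI uniform_limitI)
    fix \<epsilon> :: real assume \<epsilon>: "0 < \<epsilon>"
    have "((\<lambda>w. \<Sum>i<n. norm (q w i - D i)) \<longlongrightarrow> (\<Sum>i<n. 0)) (at z within upper_half_plane)"
      by (intro tendsto_sum tendsto_norm_zero) (use q_lim in \<open>simp add: LIM_zero_iff\<close>)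
    then have "\<forall>\<^sub>F w in at z within upper_half_plane. (\<Sum>i<n. norm (q w i - D i)) < \<epsilon>"
      using \<epsilon> by (intro order_tendstoD(2)[where y = 0]) auto
    moreover have "\<forall>\<^sub>F w in at z within upper_half_plane. w \<in> upper_half_plane"
      by (simp add: eventually_at_filter)
    ultimately show "\<forall>\<^sub>F w in at z within upper_half_plane. \<forall>\<psi>\<in>{\<psi> \<in> defect_subspace A \<i>. norm \<psi> \<le> 1}.
       dist (inverse (w - z) *\<^sub>C (param w \<psi> - param z \<psi>)) (\<Sum>i<n. cinner \<psi> (e i) *\<^sub>C D i) < \<epsilon>"
    proof eventually_elim
      case (elim w)
      show ?case
      proof
        fix \<psi> assume \<psi>: "\<psi> \<in> {\<psi> \<in> defect_subspace A \<i>. norm \<psi> \<le> 1}"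
        have "inverse (w - z) *\<^sub>C (param w \<psi> - param z \<psi>) = (\<Sum>i<n. cinner \<psi> (e i) *\<^sub>C q w i)"
          using \<psi> z elim(2)
          by (simp add: param_eq clinear_op_expand[OF clinear_U, of _ \<psi>] q_def sum_subtractf[symmetric]
              scaleC_diff_right complex_vector.scale_sum_right scaleC_scaleC mult.commute)
        then have "dist (inverse (w - z) *\<^sub>C (param w \<psi> - param z \<psi>)) (\<Sum>i<n. cinner \<psi> (e i) *\<^sub>C D i)
           = norm (\<Sum>i<n. cinner \<psi> (e i) *\<^sub>C (q w i - D i))"
          by (simp add: dist_norm sum_subtractf scaleC_diff_right)
        also have "\<dots> \<le> (\<Sum>i<n. norm (q w i - D i))"
        proof (rule sum_norm_le)
          fix i assume "i \<in> {..<n}"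
          then have "cmod (cinner \<psi> (e i)) \<le> 1"
            using cinner_cauchy_schwarz[of \<psi> "e i"] \<psi> by (simp add: norm_e)
          then show "norm (cinner \<psi> (e i) *\<^sub>C (q w i - D i)) \<le> norm (q w i - D i)"
            by (simp add: norm_scaleC mult_left_le_one_le)
        qed
        finally show "dist (inverse (w - z) *\<^sub>C (param w \<psi> - param z \<psi>)) (\<Sum>i<n. cinner \<psi> (e i) *\<^sub>C D i) < \<epsilon>"
          using elim(1) by simp
      qed
    qed
  qed
qed

lemma param_contractive: "param \<in> contractive_class A"
  unfolding contractive_class_def
  using param_analytic
  by (auto simp: param_eq U_defect norm_U_le defect_subspace_add defect_subspace_scale
      clinear_op_add[OF clinear_U] clinear_op_scale[OF clinear_U] param_def)

end

section \<open>The generalized resolvent of a contractive parameter\<close>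

context symmetric_relation
begin

definition cayley :: "'h \<Rightarrow> 'h" where
  "cayley w = (SOME w'. \<exists>f g. (f, g) \<in> A \<and> w = g - \<i> *\<^sub>C f \<and> w' = g + \<i> *\<^sub>C f)"

text \<open>Well-definedness of the choice: two representations of the same g - i f differ by an
  element of \<open>A\<close> that A - i sends to 0, and by the isometry so does A + i.\<close>

lemma cayley_eq:
  assumes fg: "(f, g) \<in> A"
  shows "cayley (g - \<i> *\<^sub>C f) = g + \<i> *\<^sub>C f"
  unfolding cayley_def
proof (rule some_equality)
  show "\<exists>f' g'. (f', g') \<in> A \<and> g - \<i> *\<^sub>C f = g' - \<i> *\<^sub>C f' \<and> g + \<i> *\<^sub>C f = g' + \<i> *\<^sub>C f'"
    using fg by blast
  fix w' assume "\<exists>f' g'. (f', g') \<in> A \<and> g - \<i> *\<^sub>C f = g' - \<i> *\<^sub>C f' \<and> w' = g' + \<i> *\<^sub>C f'"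
  then obtain f' g' where fg': "(f', g') \<in> A" and eq: "g - \<i> *\<^sub>C f = g' - \<i> *\<^sub>C f'" and w': "w' = g' + \<i> *\<^sub>C f'"
    by blast
  have "(f' + (- 1) *\<^sub>C f, g' + (- 1) *\<^sub>C g) \<in> A" by (rule add_mem[OF fg' scale_mem[OF fg]])
  then have "(f' - f, g' - g) \<in> A" by (simp add: scaleC_minus_one)
  from norm_minus_plus[OF this]
  have "norm ((g' - g) + \<i> *\<^sub>C (f' - f)) = norm ((g' - \<i> *\<^sub>C f') - (g - \<i> *\<^sub>C f))"
    by (simp add: scaleC_diff_right algebra_simps)
  then have "norm ((g' + \<i> *\<^sub>C f') - (g + \<i> *\<^sub>C f)) = 0"
    using eq by (simp add: scaleC_diff_right algebra_simps)
  then show "w' = g + \<i> *\<^sub>C f" using w' by simp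
qed

lemma defect_proj_zero:
  assumes w: "w \<in> cayley_domain"
  shows "defect_proj w = 0"
proof -
  have "cinner (defect_proj w) (defect_proj w) = cinner (defect_proj w) w - cinner (defect_proj w) (w - defect_proj w)"
    by (simp add: cinner_diff_right)
  also have "\<dots> = 0" using defect_proj_orth[OF w] defect_proj_orth[OF defect_proj_diff] by simp
  finally show ?thesis by (simp add: cinner_self)
qed

end

locale contractive_parameter = symmetric_relation e n A
  for e :: "nat \<Rightarrow> 'h::complex_inner_space" and n and A +
  fixes F :: "complex \<Rightarrow> 'h \<Rightarrow> 'h"
  assumes F: "F \<in> contractive_class A"
begin

text \<open>The prescribed Cayley transform: that of \<open>A\<close> on the range of A - i, and F
  on N_i. As F maps into N_(-i), the two images are orthogonal and the sum is again a
  contraction.\<close>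

definition S :: "complex \<Rightarrow> 'h \<Rightarrow> 'h" where
  "S z u = cayley (u - defect_proj u) + F z (defect_proj u)"

text \<open>The right side of \<open>Y_eq\<close> with \<open>S\<close> in place of
  \<open>U\<close>, hence the future inverse of V_z. Its invertibility rests on |z - i| < |z +
  i|.\<close>

definition X :: "complex \<Rightarrow> 'h \<Rightarrow> 'h" where
  "X z u = (1 / (2 * \<i>)) *\<^sub>C ((z + \<i>) *\<^sub>C u - (z - \<i>) *\<^sub>C S z u)"

definition X_inv :: "complex \<Rightarrow> 'h \<Rightarrow> 'h" where
  "X_inv z = inv_into UNIV (X z)"

definition res :: "complex \<Rightarrow> 'h \<Rightarrow> 'h" where
  "res z u = (1 / (2 * \<i>)) *\<^sub>C (S z (X_inv z u) - X_inv z u)"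

lemma weakly_holomorphic_S: "weakly_holomorphic S"
  unfolding weakly_holomorphic_def
proof (intro allI)
  fix u v
  let ?\<psi> = "defect_proj u"
  have "(\<lambda>z. cinner (F z ?\<psi>) v) holomorphic_on upper_half_plane"
    unfolding holomorphic_on_def
  proof
    fix z assume z: "z \<in> upper_half_plane"
    \<comment> \<open>Uniform differentiability is given on the unit ball, so the vector is scaled
      into it; adding 1 avoids a case distinction at the zero vector.\<close>
    define c where "c = complex_of_real (norm ?\<psi> + 1)"
    have c0: "0 < norm ?\<psi> + 1" by (simp add: add_nonneg_pos)
    have c: "c \<noteq> 0" unfolding c_def using c0 by (metis less_irrefl of_real_eq_0_iff)
    define \<phi> where "\<phi> = inverse c *\<^sub>C ?\<psi>"
    have \<phi>: "\<phi> \<in> defect_subspace A \<i>" unfolding \<phi>_def by (intro defect_subspace_scale defect_proj_mem)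
    have "norm \<phi> = norm ?\<psi> / (norm ?\<psi> + 1)"
      using c0 by (simp add: \<phi>_def c_def norm_scaleC norm_inverse divide_inverse mult.commute del: of_real_add)
    then have \<phi>1: "norm \<phi> \<le> 1" using c0 by simp
    have F\<psi>: "F w ?\<psi> = c *\<^sub>C F w \<phi>" if "w \<in> upper_half_plane" for w
    proof -
      have "F w (c *\<^sub>C \<phi>) = c *\<^sub>C F w \<phi>" using F that \<phi> by (simp add: contractive_class_def)
      moreover have "c *\<^sub>C \<phi> = ?\<psi>" using c by (simp add: \<phi>_def scaleC_scaleC)
      ultimately show ?thesis by simp
    qed
    obtain D where D: "uniform_limit {\<psi>\<in>defect_subspace A \<i>. norm \<psi> \<le> 1}
        (\<lambda>w \<psi>. inverse (w - z) *\<^sub>C (F w \<psi> - F z \<psi>)) D (at z within upper_half_plane)"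
      using F z by (auto simp: contractive_class_def operator_analytic_on_def)
    have "((\<lambda>w. inverse (w - z) *\<^sub>C (F w \<phi> - F z \<phi>)) \<longlongrightarrow> D \<phi>) (at z within upper_half_plane)"
      by (rule tendsto_uniform_limitI[OF D]) (use \<phi> \<phi>1 in simp)
    then have "((\<lambda>w. c * cinner (inverse (w - z) *\<^sub>C (F w \<phi> - F z \<phi>)) v) \<longlongrightarrow> c * cinner (D \<phi>) v) (at z within upper_half_plane)"
      by (intro tendsto_intros tendsto_cinner_left)
    moreover have "\<forall>\<^sub>F w in at z within upper_half_plane. c * cinner (inverse (w - z) *\<^sub>C (F w \<phi> - F z \<phi>)) v
        = (cinner (F w ?\<psi>) v - cinner (F z ?\<psi>) v) / (w - z)"
    proof -
      have "\<forall>\<^sub>F w in at z within upper_half_plane. w \<in> upper_half_plane" by (simp add: eventually_at_filter)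
      then show ?thesis
        by eventually_elim (simp add: F\<psi> z cinner_simps divide_inverse algebra_simps)
    qed
    ultimately have "((\<lambda>w. (cinner (F w ?\<psi>) v - cinner (F z ?\<psi>) v) / (w - z)) \<longlongrightarrow> c * cinner (D \<phi>) v) (at z within upper_half_plane)"
      by (rule Lim_transform_eventually)
    then have "((\<lambda>w. cinner (F w ?\<psi>) v) has_field_derivative c * cinner (D \<phi>) v) (at z within upper_half_plane)"
      by (simp only: has_field_derivative_iff)
    then show "(\<lambda>z. cinner (F z ?\<psi>) v) field_differentiable at z within upper_half_plane"
      by (auto simp: field_differentiable_def)
  qed
  then show "(\<lambda>z. cinner (S z u) v) holomorphic_on upper_half_plane"
    unfolding S_def cinner_add_left by (intro holomorphic_intros)
qed

context
  fixes z assumes z: "z \<in> upper_half_plane"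
begin

lemma F_mem: "\<psi> \<in> defect_subspace A \<i> \<Longrightarrow> F z \<psi> \<in> defect_subspace A (- \<i>)"
  using F z by (auto simp: contractive_class_def PiE_iff)

lemma F_add: "\<psi> \<in> defect_subspace A \<i> \<Longrightarrow> \<phi> \<in> defect_subspace A \<i> \<Longrightarrow> F z (\<psi> + \<phi>) = F z \<psi> + F z \<phi>"
  using F z by (simp add: contractive_class_def)

lemma F_scale: "\<psi> \<in> defect_subspace A \<i> \<Longrightarrow> F z (c *\<^sub>C \<psi>) = c *\<^sub>C F z \<psi>"
  using F z by (simp add: contractive_class_def)

lemma F_norm: "\<psi> \<in> defect_subspace A \<i> \<Longrightarrow> norm (F z \<psi>) \<le> norm \<psi>"
  using F z by (simp add: contractive_class_def)

lemma S_eq: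
  assumes fg: "(f, g) \<in> A" and \<psi>: "\<psi> \<in> defect_subspace A \<i>"
  shows "S z ((g - \<i> *\<^sub>C f) + \<psi>) = (g + \<i> *\<^sub>C f) + F z \<psi>"
proof -
  have "defect_proj ((g - \<i> *\<^sub>C f) + \<psi>) = \<psi>"
    using defect_proj_zero[OF cayley_domainI[OF fg]] defect_proj_id[OF \<psi>]
    by (simp add: clinear_op_add[OF clinear_defect_proj])
  then show ?thesis using cayley_eq[OF fg] by (simp add: S_def)
qed

lemma clinear_S: "clinear_op (S z)"
proof (rule clinear_opI)
  fix u v
  obtain f g where fg: "(f, g) \<in> A" and u: "u = (g - \<i> *\<^sub>C f) + defect_proj u"
    using decompose[of u] by blast
  obtain f' g' where fg': "(f', g') \<in> A" and v: "v = (g' - \<i> *\<^sub>C f') + defect_proj v"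
    using decompose[of v] by blast
  have "u + v = ((g - \<i> *\<^sub>C f) + defect_proj u) + ((g' - \<i> *\<^sub>C f') + defect_proj v)"
    by (rule arg_cong2[where f = plus, OF u v])
  also have "\<dots> = ((g + g') - \<i> *\<^sub>C (f + f')) + (defect_proj u + defect_proj v)"
    by (simp add: scaleC_add_right)
  finally have "S z (u + v) = S z (((g + g') - \<i> *\<^sub>C (f + f')) + (defect_proj u + defect_proj v))" by (rule arg_cong)
  also have "\<dots> = ((g + g') + \<i> *\<^sub>C (f + f')) + (F z (defect_proj u) + F z (defect_proj v))"
    by (subst S_eq[OF add_mem[OF fg fg']]) (simp_all add: defect_subspace_add defect_proj_mem F_add)
  also have "\<dots> = S z ((g - \<i> *\<^sub>C f) + defect_proj u) + S z ((g' - \<i> *\<^sub>C f') + defect_proj v)"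
    by (simp add: S_eq[OF fg defect_proj_mem] S_eq[OF fg' defect_proj_mem] scaleC_add_right)
  also have "\<dots> = S z u + S z v" by (rule arg_cong2[where f = "\<lambda>a b. S z a + S z b", OF u[symmetric] v[symmetric]])
  finally show "S z (u + v) = S z u + S z v" .
next
  fix c u
  obtain f g where fg: "(f, g) \<in> A" and u: "u = (g - \<i> *\<^sub>C f) + defect_proj u"
    using decompose[of u] by blast
  have "c *\<^sub>C u = c *\<^sub>C ((g - \<i> *\<^sub>C f) + defect_proj u)" by (rule arg_cong[OF u])
  also have "\<dots> = (c *\<^sub>C g - \<i> *\<^sub>C (c *\<^sub>C f)) + c *\<^sub>C defect_proj u"
    by (simp add: scaleC_add_right scaleC_diff_right scaleC_scaleC mult.commute)
  finally have "S z (c *\<^sub>C u) = S z ((c *\<^sub>C g - \<i> *\<^sub>C (c *\<^sub>C f)) + c *\<^sub>C defect_proj u)" by (rule arg_cong)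
  also have "\<dots> = (c *\<^sub>C g + \<i> *\<^sub>C (c *\<^sub>C f)) + c *\<^sub>C F z (defect_proj u)"
    by (subst S_eq[OF scale_mem[OF fg]]) (simp_all add: defect_subspace_scale defect_proj_mem F_scale)
  also have "\<dots> = c *\<^sub>C S z ((g - \<i> *\<^sub>C f) + defect_proj u)"
    by (simp add: S_eq[OF fg defect_proj_mem] scaleC_add_right scaleC_scaleC mult.commute)
  also have "\<dots> = c *\<^sub>C S z u" by (rule arg_cong[where f = "\<lambda>a. c *\<^sub>C S z a", OF u[symmetric]])
  finally show "S z (c *\<^sub>C u) = c *\<^sub>C S z u" .
qed

lemma norm_S_le: "norm (S z u) \<le> norm u"
proof (rule power2_le_imp_le)
  obtain f g where fg: "(f, g) \<in> A" and u: "u = (g - \<i> *\<^sub>C f) + defect_proj u"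
    using decompose[of u] by blast
  have "(norm (S z u))\<^sup>2 = (norm (S z ((g - \<i> *\<^sub>C f) + defect_proj u)))\<^sup>2"
    by (rule arg_cong[where f = "\<lambda>a. (norm (S z a))\<^sup>2", OF u])
  also have "\<dots> = (norm (g + \<i> *\<^sub>C f))\<^sup>2 + (norm (F z (defect_proj u)))\<^sup>2"
    unfolding S_eq[OF fg defect_proj_mem] by (rule norm_decompose'[OF fg F_mem[OF defect_proj_mem]])
  also have "\<dots> \<le> (norm (g + \<i> *\<^sub>C f))\<^sup>2 + (norm (defect_proj u))\<^sup>2"
    by (intro add_left_mono power_mono F_norm defect_proj_mem) simp
  also have "\<dots> = (norm ((g - \<i> *\<^sub>C f) + defect_proj u))\<^sup>2"
    by (rule norm_decompose[OF fg defect_proj_mem, symmetric])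
  also have "\<dots> = (norm u)\<^sup>2" by (rule arg_cong[where f = "\<lambda>a. (norm a)\<^sup>2", OF u[symmetric]])
  finally show "(norm (S z u))\<^sup>2 \<le> (norm u)\<^sup>2" .
qed simp

lemma clinear_X: "clinear_op (X z)"
  by (rule clinear_opI)
     (simp_all only: X_def clinear_op_add[OF clinear_S] clinear_op_scale[OF clinear_S] scaleC_add_right
       scaleC_diff_right scaleC_scaleC mult_ac, simp_all)

lemma norm_X_ge: "(cmod (z + \<i>) - cmod (z - \<i>)) / 2 * norm u \<le> norm (X z u)"
proof -
  have "norm ((z + \<i>) *\<^sub>C u) - norm ((z - \<i>) *\<^sub>C S z u) \<le> norm ((z + \<i>) *\<^sub>C u - (z - \<i>) *\<^sub>C S z u)"
    by (rule norm_triangle_ineq2)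
  moreover have "cmod (z - \<i>) * norm (S z u) \<le> cmod (z - \<i>) * norm u"
    by (intro mult_left_mono norm_S_le) simp
  ultimately show ?thesis by (simp add: X_def norm_scaleC norm_divide left_diff_distrib)
qed

lemma bij_X: "bij (X z)"
proof (rule injective_imp_bij[OF clinear_X])
  fix u assume "X z u = 0"
  then have "(cmod (z + \<i>) - cmod (z - \<i>)) / 2 * norm u \<le> 0" using norm_X_ge[of u] by simp
  then show "u = 0" using uhp_norm_less[OF z] by (simp add: mult_le_0_iff)
qed

lemma X_X_inv: "X z (X_inv z u) = u" and X_inv_X: "X_inv z (X z u) = u"
  unfolding X_inv_def using bij_X by (auto simp: bij_def surj_f_inv_f inv_f_f)

lemma clinear_X_inv: "clinear_op (X_inv z)"
  unfolding X_inv_def by (rule clinear_op_inv[OF clinear_X bij_X])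

lemma X_res:
  shows V_res: "u + (z - \<i>) *\<^sub>C res z u = X_inv z u" and W_res: "u + (z + \<i>) *\<^sub>C res z u = S z (X_inv z u)"
proof -
  define w where "w = X_inv z u"
  have u: "u = (1 / (2 * \<i>)) *\<^sub>C ((z + \<i>) *\<^sub>C w - (z - \<i>) *\<^sub>C S z w)"
    using X_X_inv[of u] by (simp add: w_def X_def)
  have r: "res z u = (1 / (2 * \<i>)) *\<^sub>C (S z w - w)" by (simp add: res_def w_def)
  have "u + (z - \<i>) *\<^sub>C res z u = (1 / (2 * \<i>)) *\<^sub>C ((z + \<i>) *\<^sub>C w - (z - \<i>) *\<^sub>C S z w)
      + (z - \<i>) *\<^sub>C ((1 / (2 * \<i>)) *\<^sub>C (S z w - w))"
    by (rule arg_cong2[where f = "\<lambda>a b. a + (z - \<i>) *\<^sub>C b", OF u r])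
  also have "\<dots> = (1 / (2 * \<i>)) *\<^sub>C (((z + \<i>) *\<^sub>C w - (z - \<i>) *\<^sub>C S z w) + (z - \<i>) *\<^sub>C (S z w - w))"
    by (simp only: scaleC_add_right scaleC_scaleC mult.commute)
  also have "\<dots> = (1 / (2 * \<i>)) *\<^sub>C ((z + \<i>) *\<^sub>C w - (z - \<i>) *\<^sub>C w)"
    by (simp add: scaleC_diff_right)
  also have "\<dots> = w" unfolding scaleC_diff_left[symmetric] by (simp add: scaleC_scaleC)
  finally show "u + (z - \<i>) *\<^sub>C res z u = X_inv z u" by (simp add: w_def)
  have "u + (z + \<i>) *\<^sub>C res z u = (1 / (2 * \<i>)) *\<^sub>C ((z + \<i>) *\<^sub>C w - (z - \<i>) *\<^sub>C S z w)
      + (z + \<i>) *\<^sub>C ((1 / (2 * \<i>)) *\<^sub>C (S z w - w))"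
    by (rule arg_cong2[where f = "\<lambda>a b. a + (z + \<i>) *\<^sub>C b", OF u r])
  also have "\<dots> = (1 / (2 * \<i>)) *\<^sub>C (((z + \<i>) *\<^sub>C w - (z - \<i>) *\<^sub>C S z w) + (z + \<i>) *\<^sub>C (S z w - w))"
    by (simp only: scaleC_add_right scaleC_scaleC mult.commute)
  also have "\<dots> = (1 / (2 * \<i>)) *\<^sub>C ((z + \<i>) *\<^sub>C S z w - (z - \<i>) *\<^sub>C S z w)"
    by (simp add: scaleC_diff_right)
  also have "\<dots> = S z w" unfolding scaleC_diff_left[symmetric] by (simp add: scaleC_scaleC)
  finally show "u + (z + \<i>) *\<^sub>C res z u = S z (X_inv z u)" by (simp add: w_def)
qed

end

lemma weakly_holomorphic_X: "weakly_holomorphic X"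
  unfolding X_def[abs_def]
  by (intro weakly_holomorphic_diff weakly_holomorphic_scale weakly_holomorphic_const weakly_holomorphic_S
      holomorphic_intros)

lemma weakly_holomorphic_X_inv: "weakly_holomorphic X_inv"
proof (rule weakly_holomorphic_inverse[OF weakly_holomorphic_X])
  fix z assume z: "z \<in> upper_half_plane"
  define \<delta> where "\<delta> = cmod (z + \<i>) - cmod (z - \<i>)"
  have \<delta>: "0 < \<delta>" using uhp_norm_less[OF z] by (simp add: \<delta>_def)
  show "\<exists>B. \<forall>\<^sub>F w in at z. \<forall>u. norm (X_inv w u) \<le> B * norm u"
  proof (intro exI)
    have "((\<lambda>w. cmod (w + \<i>) - cmod (w - \<i>)) \<longlongrightarrow> \<delta>) (at z)" unfolding \<delta>_def by (intro tendsto_intros)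
    then have 1: "\<forall>\<^sub>F w in at z. \<delta> / 2 < cmod (w + \<i>) - cmod (w - \<i>)"
      by (rule order_tendstoD) (use \<delta> in simp)
    have 2: "\<forall>\<^sub>F w in at z. w \<in> upper_half_plane"
      using z open_upper_half_plane by (metis eventually_at_topological)
    show "\<forall>\<^sub>F w in at z. \<forall>u. norm (X_inv w u) \<le> 4 / \<delta> * norm u"
      using 1 2
    proof eventually_elim
      case (elim w)
      show ?case
      proof
        fix u
        have "\<delta> / 2 / 2 * norm (X_inv w u) \<le> (cmod (w + \<i>) - cmod (w - \<i>)) / 2 * norm (X_inv w u)"
          using elim(1) by (intro mult_right_mono divide_right_mono) auto
        also have "\<dots> \<le> norm (X w (X_inv w u))" by (rule norm_X_ge[OF elim(2)])
        also have "X w (X_inv w u) = u" by (rule X_X_inv[OF elim(2)])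
        finally show "norm (X_inv w u) \<le> 4 / \<delta> * norm u" using \<delta> by (simp add: field_simps)
      qed
    qed
  qed
qed (auto intro: clinear_X clinear_X_inv simp: X_X_inv X_inv_X)

lemma weakly_holomorphic_res: "weakly_holomorphic res"
  unfolding res_def[abs_def]
  by (intro weakly_holomorphic_scale weakly_holomorphic_diff holomorphic_intros weakly_holomorphic_X_inv
      weakly_holomorphic_compose[OF weakly_holomorphic_S clinear_S weakly_holomorphic_X_inv])

text \<open>\<open>cayley_norm_identity\<close> read backwards: contractivity of \<open>S\<close> is
  dissipativity of \<open>res\<close>.\<close>

sublocale gr: generalized_resolvent e n A res
proof
  fix z assume z: "z \<in> upper_half_plane"
  show "clinear_op (res z)"
    by (rule clinear_opI)
       (simp_all only: res_def clinear_op_add[OF clinear_X_inv[OF z]] clinear_op_add[OF clinear_S[OF z]]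
         clinear_op_scale[OF clinear_X_inv[OF z]] clinear_op_scale[OF clinear_S[OF z]] scaleC_add_right
         scaleC_diff_right scaleC_scaleC mult_ac, simp_all)
  fix u
  have "0 \<le> (norm (u + (z - \<i>) *\<^sub>C res z u))\<^sup>2 - (norm (u + (z + \<i>) *\<^sub>C res z u))\<^sup>2"
    unfolding V_res[OF z] W_res[OF z] using norm_S_le[OF z, of "X_inv z u"] by (simp add: power_mono)
  then show "Im z * (norm (res z u))\<^sup>2 \<le> Im (cinner (res z u) u)"
    unfolding cayley_norm_identity by simp
next
  fix z f g assume z: "z \<in> upper_half_plane" and fg: "(f, g) \<in> A"
  have S: "S z (g - \<i> *\<^sub>C f) = g + \<i> *\<^sub>C f"
    using S_eq[OF z fg defect_subspace_zero] F_scale[OF z defect_subspace_zero, of 0] by simp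
  have "X z (g - \<i> *\<^sub>C f) = (1 / (2 * \<i>)) *\<^sub>C ((2 * \<i>) *\<^sub>C (g - z *\<^sub>C f))"
    unfolding X_def S
  proof (rule arg_cong[where f = "scaleC (1 / (2 * \<i>))"])
    have "(z + \<i>) *\<^sub>C (g - \<i> *\<^sub>C f) - (z - \<i>) *\<^sub>C (g + \<i> *\<^sub>C f)
        = ((z + \<i>) - (z - \<i>)) *\<^sub>C g - ((z + \<i>) * \<i> + (z - \<i>) * \<i>) *\<^sub>C f"
      by (simp only: scaleC_diff_right scaleC_add_right scaleC_scaleC scaleC_diff_left scaleC_add_left) simp
    also have "(z + \<i>) - (z - \<i>) = 2 * \<i>" by simp
    also have "(z + \<i>) * \<i> + (z - \<i>) * \<i> = (2 * \<i>) * z" by (simp add: algebra_simps)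
    finally show "(z + \<i>) *\<^sub>C (g - \<i> *\<^sub>C f) - (z - \<i>) *\<^sub>C (g + \<i> *\<^sub>C f) = (2 * \<i>) *\<^sub>C (g - z *\<^sub>C f)"
      by (simp only: scaleC_diff_right scaleC_scaleC)
  qed
  also have "\<dots> = g - z *\<^sub>C f" by (simp add: scaleC_scaleC)
  finally have "X_inv z (g - z *\<^sub>C f) = g - \<i> *\<^sub>C f" using X_inv_X[OF z] by metis
  then have "res z (g - z *\<^sub>C f) = (1 / (2 * \<i>)) *\<^sub>C ((2 * \<i>) *\<^sub>C f)"
    unfolding res_def by (simp only: S scaleC_two_i) simp
  then show "res z (g - z *\<^sub>C f) = f" by (simp add: scaleC_scaleC)
qed (rule weakly_holomorphic_res)

lemma U_eq_S: "z \<in> upper_half_plane \<Longrightarrow> gr.U z u = S z u"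
  using W_res[of z "gr.Y z u"] V_res[of z "gr.Y z u"] gr.V_Y[of z u]
  by (simp add: gr.U_def gr.W_def gr.V_def)

text \<open>Every element of the contractive class is thus the parameter of a generalized resolvent.
  Off the upper half plane and off N_i both sides are undefined in the same way, by
  extensionality.\<close>

lemma param_res: "gr.param = F"
proof (rule ext)
  fix z
  show "gr.param z = F z"
  proof (cases "z \<in> upper_half_plane")
    case True
    show ?thesis
    proof (rule ext)
      fix \<psi>
      show "gr.param z \<psi> = F z \<psi>"
      proof (cases "\<psi> \<in> defect_subspace A \<i>")
        case \<psi>: True
        have "S z \<psi> = F z \<psi>" using S_eq[OF True zero_mem \<psi>] by simp
        then show ?thesis using True \<psi> by (simp add: gr.param_eq U_eq_S)
      next
        case False
        have Fz: "F z \<in> defect_subspace A \<i> \<rightarrow>\<^sub>E defect_subspace A (- \<i>)"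
          using F True by (auto simp: contractive_class_def PiE_iff)
        show ?thesis using True False by (simp add: gr.param_def PiE_arb[OF Fz False])
      qed
    qed
  next
    case False
    then show ?thesis using F by (simp add: gr.param_def contractive_class_def PiE_iff extensional_def)
  qed
qed

end

subsection \<open>Spectral measures\<close>

lemma sum_four: "(\<Sum>\<sigma><4. f \<sigma>) = f 0 + f 1 + f 2 + f (3::nat)"
  by (simp add: numeral_eq_Suc)

lemma i_power: "\<i> ^ 0 = 1" "\<i> ^ 1 = \<i>" "\<i> ^ 2 = - 1" "\<i> ^ 3 = - \<i>"
  by (simp_all add: power3_eq_cube)

lemma sum_triple: "(\<Sum>p\<in>A \<times> B \<times> C. f p) = (\<Sum>i\<in>A. \<Sum>j\<in>B. \<Sum>k\<in>C. f (i, j, k))"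
  by (simp add: sum.cartesian_product')

text \<open>The factor 1/2 sits inside the vectors so that the four terms of the polarization
  identity carry exactly the weights \<open>\<i> ^ \<sigma>\<close>, which are also the weights of
  the four parts of a complex measure.\<close>

definition polar_vec :: "'h::complex_inner_space \<Rightarrow> 'h \<Rightarrow> nat \<Rightarrow> 'h" where
  "polar_vec u v \<sigma> = (1 / 2) *\<^sub>C (u + (\<i> ^ \<sigma>) *\<^sub>C v)"

text \<open>Two operators are allowed so that both <R u, v> and <u, R v> are covered.\<close>

lemma polarization:
  assumes T: "clinear_op T" and T': "clinear_op T'"
  shows "(\<Sum>\<sigma><4. \<i> ^ \<sigma> * cinner (T (polar_vec u v \<sigma>)) (T' (polar_vec u v \<sigma>))) = cinner (T u) (T' v)"
proof -
  have "cinner (T (polar_vec u v \<sigma>)) (T' (polar_vec u v \<sigma>)) =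
    (1 / 4) * (cinner (T u) (T' u) + cnj (\<i> ^ \<sigma>) * cinner (T u) (T' v) + \<i> ^ \<sigma> * cinner (T v) (T' u)
      + \<i> ^ \<sigma> * cnj (\<i> ^ \<sigma>) * cinner (T v) (T' v))" for \<sigma>
    by (simp add: polar_vec_def clinear_op_add[OF T] clinear_op_add[OF T'] clinear_op_scale[OF T]
        clinear_op_scale[OF T'] cinner_simps algebra_simps)
  then show ?thesis unfolding sum_four by (simp add: i_power[unfolded One_nat_def] algebra_simps)
qed

lemma polarization_id: "(\<Sum>\<sigma><4. \<i> ^ \<sigma> * cinner (polar_vec u v \<sigma>) (polar_vec u v \<sigma>)) = cinner u v"
  using polarization[of "\<lambda>x. x" "\<lambda>x. x" u v] by (simp add: clinear_op_def)

lemma hermitian_of_real_form: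
  assumes T: "clinear_op T" and re: "\<And>u. Im (cinner (T u) u) = 0"
  shows "cinner (T u) v = cinner u (T v)"
proof -
  have id: "clinear_op (\<lambda>x. x)" by (simp add: clinear_op_def)
  have "cinner (T w) w = cinner w (T w)" for w
    using re[of w] by (subst (2) cinner_commute) (simp add: complex_eq_iff)
  then show ?thesis using polarization[OF T id, of u v] polarization[OF id T, of u v] by simp
qed

definition herglotz_measure :: "(complex \<Rightarrow> complex) \<Rightarrow> real measure" where
  "herglotz_measure q = (SOME \<mu>. finite_borel_measure \<mu> \<and>
    (\<forall>z\<in>upper_half_plane. q z = (\<integral>t. 1 / (complex_of_real t - z) \<partial>\<mu>)))"

lemma cnj_resolvent_integral:
  "(\<integral>t. 1 / (complex_of_real t - cnj z) \<partial>M) = cnj (\<integral>t. 1 / (complex_of_real t - z) \<partial>M)"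
  by (subst Bochner_Integration.integral_cnj[symmetric]) simp

context generalized_resolvent
begin

definition \<mu> :: "'h \<Rightarrow> real measure" where "\<mu> u = herglotz_measure (\<lambda>z. cinner (R z u) u)"

lemma finite_borel_\<mu>: "finite_borel_measure (\<mu> u)"
  and R_\<mu>: "z \<in> upper_half_plane \<Longrightarrow> cinner (R z u) u = (\<integral>t. 1 / (complex_of_real t - z) \<partial>\<mu> u)"
proof -
  have "\<exists>\<mu>. finite_borel_measure \<mu> \<and>
    (\<forall>z\<in>upper_half_plane. cinner (R z u) u = (\<integral>t. 1 / (complex_of_real t - z) \<partial>\<mu>))"
  proof (rule herglotz_resolvent_measure)
    show "(\<lambda>z. cinner (R z u) u) holomorphic_on upper_half_plane" by (rule weakly_holomorphicD[OF holomorphic])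
  next
    fix z assume z: "z \<in> upper_half_plane"
    show "0 \<le> Im (cinner (R z u) u)"
      using dissipative[OF z, of u] uhp_ne(2)[OF z] by (meson mult_nonneg_nonneg order_trans less_imp_le zero_le_power2)
    have "cmod (cinner (R z u) u) \<le> norm (R z u) * norm u" by (rule cinner_cauchy_schwarz)
    also have "\<dots> \<le> norm u / Im z * norm u" by (intro mult_right_mono R_bound z) simp
    finally show "cmod (cinner (R z u) u) \<le> (norm u)\<^sup>2 / Im z" by (simp add: power2_eq_square)
  qed
  then have "finite_borel_measure (\<mu> u) \<and>
    (\<forall>z\<in>upper_half_plane. cinner (R z u) u = (\<integral>t. 1 / (complex_of_real t - z) \<partial>\<mu> u))"
    unfolding \<mu>_def herglotz_measure_def by (rule someI_ex)
  then show "finite_borel_measure (\<mu> u)"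
    "z \<in> upper_half_plane \<Longrightarrow> cinner (R z u) u = (\<integral>t. 1 / (complex_of_real t - z) \<partial>\<mu> u)" by auto
qed

text \<open>Stands for the integral of h against the complex measure <dE u, v>. The measures
  \<open>\<mu>\<close> are chosen vector by vector, so linearity in u and v is not visible from the
  definition.\<close>

definition pol :: "'h \<Rightarrow> 'h \<Rightarrow> (real \<Rightarrow> complex) \<Rightarrow> complex" where
  "pol u v h = (\<Sum>\<sigma><4. \<i> ^ \<sigma> * (\<integral>t. h t \<partial>\<mu> (polar_vec u v \<sigma>)))"

lemma pol_resolvent: "z \<in> upper_half_plane \<Longrightarrow> pol u v (\<lambda>t. 1 / (complex_of_real t - z)) = cinner (R z u) v"
  unfolding pol_def R_\<mu>[symmetric] using polarization[OF lin, of z "\<lambda>x. x" u v]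
  by (simp add: clinear_op_def)

lemma pol_resolvent_cnj: "z \<in> upper_half_plane \<Longrightarrow> pol u v (\<lambda>t. 1 / (complex_of_real t - cnj z)) = cinner u (R z v)"
  unfolding pol_def cnj_resolvent_integral R_\<mu>[symmetric] cinner_commute[symmetric]
  using polarization[OF _ lin, of "\<lambda>x. x" z u v] by (simp add: clinear_op_def)

text \<open>The transforms of both sides agree because R_z is linear, and inversion carries the
  identity over to interval masses. This makes the separately chosen measures the diagonal of one
  sesquilinear operator measure.\<close>

lemma interval_form:
  assumes ab: "a \<le> b"
  shows "(\<Sum>i<K. \<Sum>j<K. c i * cnj (c j) * (\<Sum>\<sigma><4. \<i> ^ \<sigma> * measure (\<mu> (polar_vec (u i) (u j) \<sigma>)) {a..<b}))
    = measure (\<mu> (\<Sum>i<(K::nat). c i *\<^sub>C u i)) {a..<b}"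
proof -
  \<comment> \<open>\<open>None\<close> carries the measure of the combined vector with coefficient
    -1, so that the claim is the vanishing of a single combination.\<close>
  define I where "I = insert None (Some ` ({..<K} \<times> {..<K} \<times> {..<4::nat}))"
  define M where "M p = (case p of None \<Rightarrow> \<mu> (\<Sum>i<K. c i *\<^sub>C u i) | Some (i, j, \<sigma>) \<Rightarrow> \<mu> (polar_vec (u i) (u j) \<sigma>))" for p
  define \<alpha> where "\<alpha> p = (case p of None \<Rightarrow> - 1 | Some (i, j, \<sigma>) \<Rightarrow> c i * cnj (c j) * \<i> ^ \<sigma>)" for p
  have sum_I: "(\<Sum>p\<in>I. \<alpha> p * F (M p)) = (\<Sum>i<K. \<Sum>j<K. c i * cnj (c j) * (\<Sum>\<sigma><4. \<i> ^ \<sigma> * F (\<mu> (polar_vec (u i) (u j) \<sigma>))))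
      - F (\<mu> (\<Sum>i<K. c i *\<^sub>C u i))" for F :: "real measure \<Rightarrow> complex"
  proof -
    have "(\<Sum>p\<in>I. \<alpha> p * F (M p)) = - F (\<mu> (\<Sum>i<K. c i *\<^sub>C u i)) +
       (\<Sum>(i, j, \<sigma>)\<in>{..<K} \<times> {..<K} \<times> {..<4}. c i * cnj (c j) * \<i> ^ \<sigma> * F (\<mu> (polar_vec (u i) (u j) \<sigma>)))"
      unfolding I_def by (subst sum.insert) (auto simp: sum.reindex \<alpha>_def M_def split_def)
    also have "(\<Sum>(i, j, \<sigma>)\<in>{..<K} \<times> {..<K} \<times> {..<4}. c i * cnj (c j) * \<i> ^ \<sigma> * F (\<mu> (polar_vec (u i) (u j) \<sigma>)))
      = (\<Sum>i<K. \<Sum>j<K. c i * cnj (c j) * (\<Sum>\<sigma><4. \<i> ^ \<sigma> * F (\<mu> (polar_vec (u i) (u j) \<sigma>))))"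
      by (simp add: sum_triple sum_distrib_left mult.assoc)
    finally show ?thesis by simp
  qed
  have form: "(\<Sum>i<K. \<Sum>j<K. c i * cnj (c j) * cinner (T (u i)) (T' (u j))) = cinner (T (\<Sum>i<K. c i *\<^sub>C u i)) (T' (\<Sum>i<K. c i *\<^sub>C u i))"
    if "clinear_op T" "clinear_op T'" for T T'
    using that by (simp add: clinear_op_sum clinear_op_scale cinner_sum_left cinner_sum_right cinner_simps sum_distrib_left mult_ac)
      (rule sum.swap)
  have id: "clinear_op (\<lambda>x::'h. x)" by (simp add: clinear_op_def)
  have "(\<Sum>p\<in>I. \<alpha> p * complex_of_real (measure (M p) {a..<b})) = 0"
  proof (rule resolvent_kernel_combination_inversion[OF _ _ _ ab])
    show "finite I" by (simp add: I_def)
    show "finite_borel_measure (M p)" for p by (auto simp: M_def finite_borel_\<mu> split: option.split)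
    fix z :: complex assume nr: "Im z \<noteq> 0"
    show "(\<Sum>p\<in>I. \<alpha> p * (\<integral>t. 1 / (complex_of_real t - z) \<partial>M p)) = 0"
    proof (cases "0 < Im z")
      case True
      then have z: "z \<in> upper_half_plane" by (simp add: upper_half_plane_def)
      show ?thesis
        unfolding sum_I[of "\<lambda>m. \<integral>t. 1 / (complex_of_real t - z) \<partial>m"] 
        unfolding pol_resolvent[OF z, unfolded pol_def] unfolding R_\<mu>[OF z, symmetric]
        using form[OF lin[OF z] id] by simp
    next
      case False
      \<comment> \<open>Inversion needs the lower half plane too; there the transform is the
        conjugate of that at conj z, which moves R to the second argument.\<close>
      define z' where "z' = cnj z"
      have z': "z' \<in> upper_half_plane" using False nr by (simp add: upper_half_plane_def z'_def)
      have zz: "z = cnj z'" by (simp add: z'_def)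
      show ?thesis
        unfolding sum_I[of "\<lambda>m. \<integral>t. 1 / (complex_of_real t - z) \<partial>m"] 
        unfolding zz unfolding pol_resolvent_cnj[OF z', unfolded pol_def]
        unfolding cnj_resolvent_integral R_\<mu>[OF z', symmetric] cinner_commute[symmetric]
        using form[OF id lin[OF z']] by simp
    qed
  qed
  then show ?thesis unfolding sum_I[of "\<lambda>m. complex_of_real (measure m {a..<b})"] by simp
qed

text \<open>Positivity of $\int \langle dE(t)\,p(t), p(t)\rangle$ for $p = \sum_i g_i u_i$, where \<open>E\<close> is the
  operator measure whose quadratic form at \<open>u\<close> is \<open>\<mu> u\<close>.\<close>

lemma kernel_nonneg:
  fixes g :: "nat \<Rightarrow> real \<Rightarrow> complex"
  assumes cont: "\<And>i. i < K \<Longrightarrow> continuous_on UNIV (g i)" and bound: "\<And>i t. i < K \<Longrightarrow> cmod (g i t) \<le> C"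
  shows "0 \<le> Re (\<Sum>i<K. \<Sum>j<K. pol (u i) (u j) (\<lambda>t. g i t * cnj (g j t)))"
proof -
  define I where "I = {..<K} \<times> {..<K} \<times> {..<4::nat}"
  define M where "M = (\<lambda>(i, j, \<sigma>). \<mu> (polar_vec (u i) (u j) \<sigma>))"
  define h where "h = (\<lambda>(i, j, \<sigma>::nat) t. \<i> ^ \<sigma> * (g i t * cnj (g j t)))"
  have "0 \<le> Re (\<Sum>p\<in>I. \<integral>t. h p t \<partial>M p)"
  proof (rule stieltjes_form_nonneg[where C = "C * C" and m = 0])
    show "finite I" by (simp add: I_def)
    show "finite_borel_measure (M p)" for p by (auto simp: M_def finite_borel_\<mu> split: prod.split)
    show "continuous_on UNIV (h p)" if "p \<in> I" for p
      using that by (auto simp: I_def h_def intro!: continuous_intros cont)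
    show "cmod (h p t) \<le> C * C * (1 + \<bar>t\<bar>) ^ 0" if "p \<in> I" for p t
      using that by (auto simp: I_def h_def norm_mult norm_power intro!: mult_mono bound order_trans[OF norm_ge_zero bound])
    show "integrable (M p) (\<lambda>t. (1 + \<bar>t\<bar>) ^ 0)" for p
    proof -
      have "finite_borel_measure (M p)" by (auto simp: M_def finite_borel_\<mu> split: prod.split)
      then interpret finite_borel_measure "M p" .
      show ?thesis by simp
    qed
    fix t and a b :: real assume ab: "a \<le> b"
    \<comment> \<open>With the coefficients frozen at t this becomes the interval mass of one
      vector, the sum of the g_i(t) u_i.\<close>
    have "(\<Sum>p\<in>I. h p t * complex_of_real (measure (M p) {a..<b})) =
      (\<Sum>i<K. \<Sum>j<K. g i t * cnj (g j t) * (\<Sum>\<sigma><4. \<i> ^ \<sigma> * measure (\<mu> (polar_vec (u i) (u j) \<sigma>)) {a..<b}))"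
      unfolding I_def h_def M_def
      by (simp add: sum_triple sum_distrib_left mult_ac)
    also have "\<dots> = measure (\<mu> (\<Sum>i<K. g i t *\<^sub>C u i)) {a..<b}" by (rule interval_form[OF ab])
    finally show "0 \<le> Re (\<Sum>p\<in>I. h p t * complex_of_real (measure (M p) {a..<b}))" by simp
  qed
  also have "(\<Sum>p\<in>I. \<integral>t. h p t \<partial>M p) = (\<Sum>i<K. \<Sum>j<K. pol (u i) (u j) (\<lambda>t. g i t * cnj (g j t)))"
    unfolding I_def h_def M_def pol_def by (simp add: sum_triple)
  finally show ?thesis .
qed

text \<open>Partial fractions. The right side is the Nevanlinna kernel of \<open>R\<close>, so that
  \<open>kernel_nonneg\<close> turns into inequalities for R alone.\<close>

lemma pol_kernel:
  assumes z: "z \<in> upper_half_plane" and w: "w \<in> upper_half_plane"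
  shows "pol u v (\<lambda>t. 1 / (complex_of_real t - z) * cnj (1 / (complex_of_real t - w)))
    = (cinner (R z u) v - cinner u (R w v)) / (z - cnj w)"
proof -
  have zw: "z - cnj w \<noteq> 0" using uhp_ne(2)[OF z] uhp_ne(2)[OF w] by (auto simp: complex_eq_iff)
  have "(\<integral>t. 1 / (complex_of_real t - z) * cnj (1 / (complex_of_real t - w)) \<partial>\<mu> x) =
     ((\<integral>t. 1 / (complex_of_real t - z) \<partial>\<mu> x) - (\<integral>t. 1 / (complex_of_real t - cnj w) \<partial>\<mu> x)) / (z - cnj w)" for x
  proof -
    have "1 / (complex_of_real t - z) * cnj (1 / (complex_of_real t - w)) =
      (1 / (complex_of_real t - z) - 1 / (complex_of_real t - cnj w)) / (z - cnj w)" for t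
    proof -
      have "complex_of_real t - z \<noteq> 0" "complex_of_real t - cnj w \<noteq> 0"
        using uhp_ne(2)[OF z] uhp_ne(2)[OF w] by (auto simp: complex_eq_iff)
      then show ?thesis using zw by (simp add: divide_simps)
    qed
    then show ?thesis
      using integrable_resolvent_kernel[OF finite_borel_\<mu>[of x], of z] integrable_resolvent_kernel[OF finite_borel_\<mu>[of x], of "cnj w"]
        uhp_ne(2)[OF z] uhp_ne(2)[OF w] by simp
  qed
  note eq = this
  have "pol u v (\<lambda>t. 1 / (complex_of_real t - z) * cnj (1 / (complex_of_real t - w))) =
    (pol u v (\<lambda>t. 1 / (complex_of_real t - z)) - pol u v (\<lambda>t. 1 / (complex_of_real t - cnj w))) / (z - cnj w)"
    unfolding pol_def eq
    by (simp only: sum_subtractf[symmetric] sum_divide_distrib right_diff_distrib[symmetric] times_divide_eq_right)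
  then show ?thesis by (simp add: pol_resolvent[OF z] pol_resolvent_cnj[OF w])
qed

text \<open>The total mass of the operator measure, defined by its coordinates. That its form is
  \<open>pol\<close> for every second argument is \<open>cinner_E\<close>, which follows by
  identifying E as the limit of -z R_z.\<close>

definition E :: "'h \<Rightarrow> 'h" where "E u = (\<Sum>i<n. pol u (e i) (\<lambda>_. 1) *\<^sub>C e i)"

lemma E_e: "i < n \<Longrightarrow> cinner (E u) (e i) = pol u (e i) (\<lambda>_. 1)"
proof -
  assume "i < n"
  have "cinner (E u) (e i) = (\<Sum>k<n. if k = i then pol u (e i) (\<lambda>_. 1) else 0)"
    unfolding E_def cinner_sum_left using \<open>i < n\<close> orth by (intro sum.cong) (auto simp: cinner_scaleC_left)
  then show ?thesis using \<open>i < n\<close> by simp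
qed

lemma pol_one_limit:
  assumes \<epsilon>: "0 < \<epsilon>" "\<epsilon> \<le> pi / 2"
  shows "((\<lambda>z. - z * cinner (R z u) v) \<longlongrightarrow> pol u v (\<lambda>_. 1)) (sector_at_infinity \<epsilon>)"
proof -
  have "((\<lambda>z. \<Sum>\<sigma><4. \<i> ^ \<sigma> * (- z * (\<integral>t. 1 / (complex_of_real t - z) \<partial>\<mu> (polar_vec u v \<sigma>)))) \<longlongrightarrow> pol u v (\<lambda>_. 1)) (sector_at_infinity \<epsilon>)"
    unfolding pol_def
  proof (intro tendsto_intros resolvent_kernel_integral_limit finite_borel_\<mu> \<epsilon>)
    fix \<sigma>
    interpret finite_borel_measure "\<mu> (polar_vec u v \<sigma>)" by (rule finite_borel_\<mu>)
    show "integrable (\<mu> (polar_vec u v \<sigma>)) (\<lambda>t. 1 :: complex)" by simp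
  qed
  then show ?thesis
  proof (rule Lim_transform_eventually)
    show "\<forall>\<^sub>F z in sector_at_infinity \<epsilon>. (\<Sum>\<sigma><4. \<i> ^ \<sigma> * (- z * (\<integral>t. 1 / (complex_of_real t - z) \<partial>\<mu> (polar_vec u v \<sigma>)))) = - z * cinner (R z u) v"
      using eventually_sector_at_infinity
    proof eventually_elim
      case (elim z)
      then have z: "z \<in> upper_half_plane" by (simp add: upper_sector_def)
      show ?case unfolding pol_resolvent[OF z, symmetric] pol_def by (simp add: sum_distrib_left mult_ac)
    qed
  qed
qed

lemma E_limit:
  assumes \<epsilon>: "0 < \<epsilon>" "\<epsilon> \<le> pi / 2"
  shows "((\<lambda>z. (- z) *\<^sub>C R z u) \<longlongrightarrow> E u) (sector_at_infinity \<epsilon>)"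
proof (rule tendsto_onb)
  fix i assume "i < n"
  then show "((\<lambda>z. cinner ((- z) *\<^sub>C R z u) (e i)) \<longlongrightarrow> cinner (E u) (e i)) (sector_at_infinity \<epsilon>)"
    unfolding cinner_scaleC_left E_e[OF \<open>i < n\<close>] by (intro pol_one_limit[OF \<epsilon>])
qed

lemma half_pi: "0 < pi / 2" "pi / 2 \<le> pi / 2" by simp_all

lemma cinner_E: "cinner (E u) v = pol u v (\<lambda>_. 1)"
proof (rule tendsto_unique[OF sector_at_infinity_neq_bot[OF half_pi]])
  show "((\<lambda>z. - z * cinner (R z u) v) \<longlongrightarrow> cinner (E u) v) (sector_at_infinity (pi / 2))"
    using tendsto_cinner_left[OF E_limit[OF half_pi], of u v] by (simp add: cinner_scaleC_left)
qed (rule pol_one_limit[OF half_pi])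

lemma eventually_sector_uhp: "\<forall>\<^sub>F z in sector_at_infinity \<epsilon>. z \<in> upper_half_plane"
  using eventually_sector_at_infinity by (rule eventually_mono) (simp add: upper_sector_def)

lemma clinear_E: "clinear_op E"
proof (rule clinear_opI)
  note nb = sector_at_infinity_neq_bot[OF half_pi]
  show "E (u + v) = E u + E v" for u v
  proof (rule tendsto_unique[OF nb E_limit[OF half_pi]])
    have "((\<lambda>z. (- z) *\<^sub>C R z u + (- z) *\<^sub>C R z v) \<longlongrightarrow> E u + E v) (sector_at_infinity (pi / 2))"
      by (intro tendsto_add E_limit half_pi)
    then show "((\<lambda>z. (- z) *\<^sub>C R z (u + v)) \<longlongrightarrow> E u + E v) (sector_at_infinity (pi / 2))"
      by (rule Lim_transform_eventually)
         (use eventually_sector_uhp in \<open>eventually_elim, simp add: clinear_op_add[OF lin] scaleC_add_right\<close>)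
  qed
  show "E (c *\<^sub>C u) = c *\<^sub>C E u" for c u
  proof (rule cinner_eqI)
    fix v
    have "((\<lambda>z. c * (- z * cinner (R z u) v)) \<longlongrightarrow> c * pol u v (\<lambda>_. 1)) (sector_at_infinity (pi / 2))"
      by (intro tendsto_intros pol_one_limit half_pi)
    then have "((\<lambda>z. - z * cinner (R z (c *\<^sub>C u)) v) \<longlongrightarrow> c * pol u v (\<lambda>_. 1)) (sector_at_infinity (pi / 2))"
      by (rule Lim_transform_eventually)
         (use eventually_sector_uhp in \<open>eventually_elim, simp add: clinear_op_scale[OF lin] cinner_scaleC_left\<close>)
    from tendsto_unique[OF nb pol_one_limit[OF half_pi] this]
    show "cinner (E (c *\<^sub>C u)) v = cinner (c *\<^sub>C E u) v" by (simp add: cinner_E cinner_scaleC_left)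
  qed
qed

lemma imaginary_axis_limit:
  assumes "(f \<longlongrightarrow> l) (sector_at_infinity (pi / 2))"
  shows "((\<lambda>y. f (\<i> * complex_of_real y)) \<longlongrightarrow> l) at_top"
  by (rule filterlim_compose[OF assms imaginary_axis_sector[OF half_pi]])

lemma iy_uhp: "0 < y \<Longrightarrow> \<i> * complex_of_real y \<in> upper_half_plane"
  by (simp add: upper_half_plane_def)

lemma E_real: "Im (cinner (E u) u) = 0"
  and E_mass: "cinner (E u) u = complex_of_real (measure (\<mu> u) UNIV)"
proof -
  interpret finite_borel_measure "\<mu> u" by (rule finite_borel_\<mu>)
  have "((\<lambda>z. - z * (\<integral>t. 1 / (complex_of_real t - z) \<partial>\<mu> u)) \<longlongrightarrow> (\<integral>t. 1 \<partial>\<mu> u)) (sector_at_infinity (pi / 2))"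
    by (rule resolvent_kernel_integral_limit[OF finite_borel_\<mu> _ half_pi]) simp
  then have "((\<lambda>z. - z * cinner (R z u) u) \<longlongrightarrow> (\<integral>t. 1 \<partial>\<mu> u)) (sector_at_infinity (pi / 2))"
    by (rule Lim_transform_eventually)
       (use eventually_sector_uhp in \<open>eventually_elim, simp add: R_\<mu>\<close>)
  from tendsto_unique[OF sector_at_infinity_neq_bot[OF half_pi] pol_one_limit[OF half_pi] this]
  show "cinner (E u) u = complex_of_real (measure (\<mu> u) UNIV)" by (simp add: cinner_E borel_UNIV scaleR_conv_of_real)
  then show "Im (cinner (E u) u) = 0" by simp
qed

lemma E_hermitian: "cinner (E u) v = cinner u (E v)"
  by (rule hermitian_of_real_form[OF clinear_E E_real])

lemma E_le: "Re (cinner (E u) u) \<le> (norm u)\<^sup>2"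
proof (rule tendsto_upperbound)
  show "((\<lambda>y. Re (- (\<i> * complex_of_real y) * cinner (R (\<i> * complex_of_real y) u) u)) \<longlongrightarrow> Re (cinner (E u) u)) at_top"
    using imaginary_axis_limit[OF pol_one_limit[OF half_pi]] by (intro tendsto_Re) (simp add: cinner_E)
  show "\<forall>\<^sub>F y in at_top. Re (- (\<i> * complex_of_real y) * cinner (R (\<i> * complex_of_real y) u) u) \<le> (norm u)\<^sup>2"
  proof (rule eventually_mono[OF eventually_gt_at_top[of 0]])
    fix y :: real assume y: "0 < y"
    let ?z = "\<i> * complex_of_real y"
    have "Re (- ?z * cinner (R ?z u) u) \<le> cmod (- ?z * cinner (R ?z u) u)" by (rule complex_Re_le_cmod)
    also have "\<dots> = y * cmod (cinner (R ?z u) u)" using y by (simp add: norm_mult)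
    also have "\<dots> \<le> y * (norm (R ?z u) * norm u)" using y by (intro mult_left_mono cinner_cauchy_schwarz) simp
    also have "\<dots> \<le> y * (norm u / y * norm u)"
      using R_bound[OF iy_uhp[OF y], of u] y by (intro mult_left_mono mult_right_mono) auto
    also have "\<dots> = (norm u)\<^sup>2" using y by (simp add: power2_eq_square)
    finally show "Re (- ?z * cinner (R ?z u) u) \<le> (norm u)\<^sup>2" .
  qed
qed simp

text \<open>The quantity $\int d\mu_v(t)/|t-z|^2$.\<close>

definition D :: "complex \<Rightarrow> 'h \<Rightarrow> real" where "D z v = Im (cinner (R z v) v) / Im z"

lemma pol_D: "z \<in> upper_half_plane \<Longrightarrow> Re (pol v v (\<lambda>t. 1 / (complex_of_real t - z) * cnj (1 / (complex_of_real t - z)))) = D z v"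
proof -
  assume z: "z \<in> upper_half_plane"
  have "cinner (R z v) v - cinner v (R z v) = 2 * \<i> * complex_of_real (Im (cinner (R z v) v))"
    by (subst (2) cinner_commute) (simp add: complex_eq_iff)
  moreover have "z - cnj z = 2 * \<i> * complex_of_real (Im z)" by (simp add: complex_eq_iff)
  ultimately show ?thesis unfolding pol_kernel[OF z z] D_def using uhp_ne(2)[OF z] by simp
qed

text \<open>Positivity of the operator measure on p(t) = v/(t - z) - R_z v. The mixed terms give -2
  |R_z v|^2 and the constant term gives <E R_z v, R_z v>, so the excess of \<open>D\<close> over
  |R_z v|^2 dominates the form of 1 - E at R_z v.\<close>

lemma dissipation_lower_bound:
  assumes z: "z \<in> upper_half_plane"
  shows "(norm (R z v))\<^sup>2 + ((norm (R z v))\<^sup>2 - Re (cinner (E (R z v)) (R z v))) \<le> D z v"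
proof -
  define h where "h = R z v"
  define u where "u i = (if i = 0 then v else - h)" for i :: nat
  define g where "g i = (if i = 0 then (\<lambda>t. 1 / (complex_of_real t - z)) else (\<lambda>_. 1))" for i :: nat
  have "0 \<le> Re (\<Sum>i<2. \<Sum>j<2. pol (u i) (u j) (\<lambda>t. g i t * cnj (g j t)))"
  proof (rule kernel_nonneg[where C = "max 1 (1 / Im z)"])
    show "continuous_on UNIV (g i)" for i
      using continuous_resolvent_kernel[of z] uhp_ne(2)[OF z] by (auto simp: g_def)
    show "cmod (g i t) \<le> max 1 (1 / Im z)" for i t
      using resolvent_kernel_bound[of z t] uhp_ne(2)[OF z] by (auto simp: g_def le_max_iff_disj)
  qed
  also have "(\<Sum>i<2. \<Sum>j<2. pol (u i) (u j) (\<lambda>t. g i t * cnj (g j t))) =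
     pol v v (\<lambda>t. 1 / (complex_of_real t - z) * cnj (1 / (complex_of_real t - z)))
     + pol v (- h) (\<lambda>t. 1 / (complex_of_real t - z)) + pol (- h) v (\<lambda>t. 1 / (complex_of_real t - cnj z)) + pol (- h) (- h) (\<lambda>t. 1)"
    by (simp add: numeral_2_eq_2 u_def g_def)
  also have "Re \<dots> = D z v - 2 * (norm h)\<^sup>2 + Re (cinner (E h) h)"
    using pol_D[OF z, of v] unfolding pol_resolvent[OF z] pol_resolvent_cnj[OF z] cinner_E[symmetric] h_def[symmetric]
    by (simp add: clinear_op_minus[OF clinear_E] cinner_self)
  finally show ?thesis by (simp add: h_def)
qed

end

subsection \<open>Admissible parameters\<close>

context generalized_resolvent
begin

text \<open>This is (T - i)^(-1) for the extension T = A_(F(z)), bounded by 1 for every z.\<close>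

definition G :: "complex \<Rightarrow> 'h \<Rightarrow> 'h" where "G z u = (1 / (2 * \<i>)) *\<^sub>C (U z u - u)"

context
  fixes z assumes z: "z \<in> upper_half_plane"
begin

lemma clinear_G: "clinear_op (G z)"
  by (rule clinear_opI)
     (simp_all only: G_def clinear_op_add[OF clinear_U[OF z]] clinear_op_scale[OF clinear_U[OF z]]
       scaleC_add_right scaleC_diff_right scaleC_scaleC mult_ac, simp_all)

lemma G_V: "G z (V z u) = R z u"
proof -
  have "G z (V z u) = (1 / (2 * \<i>)) *\<^sub>C ((2 * \<i>) *\<^sub>C R z u)"
    unfolding G_def U_V[OF z] W_minus_V[OF z] by simp
  then show ?thesis by (simp add: scaleC_scaleC)
qed

lemma G_eq: "G z u = R z (Y z u)"
  using G_V[of "Y z u"] by (simp add: V_Y[OF z])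

lemma norm_G_le: "norm (G z u) \<le> norm u"
proof -
  have "norm (G z u) = norm (U z u - u) / 2" by (simp add: G_def norm_scaleC norm_divide)
  also have "\<dots> \<le> (norm (U z u) + norm u) / 2" by (intro divide_right_mono norm_triangle_ineq4) simp
  also have "\<dots> \<le> norm u" using norm_U_le[OF z, of u] by simp
  finally show ?thesis .
qed

lemma U_G: "U z u = u + (2 * \<i>) *\<^sub>C G z u"
  by (simp add: G_def scaleC_scaleC)

lemma G_extends: "(f, g) \<in> A \<Longrightarrow> G z (g - \<i> *\<^sub>C f) = f"
proof -
  assume "(f, g) \<in> A"
  then have "G z (g - \<i> *\<^sub>C f) = (1 / (2 * \<i>)) *\<^sub>C ((2 * \<i>) *\<^sub>C f)"
    unfolding G_def by (simp only: U_extends[OF z] scaleC_two_i) simp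
  then show ?thesis by (simp add: scaleC_scaleC)
qed

lemma norm_defect_U:
  "(norm u)\<^sup>2 - (norm (U z u))\<^sup>2 = 4 * (Im z * (D z (Y z u) - (norm (G z u))\<^sup>2))"
proof -
  have "(norm (V z (Y z u)))\<^sup>2 - (norm (W z (Y z u)))\<^sup>2
      = 4 * (Im (cinner (R z (Y z u)) (Y z u)) - Im z * (norm (R z (Y z u)))\<^sup>2)"
    by (rule norm_V_W[OF z])
  then show ?thesis
    using uhp_ne(2)[OF z] unfolding V_Y[OF z] U_def[symmetric] G_eq D_def by (simp add: right_diff_distrib)
qed

text \<open>The part from \<open>A\<close> is mapped isometrically, and its image is orthogonal to
  that of N_i, so the loss of norm is that of the N_i component alone.\<close>

lemma norm_defect_param:
  assumes fg: "(f, g) \<in> A" and \<psi>: "\<psi> \<in> defect_subspace A \<i>"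
  shows "(norm ((g - \<i> *\<^sub>C f) + \<psi>))\<^sup>2 - (norm (U z ((g - \<i> *\<^sub>C f) + \<psi>)))\<^sup>2 = (norm \<psi>)\<^sup>2 - (norm (U z \<psi>))\<^sup>2"
  unfolding clinear_op_add[OF clinear_U[OF z]] U_extends[OF z fg] norm_decompose[OF fg \<psi>]
    norm_decompose'[OF fg U_defect[OF z \<psi>]] by simp

lemma Y_G: "Y z u = u - (z - \<i>) *\<^sub>C G z u"
  using V_Y[OF z, of u] unfolding V_def G_eq by (metis add_diff_cancel_right')

end

text \<open>Let h = G_z w and let 4q be the loss of norm. Cauchy-Schwarz for the form of 1 - E gives
  |<w, h>|^2 \<le> |u|^2 <(1 - E) h, h> \<le> |u|^2 q / Im z, the last step by
  \<open>dissipation_lower_bound\<close>; and Im <h, w> = q + |h|^2 gives q \<le> |<w, h>|. Hence q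
  \<le> |u|^2 / Im z.\<close>

lemma defect_contraction_bound:
  assumes z: "z \<in> upper_half_plane" and w: "w = u - E u"
  shows "(norm w)\<^sup>2 - (norm (U z w))\<^sup>2 \<le> 4 * (norm u)\<^sup>2 / Im z"
proof -
  define h where "h = G z w"
  define x where "x = Y z w"
  have hR: "h = R z x" by (simp add: h_def x_def G_eq[OF z])
  define q where "q = Im z * (D z x - (norm h)\<^sup>2)"
  have Dh: "(norm h)\<^sup>2 - Re (cinner (E h) h) \<le> D z x - (norm h)\<^sup>2"
    using dissipation_lower_bound[OF z, of x] by (simp add: hR)
  have q0: "0 \<le> q"
    unfolding q_def using Dh E_le[of h] uhp_ne(2)[OF z] by (intro mult_nonneg_nonneg) auto
  have 1: "(cmod (cinner w h))\<^sup>2 \<le> ((norm u)\<^sup>2 - Re (cinner (E u) u)) * ((norm h)\<^sup>2 - Re (cinner (E h) h))"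
  proof (rule cmod_sq_le_of_quadratic)
    show "0 \<le> (norm h)\<^sup>2 - Re (cinner (E h) h)" using E_le[of h] by simp
    fix \<zeta>
    \<comment> \<open>The conjugate makes \<zeta> itself multiply <w, h>, as the second argument is
      conjugate linear.\<close>
    define y where "y = u + cnj \<zeta> *\<^sub>C h"
    have "0 \<le> (norm y)\<^sup>2 - Re (cinner (E y) y)" using E_le[of y] by simp
    also have "(norm y)\<^sup>2 - Re (cinner (E y) y) = Re (cinner (y - E y) y)"
      by (simp add: cinner_diff_left cinner_self)
    also have "y - E y = w + cnj \<zeta> *\<^sub>C (h - E h)"
      by (simp add: y_def w clinear_op_add[OF clinear_E] clinear_op_scale[OF clinear_E] scaleC_diff_right)
    also have "Re (cinner (w + cnj \<zeta> *\<^sub>C (h - E h)) y) =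
      Re (cinner w u) + Re (\<zeta> * cinner w h) + Re (cnj \<zeta> * cinner (h - E h) u) + (cmod \<zeta>)\<^sup>2 * Re (cinner (h - E h) h)"
    proof -
      have re: "Re (complex_of_real r * s) = r * Re s" for r s by simp
      have "Re (\<zeta> * (cnj \<zeta> * s)) = (cmod \<zeta>)\<^sup>2 * Re s" for s
      proof -
        have "\<zeta> * (cnj \<zeta> * s) = complex_of_real ((cmod \<zeta>)\<^sup>2) * s"
          by (simp only: complex_norm_square mult.assoc)
        then show ?thesis by (simp only: re)
      qed
      from this[of "cinner (h - E h) h"] show ?thesis
        unfolding y_def cinner_add_left cinner_add_right cinner_scaleC_left cinner_scaleC_right complex_cnj_cnj
        by (simp add: distrib_left mult.left_commute[of "cnj \<zeta>" \<zeta>])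
    qed
    also have "cinner (h - E h) u = cnj (cinner w h)"
      by (subst cinner_commute) (simp add: w cinner_diff_left cinner_diff_right E_hermitian)
    also have "Re (cnj \<zeta> * cnj (cinner w h)) = Re (\<zeta> * cinner w h)" by simp
    also have "Re (cinner w u) = (norm u)\<^sup>2 - Re (cinner (E u) u)" by (simp add: w cinner_diff_left cinner_self)
    also have "Re (cinner (h - E h) h) = (norm h)\<^sup>2 - Re (cinner (E h) h)" by (simp add: cinner_diff_left cinner_self)
    finally show "0 \<le> (norm u)\<^sup>2 - Re (cinner (E u) u) + 2 * Re (\<zeta> * cinner w h) + (cmod \<zeta>)\<^sup>2 * ((norm h)\<^sup>2 - Re (cinner (E h) h))"
      by simp
  qed
  have Eu: "0 \<le> Re (cinner (E u) u)" by (simp add: E_mass)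
  have "((norm u)\<^sup>2 - Re (cinner (E u) u)) * ((norm h)\<^sup>2 - Re (cinner (E h) h)) \<le> (norm u)\<^sup>2 * (D z x - (norm h)\<^sup>2)"
    using Dh E_le[of h] Eu by (intro mult_mono) auto
  with 1 have 2: "Im z * (cmod (cinner w h))\<^sup>2 \<le> (norm u)\<^sup>2 * q"
    using uhp_ne(2)[OF z] mult_left_mono[of "(cmod (cinner w h))\<^sup>2" "(norm u)\<^sup>2 * (D z x - (norm h)\<^sup>2)" "Im z"]
    by (simp add: q_def mult_ac)
  have "w = x + (z - \<i>) *\<^sub>C h" using V_Y[OF z, of w] by (simp add: V_def hR x_def)
  then have "cinner h w = cinner h (x + (z - \<i>) *\<^sub>C h)" by simp
  then have "Im (cinner h w) = q + (norm h)\<^sup>2"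
    using uhp_ne(2)[OF z] by (simp add: cinner_add_right cinner_scaleC_right cinner_self q_def D_def hR right_diff_distrib left_diff_distrib)
  moreover have "Im (cinner h w) \<le> cmod (cinner h w)" using abs_Im_le_cmod[of "cinner h w"] by simp
  moreover have "cmod (cinner h w) = cmod (cinner w h)" by (subst cinner_commute) simp
  ultimately have "q \<le> cmod (cinner w h)" using zero_le_power2[of "norm h"] by linarith
  then have "q\<^sup>2 \<le> (cmod (cinner w h))\<^sup>2" using q0 by (intro power_mono)
  then have "Im z * q\<^sup>2 \<le> (norm u)\<^sup>2 * q"
    using 2 uhp_ne(2)[OF z] by (meson less_imp_le mult_left_mono order_trans)
  then have "q * (Im z * q) \<le> q * (norm u)\<^sup>2" by (simp add: power2_eq_square mult_ac)
  then have "Im z * q \<le> (norm u)\<^sup>2"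
    using q0 by (cases "q = 0") (auto dest: mult_left_le_imp_le)
  then have "q \<le> (norm u)\<^sup>2 / Im z" using uhp_ne(2)[OF z] by (simp add: field_simps)
  moreover have "(norm w)\<^sup>2 - (norm (U z w))\<^sup>2 = 4 * q"
    unfolding norm_defect_U[OF z] q_def h_def x_def by simp
  ultimately show ?thesis by simp
qed

lemma R_tendsto_zero:
  assumes \<epsilon>: "0 < \<epsilon>" "\<epsilon> \<le> pi / 2"
  shows "((\<lambda>z. R z u) \<longlongrightarrow> 0) (sector_at_infinity \<epsilon>)"
proof -
  have "filterlim (\<lambda>z. - z) at_infinity (sector_at_infinity \<epsilon>)"
    using cmod_sector_at_infinity by (simp add: filterlim_at_infinity_conv_norm_at_top)
  then have inv: "((\<lambda>z. inverse (- z)) \<longlongrightarrow> 0) (sector_at_infinity \<epsilon>)"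
    by (rule filterlim_compose[OF tendsto_inverse_0])
  show ?thesis
  proof (rule tendsto_onb)
    fix i
    have "((\<lambda>z. inverse (- z) * cinner ((- z) *\<^sub>C R z u) (e i)) \<longlongrightarrow> 0 * cinner (E u) (e i)) (sector_at_infinity \<epsilon>)"
      by (intro tendsto_mult inv tendsto_cinner_left E_limit \<epsilon>)
    then have "((\<lambda>z. cinner (R z u) (e i)) \<longlongrightarrow> 0 * cinner (E u) (e i)) (sector_at_infinity \<epsilon>)"
    proof (rule Lim_transform_eventually)
      show "\<forall>\<^sub>F z in sector_at_infinity \<epsilon>. inverse (- z) * cinner ((- z) *\<^sub>C R z u) (e i) = cinner (R z u) (e i)"
        using eventually_sector_uhp
      proof eventually_elim
        case (elim z)
        then have "z \<noteq> 0" by (auto simp: upper_half_plane_def)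
        then show ?case by (simp add: cinner_scaleC_left)
      qed
    qed
    then show "((\<lambda>z. cinner (R z u) (e i)) \<longlongrightarrow> cinner 0 (e i)) (sector_at_infinity \<epsilon>)" by simp
  qed
qed

text \<open>Put w = u - E u. Then V_z u tends to w while G_z V_z u = R_z u tends to 0, and as G_z is
  bounded, G_z w tends to 0. Splitting w = (g - i f) + \<psi>, this says that F(z) \<psi> tends to
  \<psi> - 2i f, the value of the forbidden operator, and \<open>defect_contraction_bound\<close>
  supplies the rate. Admissibility gives \<psi> = 0; then G_z w = f for all z, so f = 0, and g = 0
  because A is an operator.\<close>

theorem admissible_imp_complete:
  assumes \<epsilon>: "0 < \<epsilon>" "\<epsilon> \<le> pi / 2" and adm: "param \<in> admissible_class \<epsilon> A"
    and single: "\<And>g. (0, g) \<in> A \<Longrightarrow> g = 0"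
  shows "E u = u"
proof -
  let ?F = "sector_at_infinity \<epsilon>"
  note nb = sector_at_infinity_neq_bot[OF \<epsilon>]
  define w where "w = u - E u"
  have V_lim: "((\<lambda>z. V z u) \<longlongrightarrow> w) ?F"
  proof -
    have "((\<lambda>z. u - (- z) *\<^sub>C R z u + (- \<i>) *\<^sub>C R z u) \<longlongrightarrow> u - E u + (- \<i>) *\<^sub>C 0) ?F"
    proof (intro tendsto_intros E_limit \<epsilon>)
      show "((\<lambda>z. (- \<i>) *\<^sub>C R z u) \<longlongrightarrow> (- \<i>) *\<^sub>C 0) ?F"
        by (rule tendsto_onb) (unfold cinner_scaleC_left, intro tendsto_intros tendsto_cinner_left R_tendsto_zero \<epsilon>)
    qed
    moreover have "u - (- z) *\<^sub>C R z u + (- \<i>) *\<^sub>C R z u = V z u" for z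
      by (simp add: V_def scaleC_diff_left scaleC_minus_left)
    ultimately show ?thesis by (simp add: w_def)
  qed
  have G_lim: "((\<lambda>z. G z w) \<longlongrightarrow> 0) ?F"
  proof -
    have "((\<lambda>z. norm (R z u) + norm (w - V z u)) \<longlongrightarrow> norm (0::'h) + norm (w - w)) ?F"
      by (intro tendsto_intros R_tendsto_zero \<epsilon> V_lim)
    then have "((\<lambda>z. norm (R z u) + norm (w - V z u)) \<longlongrightarrow> 0) ?F" by simp
    then show ?thesis
    proof (rule tendsto_0_le[where K = 1])
      show "\<forall>\<^sub>F z in ?F. norm (G z w) \<le> norm (norm (R z u) + norm (w - V z u)) * 1"
        using eventually_sector_uhp
      proof eventually_elim
        case (elim z)
        have "G z w = G z (V z u) + G z (w - V z u)"
          unfolding clinear_op_add[OF clinear_G[OF elim], symmetric] by simp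
        also have "norm \<dots> \<le> norm (R z u) + norm (w - V z u)"
          unfolding G_V[OF elim] by (rule order_trans[OF norm_triangle_ineq add_left_mono[OF norm_G_le[OF elim]]])
        finally show ?case by simp
      qed
    qed
  qed
  obtain f g where fg: "(f, g) \<in> A" and w: "w = (g - \<i> *\<^sub>C f) + defect_proj w"
    using decompose[of w] by blast
  define \<psi> where "\<psi> = defect_proj w"
  have \<psi>: "\<psi> \<in> defect_subspace A \<i>" by (simp add: \<psi>_def defect_proj_mem)
  define \<phi> where "\<phi> = \<psi> - (2 * \<i>) *\<^sub>C f"
  have G\<psi>: "G z \<psi> = G z w - f" if "z \<in> upper_half_plane" for z
  proof -
    have "G z w = G z ((g - \<i> *\<^sub>C f) + \<psi>)" unfolding \<psi>_def by (rule arg_cong[OF w])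
    then show ?thesis by (simp add: clinear_op_add[OF clinear_G[OF that]] G_extends[OF that fg])
  qed
  have param_lim: "((\<lambda>z. param z \<psi>) \<longlongrightarrow> \<phi>) ?F"
  proof (rule tendsto_onb)
    fix i
    have "((\<lambda>z. cinner \<psi> (e i) + (2 * \<i>) * cinner (G z w - f) (e i)) \<longlongrightarrow> cinner \<psi> (e i) + (2 * \<i>) * cinner (0 - f) (e i)) ?F"
      by (intro tendsto_intros tendsto_cinner_left G_lim)
    then have "((\<lambda>z. cinner (param z \<psi>) (e i)) \<longlongrightarrow> cinner \<psi> (e i) + (2 * \<i>) * cinner (0 - f) (e i)) ?F"
      by (rule Lim_transform_eventually)
         (use eventually_sector_uhp in \<open>eventually_elim, simp add: param_eq \<psi> U_G G\<psi> cinner_simps\<close>)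
    then show "((\<lambda>z. cinner (param z \<psi>) (e i)) \<longlongrightarrow> cinner \<phi> (e i)) ?F"
      by (simp add: \<phi>_def cinner_simps)
  qed
  have \<phi>: "\<phi> \<in> defect_subspace A (- \<i>)"
    unfolding defect_subspace_def
  proof safe
    fix f' g' assume fg': "(f', g') \<in> A"
    have "((\<lambda>z. cinner (param z \<psi>) (g' - (- \<i>) *\<^sub>C f')) \<longlongrightarrow> cinner \<phi> (g' - (- \<i>) *\<^sub>C f')) ?F"
      by (rule tendsto_cinner_left[OF param_lim])
    moreover have "\<forall>\<^sub>F z in ?F. cinner (param z \<psi>) (g' - (- \<i>) *\<^sub>C f') = 0"
      using eventually_sector_uhp
    proof eventually_elim
      case (elim z)
      have "param z \<psi> \<in> defect_subspace A (- \<i>)" by (simp add: param_eq elim \<psi> U_defect)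
      then show ?case using fg' unfolding defect_subspace_def by fastforce
    qed
    ultimately have "((\<lambda>z. 0) \<longlongrightarrow> cinner \<phi> (g' - (- \<i>) *\<^sub>C f')) ?F" by (rule Lim_transform_eventually)
    then show "cinner \<phi> (g' - (- \<i>) *\<^sub>C f') = 0" using nb by (simp add: tendsto_const_iff)
  qed
  have "(((- 2) * \<i>) *\<^sub>C f, ((- 2) * \<i>) *\<^sub>C g) \<in> A" by (rule scale_mem[OF fg])
  moreover have "\<phi> - \<psi> = ((- 2) * \<i>) *\<^sub>C f" by (simp add: \<phi>_def scaleC_minus_left)
  ultimately have mem: "(\<psi>, \<phi>) \<in> forbidden_operator A"
    unfolding forbidden_operator_def using \<psi> \<phi> by (auto simp: Domain_iff)
  have sin: "0 < sin \<epsilon>" using \<epsilon> by (intro sin_gt_zero) auto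
  have "\<psi> = 0"
  proof (rule ccontr)
    assume "\<psi> \<noteq> 0"
    then have \<psi>0: "0 < norm \<psi>" by simp
    \<comment> \<open>From |\<psi>| - |F \<psi>| \<le> (|\<psi>|^2 - |F \<psi>|^2) / |\<psi>|, the
      bound 4 |u|^2 / Im z for the numerator, and Im z \<ge> |z| sin \<epsilon>.\<close>
    define C where "C = 4 * (norm u)\<^sup>2 / (sin \<epsilon> * norm \<psi>)"
    have bound: "\<forall>\<^sub>F z in ?F. ereal (cmod z * (norm \<psi> - norm (param z \<psi>))) \<le> ereal C"
      using eventually_sector_at_infinity
    proof eventually_elim
      case (elim z)
      then have z: "z \<in> upper_half_plane" by (simp add: upper_sector_def)
      note zb = upper_sector_bounds[OF \<epsilon> elim]
      let ?a = "norm \<psi>" and ?b = "norm (U z \<psi>)"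
      have ab: "?b \<le> ?a" by (rule norm_U_le[OF z])
      have "?a * (?a - ?b) \<le> (?a + ?b) * (?a - ?b)" using ab by (intro mult_right_mono) auto
      also have "\<dots> = ?a\<^sup>2 - ?b\<^sup>2" by (simp add: power2_eq_square algebra_simps)
      also have "\<dots> = (norm w)\<^sup>2 - (norm (U z w))\<^sup>2"
        using norm_defect_param[OF z fg \<psi>] unfolding \<psi>_def w[symmetric] by simp
      also have "\<dots> \<le> 4 * (norm u)\<^sup>2 / Im z" by (rule defect_contraction_bound[OF z w_def])
      finally have "Im z * (?a * (?a - ?b)) \<le> 4 * (norm u)\<^sup>2" using zb(1) by (simp add: field_simps)
      moreover have "(sin \<epsilon> * cmod z) * (?a * (?a - ?b)) \<le> Im z * (?a * (?a - ?b))"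
        using zb(2) ab by (intro mult_right_mono mult_nonneg_nonneg) auto
      ultimately have "(sin \<epsilon> * ?a) * (cmod z * (?a - ?b)) \<le> 4 * (norm u)\<^sup>2" by (simp add: mult_ac)
      then have "cmod z * (?a - ?b) \<le> C" using sin \<psi>0 by (simp add: C_def field_simps)
      then show ?case using z \<psi> by (simp add: param_eq)
    qed
    have "Liminf ?F (\<lambda>z. ereal (cmod z * (norm \<psi> - norm (param z \<psi>)))) \<le> Liminf ?F (\<lambda>z. ereal C)"
      by (rule Liminf_mono[OF bound])
    also have "\<dots> < \<infinity>" using nb by (simp add: Liminf_const)
    finally show False using adm mem param_lim \<open>\<psi> \<noteq> 0\<close> unfolding admissible_class_def by blast
  qed
  then have wfg: "w = g - \<i> *\<^sub>C f" using w by (simp add: \<psi>_def)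
  have "((\<lambda>z. f) \<longlongrightarrow> 0) ?F"
    by (rule Lim_transform_eventually[OF G_lim])
       (use eventually_sector_uhp in \<open>eventually_elim, simp add: wfg G_extends fg\<close>)
  then have "f = 0" using nb by (simp add: tendsto_const_iff)
  then have "w = 0" using wfg fg single by simp
  then show ?thesis by (simp add: w_def)
qed

end

context generalized_resolvent
begin

text \<open>In a dilation of \<open>A\<close> the left-hand side is the inner product of the components orthogonal to the
  original space of the vectors $(\Theta-w)^{-1}a$ and $(\Theta-z)^{-1}v$.\<close>

lemma two_point_inequality:
  assumes complete: "\<And>u. E u = u" and z: "z \<in> upper_half_plane" and w: "w \<in> upper_half_plane"
  shows "(cmod ((cinner (R w a) v - cinner a (R z v)) / (w - cnj z) - cinner (R w a) (R z v)))\<^sup>2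
    \<le> (D z v - (norm (R z v))\<^sup>2) * (D w a - (norm (R w a))\<^sup>2)"
proof (rule cmod_sq_le_of_quadratic)
  have D_ge: "(norm (R w a))\<^sup>2 \<le> D w a"
    using dissipation_lower_bound[OF w, of a] by (simp add: complete cinner_self)
  show "0 \<le> D w a - (norm (R w a))\<^sup>2" using D_ge by simp
  fix \<zeta>
  define h where "h = R z v"
  define k where "k = R w a"
  \<comment> \<open>The constant b removes from v/(t - z) + \<zeta> a/(t - w) its component in H,
    which is R_z v + \<zeta> R_w a. With E = 1 the form of the remainder is the quadratic in \<zeta>
    whose discriminant is the claim.\<close>
  define b where "b = - (h + \<zeta> *\<^sub>C k)"
  define u where "u i = (if i = 0 then v else if i = 1 then \<zeta> *\<^sub>C a else b)" for i :: nat
  define g where "g i = (if i = 0 then (\<lambda>t. 1 / (complex_of_real t - z)) else if i = 1 then (\<lambda>t. 1 / (complex_of_real t - w)) else (\<lambda>_. 1))"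
    for i :: nat
  define Q where "Q = (cinner (R w a) v - cinner a (R z v)) / (w - cnj z)"
  have pos: "0 \<le> Re (\<Sum>i<3. \<Sum>j<3. pol (u i) (u j) (\<lambda>t. g i t * cnj (g j t)))"
  proof (rule kernel_nonneg[where C = "max 1 (max (1 / Im z) (1 / Im w))"])
    show "continuous_on UNIV (g i)" for i
      using continuous_resolvent_kernel[of z] continuous_resolvent_kernel[of w] uhp_ne(2)[OF z] uhp_ne(2)[OF w]
      by (auto simp: g_def)
    show "cmod (g i t) \<le> max 1 (max (1 / Im z) (1 / Im w))" for i t
      using resolvent_kernel_bound[of z t] uhp_ne(2)[OF z] resolvent_kernel_bound[of w t] uhp_ne(2)[OF w]
      by (auto simp: g_def le_max_iff_disj)
  qed
  have lw: "R w (\<zeta> *\<^sub>C a) = \<zeta> *\<^sub>C k" by (simp add: k_def clinear_op_scale[OF lin[OF w]])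
  have D_scale: "D w (\<zeta> *\<^sub>C a) = (cmod \<zeta>)\<^sup>2 * D w a"
  proof -
    have "cinner (R w (\<zeta> *\<^sub>C a)) (\<zeta> *\<^sub>C a) = (\<zeta> * cnj \<zeta>) * cinner k a"
      unfolding lw by (simp add: cinner_simps mult_ac)
    also have "\<zeta> * cnj \<zeta> = complex_of_real ((cmod \<zeta>)\<^sup>2)" by (simp only: complex_norm_square)
    finally show ?thesis unfolding D_def k_def by simp
  qed
  have p01: "pol v (\<zeta> *\<^sub>C a) (\<lambda>t. 1 / (complex_of_real t - z) * cnj (1 / (complex_of_real t - w))) = cnj (\<zeta> * Q)"
  proof -
    have "cnj (\<zeta> * Q) = cnj \<zeta> * (cnj (cinner k v) - cnj (cinner a h)) / (cnj w - z)"
      by (simp add: Q_def h_def k_def)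
    also have "\<dots> = cnj \<zeta> * (cinner v k - cinner h a) / (cnj w - z)"
      by (simp only: cinner_commute[symmetric])
    also have "\<dots> = cnj \<zeta> * (cinner h a - cinner v k) / (z - cnj w)"
      by (metis minus_diff_eq minus_divide_divide mult_minus_right)
    finally show ?thesis unfolding pol_kernel[OF z w] lw by (simp add: h_def cinner_scaleC_right right_diff_distrib)
  qed
  have p10: "pol (\<zeta> *\<^sub>C a) v (\<lambda>t. 1 / (complex_of_real t - w) * cnj (1 / (complex_of_real t - z))) = \<zeta> * Q"
    unfolding pol_kernel[OF w z] lw Q_def by (simp add: k_def cinner_scaleC_left right_diff_distrib)
  have b1: "pol b v (\<lambda>t. 1 / (complex_of_real t - cnj z)) = cinner b h"
    unfolding pol_resolvent_cnj[OF z] h_def ..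
  have b2: "pol b (\<zeta> *\<^sub>C a) (\<lambda>t. 1 / (complex_of_real t - cnj w)) = cinner b (\<zeta> *\<^sub>C k)"
    unfolding pol_resolvent_cnj[OF w] lw ..
  have b3: "pol v b (\<lambda>t. 1 / (complex_of_real t - z)) = cinner h b"
    unfolding pol_resolvent[OF z] h_def ..
  have b4: "pol (\<zeta> *\<^sub>C a) b (\<lambda>t. 1 / (complex_of_real t - w)) = cinner (\<zeta> *\<^sub>C k) b"
    unfolding pol_resolvent[OF w] lw ..
  have b5: "pol b b (\<lambda>t. 1) = cinner b b" using cinner_E[of b b] by (simp add: complete)
  have sum3: "(\<Sum>i<3. \<Sum>j<3. F i j) = F 0 0 + F 0 1 + F 0 2 + (F 1 0 + F 1 1 + F 1 2) + (F 2 0 + F 2 1 + F (2::nat) (2::nat))"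
    for F :: "nat \<Rightarrow> nat \<Rightarrow> complex"
    by (simp add: numeral_eq_Suc add_ac)
  have "Re (\<Sum>i<3. \<Sum>j<3. pol (u i) (u j) (\<lambda>t. g i t * cnj (g j t))) =
      D z v + Re (cnj (\<zeta> * Q)) + Re (cinner h b) + (Re (\<zeta> * Q) + D w (\<zeta> *\<^sub>C a) + Re (cinner (\<zeta> *\<^sub>C k) b))
      + (Re (cinner b h) + Re (cinner b (\<zeta> *\<^sub>C k)) + Re (cinner b b))"
    unfolding sum3 unfolding plus_complex.sel
    using pol_D[OF z, of v] pol_D[OF w, of "\<zeta> *\<^sub>C a"] p01 p10 b1 b2 b3 b4 b5
    by (simp add: u_def g_def)
  also have "\<dots> = D z v - (norm h)\<^sup>2 + 2 * Re (\<zeta> * (Q - cinner k h)) + (cmod \<zeta>)\<^sup>2 * (D w a - (norm k)\<^sup>2)"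
  proof -
    have hb: "h + \<zeta> *\<^sub>C k = - b" by (simp add: b_def)
    have "Re (cinner h b) + Re (cinner (\<zeta> *\<^sub>C k) b) = - Re (cinner b b)"
      using arg_cong[OF hb, of "\<lambda>x. Re (cinner x b)"] by (simp only: cinner_add_left cinner_minus_left plus_complex.sel uminus_complex.sel)
    moreover have "Re (cinner b h) + Re (cinner b (\<zeta> *\<^sub>C k)) = - Re (cinner b b)"
      using arg_cong[OF hb, of "\<lambda>x. Re (cinner b x)"] by (simp only: cinner_add_right cinner_minus_right plus_complex.sel uminus_complex.sel)
    moreover have "Re (cinner b b) = (norm h)\<^sup>2 + 2 * Re (\<zeta> * cinner k h) + (cmod \<zeta>)\<^sup>2 * (norm k)\<^sup>2"
      unfolding cinner_self b_def norm_minus_cancel norm_add_square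
      using Re_cinner_commute[of h "\<zeta> *\<^sub>C k"] by (simp add: cinner_scaleC_left norm_scaleC power_mult_distrib)
    moreover have "Re (cnj (\<zeta> * Q)) = Re (\<zeta> * Q)" by simp
    ultimately show ?thesis unfolding D_scale by (simp add: right_diff_distrib)
  qed
  finally show "0 \<le> D z v - (norm (R z v))\<^sup>2
      + 2 * Re (\<zeta> * ((cinner (R w a) v - cinner a (R z v)) / (w - cnj z) - cinner (R w a) (R z v)))
      + (cmod \<zeta>)\<^sup>2 * (D w a - (norm (R w a))\<^sup>2)"
    using pos by (simp add: h_def k_def Q_def)
qed

lemma iy_limit:
  assumes complete: "\<And>u. E u = u"
  shows "((\<lambda>y. y * Im (cinner (R (\<i> * complex_of_real y) a) a)) \<longlongrightarrow> (norm a)\<^sup>2) at_top"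
    and "((\<lambda>y. (- (\<i> * complex_of_real y)) *\<^sub>C R (\<i> * complex_of_real y) a) \<longlongrightarrow> a) at_top"
proof -
  show L: "((\<lambda>y. (- (\<i> * complex_of_real y)) *\<^sub>C R (\<i> * complex_of_real y) a) \<longlongrightarrow> a) at_top"
    using imaginary_axis_limit[OF E_limit[OF half_pi, of a]] by (simp add: complete)
  have "((\<lambda>y. Re (cinner ((- (\<i> * complex_of_real y)) *\<^sub>C R (\<i> * complex_of_real y) a) a)) \<longlongrightarrow> Re (cinner a a)) at_top"
    by (intro tendsto_Re tendsto_cinner_left L)
  then show "((\<lambda>y. y * Im (cinner (R (\<i> * complex_of_real y) a) a)) \<longlongrightarrow> (norm a)\<^sup>2) at_top"
    by (simp add: cinner_scaleC_left cinner_self)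
qed

text \<open>R_z u = 0 gives D z u = 0, so the two-point inequality forces <R_w u, u> = 0 for every
  w, whereas E = 1 makes y Im <R_(iy) u, u> tend to |u|^2. Injectivity of R_z is what makes A_(F(z))
  single-valued.\<close>

lemma R_injective:
  assumes complete: "\<And>u. E u = u" and z: "z \<in> upper_half_plane" and R0: "R z u = 0"
  shows "u = 0"
proof -
  have "cinner (R w u) u = 0" if w: "w \<in> upper_half_plane" for w
  proof -
    have wz: "w - cnj z \<noteq> 0" using uhp_ne(2)[OF z] uhp_ne(2)[OF w] by (auto simp: complex_eq_iff)
    have "D z u = 0" by (simp add: D_def R0)
    then have "cinner (R w u) u / (w - cnj z) = 0"
      using two_point_inequality[OF complete z w, of u u] R0 by simp
    then show ?thesis using wz by simp
  qed
  then have "((\<lambda>y::real. 0) \<longlongrightarrow> (norm u)\<^sup>2) at_top"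
    using iy_limit(1)[OF complete, of u]
    by (elim Lim_transform_eventually) (rule eventually_mono[OF eventually_gt_at_top[of 0]], simp add: iy_uhp)
  then show ?thesis by (simp add: tendsto_const_iff)
qed

text \<open>At w = iy and a = c, multiplied by y^2, the left side tends to |c|^4 and the right side
  to K (|c|^2 - |c|^2) = 0.\<close>

lemma complete_bound_zero:
  assumes complete: "\<And>u. E u = u"
    and bound: "\<And>w a. w \<in> upper_half_plane \<Longrightarrow> (cmod (cinner (R w a) c))\<^sup>2 \<le> K * (D w a - (norm (R w a))\<^sup>2)"
  shows "c = 0"
proof -
  let ?z = "\<lambda>y::real. \<i> * complex_of_real y"
  have 1: "((\<lambda>y. (cmod (cinner ((- ?z y) *\<^sub>C R (?z y) c) c))\<^sup>2) \<longlongrightarrow> (cmod (cinner c c))\<^sup>2) at_top"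
    by (intro tendsto_power tendsto_norm tendsto_cinner_left iy_limit(2)[OF complete])
  have 2: "((\<lambda>y. K * (y * Im (cinner (R (?z y) c) c) - (norm ((- ?z y) *\<^sub>C R (?z y) c))\<^sup>2)) \<longlongrightarrow> K * ((norm c)\<^sup>2 - (norm c)\<^sup>2)) at_top"
    by (intro tendsto_intros iy_limit[OF complete])
  have "(cmod (cinner c c))\<^sup>2 \<le> K * ((norm c)\<^sup>2 - (norm c)\<^sup>2)"
  proof (rule tendsto_le[OF _ 2 1])
    show "\<forall>\<^sub>F y in at_top. (cmod (cinner ((- ?z y) *\<^sub>C R (?z y) c) c))\<^sup>2
       \<le> K * (y * Im (cinner (R (?z y) c) c) - (norm ((- ?z y) *\<^sub>C R (?z y) c))\<^sup>2)"
    proof (rule eventually_mono[OF eventually_gt_at_top[of 0]])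
      fix y :: real assume y: "0 < y"
      have "y\<^sup>2 * (cmod (cinner (R (?z y) c) c))\<^sup>2 \<le> y\<^sup>2 * (K * (D (?z y) c - (norm (R (?z y) c))\<^sup>2))"
        by (intro mult_left_mono bound iy_uhp y) simp
      also have "\<dots> = K * (y\<^sup>2 * D (?z y) c - y\<^sup>2 * (norm (R (?z y) c))\<^sup>2)" by (simp add: algebra_simps)
      also have "y\<^sup>2 * D (?z y) c = y * Im (cinner (R (?z y) c) c)" using y by (simp add: D_def power2_eq_square)
      finally show "(cmod (cinner ((- ?z y) *\<^sub>C R (?z y) c) c))\<^sup>2
       \<le> K * (y * Im (cinner (R (?z y) c) c) - (norm ((- ?z y) *\<^sub>C R (?z y) c))\<^sup>2)"
        using y by (simp add: cinner_scaleC_left norm_mult norm_scaleC power_mult_distrib)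
    qed
  qed simp
  then show ?thesis by (simp add: cinner_self)
qed

text \<open>Given \<psi> with both limit relations, let f = (\<phi> - \<psi>)/(2i), (f, g) in
  \<open>A\<close> and c = \<psi> - (g - i f); then G_z c tends to 0. The two-point inequality at v
  = Y_z c, for which R_z v = G_z c, bounds <R_w a, c> in the limit by means of the assumed rate, and
  \<open>complete_bound_zero\<close> yields c = 0. So \<psi> lies in the range of A - i and is
  orthogonal to it.\<close>

theorem complete_imp_admissible:
  assumes \<epsilon>: "0 < \<epsilon>" "\<epsilon> \<le> pi / 2" and complete: "\<And>u. E u = u"
  shows "param \<in> admissible_class \<epsilon> A"
  unfolding admissible_class_def
proof (intro CollectI conjI param_contractive ballI, clarify)
  let ?F = "sector_at_infinity \<epsilon>"
  note nb = sector_at_infinity_neq_bot[OF \<epsilon>]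
  have sin: "0 < sin \<epsilon>" using \<epsilon> by (intro sin_gt_zero) auto
  fix \<psi> \<phi>
  assume mem: "(\<psi>, \<phi>) \<in> forbidden_operator A" and lim: "((\<lambda>z. param z \<psi>) \<longlongrightarrow> \<phi>) ?F"
    and liminf: "Liminf ?F (\<lambda>z. ereal (cmod z * (norm \<psi> - norm (param z \<psi>)))) < \<infinity>"
  have \<psi>: "\<psi> \<in> defect_subspace A \<i>" using mem by (auto simp: forbidden_operator_def)
  obtain g0 where "(\<phi> - \<psi>, g0) \<in> A" using mem by (auto simp: forbidden_operator_def)
  define f where "f = (1 / (2 * \<i>)) *\<^sub>C (\<phi> - \<psi>)"
  define g where "g = (1 / (2 * \<i>)) *\<^sub>C g0"
  have fg: "(f, g) \<in> A" unfolding f_def g_def by (rule scale_mem) fact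
  define c where "c = \<psi> - (g - \<i> *\<^sub>C f)"
  have G\<psi>: "((\<lambda>z. G z \<psi>) \<longlongrightarrow> f) ?F"
  proof (rule tendsto_onb)
    fix i
    have "((\<lambda>z. (1 / (2 * \<i>)) * cinner (param z \<psi> - \<psi>) (e i)) \<longlongrightarrow> (1 / (2 * \<i>)) * cinner (\<phi> - \<psi>) (e i)) ?F"
      by (intro tendsto_mult tendsto_const tendsto_cinner_left tendsto_diff lim)
    then have "((\<lambda>z. cinner (G z \<psi>) (e i)) \<longlongrightarrow> (1 / (2 * \<i>)) * cinner (\<phi> - \<psi>) (e i)) ?F"
      by (rule Lim_transform_eventually)
         (use eventually_sector_uhp in \<open>eventually_elim, simp add: G_def param_eq \<psi> cinner_scaleC_left\<close>)
    then show "((\<lambda>z. cinner (G z \<psi>) (e i)) \<longlongrightarrow> cinner f (e i)) ?F" by (simp add: f_def cinner_scaleC_left)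
  qed
  have h_lim: "((\<lambda>z. G z c) \<longlongrightarrow> 0) ?F"
  proof -
    have "((\<lambda>z. G z \<psi> - f) \<longlongrightarrow> f - f) ?F" by (intro tendsto_diff G\<psi> tendsto_const)
    then have "((\<lambda>z. G z c) \<longlongrightarrow> f - f) ?F"
    proof (rule Lim_transform_eventually)
      show "\<forall>\<^sub>F z in ?F. G z \<psi> - f = G z c"
        using eventually_sector_uhp
      proof eventually_elim
        case (elim z)
        show ?case
          unfolding c_def clinear_op_diff[OF clinear_G[OF elim], of \<psi>] G_extends[OF elim fg] ..
      qed
    qed
    then show ?thesis by simp
  qed
  \<comment> \<open>A finite lower limit bounds the quantity frequently, not eventually. That is
    enough, because everything it is combined with holds eventually.\<close>
  have "\<exists>C. \<exists>\<^sub>F z in ?F. cmod z * (norm \<psi> - norm (param z \<psi>)) < C"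
  proof (rule ccontr)
    assume "\<not> ?thesis"
    then have "\<forall>\<^sub>F z in ?F. ereal C \<le> ereal (cmod z * (norm \<psi> - norm (param z \<psi>)))" for C
      by (simp add: not_frequently not_less)
    then have ge: "ereal C \<le> Liminf ?F (\<lambda>z. ereal (cmod z * (norm \<psi> - norm (param z \<psi>))))" for C
      by (rule Liminf_bounded)
    show False using liminf ge[of "real_of_ereal (Liminf ?F (\<lambda>z. ereal (cmod z * (norm \<psi> - norm (param z \<psi>))))) + 1"] ge[of 0]
      by (cases "Liminf ?F (\<lambda>z. ereal (cmod z * (norm \<psi> - norm (param z \<psi>))))") auto
  qed
  then obtain C where C: "\<exists>\<^sub>F z in ?F. cmod z * (norm \<psi> - norm (param z \<psi>)) < C" by blast
  \<comment> \<open>Chosen so that 4 |z|^2 (D - |G_z c|^2) \<le> K at those z: the loss of norm is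
    at most 2 |\<psi>| (|\<psi>| - |F \<psi>|), and Im z \<ge> |z| sin \<epsilon>. The factor 4
    |z|^2 bounds |w - conj z|^2 once |z| \<ge> |w|.\<close>
  define K where "K = 2 * norm \<psi> * \<bar>C\<bar> / sin \<epsilon>"
  have "c = 0"
  proof (rule complete_bound_zero[OF complete])
    fix w a assume w: "w \<in> upper_half_plane"
    define k where "k = R w a"
    have Dk: "0 \<le> D w a - (norm k)\<^sup>2"
      using dissipation_lower_bound[OF w, of a] by (simp add: complete cinner_self k_def)
    \<comment> \<open>The quantity in the two-point inequality times w - conj z, with Y_z c = c - (z
      - i) G_z c inserted. In this form its coefficients no longer grow with z, and it tends to <R_w
      a, c>.\<close>
    define num where "num z = cinner k c - cinner a (G z c) - (w + \<i>) * cinner k (G z c)" for z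
    have inner_lim: "((\<lambda>z. cinner x (G z c)) \<longlongrightarrow> 0) ?F" for x
    proof -
      have "((\<lambda>z. cnj (cinner (G z c) x)) \<longlongrightarrow> cnj (cinner 0 x)) ?F"
        by (intro tendsto_cnj tendsto_cinner_left h_lim)
      then show ?thesis by (simp only: cinner_commute[symmetric] cinner_zero_left complex_cnj_zero)
    qed
    have num_lim: "((\<lambda>z. (cmod (num z))\<^sup>2) \<longlongrightarrow> (cmod (cinner k c - 0 - (w + \<i>) * 0))\<^sup>2) ?F"
      unfolding num_def by (intro tendsto_intros inner_lim)
    have freq: "\<exists>\<^sub>F z in ?F. (cmod (num z))\<^sup>2 \<le> K * (D w a - (norm k)\<^sup>2)"
    proof -
      have "\<forall>\<^sub>F z in ?F. z \<in> upper_sector \<epsilon> \<and> max 1 (cmod w) \<le> cmod z"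
        using eventually_sector_at_infinity filterlim_at_top[THEN iffD1, OF cmod_sector_at_infinity]
        by (simp add: eventually_conj)
      from frequently_eventually_conj[OF C this] show ?thesis
      proof (rule frequently_elim1)
        fix z assume "(z \<in> upper_sector \<epsilon> \<and> max 1 (cmod w) \<le> cmod z) \<and> cmod z * (norm \<psi> - norm (param z \<psi>)) < C"
        then have zs: "z \<in> upper_sector \<epsilon>" and zw: "cmod w \<le> cmod z" and z1: "1 \<le> cmod z"
          and zC: "cmod z * (norm \<psi> - norm (param z \<psi>)) < C" by auto
        have z: "z \<in> upper_half_plane" using zs by (simp add: upper_sector_def)
        note zb = upper_sector_bounds[OF \<epsilon> zs]
        have wz: "w - cnj z \<noteq> 0" using uhp_ne(2)[OF z] uhp_ne(2)[OF w] by (auto simp: complex_eq_iff)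
        let ?x = "Y z c" and ?h = "G z c"
        have hR: "R z ?x = ?h" by (simp add: G_eq[OF z])
        have x: "?x = c - (z - \<i>) *\<^sub>C ?h" by (rule Y_G[OF z])
        have "(cinner k ?x - cinner a ?h) / (w - cnj z) - cinner k ?h = num z / (w - cnj z)"
        proof -
          have "cinner k ?x = cinner k c - (cnj z + \<i>) * cinner k ?h"
            unfolding x by (simp add: cinner_diff_right cinner_scaleC_right)
          then have "cinner k ?x - cinner a ?h - (w - cnj z) * cinner k ?h = num z"
            by (simp add: num_def algebra_simps)
          then show ?thesis using wz by (simp add: divide_simps mult.commute)
        qed
        then have "(cmod (num z / (w - cnj z)))\<^sup>2 \<le> (D z ?x - (norm ?h)\<^sup>2) * (D w a - (norm k)\<^sup>2)"
          using two_point_inequality[OF complete z w, of a ?x] unfolding hR k_def[symmetric] by simp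
        then have 1: "(cmod (num z))\<^sup>2 \<le> (cmod (w - cnj z))\<^sup>2 * ((D z ?x - (norm ?h)\<^sup>2) * (D w a - (norm k)\<^sup>2))"
          using wz by (simp add: norm_divide power_divide field_simps)
        let ?d = "norm \<psi> - norm (U z \<psi>)"
        have d0: "0 \<le> ?d" using norm_U_le[OF z] by simp
        have fg': "(- f, - g) \<in> A" using scale_mem[OF fg, of "- 1"] by (simp add: scaleC_minus_one)
        have c_eq: "c = (- g - \<i> *\<^sub>C - f) + \<psi>" by (simp add: c_def scaleC_minus_right)
        have "(norm c)\<^sup>2 - (norm (U z c))\<^sup>2 = (norm \<psi>)\<^sup>2 - (norm (U z \<psi>))\<^sup>2"
          unfolding c_eq by (rule norm_defect_param[OF z fg' \<psi>])
        then have "4 * (Im z * (D z ?x - (norm ?h)\<^sup>2)) = (norm \<psi> + norm (U z \<psi>)) * ?d"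
          unfolding norm_defect_U[OF z, of c, symmetric] by (simp add: power2_eq_square algebra_simps)
        also have "\<dots> \<le> (2 * norm \<psi>) * ?d" using d0 by (intro mult_right_mono) auto
        finally have 2: "2 * (Im z * (D z ?x - (norm ?h)\<^sup>2)) \<le> norm \<psi> * ?d" by simp
        have Dh0: "0 \<le> D z ?x - (norm ?h)\<^sup>2"
          using dissipation_lower_bound[OF z, of ?x] by (simp add: complete cinner_self hR)
        have "2 * (sin \<epsilon> * cmod z) * (D z ?x - (norm ?h)\<^sup>2) \<le> 2 * (Im z * (D z ?x - (norm ?h)\<^sup>2))"
          using mult_right_mono[OF zb(2) Dh0] by (simp add: mult.assoc)
        with 2 have "2 * (sin \<epsilon> * cmod z) * (D z ?x - (norm ?h)\<^sup>2) \<le> norm \<psi> * ?d" by linarith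
        then have "cmod z * (2 * (sin \<epsilon> * cmod z) * (D z ?x - (norm ?h)\<^sup>2)) \<le> cmod z * (norm \<psi> * ?d)"
          by (rule mult_left_mono) simp
        also have "\<dots> = norm \<psi> * (cmod z * ?d)" by simp
        also have "\<dots> \<le> norm \<psi> * \<bar>C\<bar>"
          using zC z \<psi> by (intro mult_left_mono) (auto simp: param_eq)
        finally have 3: "4 * (cmod z)\<^sup>2 * (D z ?x - (norm ?h)\<^sup>2) \<le> K"
          using sin by (simp add: K_def field_simps power2_eq_square)
        have "cmod (w - cnj z) \<le> 2 * cmod z"
          using norm_triangle_ineq4[of w "cnj z"] zw by simp
        then have "(cmod (w - cnj z))\<^sup>2 \<le> (2 * cmod z)\<^sup>2" by (intro power_mono) auto
        then have "(cmod (w - cnj z))\<^sup>2 * (D z ?x - (norm ?h)\<^sup>2) \<le> (2 * cmod z)\<^sup>2 * (D z ?x - (norm ?h)\<^sup>2)"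
          using Dh0 by (rule mult_right_mono)
        also have "\<dots> \<le> K" using 3 by (simp add: power_mult_distrib)
        finally have "(cmod (w - cnj z))\<^sup>2 * (D z ?x - (norm ?h)\<^sup>2) * (D w a - (norm k)\<^sup>2) \<le> K * (D w a - (norm k)\<^sup>2)"
          using Dk by (rule mult_right_mono)
        with 1 show "(cmod (num z))\<^sup>2 \<le> K * (D w a - (norm k)\<^sup>2)" by (simp add: mult.assoc)
      qed
    qed
    show "(cmod (cinner (R w a) c))\<^sup>2 \<le> K * (D w a - (norm (R w a))\<^sup>2)"
    proof (rule ccontr)
      assume "\<not> ?thesis"
      then have "\<forall>\<^sub>F z in ?F. K * (D w a - (norm k)\<^sup>2) < (cmod (num z))\<^sup>2"
        by (intro order_tendstoD(1)[OF num_lim]) (simp add: k_def)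
      from frequently_eventually_conj[OF freq this] have "\<exists>\<^sub>F z in ?F. False"
        by (rule frequently_elim1) linarith
      then show False by (simp add: frequently_def)
    qed
  qed
  then have "\<psi> \<in> cayley_domain" using cayley_domainI[OF fg] by (simp add: c_def)
  then show "\<psi> = 0" using defect_proj_zero defect_proj_id[OF \<psi>] by simp
qed

end

subsection \<open>Moments of spectral measures\<close>

context generalized_resolvent
begin

text \<open>Fatou's lemma along the imaginary axis gives the integrability of $t^2 w$.\<close>

lemma moment_step:
  assumes complete: "\<And>u. E u = u" and fg: "(f, g) \<in> A"
    and M: "finite_borel_measure M" and w_meas: "w \<in> borel_measurable borel" and w0: "\<And>t. 0 \<le> w t"
    and w_int: "integrable M w"
    and rep: "\<And>z. z \<in> upper_half_plane \<Longrightarrow> cinner (R z f) f = (\<integral>t. complex_of_real (w t) / (complex_of_real t - z) \<partial>M)"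
  shows "(\<integral>t. w t \<partial>M) = (norm f)\<^sup>2"
    and "integrable M (\<lambda>t. t * w t)" and "complex_of_real (\<integral>t. t * w t \<partial>M) = cinner f g"
    and "integrable M (\<lambda>t. t\<^sup>2 * w t)"
    and "\<And>z. z \<in> upper_half_plane \<Longrightarrow> cinner (R z g) g = (\<integral>t. complex_of_real (t\<^sup>2 * w t) / (complex_of_real t - z) \<partial>M)"
proof -
  let ?F = "sector_at_infinity (pi / 2)"
  note nb = sector_at_infinity_neq_bot[OF half_pi]
  interpret finite_borel_measure M by fact
  have [measurable_cong]: "sets M = sets borel" by (rule M_is_borel)
  note w_meas[measurable]
  have cw: "integrable M (\<lambda>t. complex_of_real (w t))" using w_int by (rule integrable_of_real)
  have "((\<lambda>z. - z * (\<integral>t. complex_of_real (w t) / (complex_of_real t - z) \<partial>M)) \<longlongrightarrow> (\<integral>t. complex_of_real (w t) \<partial>M)) ?F"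
    by (rule resolvent_kernel_integral_limit[OF M cw half_pi])
  then have "((\<lambda>z. - z * cinner (R z f) f) \<longlongrightarrow> (\<integral>t. complex_of_real (w t) \<partial>M)) ?F"
    by (rule Lim_transform_eventually) (use eventually_sector_uhp in \<open>eventually_elim, simp add: rep\<close>)
  from tendsto_unique[OF nb this pol_one_limit[OF half_pi]]
  have "complex_of_real (\<integral>t. w t \<partial>M) = complex_of_real ((norm f)\<^sup>2)"
    by (simp only: cinner_E[symmetric] complete cinner_self integral_complex_of_real)
  then show mass: "(\<integral>t. w t \<partial>M) = (norm f)\<^sup>2" by (simp only: of_real_eq_iff)
  \<comment> \<open>From R_z g = f + z R_z f and its adjoint counterpart. On the level of transforms
    this is multiplication of the density by t^2, up to terms polynomial in z.\<close>
  have R_g: "cinner (R z g) g = cinner f g + z * complex_of_real ((norm f)\<^sup>2) + z\<^sup>2 * cinner (R z f) f"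
    if z: "z \<in> upper_half_plane" for z
  proof -
    have "R z g = R z ((g - z *\<^sub>C f) + z *\<^sub>C f)" by simp
    then have 1: "R z g = f + z *\<^sub>C R z f"
      unfolding clinear_op_add[OF lin[OF z]] clinear_op_scale[OF lin[OF z]] extends[OF z fg] .
    have "cinner (R z f) g = cinner (R z f) (g - cnj z *\<^sub>C f) + z * cinner (R z f) f"
      by (simp add: cinner_diff_right cinner_scaleC_right)
    also have "\<dots> = cinner f f + z * cinner (R z f) f" unfolding extends_adjoint[OF z fg] ..
    finally show ?thesis unfolding 1
      by (simp add: cinner_add_left cinner_scaleC_left cinner_self power2_eq_square algebra_simps)
  qed
  \<comment> \<open>At z = i k the formula becomes the integral of k^2 t^2 / (t^2 + k^2) w, whose
    integrand tends to t^2 w and whose value is at most |g|^2 by the norm bound for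
    \<open>R\<close>.\<close>
  have iy_eq: "real k * Im (cinner (R (\<i> * complex_of_real (real k)) g) g)
      = (\<integral>t. (real k)\<^sup>2 * t\<^sup>2 / (t\<^sup>2 + (real k)\<^sup>2) * w t \<partial>M)"
    and iy_int: "integrable M (\<lambda>t. (real k)\<^sup>2 * t\<^sup>2 / (t\<^sup>2 + (real k)\<^sup>2) * w t)"
    if k: "0 < k" for k :: nat
  proof -
    define y where "y = real k"
    have y: "0 < y" using k by (simp add: y_def)
    let ?z = "\<i> * complex_of_real y"
    have z: "?z \<in> upper_half_plane" by (rule iy_uhp[OF y])
    have ki: "integrable M (\<lambda>t. complex_of_real (w t) / (complex_of_real t - ?z))"
      by (rule integrable_mult_resolvent_kernel[OF M _ cw]) (use y in simp)
    have "Re (complex_of_real (w t) / (complex_of_real t - ?z)) = t * w t / (t\<^sup>2 + y\<^sup>2)" for t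
      by (simp add: Re_divide power2_eq_square)
    have im: "Im (complex_of_real (w t) / (complex_of_real t - ?z)) = y * w t / (t\<^sup>2 + y\<^sup>2)" for t
      by (simp add: Im_divide power2_eq_square mult.commute)
    have z2: "(\<i> * complex_of_real y)\<^sup>2 = complex_of_real (- (y\<^sup>2))"
      by (simp add: power_mult_distrib)
    have i2: "integrable M (\<lambda>t. y * w t / (t\<^sup>2 + y\<^sup>2))"
      using integrable_Im[OF ki] unfolding im .
    have eq: "y\<^sup>2 * t\<^sup>2 / (t\<^sup>2 + y\<^sup>2) * w t = y\<^sup>2 * w t - y\<^sup>2 * y * (y * w t / (t\<^sup>2 + y\<^sup>2))" for t
    proof -
      have "t\<^sup>2 + y\<^sup>2 \<noteq> 0" using y by (simp add: add_nonneg_eq_0_iff)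
      then show ?thesis by (simp add: field_simps power2_eq_square)
    qed
    show "integrable M (\<lambda>t. (real k)\<^sup>2 * t\<^sup>2 / (t\<^sup>2 + (real k)\<^sup>2) * w t)"
      unfolding y_def[symmetric] eq using i2 w_int
      by (intro Bochner_Integration.integrable_diff integrable_mult_right)
    have "Im (cinner (R ?z g) g) = y * (norm f)\<^sup>2 - y\<^sup>2 * Im (cinner (R ?z f) f)"
      unfolding R_g[OF z] z2 using cinner_real[OF fg] by simp
    also have "Im (cinner (R ?z f) f) = (\<integral>t. y * w t / (t\<^sup>2 + y\<^sup>2) \<partial>M)"
      unfolding rep[OF z] im[symmetric] using ki by simp
    finally have "y * Im (cinner (R ?z g) g) = y\<^sup>2 * (\<integral>t. w t \<partial>M) - y\<^sup>2 * y * (\<integral>t. y * w t / (t\<^sup>2 + y\<^sup>2) \<partial>M)"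
      by (simp add: mass power2_eq_square right_diff_distrib)
    also have "\<dots> = (\<integral>t. y\<^sup>2 * t\<^sup>2 / (t\<^sup>2 + y\<^sup>2) * w t \<partial>M)"
      unfolding eq
      by (subst Bochner_Integration.integral_diff[OF integrable_mult_right[OF w_int] integrable_mult_right[OF i2]])
         (simp only: integral_mult_right_zero)
    finally show "real k * Im (cinner (R (\<i> * complex_of_real (real k)) g) g)
      = (\<integral>t. (real k)\<^sup>2 * t\<^sup>2 / (t\<^sup>2 + (real k)\<^sup>2) * w t \<partial>M)" by (simp add: y_def)
  qed
  have iy_le: "(\<integral>t. (real k)\<^sup>2 * t\<^sup>2 / (t\<^sup>2 + (real k)\<^sup>2) * w t \<partial>M) \<le> (norm g)\<^sup>2" if k: "0 < k" for k :: nat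
  proof -
    let ?z = "\<i> * complex_of_real (real k)"
    have z: "?z \<in> upper_half_plane" using k by (intro iy_uhp) simp
    have "Im (cinner (R ?z g) g) \<le> cmod (cinner (R ?z g) g)" using abs_Im_le_cmod[of "cinner (R ?z g) g"] by simp
    also have "\<dots> \<le> norm (R ?z g) * norm g" by (rule cinner_cauchy_schwarz)
    also have "\<dots> \<le> norm g / real k * norm g" using R_bound[OF z, of g] by (intro mult_right_mono) auto
    finally have "real k * Im (cinner (R ?z g) g) \<le> real k * (norm g / real k * norm g)" by (intro mult_left_mono) auto
    also have "\<dots> = (norm g)\<^sup>2" using k by (simp add: power2_eq_square)
    finally show ?thesis by (simp only: iy_eq[OF k])
  qed
  have "(\<integral>\<^sup>+t. ennreal (t\<^sup>2 * w t) \<partial>M) = (\<integral>\<^sup>+t. liminf (\<lambda>k. ennreal ((real k)\<^sup>2 * t\<^sup>2 / (t\<^sup>2 + (real k)\<^sup>2) * w t)) \<partial>M)"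
  proof (rule nn_integral_cong, rule lim_imp_Liminf[OF sequentially_bot, symmetric], rule tendsto_ennrealI)
    fix t
    have "(\<lambda>k. (real k)\<^sup>2 * t\<^sup>2 / (t\<^sup>2 + (real k)\<^sup>2)) \<longlonglongrightarrow> t\<^sup>2" by real_asymp
    then show "(\<lambda>k. (real k)\<^sup>2 * t\<^sup>2 / (t\<^sup>2 + (real k)\<^sup>2) * w t) \<longlonglongrightarrow> t\<^sup>2 * w t" by (rule tendsto_mult_right)
  qed
  also have "\<dots> \<le> liminf (\<lambda>k. \<integral>\<^sup>+t. ennreal ((real k)\<^sup>2 * t\<^sup>2 / (t\<^sup>2 + (real k)\<^sup>2) * w t) \<partial>M)"
    by (rule nn_integral_liminf) measurable
  also have "\<dots> \<le> liminf (\<lambda>k::nat. ennreal ((norm g)\<^sup>2))"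
  proof (rule Liminf_mono, rule eventually_mono[OF eventually_gt_at_top[of 0]])
    fix k :: nat assume k: "0 < k"
    have "(\<integral>\<^sup>+t. ennreal ((real k)\<^sup>2 * t\<^sup>2 / (t\<^sup>2 + (real k)\<^sup>2) * w t) \<partial>M) = ennreal (\<integral>t. (real k)\<^sup>2 * t\<^sup>2 / (t\<^sup>2 + (real k)\<^sup>2) * w t \<partial>M)"
      by (rule nn_integral_eq_integral[OF iy_int[OF k]]) (simp add: w0)
    then show "(\<integral>\<^sup>+t. ennreal ((real k)\<^sup>2 * t\<^sup>2 / (t\<^sup>2 + (real k)\<^sup>2) * w t) \<partial>M) \<le> ennreal ((norm g)\<^sup>2)"
      using iy_le[OF k] by (simp add: ennreal_leI)
  qed
  also have "\<dots> = ennreal ((norm g)\<^sup>2)" by (simp add: Liminf_const)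
  finally have fin: "(\<integral>\<^sup>+t. ennreal (t\<^sup>2 * w t) \<partial>M) < \<infinity>"
    using ennreal_less_top le_less_trans by fastforce
  show t2: "integrable M (\<lambda>t. t\<^sup>2 * w t)"
    by (rule integrableI_nonneg) (use w0 fin in auto)
  show t1: "integrable M (\<lambda>t. t * w t)"
  proof (rule Bochner_Integration.integrable_bound[OF Bochner_Integration.integrable_add[OF w_int t2]])
    show "AE t in M. norm (t * w t) \<le> norm (w t + t\<^sup>2 * w t)"
    proof (rule AE_I2)
      fix t :: real
      have "\<bar>t\<bar> \<le> 1 + t\<^sup>2" using sum_squares_bound[of "\<bar>t\<bar>" 1] by simp
      then have "\<bar>t\<bar> * w t \<le> (1 + t\<^sup>2) * w t" using w0 by (rule mult_right_mono)
      also have "\<dots> = w t + t\<^sup>2 * w t" by (simp add: distrib_right)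
      finally show "norm (t * w t) \<le> norm (w t + t\<^sup>2 * w t)" using w0[of t] by (simp add: abs_mult)
    qed
  qed measurable
  define B where "B = complex_of_real (\<integral>t. t * w t \<partial>M)"
  have ct1: "integrable M (\<lambda>t. complex_of_real (t * w t))" using t1 by (rule integrable_of_real)
  have ct2: "integrable M (\<lambda>t. complex_of_real (t\<^sup>2 * w t))" using t2 by (rule integrable_of_real)
  \<comment> \<open>Uses t^2/(t - z) = z^2/(t - z) + z + t. Comparison with \<open>R_g\<close>
    leaves the constant B - <f, g>; both transforms tend to 0 at infinity, so it vanishes, which is
    the value of the first moment.\<close>
  have T: "(\<integral>t. complex_of_real (t\<^sup>2 * w t) / (complex_of_real t - z) \<partial>M) = cinner (R z g) g - cinner f g + B"
    if z: "z \<in> upper_half_plane" for z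
  proof -
    have ne: "complex_of_real t - z \<noteq> 0" for t using uhp_ne(2)[OF z] by (auto simp: complex_eq_iff)
    have i1: "integrable M (\<lambda>t. complex_of_real (w t) / (complex_of_real t - z))"
      by (rule integrable_mult_resolvent_kernel[OF M _ cw]) (use uhp_ne(2)[OF z] in simp)
    have "complex_of_real (t\<^sup>2 * w t) / (complex_of_real t - z) =
       (z\<^sup>2 * (complex_of_real (w t) / (complex_of_real t - z)) + z * complex_of_real (w t)) + complex_of_real (t * w t)" for t
      using ne[of t] by (simp add: divide_simps) (simp add: algebra_simps power2_eq_square)
    then have "(\<integral>t. complex_of_real (t\<^sup>2 * w t) / (complex_of_real t - z) \<partial>M) =
       (\<integral>t. (z\<^sup>2 * (complex_of_real (w t) / (complex_of_real t - z)) + z * complex_of_real (w t)) + complex_of_real (t * w t) \<partial>M)"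
      by (simp only:)
    also have "\<dots> = (\<integral>t. z\<^sup>2 * (complex_of_real (w t) / (complex_of_real t - z)) \<partial>M) + (\<integral>t. z * complex_of_real (w t) \<partial>M)
        + (\<integral>t. complex_of_real (t * w t) \<partial>M)"
      by (subst Bochner_Integration.integral_add[OF Bochner_Integration.integrable_add[OF integrable_mult_right[OF i1] integrable_mult_right[OF cw]] ct1],
          subst Bochner_Integration.integral_add[OF integrable_mult_right[OF i1] integrable_mult_right[OF cw]]) (rule refl)
    also have "\<dots> = z\<^sup>2 * cinner (R z f) f + z * complex_of_real ((norm f)\<^sup>2) + B"
      by (simp only: integral_mult_right_zero rep[OF z, symmetric] integral_complex_of_real mass B_def)
    finally show ?thesis unfolding R_g[OF z] by simp
  qed
  have z_inv: "((\<lambda>z. inverse (- z)) \<longlongrightarrow> 0) ?F"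
  proof (rule filterlim_compose[OF tendsto_inverse_0])
    show "filterlim (\<lambda>z. - z) at_infinity ?F"
      using cmod_sector_at_infinity by (simp add: filterlim_at_infinity_conv_norm_at_top)
  qed
  have "((\<lambda>z. inverse (- z) * (- z * (\<integral>t. complex_of_real (t\<^sup>2 * w t) / (complex_of_real t - z) \<partial>M))) \<longlongrightarrow>
       0 * (\<integral>t. complex_of_real (t\<^sup>2 * w t) \<partial>M)) ?F"
    by (intro tendsto_mult z_inv resolvent_kernel_integral_limit[OF M ct2 half_pi])
  then have "((\<lambda>z. cinner (R z g) g - cinner f g + B) \<longlongrightarrow> 0 * (\<integral>t. complex_of_real (t\<^sup>2 * w t) \<partial>M)) ?F"
  proof (rule Lim_transform_eventually)
    show "\<forall>\<^sub>F z in ?F. inverse (- z) * (- z * (\<integral>t. complex_of_real (t\<^sup>2 * w t) / (complex_of_real t - z) \<partial>M))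
        = cinner (R z g) g - cinner f g + B"
      using eventually_sector_uhp
    proof eventually_elim
      case (elim z)
      then have "z \<noteq> 0" by (auto simp: upper_half_plane_def)
      then show ?case unfolding T[OF elim] by simp
    qed
  qed
  moreover have "((\<lambda>z. cinner (R z g) g - cinner f g + B) \<longlongrightarrow> cinner 0 g - cinner f g + B) ?F"
    by (intro tendsto_intros tendsto_cinner_left R_tendsto_zero half_pi)
  ultimately have "0 * (\<integral>t. complex_of_real (t\<^sup>2 * w t) \<partial>M) = cinner 0 g - cinner f g + B"
    by (rule tendsto_unique[OF nb])
  then show B: "complex_of_real (\<integral>t. t * w t \<partial>M) = cinner f g" by (simp add: B_def)
  show "cinner (R z g) g = (\<integral>t. complex_of_real (t\<^sup>2 * w t) / (complex_of_real t - z) \<partial>M)"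
    if "z \<in> upper_half_plane" for z
    unfolding T[OF that] using B by (simp add: B_def)
qed

text \<open>Each link multiplies the density by t^2, so the measure of \<open>y r\<close> is t^(2r)
  times that of \<open>y 0\<close>, and \<open>moment_step\<close> applies again with this
  weight.\<close>

lemma chain_moments:
  assumes complete: "\<And>u. E u = u" and chain: "\<And>r. r < d \<Longrightarrow> (y r, y (Suc r)) \<in> A" and r: "r \<le> d"
  shows "integrable (\<mu> (y 0)) (\<lambda>t. t ^ (2 * r))"
    and "z \<in> upper_half_plane \<Longrightarrow> cinner (R z (y r)) (y r) = (\<integral>t. complex_of_real (t ^ (2 * r)) / (complex_of_real t - z) \<partial>\<mu> (y 0))"
proof -
  have "integrable (\<mu> (y 0)) (\<lambda>t. t ^ (2 * r)) \<and> (\<forall>z\<in>upper_half_plane.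
      cinner (R z (y r)) (y r) = (\<integral>t. complex_of_real (t ^ (2 * r)) / (complex_of_real t - z) \<partial>\<mu> (y 0)))"
    using r
  proof (induction r)
    case 0
    interpret finite_borel_measure "\<mu> (y 0)" by (rule finite_borel_\<mu>)
    show ?case by (simp add: R_\<mu>)
  next
    case (Suc r)
    then have "r < d" "integrable (\<mu> (y 0)) (\<lambda>t. t ^ (2 * r))" and
      rep: "\<And>z. z \<in> upper_half_plane \<Longrightarrow> cinner (R z (y r)) (y r) = (\<integral>t. complex_of_real (t ^ (2 * r)) / (complex_of_real t - z) \<partial>\<mu> (y 0))"
      by auto
    note step = moment_step[OF complete chain[OF \<open>r < d\<close>] finite_borel_\<mu> _ _ this(2) rep]
    have t: "t ^ (2 * Suc r) = t\<^sup>2 * t ^ (2 * r)" for t :: real by (simp add: power_add[symmetric])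
    show ?case
      unfolding t using step(4,5) by simp
  qed
  then show "integrable (\<mu> (y 0)) (\<lambda>t. t ^ (2 * r))"
    "z \<in> upper_half_plane \<Longrightarrow> cinner (R z (y r)) (y r) = (\<integral>t. complex_of_real (t ^ (2 * r)) / (complex_of_real t - z) \<partial>\<mu> (y 0))"
    by auto
qed

text \<open>The last link of the chain is treated separately because \<open>y d\<close> need not lie in the domain.\<close>

lemma chain_moment_values:
  assumes complete: "\<And>u. E u = u" and chain: "\<And>r. r < d \<Longrightarrow> (y r, y (Suc r)) \<in> A"
  shows "r \<le> d \<Longrightarrow> (\<integral>t. t ^ (2 * r) \<partial>\<mu> (y 0)) = (norm (y r))\<^sup>2"
    and "r < d \<Longrightarrow> integrable (\<mu> (y 0)) (\<lambda>t. t ^ (2 * r + 1))"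
    and "r < d \<Longrightarrow> complex_of_real (\<integral>t. t ^ (2 * r + 1) \<partial>\<mu> (y 0)) = cinner (y r) (y (Suc r))"
proof -
  show "(\<integral>t. t ^ (2 * r) \<partial>\<mu> (y 0)) = (norm (y r))\<^sup>2" if r: "r \<le> d"
  proof -
    let ?F = "sector_at_infinity (pi / 2)"
    have "((\<lambda>z. - z * (\<integral>t. complex_of_real (t ^ (2 * r)) / (complex_of_real t - z) \<partial>\<mu> (y 0))) \<longlongrightarrow> (\<integral>t. complex_of_real (t ^ (2 * r)) \<partial>\<mu> (y 0))) ?F"
      by (rule resolvent_kernel_integral_limit[OF finite_borel_\<mu> integrable_of_real[OF chain_moments(1)[where y = y and d = d and r = r, OF complete chain r]] half_pi])
    then have "((\<lambda>z. - z * cinner (R z (y r)) (y r)) \<longlongrightarrow> (\<integral>t. complex_of_real (t ^ (2 * r)) \<partial>\<mu> (y 0))) ?F"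
      by (rule Lim_transform_eventually)
         (use eventually_sector_uhp in \<open>eventually_elim, simp only: chain_moments(2)[where y = y and d = d and r = r, OF complete chain r]\<close>)
    from tendsto_unique[OF sector_at_infinity_neq_bot[OF half_pi] this pol_one_limit[OF half_pi]]
    have "complex_of_real (\<integral>t. t ^ (2 * r) \<partial>\<mu> (y 0)) = complex_of_real ((norm (y r))\<^sup>2)"
      by (simp only: cinner_E[symmetric] complete cinner_self integral_complex_of_real)
    then show ?thesis by (simp only: of_real_eq_iff)
  qed
  assume r: "r < d"
  note cm = chain_moments[where y = y and d = d and r = r, OF complete chain less_imp_le[OF r]]
  have t: "t ^ (2 * r + 1) = t * t ^ (2 * r)" for t :: real by simp
  have w: "(\<lambda>t::real. t ^ (2 * r)) \<in> borel_measurable borel" "\<And>t::real. 0 \<le> t ^ (2 * r)" by auto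
  show "integrable (\<mu> (y 0)) (\<lambda>t. t ^ (2 * r + 1))"
    unfolding t by (rule moment_step(2)[OF complete chain[OF r] finite_borel_\<mu> w cm])
  show "complex_of_real (\<integral>t. t ^ (2 * r + 1) \<partial>\<mu> (y 0)) = cinner (y r) (y (Suc r))"
    unfolding t by (rule moment_step(3)[OF complete chain[OF r] finite_borel_\<mu> w cm])
qed

end

subsection \<open>Stieltjes integrals in four parts\<close>

text \<open>A complex identity from a positivity statement: every complex multiple of the difference
  of the two sides vanishes on intervals, so its integral has nonnegative real part. The multiple
  -conj X of the difference X then gives -|X|^2 \<ge> 0.\<close>

lemma stieltjes_combination_eq:
  fixes \<mu> :: "'i \<Rightarrow> real measure" and \<nu> :: "'j \<Rightarrow> real measure" and f :: "real \<Rightarrow> complex"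
    and \<alpha> :: "'i \<Rightarrow> complex" and \<beta> :: "'j \<Rightarrow> complex"
  assumes fin: "finite I" "finite J"
    and \<mu>: "\<And>i. i \<in> I \<Longrightarrow> finite_borel_measure (\<mu> i)" and \<nu>: "\<And>j. j \<in> J \<Longrightarrow> finite_borel_measure (\<nu> j)"
    and cont: "continuous_on UNIV f" and bound: "\<And>t. cmod (f t) \<le> C * (1 + \<bar>t\<bar>) ^ m"
    and int: "\<And>i. i \<in> I \<Longrightarrow> integrable (\<mu> i) (\<lambda>t. (1 + \<bar>t\<bar>) ^ m)" "\<And>j. j \<in> J \<Longrightarrow> integrable (\<nu> j) (\<lambda>t. (1 + \<bar>t\<bar>) ^ m)"
    and eq: "\<And>a b. a \<le> b \<Longrightarrow> (\<Sum>i\<in>I. \<alpha> i * measure (\<mu> i) {a..<b}) = (\<Sum>j\<in>J. \<beta> j * measure (\<nu> j) {a..<b})"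
  shows "(\<Sum>i\<in>I. \<alpha> i * (\<integral>t. f t \<partial>\<mu> i)) = (\<Sum>j\<in>J. \<beta> j * (\<integral>t. f t \<partial>\<nu> j))"
proof -
  define c where "c = (\<lambda>p. case p of Inl i \<Rightarrow> \<alpha> i | Inr j \<Rightarrow> - \<beta> j)"
  define M where "M = (\<lambda>p. case p of Inl i \<Rightarrow> \<mu> i | Inr j \<Rightarrow> \<nu> j)"
  define X where "X = (\<Sum>i\<in>I. \<alpha> i * (\<integral>t. f t \<partial>\<mu> i)) - (\<Sum>j\<in>J. \<beta> j * (\<integral>t. f t \<partial>\<nu> j))"
  define \<zeta> where "\<zeta> = - cnj X"
  have split: "(\<Sum>p\<in>I <+> J. c p * g (M p)) = (\<Sum>i\<in>I. \<alpha> i * g (\<mu> i)) - (\<Sum>j\<in>J. \<beta> j * g (\<nu> j))" for g :: "real measure \<Rightarrow> complex"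
    using fin by (simp add: sum.Plus c_def M_def sum_negf)
  define K where "K = cmod \<zeta> * (\<Sum>p\<in>I <+> J. cmod (c p))"
  have finp: "finite (I <+> J)" using fin by simp
  have C0: "0 \<le> C * (1 + \<bar>t\<bar>) ^ m" for t using bound[of t] norm_ge_zero order_trans by blast
  have "0 \<le> Re (\<Sum>p\<in>I <+> J. \<integral>t. \<zeta> * (c p * f t) \<partial>M p)"
  proof (rule stieltjes_form_nonneg[OF finp, where C = "K * C" and m = m])
    show "finite_borel_measure (M p)" "integrable (M p) (\<lambda>t. (1 + \<bar>t\<bar>) ^ m)" if "p \<in> I <+> J" for p
      using that \<mu> \<nu> int by (auto simp: M_def)
    show "continuous_on UNIV (\<lambda>t. \<zeta> * (c p * f t))" for p by (intro continuous_intros cont)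
    fix p t assume p: "p \<in> I <+> J"
    have "cmod (\<zeta> * (c p * f t)) = (cmod \<zeta> * cmod (c p)) * cmod (f t)" by (simp add: norm_mult)
    also have "\<dots> \<le> K * (C * (1 + \<bar>t\<bar>) ^ m)"
      unfolding K_def using finp p
      by (intro mult_mono bound mult_left_mono member_le_sum) (auto intro!: mult_nonneg_nonneg sum_nonneg)
    finally show "cmod (\<zeta> * (c p * f t)) \<le> K * C * (1 + \<bar>t\<bar>) ^ m" by (simp add: mult.assoc)
  next
    fix t a b :: real assume "a \<le> b"
    have "(\<Sum>p\<in>I <+> J. \<zeta> * (c p * f t) * complex_of_real (measure (M p) {a..<b}))
        = \<zeta> * f t * (\<Sum>p\<in>I <+> J. c p * complex_of_real (measure (M p) {a..<b}))"
      by (simp add: sum_distrib_left mult_ac)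
    also have "\<dots> = 0" unfolding split[of "\<lambda>M. complex_of_real (measure M {a..<b})"] using eq[OF \<open>a \<le> b\<close>] by simp
    finally show "0 \<le> Re (\<Sum>p\<in>I <+> J. \<zeta> * (c p * f t) * complex_of_real (measure (M p) {a..<b}))" by simp
  qed
  also have "(\<Sum>p\<in>I <+> J. \<integral>t. \<zeta> * (c p * f t) \<partial>M p) = \<zeta> * X"
    unfolding X_def split[of "\<lambda>M. \<integral>t. f t \<partial>M", symmetric] by (simp add: sum_distrib_left)
  also have "Re (\<zeta> * X) = - (cmod X)\<^sup>2"
    unfolding \<zeta>_def cmod_power2 by (simp add: power2_eq_square)
  finally have "X = 0" by simp
  then show ?thesis by (simp add: X_def)
qed

lemma integrable_one_plus_abs_power:
  assumes \<mu>: "finite_borel_measure \<mu>" and int: "integrable \<mu> (\<lambda>t. complex_of_real (t ^ n))" and m: "m \<le> n"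
  shows "integrable \<mu> (\<lambda>t. (1 + \<bar>t\<bar>) ^ m)"
proof -
  interpret finite_borel_measure \<mu> by fact
  have [measurable_cong]: "sets \<mu> = sets borel" by (rule M_is_borel)
  have "integrable \<mu> (\<lambda>t. 2 ^ n * (1 + cmod (complex_of_real (t ^ n))))"
    using int by (intro integrable_mult_right Bochner_Integration.integrable_add integrable_const integrable_norm)
  then show ?thesis
  proof (rule Bochner_Integration.integrable_bound)
    show "AE t in \<mu>. norm ((1 + \<bar>t\<bar>) ^ m) \<le> norm (2 ^ n * (1 + cmod (complex_of_real (t ^ n))))"
    proof (rule AE_I2)
      fix t :: real
      have "(1 + \<bar>t\<bar>) ^ m \<le> (1 + \<bar>t\<bar>) ^ n" by (rule power_increasing[OF m]) simp
      also have "\<dots> \<le> (2 * max 1 \<bar>t\<bar>) ^ n" by (rule power_mono) auto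
      also have "\<dots> = 2 ^ n * (max 1 \<bar>t\<bar>) ^ n" by (rule power_mult_distrib)
      also have "(max 1 \<bar>t\<bar>) ^ n \<le> 1 + \<bar>t\<bar> ^ n" by (cases "\<bar>t\<bar> \<le> 1") (auto simp: max_def)
      finally have "(1 + \<bar>t\<bar>) ^ m \<le> 2 ^ n * (1 + \<bar>t\<bar> ^ n)" by simp
      then show "norm ((1 + \<bar>t\<bar>) ^ m) \<le> norm (2 ^ n * (1 + cmod (complex_of_real (t ^ n))))"
        by (simp add: norm_power power_abs[symmetric])
    qed
  qed measurable
qed

text \<open>The four parts of a complex measure are numbered so that part \<open>\<sigma>\<close> has the weight \<open>\<i> ^ \<sigma>\<close>.\<close>

definition stieltjes_parts :: "(real \<Rightarrow> complex) \<Rightarrow> (nat \<Rightarrow> real measure) \<Rightarrow> bool" where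
  "stieltjes_parts m \<nu> \<longleftrightarrow> (\<forall>\<sigma><4. finite_borel_measure (\<nu> \<sigma>)) \<and>
     (\<forall>a b. a \<le> b \<longrightarrow> m b - m a = (\<Sum>\<sigma><4. \<i> ^ \<sigma> * complex_of_real (measure (\<nu> \<sigma>) {a..<b})))"

lemma stieltjes_partsD:
  assumes "stieltjes_parts m \<nu>"
  shows "\<sigma> < 4 \<Longrightarrow> finite_borel_measure (\<nu> \<sigma>)"
    and "a \<le> b \<Longrightarrow> (\<Sum>\<sigma><4. \<i> ^ \<sigma> * complex_of_real (measure (\<nu> \<sigma>) {a..<b})) = m b - m a"
  using assms unfolding stieltjes_parts_def by simp_all

lemma has_stieltjes_integral_parts:
  "has_stieltjes_integral f m J \<longleftrightarrow>
    (\<exists>\<nu>. stieltjes_parts m \<nu> \<and> (\<forall>\<sigma><4. integrable (\<nu> \<sigma>) f) \<and> J = (\<Sum>\<sigma><4. \<i> ^ \<sigma> * (\<integral>t. f t \<partial>\<nu> \<sigma>)))"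
proof
  assume "has_stieltjes_integral f m J"
  then obtain \<mu>1 \<mu>2 \<mu>3 \<mu>4 where
    fb: "\<forall>\<mu>\<in>{\<mu>1, \<mu>2, \<mu>3, \<mu>4}. finite_borel_measure \<mu> \<and> integrable \<mu> f" and
    inc: "\<forall>a b. a \<le> b \<longrightarrow> m b - m a =
       complex_of_real (measure \<mu>1 {a..<b}) - complex_of_real (measure \<mu>2 {a..<b})
        + \<i> * (complex_of_real (measure \<mu>3 {a..<b}) - complex_of_real (measure \<mu>4 {a..<b}))" and
    J: "J = integral\<^sup>L \<mu>1 f - integral\<^sup>L \<mu>2 f + \<i> * (integral\<^sup>L \<mu>3 f - integral\<^sup>L \<mu>4 f)"
    unfolding has_stieltjes_integral_def by blast
  \<comment> \<open>\<open>\<mu>2\<close> and \<open>\<mu>3\<close> change places: the weight i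
    belongs to index 1 and the weight -1 to index 2.\<close>
  define \<nu> where "\<nu> = (\<lambda>\<sigma>::nat. if \<sigma> = 0 then \<mu>1 else if \<sigma> = 1 then \<mu>3 else if \<sigma> = 2 then \<mu>2 else \<mu>4)"
  have s: "(\<Sum>\<sigma><4. \<i> ^ \<sigma> * g (\<nu> \<sigma>)) = g \<mu>1 - g \<mu>2 + \<i> * (g \<mu>3 - g \<mu>4)" for g :: "real measure \<Rightarrow> complex"
    unfolding sum_four \<nu>_def by (simp add: i_power[unfolded One_nat_def] algebra_simps)
  have "stieltjes_parts m \<nu>"
    unfolding stieltjes_parts_def s[of "\<lambda>\<mu>. complex_of_real (measure \<mu> _)"] using fb inc by (simp add: \<nu>_def)
  moreover have "J = (\<Sum>\<sigma><4. \<i> ^ \<sigma> * (\<integral>t. f t \<partial>\<nu> \<sigma>))" unfolding s[of "\<lambda>\<mu>. integral\<^sup>L \<mu> f"] by (rule J)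
  moreover have "\<forall>\<sigma><4. integrable (\<nu> \<sigma>) f" using fb by (simp add: \<nu>_def)
  ultimately show "\<exists>\<nu>. stieltjes_parts m \<nu> \<and> (\<forall>\<sigma><4. integrable (\<nu> \<sigma>) f) \<and> J = (\<Sum>\<sigma><4. \<i> ^ \<sigma> * (\<integral>t. f t \<partial>\<nu> \<sigma>))"
    by blast
next
  assume "\<exists>\<nu>. stieltjes_parts m \<nu> \<and> (\<forall>\<sigma><4. integrable (\<nu> \<sigma>) f) \<and> J = (\<Sum>\<sigma><4. \<i> ^ \<sigma> * (\<integral>t. f t \<partial>\<nu> \<sigma>))"
  then obtain \<nu> where \<nu>: "stieltjes_parts m \<nu>" "\<forall>\<sigma><4. integrable (\<nu> \<sigma>) f" "J = (\<Sum>\<sigma><4. \<i> ^ \<sigma> * (\<integral>t. f t \<partial>\<nu> \<sigma>))"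
    by blast
  have s: "(\<Sum>\<sigma><4. \<i> ^ \<sigma> * g \<sigma>) = g 0 - g 2 + \<i> * (g 1 - g 3)" for g :: "nat \<Rightarrow> complex"
    unfolding sum_four by (simp add: i_power[unfolded One_nat_def] algebra_simps)
  show "has_stieltjes_integral f m J"
    unfolding has_stieltjes_integral_def
    using \<nu> unfolding stieltjes_parts_def s
    by (intro exI[of _ "\<nu> 0"] exI[of _ "\<nu> 2"] exI[of _ "\<nu> 1"] exI[of _ "\<nu> 3"]) simp
qed

text \<open>The definition of the integral chooses a decomposition for each integrand. Equal
  increments on all intervals make the value independent of that choice, for integrands whose growth
  is matched by integrable weights.\<close>

lemma stieltjes_parts_integral_unique:
  assumes \<nu>: "stieltjes_parts m \<nu>" "stieltjes_parts m \<nu>'"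
    and f: "continuous_on UNIV f" "\<And>t. cmod (f t) \<le> C * (1 + \<bar>t\<bar>) ^ k"
    and int: "\<And>\<sigma>. \<sigma> < 4 \<Longrightarrow> integrable (\<nu> \<sigma>) (\<lambda>t. (1 + \<bar>t\<bar>) ^ k)" "\<And>\<sigma>. \<sigma> < 4 \<Longrightarrow> integrable (\<nu>' \<sigma>) (\<lambda>t. (1 + \<bar>t\<bar>) ^ k)"
  shows "(\<Sum>\<sigma><4. \<i> ^ \<sigma> * (\<integral>t. f t \<partial>\<nu> \<sigma>)) = (\<Sum>\<sigma><4. \<i> ^ \<sigma> * (\<integral>t. f t \<partial>\<nu>' \<sigma>))"
  by (rule stieltjes_combination_eq[where C = C and m = k])
     (use f int stieltjes_partsD[OF \<nu>(1)] stieltjes_partsD[OF \<nu>(2)] in auto)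

lemma integrable_abs_power_zero: "finite_borel_measure \<mu> \<Longrightarrow> integrable \<mu> (\<lambda>t. (1 + \<bar>t\<bar>) ^ 0)"
proof -
  assume "finite_borel_measure \<mu>"
  then interpret finite_borel_measure \<mu> .
  show ?thesis by simp
qed

text \<open>The kernel is bounded and so integrable for every decomposition; one fixed choice, such
  as that attached to a moment, therefore computes the whole Stieltjes transform.\<close>

lemma has_stieltjes_integral_resolvent:
  assumes \<nu>: "stieltjes_parts m \<nu>" and z: "Im z \<noteq> 0"
  shows "has_stieltjes_integral (\<lambda>t. 1 / (complex_of_real t - z)) m J \<longleftrightarrow>
    J = (\<Sum>\<sigma><4. \<i> ^ \<sigma> * (\<integral>t. 1 / (complex_of_real t - z) \<partial>\<nu> \<sigma>))"
proof
  assume "has_stieltjes_integral (\<lambda>t. 1 / (complex_of_real t - z)) m J"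
  then obtain \<nu>' where \<nu>': "stieltjes_parts m \<nu>'" and J: "J = (\<Sum>\<sigma><4. \<i> ^ \<sigma> * (\<integral>t. 1 / (complex_of_real t - z) \<partial>\<nu>' \<sigma>))"
    unfolding has_stieltjes_integral_parts by blast
  show "J = (\<Sum>\<sigma><4. \<i> ^ \<sigma> * (\<integral>t. 1 / (complex_of_real t - z) \<partial>\<nu> \<sigma>))"
    unfolding J
    by (rule stieltjes_parts_integral_unique[OF \<nu>' \<nu> continuous_resolvent_kernel[OF z], where C = "1 / \<bar>Im z\<bar>" and k = 0])
       (use resolvent_kernel_bound[OF z] integrable_abs_power_zero stieltjes_partsD(1)[OF \<nu>] stieltjes_partsD(1)[OF \<nu>'] in auto)
next
  assume "J = (\<Sum>\<sigma><4. \<i> ^ \<sigma> * (\<integral>t. 1 / (complex_of_real t - z) \<partial>\<nu> \<sigma>))"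
  then show "has_stieltjes_integral (\<lambda>t. 1 / (complex_of_real t - z)) m J"
    unfolding has_stieltjes_integral_parts
    using \<nu> integrable_resolvent_kernel[OF stieltjes_partsD(1)[OF \<nu>] z] by blast
qed

lemma cnj_resolvent_combination:
  "cnj (\<Sum>\<sigma><4. \<i> ^ \<sigma> * (\<integral>t. 1 / (complex_of_real t - z) \<partial>\<nu> \<sigma>)) = (\<Sum>\<sigma><4. cnj (\<i> ^ \<sigma>) * (\<integral>t. 1 / (complex_of_real t - cnj z) \<partial>\<nu> \<sigma>))"
  unfolding cnj_sum complex_cnj_mult cnj_resolvent_integral ..

lemma eq_of_increments:
  fixes m m' :: "real \<Rightarrow> complex"
  assumes inc: "\<And>u v. u \<le> v \<Longrightarrow> m v - m u = m' v - m' u" and lim: "(m \<longlongrightarrow> 0) at_bot" "(m' \<longlongrightarrow> 0) at_bot"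
  shows "m = m'"
proof
  fix v
  have "((\<lambda>u. m v - m u) \<longlongrightarrow> m v - 0) at_bot" by (intro tendsto_intros lim)
  moreover have "((\<lambda>u. m' v - m' u) \<longlongrightarrow> m' v - 0) at_bot" by (intro tendsto_intros lim)
  then have "((\<lambda>u. m v - m u) \<longlongrightarrow> m' v - 0) at_bot"
    by (rule Lim_transform_eventually) (use eventually_le_at_bot[of v] in \<open>eventually_elim, simp add: inc\<close>)
  ultimately show "m v = m' v" using tendsto_unique[OF trivial_limit_at_bot_linorder] by fastforce
qed

text \<open>Inversion uses both half planes, the hypothesis only the upper one. For complex m the
  transform at conj z is the conjugate of the transform of conj m at z, hence the parts
  \<open>\<rho>\<close> and \<open>\<rho>'\<close> of the conjugate functions; for a Hermitian M
  these belong to the transposed entry.\<close>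

lemma stieltjes_transform_unique:
  assumes \<nu>: "stieltjes_parts m \<nu>" "stieltjes_parts m' \<nu>'" "stieltjes_parts (\<lambda>t. cnj (m t)) \<rho>" "stieltjes_parts (\<lambda>t. cnj (m' t)) \<rho>'"
    and eq: "\<And>z. 0 < Im z \<Longrightarrow> (\<Sum>\<sigma><4. \<i> ^ \<sigma> * (\<integral>t. 1 / (complex_of_real t - z) \<partial>\<nu> \<sigma>)) = (\<Sum>\<sigma><4. \<i> ^ \<sigma> * (\<integral>t. 1 / (complex_of_real t - z) \<partial>\<nu>' \<sigma>))"
      "\<And>z. 0 < Im z \<Longrightarrow> (\<Sum>\<sigma><4. \<i> ^ \<sigma> * (\<integral>t. 1 / (complex_of_real t - z) \<partial>\<rho> \<sigma>)) = (\<Sum>\<sigma><4. \<i> ^ \<sigma> * (\<integral>t. 1 / (complex_of_real t - z) \<partial>\<rho>' \<sigma>))"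
    and lim: "(m \<longlongrightarrow> 0) at_bot" "(m' \<longlongrightarrow> 0) at_bot"
  shows "m = m'"
proof -
  have swap: "(\<Sum>\<sigma><4. \<i> ^ \<sigma> * (\<integral>t. 1 / (complex_of_real t - z) \<partial>\<nu> \<sigma>)) = cnj (\<Sum>\<sigma><4. \<i> ^ \<sigma> * (\<integral>t. 1 / (complex_of_real t - cnj z) \<partial>\<rho> \<sigma>))"
    if \<nu>: "stieltjes_parts m \<nu>" "stieltjes_parts (\<lambda>t. cnj (m t)) \<rho>" and z: "Im z \<noteq> 0" for m \<nu> \<rho> z
    unfolding cnj_resolvent_combination complex_cnj_cnj
  proof (rule stieltjes_combination_eq[where C = "1 / \<bar>Im z\<bar>" and m = 0])
    fix a b :: real assume "a \<le> b"
    have "(\<Sum>\<sigma><4. cnj (\<i> ^ \<sigma>) * complex_of_real (measure (\<rho> \<sigma>) {a..<b})) = cnj (\<Sum>\<sigma><4. \<i> ^ \<sigma> * complex_of_real (measure (\<rho> \<sigma>) {a..<b}))"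
      by simp
    then show "(\<Sum>\<sigma><4. \<i> ^ \<sigma> * complex_of_real (measure (\<nu> \<sigma>) {a..<b})) = (\<Sum>\<sigma><4. cnj (\<i> ^ \<sigma>) * complex_of_real (measure (\<rho> \<sigma>) {a..<b}))"
      unfolding stieltjes_partsD(2)[OF \<nu>(1) \<open>a \<le> b\<close>] stieltjes_partsD(2)[OF \<nu>(2) \<open>a \<le> b\<close>] by simp
  qed (use continuous_resolvent_kernel[OF z] resolvent_kernel_bound[OF z] integrable_abs_power_zero stieltjes_partsD(1)[OF \<nu>(1)] stieltjes_partsD(1)[OF \<nu>(2)] in auto)
  have all: "(\<Sum>\<sigma><4. \<i> ^ \<sigma> * (\<integral>t. 1 / (complex_of_real t - z) \<partial>\<nu> \<sigma>)) = (\<Sum>\<sigma><4. \<i> ^ \<sigma> * (\<integral>t. 1 / (complex_of_real t - z) \<partial>\<nu>' \<sigma>))"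
    if "Im z \<noteq> 0" for z
  proof (cases "0 < Im z")
    case False
    then have "0 < Im (cnj z)" using that by simp
    then show ?thesis
      unfolding swap[OF \<nu>(1,3) that] swap[OF \<nu>(2,4) that] by (subst eq(2)) (simp_all only:)
  qed (rule eq(1))
  have inc: "m v - m u = m' v - m' u" if uv: "u \<le> v" for u v
  proof -
    define c where "c = (\<lambda>p. case p of Inl \<sigma> \<Rightarrow> \<i> ^ \<sigma> | Inr \<sigma> \<Rightarrow> - (\<i> ^ (\<sigma>::nat)))"
    define M where "M = (\<lambda>p. case p of Inl \<sigma> \<Rightarrow> \<nu> \<sigma> | Inr \<sigma> \<Rightarrow> \<nu>' \<sigma>)"
    have split: "(\<Sum>p\<in>{..<4} <+> {..<4}. c p * g (M p)) = (\<Sum>\<sigma><4. \<i> ^ \<sigma> * g (\<nu> \<sigma>)) - (\<Sum>\<sigma><4. \<i> ^ \<sigma> * g (\<nu>' \<sigma>))" for g :: "real measure \<Rightarrow> complex"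
      by (simp add: sum.Plus c_def M_def sum_negf)
    have "(\<Sum>p\<in>{..<4} <+> {..<4}. c p * complex_of_real (measure (M p) {u..<v})) = 0"
    proof (rule resolvent_kernel_combination_inversion[OF _ _ _ uv])
      show "finite ({..<4::nat} <+> {..<4::nat})" by simp
      show "finite_borel_measure (M p)" if "p \<in> {..<4} <+> {..<4}" for p
        using that stieltjes_partsD(1)[OF \<nu>(1)] stieltjes_partsD(1)[OF \<nu>(2)] by (auto simp: M_def)
      show "(\<Sum>p\<in>{..<4} <+> {..<4}. c p * (\<integral>t. 1 / (complex_of_real t - z) \<partial>M p)) = 0" if "Im z \<noteq> 0" for z
        unfolding split[of "\<lambda>M. \<integral>t. 1 / (complex_of_real t - z) \<partial>M"] using all[OF that] by simp
    qed
    then show ?thesis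
      unfolding split[of "\<lambda>M. complex_of_real (measure M {u..<v})"]
        stieltjes_partsD(2)[OF \<nu>(1) uv] stieltjes_partsD(2)[OF \<nu>(2) uv] by simp
  qed
  then show ?thesis by (rule eq_of_increments[OF _ lim])
qed

context finite_borel_measure
begin

lemma measure_lessThan_increment: "a \<le> b \<Longrightarrow> measure M {..<b} - measure M {..<a} = measure M {a..<b}"
proof -
  assume "a \<le> b"
  then have "measure M ({..<a} \<union> {a..<b}) = measure M {..<a} + measure M {a..<b}"
    by (intro finite_measure_Union) auto
  also have "{..<a} \<union> {a..<b} = {..<b}" using \<open>a \<le> b\<close> by auto
  finally show ?thesis by simp
qed

lemma measure_lessThan_left_continuous: "((\<lambda>t. measure M {..<t}) \<longlongrightarrow> measure M {..<a}) (at_left a)"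
proof (rule tendsto_at_left_sequentially[of "a - 1"])
  fix S :: "nat \<Rightarrow> real"
  assume S: "\<And>n. S n < a" "incseq S" "S \<longlonglongrightarrow> a"
  have "(\<lambda>n. measure M {..<S n}) \<longlonglongrightarrow> measure M (\<Union>n. {..<S n})"
    using S(2) by (intro finite_Lim_measure_incseq) (auto simp: incseq_def)
  also have "(\<Union>n. {..<S n}) = {..<a}"
  proof (intro subset_antisym subsetI)
    fix t assume "t \<in> {..<a}"
    then have "\<forall>\<^sub>F n in sequentially. t < S n" using order_tendstoD(1)[OF S(3)] by simp
    then show "t \<in> (\<Union>n. {..<S n})" by (auto simp: eventually_sequentially)
  next
    fix t assume "t \<in> (\<Union>n. {..<S n})"
    then show "t \<in> {..<a}" using S(1) less_trans by blast
  qed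
  finally show "(\<lambda>n. measure M {..<S n}) \<longlonglongrightarrow> measure M {..<a}" .
qed simp

lemma measure_lessThan_at_bot: "((\<lambda>t. measure M {..<t}) \<longlongrightarrow> 0) at_bot"
proof (rule tendsto_sandwich[OF _ _ tendsto_const cdf_lim_at_bot])
  show "\<forall>\<^sub>F t in at_bot. measure M {..<t} \<le> cdf M t"
    unfolding cdf_def by (intro always_eventually allI finite_measure_mono) auto
qed simp

end

subsection \<open>From parameters to solutions\<close>

lemma quadratic_form_sum:
  fixes G :: "complex mat"
  assumes G: "G \<in> carrier_mat m m" and v: "v \<in> carrier_vec m"
  shows "(G *\<^sub>v v) \<bullet>c v = (\<Sum>i<m. \<Sum>j<m. cnj (v $ i) * v $ j * G $$ (i, j))"
proof -
  have "(G *\<^sub>v v) \<bullet>c v = (\<Sum>i<m. (\<Sum>j<m. G $$ (i, j) * v $ j) * cnj (v $ i))"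
    using G v unfolding scalar_prod_def
    by (simp add: scalar_prod_def atLeast0LessThan)
  also have "\<dots> = (\<Sum>i<m. \<Sum>j<m. cnj (v $ i) * v $ j * G $$ (i, j))"
    by (simp add: sum_distrib_left sum_distrib_right mult_ac)
  finally show ?thesis .
qed

lemma mat_adjoint_carrier: "G \<in> carrier_mat m m \<Longrightarrow> mat_adjoint G \<in> carrier_mat m m"
  unfolding mat_adjoint_def using carrier_matD mat_of_rows_carrier(1)[of "dim_row G" "map conjugate (cols G)"] by fastforce

lemma mat_adjoint_entry:
  fixes G :: "complex mat"
  assumes "G \<in> carrier_mat m m" "i < m" "j < m"
  shows "mat_adjoint G $$ (i, j) = cnj (G $$ (j, i))"
  unfolding mat_adjoint_def using carrier_matD[OF assms(1)] assms(2,3)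
  by (simp add: mat_of_rows_index)

lemma hermitian_mat_iff:
  "hermitian_mat m G \<longleftrightarrow> G \<in> carrier_mat m m \<and> (\<forall>i<m. \<forall>j<m. cnj (G $$ (i, j)) = G $$ (j, i))"
proof
  assume G: "hermitian_mat m G"
  then have c: "G \<in> carrier_mat m m" and a: "mat_adjoint G = G" by (auto simp: hermitian_mat_def)
  have "cnj (G $$ (i, j)) = G $$ (j, i)" if "i < m" "j < m" for i j
  proof -
    show ?thesis using mat_adjoint_entry[OF c that(2) that(1)] by (simp only: a)
  qed
  with c show "G \<in> carrier_mat m m \<and> (\<forall>i<m. \<forall>j<m. cnj (G $$ (i, j)) = G $$ (j, i))" by blast
next
  assume G: "G \<in> carrier_mat m m \<and> (\<forall>i<m. \<forall>j<m. cnj (G $$ (i, j)) = G $$ (j, i))"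
  then have c: "G \<in> carrier_mat m m" by blast
  have "mat_adjoint G = G"
  proof (rule eq_matI)
    fix i j assume "i < dim_row G" "j < dim_col G"
    then have ij: "i < m" "j < m" using carrier_matD[OF c] by simp_all
    show "mat_adjoint G $$ (i, j) = G $$ (i, j)" unfolding mat_adjoint_entry[OF c ij] using G ij by simp
  qed (use carrier_matD[OF c] carrier_matD[OF mat_adjoint_carrier[OF c]] in simp_all)
  with G show "hermitian_mat m G" by (simp add: hermitian_mat_def)
qed

context
  fixes M :: "real \<Rightarrow> complex mat" and N d :: nat and S :: "nat \<Rightarrow> complex mat"
  assumes M: "M \<in> moment_solutions N d S"
begin

lemma moment_solution_carrier: "M t \<in> carrier_mat N N"
  using M unfolding moment_solutions_def hermitian_mat_def by blast

lemma moment_solution_hermitian: "k < N \<Longrightarrow> j < N \<Longrightarrow> cnj (M t $$ (k, j)) = M t $$ (j, k)"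
proof -
  have "hermitian_mat N (M t)" using M unfolding moment_solutions_def by simp
  then show "k < N \<Longrightarrow> j < N \<Longrightarrow> cnj (M t $$ (k, j)) = M t $$ (j, k)" by (simp add: hermitian_mat_iff)
qed

lemma moment_solution_lim: "k < N \<Longrightarrow> j < N \<Longrightarrow> ((\<lambda>t. M t $$ (k, j)) \<longlongrightarrow> 0) at_bot"
  using M unfolding moment_solutions_def by blast

lemma moment_solution_parts:
  assumes "n \<le> 2 * d" "k < N" "j < N"
  obtains \<nu> where "stieltjes_parts (\<lambda>t. M t $$ (k, j)) \<nu>" "\<And>\<sigma>. \<sigma> < 4 \<Longrightarrow> integrable (\<nu> \<sigma>) (\<lambda>t. complex_of_real (t ^ n))"
    "S n $$ (k, j) = (\<Sum>\<sigma><4. \<i> ^ \<sigma> * (\<integral>t. complex_of_real (t ^ n) \<partial>\<nu> \<sigma>))"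
proof -
  have "has_stieltjes_integral (\<lambda>t. complex_of_real (t ^ n)) (\<lambda>t. M t $$ (k, j)) (S n $$ (k, j))"
    using M assms unfolding moment_solutions_def by blast
  then show thesis unfolding has_stieltjes_integral_parts using that by blast
qed

end

lemma moment_solution_unique:
  assumes M: "M \<in> moment_solutions N d S" "M' \<in> moment_solutions N d S"
    and rel: "\<And>z k j. z \<in> upper_half_plane \<Longrightarrow> k < N \<Longrightarrow> j < N \<Longrightarrow>
        has_stieltjes_integral (\<lambda>t. 1 / (complex_of_real t - z)) (\<lambda>t. M t $$ (k, j)) (J z k j) \<and>
        has_stieltjes_integral (\<lambda>t. 1 / (complex_of_real t - z)) (\<lambda>t. M' t $$ (k, j)) (J z k j)"
  shows "M = M'"
proof (rule ext, rule eq_matI)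
  fix t k j assume "k < dim_row (M' t)" "j < dim_col (M' t)"
  then have kj: "k < N" "j < N" using moment_solution_carrier[OF M(2), of t] by auto
  have parts: "\<exists>\<nu>. stieltjes_parts (\<lambda>t. L t $$ (k, j)) \<nu>" if "L \<in> moment_solutions N d S" "k < N" "j < N" for L k j
    by (rule moment_solution_parts[OF that(1) _ that(2,3), of 0]) auto
  obtain \<nu> \<nu>' \<rho> \<rho>' where \<nu>: "stieltjes_parts (\<lambda>t. M t $$ (k, j)) \<nu>" "stieltjes_parts (\<lambda>t. M' t $$ (k, j)) \<nu>'"
      "stieltjes_parts (\<lambda>t. M t $$ (j, k)) \<rho>" "stieltjes_parts (\<lambda>t. M' t $$ (j, k)) \<rho>'"
    using parts[OF M(1)] parts[OF M(2)] kj by metis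
  have "(\<lambda>t. M t $$ (k, j)) = (\<lambda>t. M' t $$ (k, j))"
  proof (rule stieltjes_transform_unique[OF \<nu>(1,2)])
    show "stieltjes_parts (\<lambda>t. cnj (M t $$ (k, j))) \<rho>" "stieltjes_parts (\<lambda>t. cnj (M' t $$ (k, j))) \<rho>'"
      using \<nu>(3,4) by (simp_all add: moment_solution_hermitian[OF M(1) kj] moment_solution_hermitian[OF M(2) kj])
    fix z assume z: "0 < Im z"
    then have z': "Im z \<noteq> 0" "z \<in> upper_half_plane" by (simp_all add: upper_half_plane_def)
    show "(\<Sum>\<sigma><4. \<i> ^ \<sigma> * (\<integral>t. 1 / (complex_of_real t - z) \<partial>\<nu> \<sigma>)) = (\<Sum>\<sigma><4. \<i> ^ \<sigma> * (\<integral>t. 1 / (complex_of_real t - z) \<partial>\<nu>' \<sigma>))"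
      using rel[OF z'(2) kj] unfolding has_stieltjes_integral_resolvent[OF \<nu>(1) z'(1)] has_stieltjes_integral_resolvent[OF \<nu>(2) z'(1)]
      by (elim conjE) (drule sym, erule trans, assumption)
    show "(\<Sum>\<sigma><4. \<i> ^ \<sigma> * (\<integral>t. 1 / (complex_of_real t - z) \<partial>\<rho> \<sigma>)) = (\<Sum>\<sigma><4. \<i> ^ \<sigma> * (\<integral>t. 1 / (complex_of_real t - z) \<partial>\<rho>' \<sigma>))"
      using rel[OF z'(2) kj(2) kj(1)] unfolding has_stieltjes_integral_resolvent[OF \<nu>(3) z'(1)] has_stieltjes_integral_resolvent[OF \<nu>(4) z'(1)]
      by (elim conjE) (drule sym, erule trans, assumption)
  qed (rule moment_solution_lim[OF M(1) kj] moment_solution_lim[OF M(2) kj])+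
  then show "M t $$ (k, j) = M' t $$ (k, j)" by (rule fun_cong)
qed (simp_all add: carrier_matD[OF moment_solution_carrier[OF M(1)]] carrier_matD[OF moment_solution_carrier[OF M(2)]])

section \<open>The moment data and its shift operator\<close>

locale moment_data = onb e n for e :: "nat \<Rightarrow> 'h::complex_inner_space" and n +
  fixes N d :: nat and S :: "nat \<Rightarrow> complex mat" and x :: "nat \<Rightarrow> 'h"
  assumes N: "1 \<le> N" and d: "1 \<le> d"
    and pos_def: "pos_def_mat (d * N) (block_hankel N S (d - 1))"
    and span_x: "complex_vector.span (x ` {..<d * N + N}) = UNIV"
    and gram: "\<And>n m. n < d * N + N \<Longrightarrow> m < d * N + N \<Longrightarrow> cinner (x n) (x m) = block_hankel N S d $$ (n, m)"
begin

abbreviation "A \<equiv> shift_operator N d x"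

lemma block_index_less: "r < m \<Longrightarrow> k < N \<Longrightarrow> r * N + k < m * N" for r m k :: nat
proof -
  assume rk: "r < m" "k < N"
  then have "r * N + k < Suc r * N" by simp
  also have "\<dots> \<le> m * N" using rk(1) by (intro mult_le_mono1) simp
  finally show ?thesis .
qed

lemma gram_blocks:
  assumes "r \<le> d" "s \<le> d" "k < N" "j < N"
  shows "cinner (x (r * N + k)) (x (s * N + j)) = S (r + s) $$ (k, j)"
  using gram[of "r * N + k" "s * N + j"] block_index_less[of r "Suc d" k] block_index_less[of s "Suc d" j] assms N
  by (simp add: block_hankel_def add.commute)

text \<open>The Hankel structure: Gram entries depend on the block indices through their sum. This
  is the symmetry of \<open>A\<close>.\<close>

lemma gram_shift: "k < d * N \<Longrightarrow> l < d * N \<Longrightarrow> cinner (x (k + N)) (x l) = cinner (x k) (x (l + N))"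
  using N by (simp add: gram block_hankel_def)

lemma shift_mem: "i < d * N \<Longrightarrow> (x i, x (i + N)) \<in> A"
  unfolding shift_operator_def
  by (rule CollectI, rule exI[of _ "\<lambda>k. if k = i then 1 else 0"])
     (simp add: if_distrib[of "\<lambda>c. c *\<^sub>C _"] sum.delta cong: if_cong)

sublocale symmetric_relation e n A
proof
  show "(0, 0) \<in> A"
    unfolding shift_operator_def by (rule CollectI, rule exI[of _ "\<lambda>_. 0"]) simp
  show "(f + f', g + g') \<in> A" if fg: "(f, g) \<in> A" "(f', g') \<in> A" for f g f' g'
  proof -
    from fg obtain \<alpha> \<beta> where "f = (\<Sum>k<d * N. \<alpha> k *\<^sub>C x k)" "g = (\<Sum>k<d * N. \<alpha> k *\<^sub>C x (k + N))"
      "f' = (\<Sum>k<d * N. \<beta> k *\<^sub>C x k)" "g' = (\<Sum>k<d * N. \<beta> k *\<^sub>C x (k + N))"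
      unfolding shift_operator_def by auto
    then show ?thesis
      unfolding shift_operator_def
      by (intro CollectI exI[of _ "\<lambda>k. \<alpha> k + \<beta> k"]) (simp add: scaleC_add_left sum.distrib)
  qed
  show "(c *\<^sub>C f, c *\<^sub>C g) \<in> A" if fg: "(f, g) \<in> A" for c f g
  proof -
    from fg obtain \<alpha> where "f = (\<Sum>k<d * N. \<alpha> k *\<^sub>C x k)" "g = (\<Sum>k<d * N. \<alpha> k *\<^sub>C x (k + N))"
      unfolding shift_operator_def by auto
    then show ?thesis
      unfolding shift_operator_def
      by (intro CollectI exI[of _ "\<lambda>k. c * \<alpha> k"]) (simp add: complex_vector.scale_sum_right scaleC_scaleC)
  qed
  show "cinner g f' = cinner f g'" if fg: "(f, g) \<in> A" "(f', g') \<in> A" for f g f' g'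
  proof -
    from fg obtain \<alpha> \<beta> where "f = (\<Sum>k<d * N. \<alpha> k *\<^sub>C x k)" "g = (\<Sum>k<d * N. \<alpha> k *\<^sub>C x (k + N))"
      "f' = (\<Sum>k<d * N. \<beta> k *\<^sub>C x k)" "g' = (\<Sum>k<d * N. \<beta> k *\<^sub>C x (k + N))"
      unfolding shift_operator_def by auto
    then show ?thesis
      by (simp add: cinner_sum_left cinner_sum_right cinner_scaleC_left cinner_scaleC_right gram_shift)
  qed
qed

text \<open>Positivity of \<Gamma>_(d-1) makes x_0, ..., x_(dN-1) independent, so all coefficients
  of a pair (0, g) vanish.\<close>

lemma zero_mem_imp_zero:
  assumes "(0, g) \<in> A"
  shows "g = 0"
proof -
  from assms obtain \<alpha> where 0: "(\<Sum>k<d * N. \<alpha> k *\<^sub>C x k) = 0" and g: "g = (\<Sum>k<d * N. \<alpha> k *\<^sub>C x (k + N))"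
    unfolding shift_operator_def by auto
  \<comment> \<open>Conjugated because the matrix form puts the bar on the row coefficient v_i,
    while the scalar product is linear in its first argument.\<close>
  define v where "v = vec (d * N) (\<lambda>k. cnj (\<alpha> k))"
  have v: "v \<in> carrier_vec (d * N)" by (simp add: v_def)
  have dN: "(d - Suc 0) * N + N = d * N" using d by (simp add: diff_mult_distrib)
  have "(block_hankel N S (d - 1) *\<^sub>v v) \<bullet>c v
      = (\<Sum>i<d * N. \<Sum>j<d * N. cnj (v $ i) * v $ j * block_hankel N S (d - 1) $$ (i, j))"
    by (rule quadratic_form_sum[OF _ v]) (simp add: block_hankel_def dN)
  also have "\<dots> = (\<Sum>i<d * N. \<Sum>j<d * N. \<alpha> i * cnj (\<alpha> j) * cinner (x i) (x j))"
    by (intro sum.cong refl) (simp add: v_def gram block_hankel_def dN)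
  also have "\<dots> = cinner (\<Sum>k<d * N. \<alpha> k *\<^sub>C x k) (\<Sum>k<d * N. \<alpha> k *\<^sub>C x k)"
    by (subst sum.swap) (simp add: cinner_sum_left cinner_sum_right cinner_scaleC_left cinner_scaleC_right mult_ac sum_distrib_left)
  also have "\<dots> = 0" by (simp only: 0 cinner_zero_left)
  finally have "\<not> 0 < Re ((block_hankel N S (d - 1) *\<^sub>v v) \<bullet>c v)" by simp
  then have "v = 0\<^sub>v (d * N)" using pos_def v unfolding pos_def_mat_def by blast
  then have "Matrix.vec_index v k = 0" if "k < d * N" for k using that by simp
  then have "\<alpha> k = 0" if "k < d * N" for k using that by (simp add: v_def)
  then show ?thesis unfolding g by simp
qed

lemma span_x_induct:
  assumes "complex_vector.subspace {v. P v}" "\<And>m. m < d * N + N \<Longrightarrow> P (x m)"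
  shows "P v"
proof -
  have "complex_vector.span (x ` {..<d * N + N}) \<subseteq> {v. P v}"
    by (rule complex_vector.span_minimal) (use assms in auto)
  then show ?thesis unfolding span_x by auto
qed

text \<open>R_z x_(i+N) = x_i + z R_z x_i, and the adjoint relation does the same in the second
  argument. By induction on both indices the first N x N block of matrix elements determines R_z, as
  the x_n span H.\<close>

lemma resolvent_determined:
  assumes R: "generalized_resolvent e n A R" and R': "generalized_resolvent e n A R'"
    and eq: "\<And>k j. k < N \<Longrightarrow> j < N \<Longrightarrow> cinner (R z (x k)) (x j) = cinner (R' z (x k)) (x j)"
    and z: "z \<in> upper_half_plane"
  shows "R z = R' z"
proof -
  interpret g: generalized_resolvent e n A R by (rule R)
  interpret g': generalized_resolvent e n A R' by (rule R')
  have shift: "T z (x (i + N)) = x i + z *\<^sub>C T z (x i)" "cinner (T z v) (x (i + N)) = cinner v (x i) + z * cinner (T z v) (x i)"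
    if T: "generalized_resolvent e n A T" and i: "i < d * N" for T i v
  proof -
    interpret t: generalized_resolvent e n A T by (rule T)
    have "T z (x (i + N)) = T z ((x (i + N) - z *\<^sub>C x i) + z *\<^sub>C x i)" by simp
    then show "T z (x (i + N)) = x i + z *\<^sub>C T z (x i)"
      unfolding clinear_op_add[OF t.lin[OF z]] clinear_op_scale[OF t.lin[OF z]] t.extends[OF z shift_mem[OF i]] .
    have "cinner (T z v) (x (i + N)) = cinner (T z v) (x (i + N) - cnj z *\<^sub>C x i) + z * cinner (T z v) (x i)"
      by (simp add: cinner_diff_right cinner_scaleC_right)
    then show "cinner (T z v) (x (i + N)) = cinner v (x i) + z * cinner (T z v) (x i)"
      unfolding t.extends_adjoint[OF z shift_mem[OF i]] .
  qed
  have 1: "cinner (R z (x m)) (x j) = cinner (R' z (x m)) (x j)" if "m < d * N + N" "j < N" for m j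
    using that(1)
  proof (induction m rule: less_induct)
    case (less m)
    show ?case
    proof (cases "m < N")
      case False
      then obtain i where m: "m = i + N" by (metis add.commute le_Suc_ex not_less)
      then have i: "i < d * N" "i < m" "i < d * N + N" using less.prems N by auto
      show ?thesis unfolding m shift(1)[OF R i(1)] shift(1)[OF R' i(1)] cinner_add_left cinner_scaleC_left less.IH[OF i(2,3)] ..
    qed (use eq that(2) in simp)
  qed
  have 2: "cinner (R z (x m)) (x j) = cinner (R' z (x m)) (x j)" if "m < d * N + N" "j < d * N + N" for m j
    using that(2)
  proof (induction j rule: less_induct)
    case (less j)
    show ?case
    proof (cases "j < N")
      case False
      then obtain i where j: "j = i + N" by (metis add.commute le_Suc_ex not_less)
      then have i: "i < d * N" "i < j" "i < d * N + N" using less.prems N by auto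
      show ?thesis unfolding j shift(2)[OF R i(1)] shift(2)[OF R' i(1)] less.IH[OF i(2,3)] ..
    qed (use 1 that(1) in simp)
  qed
  have 3: "R z (x m) = R' z (x m)" if "m < d * N + N" for m
  proof -
    have "cinner (R z (x m)) v = cinner (R' z (x m)) v" for v
      by (rule span_x_induct)
         (use 2[OF that] in \<open>auto simp: complex_vector.subspace_def cinner_add_right cinner_scaleC_right\<close>)
    then show ?thesis by (rule cinner_eqI)
  qed
  have "R z v = R' z v" for v
    by (rule span_x_induct)
       (use 3 in \<open>auto simp: complex_vector.subspace_def clinear_op_zero[OF g.lin[OF z]] clinear_op_zero[OF g'.lin[OF z]]
         clinear_op_add[OF g.lin[OF z]] clinear_op_add[OF g'.lin[OF z]] clinear_op_scale[OF g.lin[OF z]] clinear_op_scale[OF g'.lin[OF z]]\<close>)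
  then show ?thesis by (rule ext)
qed

lemma param_determined:
  assumes R: "generalized_resolvent e n A R" and R': "generalized_resolvent e n A R'"
    and eq: "\<And>z. z \<in> upper_half_plane \<Longrightarrow> R z = R' z"
  shows "generalized_resolvent.param A R = generalized_resolvent.param A R'"
proof -
  interpret g: generalized_resolvent e n A R by (rule R)
  interpret g': generalized_resolvent e n A R' by (rule R')
  have "g.U z \<psi> = g'.U z \<psi>" if "z \<in> upper_half_plane" for z \<psi>
  proof -
    have "g.V z = g'.V z" "g.W z = g'.W z"
      using eq[OF that] by (auto simp: g.V_def g'.V_def g.W_def g'.W_def)
    then show ?thesis by (simp add: g.U_def g'.U_def g.Y_def g'.Y_def)
  qed
  then show ?thesis unfolding g.param_def g'.param_def by (intro restrict_ext) auto
qed

end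

locale moment_resolvent = moment_data e n N d S x + generalized_resolvent e n "shift_operator N d x" R
  for e :: "nat \<Rightarrow> 'h::complex_inner_space" and n N d S x R +
  assumes complete: "E u = u"
begin

text \<open>With E = 1 the clauses on A_(F(z)) hold automatically: its graph is parametrized by R_z,
  injectivity of R_z makes it an operator, and its resolvent is the everywhere defined R_z.\<close>

lemma relation_iff:
  assumes F: "\<And>z \<psi>. z \<in> upper_half_plane \<Longrightarrow> \<psi> \<in> defect_subspace A \<i> \<Longrightarrow> F z \<psi> = U z \<psi>"
  shows "stieltjes_resolvent_relation N x A M F \<longleftrightarrow> (\<forall>z\<in>upper_half_plane. \<forall>k<N. \<forall>j<N.
    has_stieltjes_integral (\<lambda>t. 1 / (complex_of_real t - z)) (\<lambda>t. M t $$ (k, j)) (cinner (R z (x k)) (x j)))"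
proof -
  have res: "resolvent (extension_operator A (F z)) z = {(v, R z v) | v. True}" if z: "z \<in> upper_half_plane" for z
    by (rule resolvent_eq[OF z F[OF z]])
  have ap: "op_apply (resolvent (extension_operator A (F z)) z) u = R z u" if z: "z \<in> upper_half_plane" for z u
    unfolding op_apply_def res[OF z] by auto
  have graph: "extension_operator A (F z) = {(R z v, v + z *\<^sub>C R z v) | v. True}" if z: "z \<in> upper_half_plane" for z
    by (rule resolvent_graph_eq[OF z F[OF z]])
  have "single_valued (extension_operator A (F z))" if z: "z \<in> upper_half_plane" for z
    unfolding graph[OF z]
  proof (rule single_valuedI)
    fix u v w assume "(u, v) \<in> {(R z v, v + z *\<^sub>C R z v) | v. True}" "(u, w) \<in> {(R z v, v + z *\<^sub>C R z v) | v. True}"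
    then obtain a b where ab: "u = R z a" "v = a + z *\<^sub>C R z a" "u = R z b" "w = b + z *\<^sub>C R z b" by blast
    then have "R z (a - b) = 0" by (simp add: clinear_op_diff[OF lin[OF z]])
    then have "a - b = 0" by (rule R_injective[OF complete z])
    then have "a = b" by simp
    then show "v = w" using ab by simp
  qed
  moreover have "single_valued (resolvent (extension_operator A (F z)) z)"
    "Domain (resolvent (extension_operator A (F z)) z) = UNIV" if z: "z \<in> upper_half_plane" for z
    unfolding res[OF z] by (auto simp: single_valued_def Domain_iff)
  ultimately show ?thesis unfolding stieltjes_resolvent_relation_def by (simp add: ap)
qed

text \<open>Open left rays make the entries left-continuous and their increments combinations of the
  masses of [a, b).\<close>

definition spectral_function :: "real \<Rightarrow> complex mat" where
  "spectral_function t = mat N N (\<lambda>(k, j). \<Sum>\<sigma><4. \<i> ^ \<sigma> * complex_of_real (measure (\<mu> (polar_vec (x k) (x j) \<sigma>)) {..<t}))"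

lemma spectral_function_entry:
  "k < N \<Longrightarrow> j < N \<Longrightarrow> spectral_function t $$ (k, j) = (\<Sum>\<sigma><4. \<i> ^ \<sigma> * complex_of_real (measure (\<mu> (polar_vec (x k) (x j) \<sigma>)) {..<t}))"
  by (simp add: spectral_function_def)

lemma spectral_function_parts:
  assumes "k < N" "j < N"
  shows "stieltjes_parts (\<lambda>t. spectral_function t $$ (k, j)) (\<lambda>\<sigma>. \<mu> (polar_vec (x k) (x j) \<sigma>))"
  unfolding stieltjes_parts_def spectral_function_entry[OF assms]
  by (simp add: finite_borel_\<mu> sum_subtractf[symmetric] right_diff_distrib[symmetric] of_real_diff[symmetric]
      finite_borel_measure.measure_lessThan_increment[OF finite_borel_\<mu>] del: of_real_diff)

lemmas spectral_function_increment = stieltjes_partsD(2)[OF spectral_function_parts]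

lemma spectral_function_at_bot:
  assumes "k < N" "j < N"
  shows "((\<lambda>t. spectral_function t $$ (k, j)) \<longlongrightarrow> 0) at_bot"
proof -
  have "((\<lambda>t. \<Sum>\<sigma><4. \<i> ^ \<sigma> * complex_of_real (measure (\<mu> (polar_vec (x k) (x j) \<sigma>)) {..<t})) \<longlongrightarrow> (\<Sum>\<sigma><(4::nat). \<i> ^ \<sigma> * complex_of_real 0)) at_bot"
    by (intro tendsto_intros finite_borel_measure.measure_lessThan_at_bot finite_borel_\<mu>)
  then show ?thesis unfolding spectral_function_entry[OF assms] by simp
qed

text \<open>\<open>interval_form\<close> with a single vector gives the mass of c u as |c|^2 times a
  quantity that depends on u alone.\<close>

lemma measure_rotate:
  assumes "a \<le> b"
  shows "measure (\<mu> ((\<i> ^ \<tau>) *\<^sub>C u)) {a..<b} = measure (\<mu> u) {a..<b}"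
proof -
  have ii: "\<i> ^ \<tau> * cnj (\<i> ^ \<tau>) = 1" by (simp add: power_mult_distrib[symmetric])
  have "complex_of_real (measure (\<mu> (c *\<^sub>C u)) {a..<b}) = c * cnj c * (\<Sum>\<sigma><4. \<i> ^ \<sigma> * measure (\<mu> (polar_vec u u \<sigma>)) {a..<b})" for c
    using interval_form[OF assms, where K = 1 and c = "\<lambda>_. c" and u = "\<lambda>_. u"] by simp
  from this[of "\<i> ^ \<tau>"] this[of 1]
  have "complex_of_real (measure (\<mu> ((\<i> ^ \<tau>) *\<^sub>C u)) {a..<b}) = complex_of_real (measure (\<mu> (1 *\<^sub>C u)) {a..<b})"
    by (simp only: ii complex_cnj_one mult_1_right)
  then show ?thesis by (simp only: of_real_eq_iff scaleC_one_left)
qed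

text \<open>Exchanging u and v turns the polar vectors into rotations of the original ones, with the
  indices 1 and 3 exchanged; this conjugates the weights.\<close>

lemma measure_polar_swap:
  assumes "a \<le> b"
  shows "(\<Sum>\<sigma><4. \<i> ^ \<sigma> * complex_of_real (measure (\<mu> (polar_vec v u \<sigma>)) {a..<b}))
    = cnj (\<Sum>\<sigma><4. \<i> ^ \<sigma> * complex_of_real (measure (\<mu> (polar_vec u v \<sigma>)) {a..<b}))"
proof -
  have "polar_vec v u 0 = (\<i> ^ 0) *\<^sub>C polar_vec u v 0" "polar_vec v u 1 = (\<i> ^ 1) *\<^sub>C polar_vec u v 3"
    "polar_vec v u 2 = (\<i> ^ 2) *\<^sub>C polar_vec u v 2" "polar_vec v u 3 = (\<i> ^ 3) *\<^sub>C polar_vec u v 1"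
    unfolding polar_vec_def i_power
    by (simp_all add: scaleC_add_right scaleC_diff_right scaleC_scaleC scaleC_minus_left scaleC_minus_right algebra_simps)
  then show ?thesis
    unfolding sum_four by (simp only: measure_rotate[OF assms]) (simp add: i_power[unfolded One_nat_def])
qed

lemma spectral_function_hermitian: "hermitian_mat N (spectral_function t)"
  unfolding hermitian_mat_iff
proof (intro conjI allI impI)
  show "spectral_function t \<in> carrier_mat N N" by (simp add: spectral_function_def)
  fix k j assume kj: "k < N" "j < N"
  have "(\<lambda>t. spectral_function t $$ (j, k)) = (\<lambda>t. cnj (spectral_function t $$ (k, j)))"
  proof (rule eq_of_increments)
    show "((\<lambda>t. cnj (spectral_function t $$ (k, j))) \<longlongrightarrow> 0) at_bot"
      using tendsto_cnj[OF spectral_function_at_bot[OF kj]] by simp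
    fix u v :: real assume uv: "u \<le> v"
    show "spectral_function v $$ (j, k) - spectral_function u $$ (j, k) = cnj (spectral_function v $$ (k, j)) - cnj (spectral_function u $$ (k, j))"
      unfolding complex_cnj_diff[symmetric] spectral_function_increment[OF kj uv, symmetric]
        spectral_function_increment[OF kj(2) kj(1) uv, symmetric]
      by (rule measure_polar_swap[OF uv])
  qed (rule spectral_function_at_bot[OF kj(2) kj(1)])
  from fun_cong[OF this] show "cnj (spectral_function t $$ (k, j)) = spectral_function t $$ (j, k)" by (rule sym)
qed

text \<open>By \<open>interval_form\<close> the quadratic form of an increment at v is the mass of
  [s, t) for the vector with coefficients conj(v_i) along x_i.\<close>

lemma spectral_function_increasing:
  assumes st: "s \<le> t"
  shows "pos_semidef_mat N (spectral_function t - spectral_function s)"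
  unfolding pos_semidef_mat_def
proof (intro conjI ballI)
  have c: "spectral_function t \<in> carrier_mat N N" for t by (simp add: spectral_function_def)
  show "hermitian_mat N (spectral_function t - spectral_function s)"
    using spectral_function_hermitian[of t] spectral_function_hermitian[of s] c[of s] c[of t]
minus_carrier_mat[OF c[of s], of "spectral_function t"]
    by (simp add: hermitian_mat_iff)
  fix v :: "complex vec" assume v: "v \<in> carrier_vec N"
  have "((spectral_function t - spectral_function s) *\<^sub>v v) \<bullet>c v
      = (\<Sum>i<N. \<Sum>j<N. cnj (v $ i) * v $ j * (spectral_function t - spectral_function s) $$ (i, j))"
    by (rule quadratic_form_sum[OF minus_carrier_mat[OF c] v])
  also have "\<dots> = (\<Sum>i<N. \<Sum>j<N. cnj (v $ i) * cnj (cnj (v $ j)) * (\<Sum>\<sigma><4. \<i> ^ \<sigma> * measure (\<mu> (polar_vec (x i) (x j) \<sigma>)) {s..<t}))"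
    by (intro sum.cong refl) (use c[of s] c[of t] in \<open>simp add: spectral_function_increment[OF _ _ st]\<close>)
  also have "\<dots> = measure (\<mu> (\<Sum>i<N. cnj (v $ i) *\<^sub>C x i)) {s..<t}" by (rule interval_form[OF st])
  finally show "0 \<le> Re (((spectral_function t - spectral_function s) *\<^sub>v v) \<bullet>c v)" by simp
qed

lemma spectral_function_left_continuous:
  assumes kj: "k < N" "j < N"
  shows "continuous (at_left t) (\<lambda>s. spectral_function s $$ (k, j))"
  unfolding continuous_within spectral_function_entry[OF kj]
  by (intro tendsto_intros finite_borel_measure.measure_lessThan_left_continuous finite_borel_\<mu>)

text \<open>The polar vectors y r of x_(rN+k) and x_(rN+j) form a chain in \<open>A\<close>. Even
  moments of the measure of y 0 are |y r|^2 and odd ones <y r, y (r+1)>; summation with the weights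
  \<open>\<i> ^ \<sigma>\<close> returns Gram entries, that is, entries of S_m. The top moment 2d is
  the squared norm at the end of the chain.\<close>

lemma spectral_function_moments:
  assumes m: "m \<le> 2 * d" and kj: "k < N" "j < N"
  shows "has_stieltjes_integral (\<lambda>t. complex_of_real (t ^ m)) (\<lambda>t. spectral_function t $$ (k, j)) (S m $$ (k, j))"
proof -
  define y where "y \<sigma> r = polar_vec (x (r * N + k)) (x (r * N + j)) \<sigma>" for \<sigma> r
  have chain: "(y \<sigma> r, y \<sigma> (Suc r)) \<in> A" if "r < d" for \<sigma> r
  proof -
    have "(x (r * N + k), x (Suc r * N + k)) \<in> A" "(x (r * N + j), x (Suc r * N + j)) \<in> A"
      using shift_mem[OF block_index_less[OF that kj(1)]] shift_mem[OF block_index_less[OF that kj(2)]]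
      by (simp_all add: add_ac)
    then show ?thesis unfolding y_def polar_vec_def by (intro scale_mem add_mem)
  qed
  have y0: "y \<sigma> 0 = polar_vec (x k) (x j) \<sigma>" for \<sigma> by (simp add: y_def)
  have cm: "integrable (\<mu> (polar_vec (x k) (x j) \<sigma>)) (\<lambda>t. t ^ (2 * r))" if "r \<le> d" for \<sigma> r
    using chain_moments(1)[where y = "y \<sigma>" and d = d, OF complete chain that] by (simp only: y0)
  have cv1: "(\<integral>t. t ^ (2 * r) \<partial>\<mu> (polar_vec (x k) (x j) \<sigma>)) = (norm (y \<sigma> r))\<^sup>2" if "r \<le> d" for \<sigma> r
    using chain_moment_values(1)[where y = "y \<sigma>" and d = d, OF complete chain that] by (simp only: y0)
  have cv2: "integrable (\<mu> (polar_vec (x k) (x j) \<sigma>)) (\<lambda>t. t ^ (2 * r + 1))" if "r < d" for \<sigma> r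
    using chain_moment_values(2)[where y = "y \<sigma>" and d = d, OF complete chain that] by (simp only: y0)
  have cv3: "complex_of_real (\<integral>t. t ^ (2 * r + 1) \<partial>\<mu> (polar_vec (x k) (x j) \<sigma>)) = cinner (y \<sigma> r) (y \<sigma> (Suc r))" if "r < d" for \<sigma> r
    using chain_moment_values(3)[where y = "y \<sigma>" and d = d, OF complete chain that] by (simp only: y0)
  have "(\<forall>\<sigma><4. integrable (\<mu> (polar_vec (x k) (x j) \<sigma>)) (\<lambda>t. complex_of_real (t ^ m))) \<and>
     S m $$ (k, j) = (\<Sum>\<sigma><4. \<i> ^ \<sigma> * (\<integral>t. complex_of_real (t ^ m) \<partial>\<mu> (polar_vec (x k) (x j) \<sigma>)))"
  proof (cases "even m")
    case True
    then obtain r where mr: "m = 2 * r" by blast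
    then have r: "r \<le> d" using m by simp
    have "(\<Sum>\<sigma><4. \<i> ^ \<sigma> * (\<integral>t. complex_of_real (t ^ m) \<partial>\<mu> (polar_vec (x k) (x j) \<sigma>))) = (\<Sum>\<sigma><4. \<i> ^ \<sigma> * cinner (y \<sigma> r) (y \<sigma> r))"
      unfolding integral_complex_of_real mr cv1[OF r] cinner_self ..
    also have "\<dots> = cinner (x (r * N + k)) (x (r * N + j))" unfolding y_def by (rule polarization_id)
    also have "\<dots> = S m $$ (k, j)" unfolding mr gram_blocks[OF r r kj] mult_2 ..
    finally show ?thesis using cm[OF r] by (simp add: mr integrable_of_real del: of_real_power)
  next
    case False
    then obtain r where mr: "m = 2 * r + 1" by (metis oddE)
    then have r: "r < d" using m by simp
    have "(\<Sum>\<sigma><4. \<i> ^ \<sigma> * (\<integral>t. complex_of_real (t ^ m) \<partial>\<mu> (polar_vec (x k) (x j) \<sigma>))) = (\<Sum>\<sigma><4. \<i> ^ \<sigma> * cinner (y \<sigma> r) (y \<sigma> (Suc r)))"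
      unfolding integral_complex_of_real mr cv3[OF r] ..
    also have "\<dots> = cinner (x (r * N + k)) (x (Suc r * N + j))"
      unfolding y_def polar_vec_def sum_four
      by (simp add: i_power[unfolded One_nat_def] cinner_simps) (simp add: field_simps)
    also have "\<dots> = S m $$ (k, j)" unfolding mr gram_blocks[OF less_imp_le[OF r] Suc_leI[OF r] kj] by (simp add: mult_2)
    finally show ?thesis using cv2[OF r] by (simp add: mr integrable_of_real del: of_real_power of_real_mult)
  qed
  then show ?thesis
    unfolding has_stieltjes_integral_parts using spectral_function_parts[OF kj]
    by (intro exI[of _ "\<lambda>\<sigma>. \<mu> (polar_vec (x k) (x j) \<sigma>)"]) blast
qed

lemma spectral_function_solution: "spectral_function \<in> moment_solutions N d S"
  unfolding moment_solutions_def
  by (intro CollectI conjI allI impI spectral_function_hermitian spectral_function_increasing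
      spectral_function_left_continuous spectral_function_at_bot spectral_function_moments)

lemma spectral_function_resolvent:
  "z \<in> upper_half_plane \<Longrightarrow> k < N \<Longrightarrow> j < N \<Longrightarrow>
    has_stieltjes_integral (\<lambda>t. 1 / (complex_of_real t - z)) (\<lambda>t. spectral_function t $$ (k, j)) (cinner (R z (x k)) (x j))"
  using uhp_ne(2)[of z] unfolding pol_resolvent[symmetric] pol_def
  by (subst has_stieltjes_integral_resolvent[OF spectral_function_parts]) auto

end

context moment_data
begin

theorem admissible_parameter_solution:
  assumes \<epsilon>: "0 < \<epsilon>" "\<epsilon> \<le> pi / 2" and F: "F \<in> admissible_class \<epsilon> A"
  shows "\<exists>!M. M \<in> moment_solutions N d S \<and> stieltjes_resolvent_relation N x A M F"
proof -
  interpret cp: contractive_parameter e n A F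
    by unfold_locales (use F in \<open>simp add: admissible_class_def\<close>)
  interpret mr: moment_resolvent e n N d S x cp.res
    by unfold_locales (rule cp.gr.admissible_imp_complete[OF \<epsilon> _ zero_mem_imp_zero], simp_all add: cp.param_res F)
  have FU: "F z \<psi> = cp.gr.U z \<psi>" if "z \<in> upper_half_plane" "\<psi> \<in> defect_subspace A \<i>" for z \<psi>
    using cp.gr.param_eq[OF that] by (simp add: cp.param_res)
  have rel: "stieltjes_resolvent_relation N x A M F \<longleftrightarrow> (\<forall>z\<in>upper_half_plane. \<forall>k<N. \<forall>j<N.
      has_stieltjes_integral (\<lambda>t. 1 / (complex_of_real t - z)) (\<lambda>t. M t $$ (k, j)) (cinner (cp.res z (x k)) (x j)))" for M
    by (rule mr.relation_iff[OF FU])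
  show ?thesis
  proof (rule ex1I[of _ mr.spectral_function], intro conjI mr.spectral_function_solution)
    show "stieltjes_resolvent_relation N x A mr.spectral_function F"
      unfolding rel by (intro ballI allI impI mr.spectral_function_resolvent)
    fix M assume M: "M \<in> moment_solutions N d S \<and> stieltjes_resolvent_relation N x A M F"
    show "M = mr.spectral_function"
      by (rule moment_solution_unique[where J = "\<lambda>z k j. cinner (cp.res z (x k)) (x j)", OF _ mr.spectral_function_solution])
         (use M mr.spectral_function_resolvent in \<open>auto simp: rel\<close>)
  qed
qed

text \<open>M fixes the integrals in the relation, these fix the first block of matrix elements of
  R_z, the block fixes R_z, and R_z fixes its Cayley transform and so the parameter.\<close>

theorem admissible_parameter_unique:
  assumes \<epsilon>: "0 < \<epsilon>" "\<epsilon> \<le> pi / 2" and M: "M \<in> moment_solutions N d S"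
    and F: "F \<in> admissible_class \<epsilon> A" "stieltjes_resolvent_relation N x A M F"
    and F': "F' \<in> admissible_class \<epsilon> A" "stieltjes_resolvent_relation N x A M F'"
  shows "F = F'"
proof -
  have main: "\<exists>R. generalized_resolvent e n A R \<and> generalized_resolvent.param A R = G \<and> (\<forall>z\<in>upper_half_plane. \<forall>k<N. \<forall>j<N.
      has_stieltjes_integral (\<lambda>t. 1 / (complex_of_real t - z)) (\<lambda>t. M t $$ (k, j)) (cinner (R z (x k)) (x j)))"
    if G: "G \<in> admissible_class \<epsilon> A" "stieltjes_resolvent_relation N x A M G" for G
  proof -
    interpret cp: contractive_parameter e n A G
      by unfold_locales (use G(1) in \<open>simp add: admissible_class_def\<close>)
    interpret mr: moment_resolvent e n N d S x cp.res
      by unfold_locales (rule cp.gr.admissible_imp_complete[OF \<epsilon> _ zero_mem_imp_zero], simp_all add: cp.param_res G(1))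
    have FU: "G z \<psi> = cp.gr.U z \<psi>" if "z \<in> upper_half_plane" "\<psi> \<in> defect_subspace A \<i>" for z \<psi>
      using cp.gr.param_eq[OF that] by (simp add: cp.param_res)
    show ?thesis
      using cp.gr.generalized_resolvent_axioms cp.param_res G(2) mr.relation_iff[OF FU, of M] by blast
  qed
  obtain R where R: "generalized_resolvent e n A R" "generalized_resolvent.param A R = F"
      "\<And>z k j. z \<in> upper_half_plane \<Longrightarrow> k < N \<Longrightarrow> j < N \<Longrightarrow>
        has_stieltjes_integral (\<lambda>t. 1 / (complex_of_real t - z)) (\<lambda>t. M t $$ (k, j)) (cinner (R z (x k)) (x j))"
    using main[OF F] by blast
  obtain R' where R': "generalized_resolvent e n A R'" "generalized_resolvent.param A R' = F'"
      "\<And>z k j. z \<in> upper_half_plane \<Longrightarrow> k < N \<Longrightarrow> j < N \<Longrightarrow>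
        has_stieltjes_integral (\<lambda>t. 1 / (complex_of_real t - z)) (\<lambda>t. M t $$ (k, j)) (cinner (R' z (x k)) (x j))"
    using main[OF F'] by blast
  have "R z = R' z" if z: "z \<in> upper_half_plane" for z
  proof (rule resolvent_determined[OF R(1) R'(1) _ z])
    fix k j assume kj: "k < N" "j < N"
    obtain \<nu> where \<nu>: "stieltjes_parts (\<lambda>t. M t $$ (k, j)) \<nu>" using moment_solution_parts[OF M le0 kj] by blast
    have "Im z \<noteq> 0" using uhp_ne(2)[OF z] by simp
    note eq = has_stieltjes_integral_resolvent[OF \<nu> this]
    show "cinner (R z (x k)) (x j) = cinner (R' z (x k)) (x j)"
      using R(3)[OF z kj] R'(3)[OF z kj] unfolding eq by simp
  qed
  from param_determined[OF R(1) R'(1) this] show ?thesis using R(2) R'(2) by simp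
qed

end

subsection \<open>From solutions to parameters\<close>

text \<open>The difference quotient between z and w is the transform of g(t)/(t - z) at w, so
  differentiability follows from continuity of such transforms. Continuity follows from the same
  identity and a lower bound for Im w near z.\<close>

lemma resolvent_kernel_integral_holomorphic:
  assumes \<mu>: "finite_borel_measure \<mu>" and g: "integrable \<mu> (g :: real \<Rightarrow> complex)"
  shows "(\<lambda>z. \<integral>t. g t / (complex_of_real t - z) \<partial>\<mu>) holomorphic_on upper_half_plane"
proof -
  define F where "F h z = (\<integral>t. h t / (complex_of_real t - z) \<partial>\<mu>)" for h z
  have diff: "F h w - F h z = (w - z) * F (\<lambda>t. h t / (complex_of_real t - z)) w"
    if h: "integrable \<mu> h" and z: "z \<in> upper_half_plane" and w: "w \<in> upper_half_plane" for h :: "real \<Rightarrow> complex" and w z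
  proof -
    have "Im w \<noteq> 0" "Im z \<noteq> 0" using uhp_ne(2)[OF z] uhp_ne(2)[OF w] by auto
    note i = integrable_mult_resolvent_kernel[OF \<mu> \<open>Im w \<noteq> 0\<close> h] integrable_mult_resolvent_kernel[OF \<mu> \<open>Im z \<noteq> 0\<close> h]
    have ne: "complex_of_real t - w \<noteq> 0" "complex_of_real t - z \<noteq> 0" for t
      using \<open>Im w \<noteq> 0\<close> \<open>Im z \<noteq> 0\<close> by (auto simp: complex_eq_iff)
    have "h t / (complex_of_real t - w) - h t / (complex_of_real t - z) = (w - z) * (h t / (complex_of_real t - z) / (complex_of_real t - w))" for t
      using ne[of t] by (simp add: divide_simps) (simp add: algebra_simps)
    then show ?thesis
      unfolding F_def Bochner_Integration.integral_diff[OF i, symmetric] by (simp only: integral_mult_right_zero)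
  qed
  have cont: "(F h \<longlongrightarrow> F h z) (at z)" if h: "integrable \<mu> h" and z: "z \<in> upper_half_plane" for h z
  proof -
    have Iz: "0 < Im z" using uhp_ne(2)[OF z] .
    let ?h = "\<lambda>t. h t / (complex_of_real t - z)"
    have h': "integrable \<mu> ?h" by (rule integrable_mult_resolvent_kernel[OF \<mu> _ h]) (use Iz in simp)
    define C where "C = (\<integral>t. 2 / Im z * cmod (?h t) \<partial>\<mu>)"
    have ev: "\<forall>\<^sub>F w in at z. Im z / 2 < Im w"
      by (rule order_tendstoD(1)[where y = "Im z"]) (use Iz in \<open>auto intro!: tendsto_Im tendsto_ident_at\<close>)
    have "((\<lambda>w. F h w - F h z) \<longlongrightarrow> 0) (at z)"
    proof (rule Lim_null_comparison)
      show "\<forall>\<^sub>F w in at z. cmod (F h w - F h z) \<le> cmod (w - z) * C"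
        using ev
      proof eventually_elim
        case (elim w)
        then have w: "w \<in> upper_half_plane" using Iz by (simp add: upper_half_plane_def)
        have "cmod (F ?h w) \<le> C"
          unfolding F_def C_def
        proof (rule Bochner_Integration.integral_norm_bound_integral)
          show "integrable \<mu> (\<lambda>t. ?h t / (complex_of_real t - w))"
            by (rule integrable_mult_resolvent_kernel[OF \<mu> _ h']) (use elim Iz in simp)
          show "integrable \<mu> (\<lambda>t. 2 / Im z * cmod (?h t))" using h' by (intro integrable_mult_right integrable_norm)
          fix t
          have "cmod (?h t / (complex_of_real t - w)) = cmod (1 / (complex_of_real t - w)) * cmod (?h t)"
            by (simp add: norm_divide norm_mult)
          also have "\<dots> \<le> 2 / Im z * cmod (?h t)"
          proof (rule mult_right_mono)
            have "cmod (1 / (complex_of_real t - w)) \<le> 1 / \<bar>Im w\<bar>" by (rule resolvent_kernel_bound) (use elim Iz in simp)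
            also have "\<dots> \<le> 2 / Im z" using elim Iz by (simp add: divide_simps)
            finally show "cmod (1 / (complex_of_real t - w)) \<le> 2 / Im z" .
          qed simp
          finally show "cmod (?h t / (complex_of_real t - w)) \<le> 2 / Im z * cmod (?h t)" .
        qed
        then show ?case unfolding diff[OF h z w] norm_mult by (rule mult_left_mono) simp
      qed
      have "((\<lambda>w. cmod (w - z) * C) \<longlongrightarrow> cmod (z - z) * C) (at z)"
        by (intro tendsto_intros)
      then show "((\<lambda>w. cmod (w - z) * C) \<longlongrightarrow> 0) (at z)" by simp
    qed
    then show ?thesis by (simp add: LIM_zero_iff)
  qed
  have "(F g has_field_derivative F (\<lambda>t. g t / (complex_of_real t - z)) z) (at z)" if z: "z \<in> upper_half_plane" for z
  proof -
    have Iz: "Im z \<noteq> 0" using uhp_ne(2)[OF z] by simp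
    have "((\<lambda>w. (F g w - F g z) / (w - z)) \<longlongrightarrow> F (\<lambda>t. g t / (complex_of_real t - z)) z) (at z)"
    proof (rule Lim_transform_eventually[OF cont[OF integrable_mult_resolvent_kernel[OF \<mu> Iz g] z]])
      show "\<forall>\<^sub>F w in at z. F (\<lambda>t. g t / (complex_of_real t - z)) w = (F g w - F g z) / (w - z)"
        using eventually_at_in_open'[OF open_upper_half_plane z] eventually_neq_at_within[of z]
        by eventually_elim (simp add: diff[OF g z])
    qed
    then show ?thesis by (simp only: has_field_derivative_iff)
  qed
  then show ?thesis unfolding F_def holomorphic_on_def field_differentiable_def by (meson has_field_derivative_at_within)
qed

section \<open>The semidefinite form of a matrix measure\<close>

locale matrix_measure =
  fixes N d :: nat and \<nu> :: "nat \<Rightarrow> nat \<Rightarrow> nat \<Rightarrow> real measure"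
  assumes finite_borel_\<nu>: "k < N \<Longrightarrow> j < N \<Longrightarrow> \<sigma> < 4 \<Longrightarrow> finite_borel_measure (\<nu> k j \<sigma>)"
    and integrable_\<nu>: "k < N \<Longrightarrow> j < N \<Longrightarrow> \<sigma> < 4 \<Longrightarrow> integrable (\<nu> k j \<sigma>) (\<lambda>t. (1 + \<bar>t\<bar>) ^ (2 * d))"
    and interval_nonneg: "a \<le> b \<Longrightarrow>
      0 \<le> Re (\<Sum>k<N. \<Sum>j<N. c k * cnj (c j) * (\<Sum>\<sigma><4. \<i> ^ \<sigma> * complex_of_real (measure (\<nu> k j \<sigma>) {a..<b})))"
    and interval_real: "a \<le> b \<Longrightarrow>
      Im (\<Sum>k<N. \<Sum>j<N. c k * cnj (c j) * (\<Sum>\<sigma><4. \<i> ^ \<sigma> * complex_of_real (measure (\<nu> k j \<sigma>) {a..<b}))) = 0"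
begin

text \<open>Growth of degree d: products of two such functions are integrable by the moment of order
  2d, and multiplication by the bounded kernel 1/(t - z) preserves the class.\<close>

definition moderate :: "(real \<Rightarrow> nat \<Rightarrow> complex) \<Rightarrow> bool" where
  "moderate p \<longleftrightarrow> (\<forall>k<N. continuous_on UNIV (\<lambda>t. p t k)) \<and> (\<exists>C. \<forall>k<N. \<forall>t. cmod (p t k) \<le> C * (1 + \<bar>t\<bar>) ^ d)"

text \<open>The scalar product of L^2(M) before passing to the quotient; null vectors are handled by
  \<open>B_null\<close>.\<close>

definition B :: "(real \<Rightarrow> nat \<Rightarrow> complex) \<Rightarrow> (real \<Rightarrow> nat \<Rightarrow> complex) \<Rightarrow> complex" where
  "B p q = (\<Sum>k<N. \<Sum>j<N. \<Sum>\<sigma><4. \<i> ^ \<sigma> * (\<integral>t. p t k * cnj (q t j) \<partial>\<nu> k j \<sigma>))"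

lemma moderateE:
  assumes "moderate p"
  obtains C where "0 \<le> C" "\<And>k t. k < N \<Longrightarrow> cmod (p t k) \<le> C * (1 + \<bar>t\<bar>) ^ d"
proof -
  obtain C where C: "\<And>k t. k < N \<Longrightarrow> cmod (p t k) \<le> C * (1 + \<bar>t\<bar>) ^ d"
    using assms unfolding moderate_def by blast
  have "cmod (p t k) \<le> \<bar>C\<bar> * (1 + \<bar>t\<bar>) ^ d" if "k < N" for k t
    by (rule order_trans[OF C[OF that] mult_right_mono]) simp_all
  then show thesis by (rule that[of "\<bar>C\<bar>", rotated]) simp_all
qed

lemma moderate_product_bound:
  assumes "moderate p" "moderate q"
  obtains C where "0 \<le> C" "\<And>k j t. k < N \<Longrightarrow> j < N \<Longrightarrow> cmod (p t k * cnj (q t j)) \<le> C * (1 + \<bar>t\<bar>) ^ (2 * d)"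
proof -
  obtain C where C: "0 \<le> C" "\<And>k t. k < N \<Longrightarrow> cmod (p t k) \<le> C * (1 + \<bar>t\<bar>) ^ d" using moderateE[OF assms(1)] by blast
  obtain C' where C': "0 \<le> C'" "\<And>k t. k < N \<Longrightarrow> cmod (q t k) \<le> C' * (1 + \<bar>t\<bar>) ^ d" using moderateE[OF assms(2)] by blast
  have "cmod (p t k * cnj (q t j)) \<le> (C * C') * (1 + \<bar>t\<bar>) ^ (2 * d)" if "k < N" "j < N" for k j t
  proof -
    have "cmod (p t k) * cmod (q t j) \<le> (C * (1 + \<bar>t\<bar>) ^ d) * (C' * (1 + \<bar>t\<bar>) ^ d)"
      by (intro mult_mono C C' that) (use C(1) in auto)
    also have "\<dots> = (C * C') * (1 + \<bar>t\<bar>) ^ (2 * d)" unfolding mult_2 power_add by (simp only: mult_ac)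
    finally show ?thesis by (simp add: norm_mult)
  qed
  then show thesis using that[of "C * C'"] C(1) C'(1) by simp
qed

lemma moderate_product_continuous:
  "moderate p \<Longrightarrow> moderate q \<Longrightarrow> k < N \<Longrightarrow> j < N \<Longrightarrow> continuous_on UNIV (\<lambda>t. p t k * cnj (q t j))"
  unfolding moderate_def by (intro continuous_intros) auto

lemma integrable_product:
  assumes "moderate p" "moderate q" "k < N" "j < N" "\<sigma> < 4"
  shows "integrable (\<nu> k j \<sigma>) (\<lambda>t. p t k * cnj (q t j))"
proof -
  obtain C where C: "0 \<le> C" "\<And>k j t. k < N \<Longrightarrow> j < N \<Longrightarrow> cmod (p t k * cnj (q t j)) \<le> C * (1 + \<bar>t\<bar>) ^ (2 * d)"
    using moderate_product_bound[OF assms(1,2)] by blast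
  show ?thesis
  proof (rule Bochner_Integration.integrable_bound)
    show "integrable (\<nu> k j \<sigma>) (\<lambda>t. C * (1 + \<bar>t\<bar>) ^ (2 * d))" by (intro integrable_mult_right integrable_\<nu> assms)
    show "(\<lambda>t. p t k * cnj (q t j)) \<in> borel_measurable (\<nu> k j \<sigma>)"
      by (rule finite_borel_measure_measurable[OF finite_borel_\<nu>[OF assms(3-5)]
            borel_measurable_continuous_onI[OF moderate_product_continuous[OF assms(1-4)]]])
    show "AE t in \<nu> k j \<sigma>. norm (p t k * cnj (q t j)) \<le> norm (C * (1 + \<bar>t\<bar>) ^ (2 * d))"
      using C(2)[OF assms(3,4)] by (intro AE_I2) (simp add: order_trans[OF _ abs_ge_self])
  qed
qed

lemma moderate_add: "moderate p \<Longrightarrow> moderate q \<Longrightarrow> moderate (\<lambda>t k. p t k + q t k)"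
proof -
  assume pq: "moderate p" "moderate q"
  obtain C where C: "0 \<le> C" "\<And>k t. k < N \<Longrightarrow> cmod (p t k) \<le> C * (1 + \<bar>t\<bar>) ^ d" using moderateE[OF pq(1)] by blast
  obtain C' where C': "0 \<le> C'" "\<And>k t. k < N \<Longrightarrow> cmod (q t k) \<le> C' * (1 + \<bar>t\<bar>) ^ d" using moderateE[OF pq(2)] by blast
  have "cmod (p t k + q t k) \<le> (C + C') * (1 + \<bar>t\<bar>) ^ d" if "k < N" for k t
    unfolding distrib_right by (rule order_trans[OF norm_triangle_ineq add_mono[OF C(2)[OF that] C'(2)[OF that]]])
  moreover have "continuous_on UNIV (\<lambda>t. p t k + q t k)" if "k < N" for k
    using pq that unfolding moderate_def by (intro continuous_on_add) auto
  ultimately show ?thesis unfolding moderate_def by blast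
qed

lemma moderate_mult: 
  assumes p: "moderate p" and f: "continuous_on UNIV f" and K: "\<And>t. cmod (f t) \<le> K"
  shows "moderate (\<lambda>t k. f t * p t k)"
proof -
  obtain C where C: "0 \<le> C" "\<And>k t. k < N \<Longrightarrow> cmod (p t k) \<le> C * (1 + \<bar>t\<bar>) ^ d" using moderateE[OF p] by blast
  have "0 \<le> K" using K[of 0] norm_ge_zero order_trans by blast
  then have "cmod (f t * p t k) \<le> (K * C) * (1 + \<bar>t\<bar>) ^ d" if "k < N" for k t
    unfolding norm_mult mult.assoc by (intro mult_mono K C that) simp_all
  moreover have "continuous_on UNIV (\<lambda>t. f t * p t k)" if "k < N" for k
    using p that unfolding moderate_def by (intro continuous_on_mult f) auto
  ultimately show ?thesis unfolding moderate_def by blast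
qed

lemma moderate_scale: "moderate p \<Longrightarrow> moderate (\<lambda>t k. c * p t k)"
  by (rule moderate_mult[where K = "cmod c"]) simp_all

lemma moderate_sum: "(\<And>i. i < K \<Longrightarrow> moderate (p i)) \<Longrightarrow> moderate (\<lambda>t k. \<Sum>i<(K::nat). c i * p i t k)"
proof (induction K)
  case 0
  show ?case unfolding moderate_def by (auto intro!: exI[of _ 0])
next
  case (Suc K)
  then have "moderate (\<lambda>t k. (\<Sum>i<K. c i * p i t k) + c K * p K t k)" by (intro moderate_add moderate_scale) auto
  then show ?case by simp
qed

definition kernel_mult :: "complex \<Rightarrow> (real \<Rightarrow> nat \<Rightarrow> complex) \<Rightarrow> real \<Rightarrow> nat \<Rightarrow> complex" where
  "kernel_mult z p = (\<lambda>t k. 1 / (complex_of_real t - z) * p t k)"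

lemma moderate_kernel_mult: "moderate p \<Longrightarrow> Im z \<noteq> 0 \<Longrightarrow> moderate (kernel_mult z p)"
  unfolding kernel_mult_def by (rule moderate_mult[OF _ continuous_resolvent_kernel resolvent_kernel_bound])

lemma B_kernel_mult: "B (kernel_mult z p) q = B p (kernel_mult (cnj z) q)"
  unfolding B_def kernel_mult_def by (simp add: mult_ac)

lemma B_add_left:
  assumes "moderate p" "moderate p'" "moderate q"
  shows "B (\<lambda>t k. p t k + p' t k) q = B p q + B p' q"
proof -
  have "(\<integral>t. (p t k + p' t k) * cnj (q t j) \<partial>\<nu> k j \<sigma>) = (\<integral>t. p t k * cnj (q t j) \<partial>\<nu> k j \<sigma>) + (\<integral>t. p' t k * cnj (q t j) \<partial>\<nu> k j \<sigma>)"
    if "k < N" "j < N" "\<sigma> < 4" for k j \<sigma>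
    unfolding distrib_right
    by (rule Bochner_Integration.integral_add[OF integrable_product[OF assms(1,3) that] integrable_product[OF assms(2,3) that]])
  then show ?thesis unfolding B_def sum.distrib[symmetric] distrib_left[symmetric] by (intro sum.cong refl) simp
qed

lemma B_scale_left: "B (\<lambda>t k. c * p t k) q = c * B p q"
  unfolding B_def by (simp add: mult.assoc sum_distrib_left mult.left_commute)

lemma B_add_right:
  assumes "moderate p" "moderate q" "moderate q'"
  shows "B p (\<lambda>t k. q t k + q' t k) = B p q + B p q'"
proof -
  have "(\<integral>t. p t k * cnj (q t j + q' t j) \<partial>\<nu> k j \<sigma>) = (\<integral>t. p t k * cnj (q t j) \<partial>\<nu> k j \<sigma>) + (\<integral>t. p t k * cnj (q' t j) \<partial>\<nu> k j \<sigma>)"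
    if "k < N" "j < N" "\<sigma> < 4" for k j \<sigma>
    unfolding complex_cnj_add distrib_left
    by (rule Bochner_Integration.integral_add[OF integrable_product[OF assms(1,2) that] integrable_product[OF assms(1,3) that]])
  then show ?thesis unfolding B_def sum.distrib[symmetric] distrib_left[symmetric] by (intro sum.cong refl) simp
qed

lemma B_scale_right: "B p (\<lambda>t k. c * q t k) = cnj c * B p q"
proof -
  have "(\<integral>t. p t k * cnj (c * q t j) \<partial>\<nu> k j \<sigma>) = cnj c * (\<integral>t. p t k * cnj (q t j) \<partial>\<nu> k j \<sigma>)" for k j \<sigma>
    unfolding integral_mult_right_zero[symmetric] by (simp add: mult_ac)
  then show ?thesis unfolding B_def by (simp add: sum_distrib_left mult.left_commute)
qed

lemma B_self: 
  assumes p: "moderate p"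
  shows B_real: "Im (B p p) = 0" and B_nonneg: "0 \<le> Re (B p p)"
proof -
  obtain C where C: "0 \<le> C" "\<And>k j t. k < N \<Longrightarrow> j < N \<Longrightarrow> cmod (p t k * cnj (p t j)) \<le> C * (1 + \<bar>t\<bar>) ^ (2 * d)"
    using moderate_product_bound[OF p p] by blast
  define I where "I = {..<N} \<times> {..<N} \<times> {..<4::nat}"
  define Mu where "Mu = (\<lambda>(k, j, \<sigma>). \<nu> k j \<sigma>)"
  \<comment> \<open>One argument for sign and reality: the interval values w are real and
    nonnegative, so Re (\<zeta> w) \<ge> 0 holds for \<zeta> = 1 and, with equality, for \<zeta> = i
    and -i.\<close>
  have main: "0 \<le> Re (\<zeta> * B p p)" if \<zeta>: "cmod \<zeta> = 1" and pos: "\<And>w. Im w = 0 \<Longrightarrow> 0 \<le> Re w \<Longrightarrow> 0 \<le> Re (\<zeta> * w)" for \<zeta>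
  proof -
    define h where "h = (\<lambda>(k, j, \<sigma>::nat) t. \<zeta> * (\<i> ^ \<sigma> * (p t k * cnj (p t j))))"
    have "0 \<le> Re (\<Sum>i\<in>I. \<integral>t. h i t \<partial>Mu i)"
    proof (rule stieltjes_form_nonneg[where C = C and m = "2 * d"])
      show "finite I" by (simp add: I_def)
      show "finite_borel_measure (Mu i)" "integrable (Mu i) (\<lambda>t. (1 + \<bar>t\<bar>) ^ (2 * d))" if "i \<in> I" for i
        using that finite_borel_\<nu> integrable_\<nu> by (auto simp: I_def Mu_def)
      show "continuous_on UNIV (h i)" if "i \<in> I" for i
        using that by (auto simp: I_def h_def intro!: continuous_on_mult_left moderate_product_continuous[OF p p])
      show "cmod (h i t) \<le> C * (1 + \<bar>t\<bar>) ^ (2 * d)" if "i \<in> I" for i t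
        using that C(2) \<zeta> by (auto simp: I_def h_def norm_mult norm_power)
      fix t a b :: real assume ab: "a \<le> b"
      have "(\<Sum>i\<in>I. h i t * complex_of_real (measure (Mu i) {a..<b}))
          = \<zeta> * (\<Sum>k<N. \<Sum>j<N. p t k * cnj (p t j) * (\<Sum>\<sigma><4. \<i> ^ \<sigma> * complex_of_real (measure (\<nu> k j \<sigma>) {a..<b})))"
        unfolding I_def sum_triple by (simp add: h_def Mu_def sum_distrib_left mult_ac)
      also have "0 \<le> Re \<dots>" by (intro pos interval_real interval_nonneg ab)
      finally show "0 \<le> Re (\<Sum>i\<in>I. h i t * complex_of_real (measure (Mu i) {a..<b}))" .
    qed
    also have "(\<Sum>i\<in>I. \<integral>t. h i t \<partial>Mu i) = \<zeta> * B p p"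
      unfolding I_def sum_triple B_def by (simp add: h_def Mu_def sum_distrib_left)
    finally show ?thesis .
  qed
  show "0 \<le> Re (B p p)" using main[of 1] by simp
  show "Im (B p p) = 0" using main[of \<i>] main[of "- \<i>"] by simp
qed

lemma B_sesquilinear_expand:
  assumes "moderate p" "moderate q"
  shows "B (\<lambda>t k. q t k + c * p t k) (\<lambda>t k. q t k + c * p t k) = B q q + c * B p q + cnj c * B q p + (c * cnj c) * B p p"
  using assms by (simp add: B_add_left B_add_right moderate_add moderate_scale B_scale_left B_scale_right algebra_simps)

text \<open>The form is real on the diagonal; evaluation at q + p and at q + i p gives the imaginary
  and the real part of the symmetry.\<close>

lemma B_hermitian:
  assumes pq: "moderate p" "moderate q"
  shows "B q p = cnj (B p q)"
proof -
  have "Im (B q q + c * B p q + cnj c * B q p + (c * cnj c) * B p p) = 0" for c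
    unfolding B_sesquilinear_expand[OF pq, symmetric] by (intro B_real moderate_add moderate_scale pq)
  from this[of 1] this[of \<i>] show ?thesis by (simp add: B_real pq complex_eq_iff)
qed

lemma B_null:
  assumes pq: "moderate p" "moderate q" and null: "B p p = 0"
  shows "B p q = 0" "B q p = 0"
proof -
  have "(cmod (B p q))\<^sup>2 \<le> Re (B q q) * 0"
  proof (rule cmod_sq_le_of_quadratic)
    fix \<zeta>
    have "0 \<le> Re (B q q + \<zeta> * B p q + cnj \<zeta> * cnj (B p q) + (\<zeta> * cnj \<zeta>) * B p p)"
      unfolding B_hermitian[OF pq, symmetric] B_sesquilinear_expand[OF pq, symmetric] by (intro B_nonneg moderate_add moderate_scale pq)
    then show "0 \<le> Re (B q q) + 2 * Re (\<zeta> * B p q) + (cmod \<zeta>)\<^sup>2 * 0" by (simp add: null)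
  qed simp
  then show "B p q = 0" by simp
  then show "B q p = 0" unfolding B_hermitian[OF pq] by simp
qed

lemma B_sum_left:
  assumes "\<And>i. i < K \<Longrightarrow> moderate (p i)" "moderate q"
  shows "B (\<lambda>t k. \<Sum>i<(K::nat). c i * p i t k) q = (\<Sum>i<K. c i * B (p i) q)"
  using assms(1)
proof (induction K)
  case 0
  show ?case by (simp add: B_def)
next
  case (Suc K)
  then have "B (\<lambda>t k. (\<Sum>i<K. c i * p i t k) + c K * p K t k) q = B (\<lambda>t k. \<Sum>i<K. c i * p i t k) q + B (\<lambda>t k. c K * p K t k) q"
    by (intro B_add_left moderate_sum moderate_scale assms(2)) auto
  then show ?case using Suc by (simp add: B_scale_left)
qed

lemma B_sum_right:
  assumes "\<And>i. i < K \<Longrightarrow> moderate (p i)" "moderate q"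
  shows "B q (\<lambda>t k. \<Sum>i<(K::nat). c i * p i t k) = (\<Sum>i<K. cnj (c i) * B q (p i))"
proof -
  have "B q (\<lambda>t k. \<Sum>i<K. c i * p i t k) = cnj (B (\<lambda>t k. \<Sum>i<K. c i * p i t k) q)"
    by (rule B_hermitian) (intro moderate_sum assms, assumption, rule assms)
  also have "\<dots> = (\<Sum>i<K. cnj (c i) * cnj (B (p i) q))" by (simp add: B_sum_left[OF assms])
  also have "\<dots> = (\<Sum>i<K. cnj (c i) * B q (p i))" by (intro sum.cong refl) (simp add: B_hermitian[OF assms(1) assms(2)])
  finally show ?thesis .
qed

lemma B_single:
  assumes "k' < N" "j' < N"
  shows "B (\<lambda>t k. if k = k' then f t else 0) (\<lambda>t j. if j = j' then g t else 0) = (\<Sum>\<sigma><4. \<i> ^ \<sigma> * (\<integral>t. f t * cnj (g t) \<partial>\<nu> k' j' \<sigma>))"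
proof -
  have "B (\<lambda>t k. if k = k' then f t else 0) (\<lambda>t j. if j = j' then g t else 0)
     = (\<Sum>k<N. \<Sum>j<N. if k = k' then if j = j' then (\<Sum>\<sigma><4. \<i> ^ \<sigma> * (\<integral>t. f t * cnj (g t) \<partial>\<nu> k j \<sigma>)) else 0 else 0)"
    unfolding B_def by (intro sum.cong refl) auto
  also have "\<dots> = (\<Sum>k<N. if k = k' then \<Sum>j<N. if j = j' then (\<Sum>\<sigma><4. \<i> ^ \<sigma> * (\<integral>t. f t * cnj (g t) \<partial>\<nu> k j \<sigma>)) else 0 else 0)"
    by (intro sum.cong refl) auto
  also have "\<dots> = (\<Sum>\<sigma><4. \<i> ^ \<sigma> * (\<integral>t. f t * cnj (g t) \<partial>\<nu> k' j' \<sigma>))" using assms by (simp add: sum.delta)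
  finally show ?thesis .
qed

lemma B_kernel_holomorphic:
  assumes "moderate p" "moderate q"
  shows "(\<lambda>z. B (kernel_mult z p) q) holomorphic_on upper_half_plane"
proof -
  have "(\<lambda>z. \<Sum>k<N. \<Sum>j<N. \<Sum>\<sigma><4. \<i> ^ \<sigma> * (\<integral>t. p t k * cnj (q t j) / (complex_of_real t - z) \<partial>\<nu> k j \<sigma>)) holomorphic_on upper_half_plane"
    by (intro holomorphic_intros resolvent_kernel_integral_holomorphic finite_borel_\<nu> integrable_product assms) auto
  then show ?thesis unfolding B_def kernel_mult_def by simp
qed

lemma B_kernel_limit:
  assumes "moderate p" "moderate q" and \<epsilon>: "0 < \<epsilon>" "\<epsilon> \<le> pi / 2"
  shows "((\<lambda>z. - z * B (kernel_mult z p) q) \<longlongrightarrow> B p q) (sector_at_infinity \<epsilon>)"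
proof -
  have "((\<lambda>z. \<Sum>k<N. \<Sum>j<N. \<Sum>\<sigma><4. \<i> ^ \<sigma> * (- z * (\<integral>t. p t k * cnj (q t j) / (complex_of_real t - z) \<partial>\<nu> k j \<sigma>))) \<longlongrightarrow> B p q) (sector_at_infinity \<epsilon>)"
    unfolding B_def
    by (intro tendsto_sum tendsto_mult tendsto_const resolvent_kernel_integral_limit finite_borel_\<nu> integrable_product assms) auto
  then show ?thesis unfolding B_def kernel_mult_def by (simp add: sum_distrib_left mult_ac)
qed

text \<open>Multiplication by the real variable t is symmetric: for h = p/(t - z) one has h conj(p)
  - p conj(h) = (z - conj z) h conj(h), componentwise.\<close>

lemma B_kernel_dissipation:
  assumes p: "moderate p" and z: "Im z \<noteq> 0"
  shows "Im (B (kernel_mult z p) p) = Im z * Re (B (kernel_mult z p) (kernel_mult z p))"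
proof -
  note h = moderate_kernel_mult[OF p z]
  let ?h = "kernel_mult z p"
  have ne: "complex_of_real t - z \<noteq> 0" "complex_of_real t - cnj z \<noteq> 0" for t using z by (auto simp: complex_eq_iff)
  have "?h t k * cnj (p t j) - p t k * cnj (?h t j) = (z - cnj z) * (?h t k * cnj (?h t j))" for t k j
    unfolding kernel_mult_def using ne[of t] by (simp add: divide_simps) (simp add: algebra_simps)
  then have "(\<integral>t. ?h t k * cnj (p t j) \<partial>\<nu> k j \<sigma>) - (\<integral>t. p t k * cnj (?h t j) \<partial>\<nu> k j \<sigma>) = (z - cnj z) * (\<integral>t. ?h t k * cnj (?h t j) \<partial>\<nu> k j \<sigma>)"
    if "k < N" "j < N" "\<sigma> < 4" for k j \<sigma>
    using Bochner_Integration.integral_diff[OF integrable_product[OF h p that] integrable_product[OF p h that]]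
    by (simp only: integral_mult_right_zero)
  then have "B ?h p - B p ?h = (z - cnj z) * B ?h ?h"
    unfolding B_def sum_subtractf[symmetric] right_diff_distrib[symmetric] sum_distrib_left
    by (intro sum.cong refl) (simp add: mult.left_commute)
  moreover have "B p ?h = cnj (B ?h p)" by (rule B_hermitian[OF h p])
  ultimately have "Im (B ?h p - cnj (B ?h p)) = Im ((z - cnj z) * B ?h ?h)" by simp
  then show ?thesis by simp
qed

end

section \<open>Coordinates in H and the associated vector polynomials\<close>

context moment_data
begin

lemma combination_exists: "\<exists>\<alpha>. u = (\<Sum>m<d * N + N. \<alpha> m *\<^sub>C x m)"
proof (rule span_x_induct)
  show "complex_vector.subspace {u. \<exists>\<alpha>. u = (\<Sum>m<d * N + N. \<alpha> m *\<^sub>C x m)}"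
    unfolding complex_vector.subspace_def
  proof (intro conjI ballI allI CollectI)
    show "\<exists>\<alpha>. 0 = (\<Sum>m<d * N + N. \<alpha> m *\<^sub>C x m)" by (rule exI[of _ "\<lambda>_. 0"]) simp
    fix u v assume "u \<in> {u. \<exists>\<alpha>. u = (\<Sum>m<d * N + N. \<alpha> m *\<^sub>C x m)}"
    then obtain \<alpha> where u: "u = (\<Sum>m<d * N + N. \<alpha> m *\<^sub>C x m)" by blast
    show "\<exists>\<beta>. c *\<^sub>C u = (\<Sum>m<d * N + N. \<beta> m *\<^sub>C x m)" for c
      unfolding u by (rule exI[of _ "\<lambda>m. c * \<alpha> m"]) (simp add: complex_vector.scale_sum_right scaleC_scaleC)
    assume "v \<in> {u. \<exists>\<alpha>. u = (\<Sum>m<d * N + N. \<alpha> m *\<^sub>C x m)}"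
    then obtain \<beta> where v: "v = (\<Sum>m<d * N + N. \<beta> m *\<^sub>C x m)" by blast
    show "\<exists>\<alpha>. u + v = (\<Sum>m<d * N + N. \<alpha> m *\<^sub>C x m)"
      unfolding u v by (rule exI[of _ "\<lambda>m. \<alpha> m + \<beta> m"]) (simp add: scaleC_add_left sum.distrib)
  qed
  show "\<exists>\<alpha>. x m = (\<Sum>i<d * N + N. \<alpha> i *\<^sub>C x i)" if "m < d * N + N" for m
    by (rule exI[of _ "\<lambda>k. if k = m then 1 else 0"])
       (use that in \<open>simp add: if_distrib[of "\<lambda>c. c *\<^sub>C _"] sum.delta cong: if_cong\<close>)
qed

definition coef :: "nat \<Rightarrow> nat \<Rightarrow> complex" where
  "coef i = (SOME \<alpha>. e i = (\<Sum>m<d * N + N. \<alpha> m *\<^sub>C x m))"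

lemma coef: "e i = (\<Sum>m<d * N + N. coef i m *\<^sub>C x m)"
  unfolding coef_def by (rule someI_ex[OF combination_exists])

text \<open>The x_m may be dependent; fixing one expansion of each basis vector e_i makes the choice
  of coordinates linear in u.\<close>

definition coords :: "'h \<Rightarrow> nat \<Rightarrow> complex" where
  "coords u m = (\<Sum>i<n. cinner u (e i) * coef i m)"

lemma coords: "(\<Sum>m<d * N + N. coords u m *\<^sub>C x m) = u"
proof -
  have "(\<Sum>m<d * N + N. coords u m *\<^sub>C x m) = (\<Sum>m<d * N + N. \<Sum>i<n. cinner u (e i) *\<^sub>C coef i m *\<^sub>C x m)"
    by (simp add: coords_def complex_vector.scale_sum_left scaleC_scaleC)
  also have "\<dots> = (\<Sum>i<n. cinner u (e i) *\<^sub>C e i)"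
    by (subst sum.swap) (simp only: complex_vector.scale_sum_right[symmetric] coef[symmetric])
  also have "\<dots> = u" by (rule expand[symmetric])
  finally show ?thesis .
qed

lemma coords_add: "coords (u + v) m = coords u m + coords v m"
  by (simp add: coords_def cinner_add_left distrib_right sum.distrib)

lemma coords_scale: "coords (c *\<^sub>C u) m = c * coords u m"
  by (simp add: coords_def cinner_scaleC_left sum_distrib_left mult.assoc)

text \<open>The model of x_m: for m = rN + k it is t^r times the k-th unit vector, so that passing
  from m to m + N is multiplication by t.\<close>

definition block_monomial :: "nat \<Rightarrow> real \<Rightarrow> nat \<Rightarrow> complex" where
  "block_monomial m = (\<lambda>t k. if k = m mod N then complex_of_real (t ^ (m div N)) else 0)"

definition vector_poly :: "(nat \<Rightarrow> complex) \<Rightarrow> real \<Rightarrow> nat \<Rightarrow> complex" where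
  "vector_poly \<alpha> = (\<lambda>t k. \<Sum>m<d * N + N. \<alpha> m * block_monomial m t k)"

end

locale moment_representation = moment_data e n N d S x + matrix_measure N d \<nu>
  for e :: "nat \<Rightarrow> 'h::complex_inner_space" and n N d S x \<nu> +
  assumes moments: "m \<le> 2 * d \<Longrightarrow> k < N \<Longrightarrow> j < N \<Longrightarrow> S m $$ (k, j) = (\<Sum>\<sigma><4. \<i> ^ \<sigma> * (\<integral>t. complex_of_real (t ^ m) \<partial>\<nu> k j \<sigma>))"
begin

lemma index_bounds: "m < d * N + N \<Longrightarrow> m div N \<le> d" "m mod N < N"
proof -
  assume "m < d * N + N"
  then have "m < Suc d * N" by simp
  then have "m div N < Suc d" by (rule less_mult_imp_div_less)
  then show "m div N \<le> d" by simp
qed (use N in simp)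

lemma moderate_block_monomial:
  assumes "m < d * N + N"
  shows "moderate (block_monomial m)"
proof -
  have "cmod (block_monomial m t k) \<le> 1 * (1 + \<bar>t\<bar>) ^ d" for t k
  proof (cases "k = m mod N")
    case True
    have "cmod (block_monomial m t k) = \<bar>t\<bar> ^ (m div N)" using True by (simp add: block_monomial_def norm_power power_abs)
    also have "\<dots> \<le> (1 + \<bar>t\<bar>) ^ (m div N)" by (rule power_mono) auto
    also have "\<dots> \<le> (1 + \<bar>t\<bar>) ^ d" by (rule power_increasing[OF index_bounds(1)[OF assms]]) simp
    finally show ?thesis by simp
  qed (simp add: block_monomial_def)
  moreover have "continuous_on UNIV (\<lambda>t. block_monomial m t k)" for k
    unfolding block_monomial_def by (cases "k = m mod N") (auto intro!: continuous_intros)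
  ultimately show ?thesis unfolding moderate_def by blast
qed

lemma moderate_vector_poly: "moderate (vector_poly \<alpha>)"
  unfolding vector_poly_def by (rule moderate_sum) (rule moderate_block_monomial)

lemma B_block_monomial:
  assumes m: "m < d * N + N" and l: "l < d * N + N"
  shows "B (block_monomial m) (block_monomial l) = cinner (x m) (x l)"
proof -
  have "B (block_monomial m) (block_monomial l) = S (m div N + l div N) $$ (m mod N, l mod N)"
    unfolding block_monomial_def B_single[OF index_bounds(2)[of m] index_bounds(2)[of l]]
    using index_bounds(1)[OF m] index_bounds(1)[OF l] index_bounds(2) by (simp add: moments power_add)
  then show ?thesis using gram[OF m l] m l by (simp add: block_hankel_def)
qed

lemma B_vector_poly: "B (vector_poly \<alpha>) (vector_poly \<beta>) = cinner (\<Sum>m<d * N + N. \<alpha> m *\<^sub>C x m) (\<Sum>m<d * N + N. \<beta> m *\<^sub>C x m)"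
proof -
  have "B (vector_poly \<alpha>) (vector_poly \<beta>) = (\<Sum>m<d * N + N. \<alpha> m * B (block_monomial m) (vector_poly \<beta>))"
    unfolding vector_poly_def[of \<alpha>] by (rule B_sum_left[OF moderate_block_monomial moderate_vector_poly])
  also have "\<dots> = (\<Sum>m<d * N + N. \<alpha> m * (\<Sum>l<d * N + N. cnj (\<beta> l) * cinner (x m) (x l)))"
  proof (intro sum.cong refl arg_cong2[where f = times])
    fix m assume "m \<in> {..<d * N + N}"
    then have m: "m < d * N + N" by simp
    have "B (block_monomial m) (vector_poly \<beta>) = (\<Sum>l<d * N + N. cnj (\<beta> l) * B (block_monomial m) (block_monomial l))"
      unfolding vector_poly_def by (rule B_sum_right[OF moderate_block_monomial moderate_block_monomial[OF m]])
    also have "\<dots> = (\<Sum>l<d * N + N. cnj (\<beta> l) * cinner (x m) (x l))"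
      by (intro sum.cong refl) (simp add: B_block_monomial m)
    finally show "B (block_monomial m) (vector_poly \<beta>) = (\<Sum>l<d * N + N. cnj (\<beta> l) * cinner (x m) (x l))" .
  qed
  also have "\<dots> = cinner (\<Sum>m<d * N + N. \<alpha> m *\<^sub>C x m) (\<Sum>m<d * N + N. \<beta> m *\<^sub>C x m)"
    unfolding cinner_sum_left cinner_scaleC_left unfolding cinner_sum_right cinner_scaleC_right ..
  finally show ?thesis .
qed

text \<open>Relations between the $x_m$ are null vectors of the form and so do not affect \<open>B\<close>.\<close>

lemma B_vector_poly_cong:
  assumes eq: "(\<Sum>m<d * N + N. \<alpha> m *\<^sub>C x m) = (\<Sum>m<d * N + N. \<beta> m *\<^sub>C x m)" and q: "moderate q"
  shows "B (vector_poly \<alpha>) q = B (vector_poly \<beta>) q" "B q (vector_poly \<alpha>) = B q (vector_poly \<beta>)"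
proof -
  define w where "w = vector_poly (\<lambda>m. \<alpha> m - \<beta> m)"
  have w: "moderate w" unfolding w_def by (rule moderate_vector_poly)
  have "(\<Sum>m<d * N + N. (\<alpha> m - \<beta> m) *\<^sub>C x m) = 0" by (simp add: scaleC_diff_left sum_subtractf eq)
  then have null: "B w w = 0" unfolding w_def B_vector_poly by simp
  have split: "vector_poly \<alpha> = (\<lambda>t k. vector_poly \<beta> t k + w t k)"
    by (intro ext) (simp add: w_def vector_poly_def sum.distrib[symmetric] algebra_simps)
  show "B (vector_poly \<alpha>) q = B (vector_poly \<beta>) q" "B q (vector_poly \<alpha>) = B q (vector_poly \<beta>)"
    unfolding split by (simp_all add: B_add_left B_add_right moderate_vector_poly w q B_null[OF w q null])
qed

definition embed :: "'h \<Rightarrow> real \<Rightarrow> nat \<Rightarrow> complex" where "embed u = vector_poly (coords u)"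

lemma moderate_embed: "moderate (embed u)" unfolding embed_def by (rule moderate_vector_poly)

lemma B_embed: "B (embed u) (embed v) = cinner u v" unfolding embed_def B_vector_poly coords ..

lemma embed_sum: "embed v = (\<lambda>t k. \<Sum>i<n. cinner v (e i) * vector_poly (coef i) t k)"
proof (intro ext)
  fix t k
  have "embed v t k = (\<Sum>m<d * N + N. \<Sum>i<n. cinner v (e i) * (coef i m * block_monomial m t k))"
    by (simp add: embed_def vector_poly_def coords_def sum_distrib_right mult.assoc)
  also have "\<dots> = (\<Sum>i<n. cinner v (e i) * vector_poly (coef i) t k)"
    by (subst sum.swap) (simp add: vector_poly_def sum_distrib_left)
  finally show "embed v t k = (\<Sum>i<n. cinner v (e i) * vector_poly (coef i) t k)" .
qed

text \<open>Compression of multiplication by $(t - z)^{-1}$ to the image of \<open>H\<close>.\<close>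

definition compressed_resolvent :: "complex \<Rightarrow> 'h \<Rightarrow> 'h" where
  "compressed_resolvent z u = (\<Sum>i<n. B (kernel_mult z (embed u)) (vector_poly (coef i)) *\<^sub>C e i)"

lemma cinner_compressed_resolvent:
  assumes z: "Im z \<noteq> 0"
  shows "cinner (compressed_resolvent z u) v = B (kernel_mult z (embed u)) (embed v)"
proof -
  have "B (kernel_mult z (embed u)) (embed v) = (\<Sum>i<n. cnj (cinner v (e i)) * B (kernel_mult z (embed u)) (vector_poly (coef i)))"
    unfolding embed_sum[of v] by (rule B_sum_right[OF moderate_vector_poly moderate_kernel_mult[OF moderate_embed z]])
  then show ?thesis
    unfolding compressed_resolvent_def cinner_sum_left cinner_scaleC_left cinner_commute[of _ v, symmetric] by (simp add: mult.commute)
qed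

text \<open>Compression does not increase the norm, which turns the identity
  \<open>B_kernel_dissipation\<close> into the dissipation inequality. For (f, g) in
  \<open>A\<close>, the vector g - z f is represented by (t - z) times a polynomial representing f,
  so the kernel cancels and f is left.\<close>

lemma compressed_resolvent_generalized: "generalized_resolvent e n A compressed_resolvent"
proof
  fix z assume z: "z \<in> upper_half_plane"
  then have Iz: "0 < Im z" "Im z \<noteq> 0" by (auto simp: upper_half_plane_def)
  note c = cinner_compressed_resolvent[OF Iz(2)]
  note mk = moderate_kernel_mult[OF moderate_embed Iz(2)]
  show "clinear_op (compressed_resolvent z)"
  proof (rule clinear_opI; rule cinner_eqI)
    fix u v w
    have "kernel_mult z (embed (u + v)) = (\<lambda>t k. kernel_mult z (embed u) t k + kernel_mult z (embed v) t k)"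
      by (intro ext) (simp add: kernel_mult_def embed_def vector_poly_def coords_add distrib_right sum.distrib distrib_left add_divide_distrib)
    then show "cinner (compressed_resolvent z (u + v)) w = cinner (compressed_resolvent z u + compressed_resolvent z v) w"
      by (simp add: c cinner_add_left B_add_left mk moderate_embed)
  next
    fix a u w
    have "kernel_mult z (embed (a *\<^sub>C u)) = (\<lambda>t k. a * kernel_mult z (embed u) t k)"
      by (intro ext) (simp add: kernel_mult_def embed_def vector_poly_def coords_scale sum_distrib_left mult_ac)
    then show "cinner (compressed_resolvent z (a *\<^sub>C u)) w = cinner (a *\<^sub>C compressed_resolvent z u) w"
      by (simp add: c cinner_scaleC_left B_scale_left)
  qed
  show "Im z * (norm (compressed_resolvent z u))\<^sup>2 \<le> Im (cinner (compressed_resolvent z u) u)" for u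
  proof -
    let ?h = "kernel_mult z (embed u)" and ?r = "compressed_resolvent z u"
    have hr: "B ?h (embed ?r) = complex_of_real ((norm ?r)\<^sup>2)" unfolding c[symmetric] cinner_self ..
    have rh: "B (embed ?r) ?h = complex_of_real ((norm ?r)\<^sup>2)"
      unfolding B_hermitian[OF mk moderate_embed] hr by simp
    \<comment> \<open>Positivity at the difference of h and the image of r. That image is the
      projection of h to the image of H, so the form of the difference is B h h - |r|^2.\<close>
    have "0 \<le> Re (B (\<lambda>t k. ?h t k + (- 1) * embed ?r t k) (\<lambda>t k. ?h t k + (- 1) * embed ?r t k))"
      by (intro B_nonneg moderate_add moderate_scale mk moderate_embed)
    also have "\<dots> = Re (B ?h ?h) - (norm ?r)\<^sup>2"
      unfolding B_sesquilinear_expand[OF moderate_embed mk] hr rh B_embed cinner_self by simp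
    finally have "(norm ?r)\<^sup>2 \<le> Re (B ?h ?h)" by simp
    then show ?thesis
      unfolding c B_kernel_dissipation[OF moderate_embed Iz(2)] using Iz(1) by (intro mult_left_mono) auto
  qed
  fix f g assume fg: "(f, g) \<in> A"
  then obtain \<alpha> where f: "f = (\<Sum>k<d * N. \<alpha> k *\<^sub>C x k)" and g: "g = (\<Sum>k<d * N. \<alpha> k *\<^sub>C x (k + N))"
    unfolding shift_operator_def by auto
  \<comment> \<open>Coefficients of f and g with respect to all the x_m, padded with zeros: those of
    g are the ones of f shifted by N, so the polynomial of g is t times that of f.\<close>
  define \<phi> where "\<phi> m = (if m < d * N then \<alpha> m else 0)" for m
  define \<gamma> where "\<gamma> m = (if m < N then 0 else \<alpha> (m - N))" for m
  have \<phi>: "(\<Sum>m<d * N + N. \<phi> m *\<^sub>C y m) = (\<Sum>k<d * N. \<alpha> k *\<^sub>C y k)" for y :: "nat \<Rightarrow> 'b::complex_inner_space"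
    by (rule sum.mono_neutral_cong_right) (auto simp: \<phi>_def)
  have \<gamma>: "(\<Sum>m<d * N + N. \<gamma> m *\<^sub>C y m) = (\<Sum>k<d * N. \<alpha> k *\<^sub>C y (k + N))" for y :: "nat \<Rightarrow> 'b::complex_inner_space"
  proof -
    have "(\<Sum>m<d * N + N. \<gamma> m *\<^sub>C y m) = (\<Sum>m\<in>{N..<d * N + N}. \<gamma> m *\<^sub>C y m)"
      by (rule sum.mono_neutral_right) (auto simp: \<gamma>_def)
    also have "\<dots> = (\<Sum>k\<in>{0..<d * N}. \<gamma> (k + N) *\<^sub>C y (k + N))"
      using sum.shift_bounds_nat_ivl[of "\<lambda>m. \<gamma> m *\<^sub>C y m" 0 N "d * N"] by simp
    finally show ?thesis by (simp add: \<gamma>_def atLeast0LessThan)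
  qed
  have "vector_poly (\<lambda>m. \<gamma> m - z * \<phi> m) t k = (complex_of_real t - z) * vector_poly \<phi> t k" for t k
  proof -
    have bm: "block_monomial (m + N) t k = complex_of_real t * block_monomial m t k" for m
      using N by (simp add: block_monomial_def)
    have "vector_poly (\<lambda>m. \<gamma> m - z * \<phi> m) t k = (\<Sum>m<d * N + N. \<gamma> m * block_monomial m t k) - z * vector_poly \<phi> t k"
      by (simp add: vector_poly_def left_diff_distrib sum_subtractf sum_distrib_left mult.assoc)
    also have "(\<Sum>m<d * N + N. \<gamma> m * block_monomial m t k) = complex_of_real t * vector_poly \<phi> t k"
      using \<gamma>[of "\<lambda>m. block_monomial m t k"] \<phi>[of "\<lambda>m. block_monomial m t k"]
      by (simp add: scaleC_complex_def vector_poly_def bm sum_distrib_left mult_ac)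
    finally show ?thesis by (simp add: left_diff_distrib)
  qed
  moreover have "complex_of_real t - z \<noteq> 0" for t using Iz by (auto simp: complex_eq_iff)
  ultimately have kernel: "kernel_mult z (vector_poly (\<lambda>m. \<gamma> m - z * \<phi> m)) = vector_poly \<phi>"
    by (intro ext) (simp add: kernel_mult_def)
  \<comment> \<open>\<open>coords\<close> may select another representative of g - z f; both
    represent the same vector of H, and \<open>B_vector_poly_cong\<close> exchanges them.\<close>
  have sum: "(\<Sum>m<d * N + N. coords (g - z *\<^sub>C f) m *\<^sub>C x m) = (\<Sum>m<d * N + N. (\<gamma> m - z * \<phi> m) *\<^sub>C x m)"
  proof -
    have "(\<Sum>m<d * N + N. (\<gamma> m - z * \<phi> m) *\<^sub>C x m) = (\<Sum>m<d * N + N. \<gamma> m *\<^sub>C x m) - z *\<^sub>C (\<Sum>m<d * N + N. \<phi> m *\<^sub>C x m)"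
      by (simp add: scaleC_diff_left sum_subtractf complex_vector.scale_sum_right scaleC_scaleC)
    then show ?thesis unfolding coords \<gamma> \<phi> f g by (rule sym)
  qed
  show "compressed_resolvent z (g - z *\<^sub>C f) = f"
  proof (rule cinner_eqI)
    fix v
    have "moderate (kernel_mult (cnj z) (embed v))" by (rule moderate_kernel_mult[OF moderate_embed]) (use Iz in simp)
    from B_vector_poly_cong(1)[OF sum this]
    have "cinner (compressed_resolvent z (g - z *\<^sub>C f)) v = B (vector_poly \<phi>) (embed v)"
      unfolding c embed_def[of "g - z *\<^sub>C f"] B_kernel_mult by (simp add: B_kernel_mult[symmetric] kernel)
    also have "\<dots> = cinner f v" unfolding embed_def B_vector_poly coords \<phi> f ..
    finally show "cinner (compressed_resolvent z (g - z *\<^sub>C f)) v = cinner f v" .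
  qed
next
  show "weakly_holomorphic compressed_resolvent"
    unfolding weakly_holomorphic_def
  proof (intro allI)
    fix u v
    show "(\<lambda>z. cinner (compressed_resolvent z u) v) holomorphic_on upper_half_plane"
      by (rule holomorphic_transform[OF B_kernel_holomorphic[OF moderate_embed moderate_embed]])
         (simp add: cinner_compressed_resolvent upper_half_plane_def)
  qed
qed

sublocale generalized_resolvent e n A compressed_resolvent by (rule compressed_resolvent_generalized)

text \<open>Since -z/(t - z) tends to 1, the limit of -z R_z has the form of the images under
  \<open>embed\<close>, and \<open>embed\<close> preserves the scalar product.\<close>

sublocale moment_resolvent e n N d S x compressed_resolvent
proof
  fix u
  show "E u = u"
  proof (rule cinner_eqI)
    fix v
    have "((\<lambda>z. - z * B (kernel_mult z (embed u)) (embed v)) \<longlongrightarrow> B (embed u) (embed v)) (sector_at_infinity (pi / 2))"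
      by (rule B_kernel_limit[OF moderate_embed moderate_embed half_pi])
    then have "((\<lambda>z. - z * cinner (compressed_resolvent z u) v) \<longlongrightarrow> B (embed u) (embed v)) (sector_at_infinity (pi / 2))"
      by (rule Lim_transform_eventually)
         (use eventually_sector_uhp in \<open>eventually_elim, simp add: cinner_compressed_resolvent upper_half_plane_def\<close>)
    from tendsto_unique[OF sector_at_infinity_neq_bot[OF half_pi] pol_one_limit[OF half_pi] this]
    show "cinner (E u) v = cinner u v" unfolding cinner_E B_embed .
  qed
qed

text \<open>For k < N the vector x_k is represented by the constant k-th unit vector. As
  \<open>coords\<close> may give another representative, each argument is exchanged while the kernel
  stands on the opposite side.\<close>

lemma compressed_resolvent_transform:
  assumes z: "z \<in> upper_half_plane" and kj: "k < N" "j < N"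
  shows "cinner (compressed_resolvent z (x k)) (x j) = (\<Sum>\<sigma><4. \<i> ^ \<sigma> * (\<integral>t. 1 / (complex_of_real t - z) \<partial>\<nu> k j \<sigma>))"
proof -
  have Iz: "Im z \<noteq> 0" using uhp_ne(2)[OF z] by simp
  define \<delta> where "\<delta> i m = (if m = i then 1 else 0 :: complex)" for i m :: nat
  have sum: "(\<Sum>m<d * N + N. coords (x i) m *\<^sub>C x m) = (\<Sum>m<d * N + N. \<delta> i m *\<^sub>C x m)" if "i < N" for i
    unfolding coords \<delta>_def using that by (simp add: if_distrib[of "\<lambda>c. c *\<^sub>C _"] sum.delta cong: if_cong)
  have poly: "vector_poly (\<delta> i) = (\<lambda>t k. if k = i then 1 else 0)" if "i < N" for i
    unfolding vector_poly_def \<delta>_def using that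
    by (intro ext) (simp add: if_distrib[of "\<lambda>c. c * _"] sum.delta block_monomial_def cong: if_cong)
  have "cinner (compressed_resolvent z (x k)) (x j) = B (embed (x k)) (kernel_mult (cnj z) (embed (x j)))"
    unfolding cinner_compressed_resolvent[OF Iz] B_kernel_mult ..
  also have "\<dots> = B (vector_poly (\<delta> k)) (kernel_mult (cnj z) (embed (x j)))"
    unfolding embed_def[of "x k"]
    by (rule B_vector_poly_cong(1)[OF sum[OF kj(1)] moderate_kernel_mult[OF moderate_embed]]) (use Iz in simp)
  also have "\<dots> = B (kernel_mult z (vector_poly (\<delta> k))) (vector_poly (coords (x j)))"
    unfolding B_kernel_mult embed_def ..
  also have "\<dots> = B (kernel_mult z (vector_poly (\<delta> k))) (vector_poly (\<delta> j))"
    by (rule B_vector_poly_cong(2)[OF sum[OF kj(2)] moderate_kernel_mult[OF moderate_vector_poly Iz]])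
  also have "kernel_mult z (vector_poly (\<delta> k)) = (\<lambda>t i. if i = k then 1 / (complex_of_real t - z) else 0)"
    unfolding poly[OF kj(1)] kernel_mult_def by (intro ext) simp
  finally show ?thesis unfolding poly[OF kj(2)] B_single[OF kj] by simp
qed

end

context moment_data
begin

text \<open>The parts of M are fixed once, from the moment of order 2d, whose integrability controls
  all lower orders; the decompositions attached to the other moments then give the same
  values.\<close>

theorem solution_has_parameter:
  assumes \<epsilon>: "0 < \<epsilon>" "\<epsilon> \<le> pi / 2" and M: "M \<in> moment_solutions N d S"
  shows "\<exists>F. F \<in> admissible_class \<epsilon> A \<and> stieltjes_resolvent_relation N x A M F"
proof -
  have "\<exists>\<nu>. stieltjes_parts (\<lambda>t. M t $$ (k, j)) \<nu> \<and> (\<forall>\<sigma><4. integrable (\<nu> \<sigma>) (\<lambda>t. complex_of_real (t ^ (2 * d))))"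
    if "k < N" "j < N" for k j
    using moment_solution_parts[OF M order_refl that] by metis
  then obtain \<nu> where \<nu>: "\<And>k j. k < N \<Longrightarrow> j < N \<Longrightarrow> stieltjes_parts (\<lambda>t. M t $$ (k, j)) (\<nu> k j)"
    and \<nu>_int: "\<And>k j \<sigma>. k < N \<Longrightarrow> j < N \<Longrightarrow> \<sigma> < 4 \<Longrightarrow> integrable (\<nu> k j \<sigma>) (\<lambda>t. complex_of_real (t ^ (2 * d)))"
    by metis
  \<comment> \<open>Real because the increments of M are Hermitian, nonnegative because they are
    semidefinite.\<close>
  have form: "\<exists>r\<ge>0. (\<Sum>k<N. \<Sum>j<N. c k * cnj (c j) * (\<Sum>\<sigma><4. \<i> ^ \<sigma> * complex_of_real (measure (\<nu> k j \<sigma>) {a..<b}))) = complex_of_real r"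
    if ab: "a \<le> b" for a b c
  proof -
    define D where "D = M b - M a"
    have D: "pos_semidef_mat N D" using M ab unfolding moment_solutions_def D_def by blast
    then have h: "D \<in> carrier_mat N N" "\<And>i j. i < N \<Longrightarrow> j < N \<Longrightarrow> cnj (D $$ (i, j)) = D $$ (j, i)"
      unfolding pos_semidef_mat_def hermitian_mat_iff by blast+
    define v where "v = vec N (\<lambda>k. cnj (c k))"
    have v: "v \<in> carrier_vec N" by (simp add: v_def)
    define Q where "Q = (\<Sum>k<N. \<Sum>j<N. c k * cnj (c j) * D $$ (k, j))"
    have "(D *\<^sub>v v) \<bullet>c v = Q" unfolding quadratic_form_sum[OF h(1) v] Q_def by (simp add: v_def)
    moreover have "0 \<le> Re ((D *\<^sub>v v) \<bullet>c v)" using D v unfolding pos_semidef_mat_def by blast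
    ultimately have "0 \<le> Re Q" by simp
    have "cnj Q = (\<Sum>k<N. \<Sum>j<N. c j * cnj (c k) * D $$ (j, k))"
      unfolding Q_def by (simp add: h(2) mult_ac)
    also have "\<dots> = Q" unfolding Q_def by (rule sum.swap)
    finally have "Q = complex_of_real (Re Q)" by (simp add: complex_eq_iff)
    moreover have "(\<Sum>k<N. \<Sum>j<N. c k * cnj (c j) * (\<Sum>\<sigma><4. \<i> ^ \<sigma> * complex_of_real (measure (\<nu> k j \<sigma>) {a..<b}))) = Q"
      unfolding Q_def
      by (intro sum.cong refl) (use carrier_matD[OF moment_solution_carrier[OF M]] in \<open>simp add: stieltjes_partsD(2)[OF \<nu> ab] D_def\<close>)
    ultimately show ?thesis using \<open>0 \<le> Re Q\<close> by metis
  qed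
  interpret matrix_measure N d \<nu>
  proof (rule matrix_measure.intro)
    fix k j \<sigma> :: nat assume kj: "k < N" "j < N" and \<sigma>: "\<sigma> < 4"
    show fb: "finite_borel_measure (\<nu> k j \<sigma>)" by (rule stieltjes_partsD(1)[OF \<nu>[OF kj] \<sigma>])
    show "integrable (\<nu> k j \<sigma>) (\<lambda>t. (1 + \<bar>t\<bar>) ^ (2 * d))"
      by (rule integrable_one_plus_abs_power[OF fb \<nu>_int[OF kj \<sigma>] order_refl])
  next
    fix a b :: real and c :: "nat \<Rightarrow> complex" assume "a \<le> b"
    then obtain r where "0 \<le> r" and r: "(\<Sum>k<N. \<Sum>j<N. c k * cnj (c j) * (\<Sum>\<sigma><4. \<i> ^ \<sigma> * complex_of_real (measure (\<nu> k j \<sigma>) {a..<b}))) = complex_of_real r"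
      using form[of a b c] by blast
    then show
      "0 \<le> Re (\<Sum>k<N. \<Sum>j<N. c k * cnj (c j) * (\<Sum>\<sigma><4. \<i> ^ \<sigma> * complex_of_real (measure (\<nu> k j \<sigma>) {a..<b})))"
      "Im (\<Sum>k<N. \<Sum>j<N. c k * cnj (c j) * (\<Sum>\<sigma><4. \<i> ^ \<sigma> * complex_of_real (measure (\<nu> k j \<sigma>) {a..<b}))) = 0"
      unfolding r by simp_all
  qed
  interpret moment_representation e n N d S x \<nu>
  proof unfold_locales
    fix m k j assume m: "m \<le> 2 * d" and kj: "k < N" "j < N"
    obtain \<nu>' where \<nu>': "stieltjes_parts (\<lambda>t. M t $$ (k, j)) \<nu>'" "\<And>\<sigma>. \<sigma> < 4 \<Longrightarrow> integrable (\<nu>' \<sigma>) (\<lambda>t. complex_of_real (t ^ m))"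
      "S m $$ (k, j) = (\<Sum>\<sigma><4. \<i> ^ \<sigma> * (\<integral>t. complex_of_real (t ^ m) \<partial>\<nu>' \<sigma>))"
      using moment_solution_parts[OF M m kj] by blast
    show "S m $$ (k, j) = (\<Sum>\<sigma><4. \<i> ^ \<sigma> * (\<integral>t. complex_of_real (t ^ m) \<partial>\<nu> k j \<sigma>))"
      unfolding \<nu>'(3)
    proof (rule stieltjes_parts_integral_unique[OF \<nu>'(1) \<nu>[OF kj], where C = 1 and k = m])
      show "continuous_on UNIV (\<lambda>t. complex_of_real (t ^ m))" by (intro continuous_intros)
      show "cmod (complex_of_real (t ^ m)) \<le> 1 * (1 + \<bar>t\<bar>) ^ m" for t :: real
        by (simp add: norm_power power_mono)
      fix \<sigma> :: nat assume \<sigma>: "\<sigma> < 4"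
      show "integrable (\<nu>' \<sigma>) (\<lambda>t. (1 + \<bar>t\<bar>) ^ m)"
        by (rule integrable_one_plus_abs_power[OF stieltjes_partsD(1)[OF \<nu>'(1) \<sigma>] \<nu>'(2)[OF \<sigma>] order_refl])
      show "integrable (\<nu> k j \<sigma>) (\<lambda>t. (1 + \<bar>t\<bar>) ^ m)"
        by (rule integrable_one_plus_abs_power[OF stieltjes_partsD(1)[OF \<nu>[OF kj] \<sigma>] \<nu>_int[OF kj \<sigma>] m])
    qed
  qed
  have rel: "stieltjes_resolvent_relation N x A M param \<longleftrightarrow> (\<forall>z\<in>upper_half_plane. \<forall>k<N. \<forall>j<N.
      has_stieltjes_integral (\<lambda>t. 1 / (complex_of_real t - z)) (\<lambda>t. M t $$ (k, j)) (cinner (compressed_resolvent z (x k)) (x j)))"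
    by (rule relation_iff) (rule param_eq)
  have "stieltjes_resolvent_relation N x A M param"
    unfolding rel
  proof (intro ballI allI impI)
    fix z k j assume z: "z \<in> upper_half_plane" and kj: "k < N" "j < N"
    have Iz: "Im z \<noteq> 0" using uhp_ne(2)[OF z] by simp
    show "has_stieltjes_integral (\<lambda>t. 1 / (complex_of_real t - z)) (\<lambda>t. M t $$ (k, j)) (cinner (compressed_resolvent z (x k)) (x j))"
      unfolding has_stieltjes_integral_resolvent[OF \<nu>[OF kj] Iz] compressed_resolvent_transform[OF z kj] ..
  qed
  moreover have "param \<in> admissible_class \<epsilon> A" by (rule complete_imp_admissible[OF \<epsilon> complete])
  ultimately show ?thesis by blast
qed

end

theorem theorem7:
  fixes N d :: nat
    and S :: "nat \<Rightarrow> complex mat"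
    and x :: "nat \<Rightarrow> 'h::complex_inner_space"
    and \<epsilon> :: real
  assumes "1 \<le> N" and "1 \<le> d"
    and "\<And>n. n \<le> 2 * d \<Longrightarrow> hermitian_mat N (S n)"
    and "pos_def_mat (d * N) (block_hankel N S (d - 1))"
    and "pos_semidef_mat (d * N + N) (block_hankel N S d)"
    and "complex_vector.span (x ` {..<d * N + N}) = UNIV"
    and "\<And>n m. n < d * N + N \<Longrightarrow> m < d * N + N \<Longrightarrow>
           cinner (x n) (x m) = block_hankel N S d $$ (n, m)"
    and "0 < \<epsilon>" and "\<epsilon> \<le> pi / 2"
  defines "A \<equiv> shift_operator N d x"
  shows "(\<forall>M \<in> moment_solutions N d S.
            \<exists>!F. F \<in> admissible_class \<epsilon> A \<and> stieltjes_resolvent_relation N x A M F) \<and>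
         (\<forall>F \<in> admissible_class \<epsilon> A.
            \<exists>!M. M \<in> moment_solutions N d S \<and> stieltjes_resolvent_relation N x A M F)"
proof -
  \<comment> \<open>The span hypothesis makes the whole type the finite-dimensional space H.\<close>
  obtain e :: "nat \<Rightarrow> 'h" and n where "onb e n"
    using onb_exists[OF finite_imageI[OF finite_lessThan] assms(6)] by blast
  then interpret onb e n .
  interpret moment_data e n N d S x
    by unfold_locales (fact assms)+
  show ?thesis
    unfolding A_def
  proof (intro conjI ballI)
    fix M assume M: "M \<in> moment_solutions N d S"
    then show "\<exists>!F. F \<in> admissible_class \<epsilon> (shift_operator N d x) \<and> stieltjes_resolvent_relation N x (shift_operator N d x) M F"
      using solution_has_parameter[OF assms(8,9) M] admissible_parameter_unique[OF assms(8,9) M] by (elim exE) (rule ex1I, blast+)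
  next
    fix F assume "F \<in> admissible_class \<epsilon> (shift_operator N d x)"
    then show "\<exists>!M. M \<in> moment_solutions N d S \<and> stieltjes_resolvent_relation N x (shift_operator N d x) M F"
      by (rule admissible_parameter_solution[OF assms(8,9)])
  qed
qed

end
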